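(* Let $(\mathcal L,\mathcal P)$ be an extremal configuration. Then there are two organizing points $p_1,p_2$ and two bushes, lines $l_{1,1},\dots,l_{M_1,1}$ of $\mathcal L$ incident to $p_1$ and lines $l_{1,2},\dots,l_{M_2,2}$ of $\mathcal L$ incident to $p_2$, with $M_1,M_2\gtrsim N^{1/3-}$, and a refinement $\mathcal P'\subset\mathcal P$, such that the two bushes break $\mathcal P'$ into $M_1M_2$ cells (intersections of a sector of the first bush with a sector of the second) which form a point weighted cell decomposition (with $r^2=M_1M_2$), and such that each sector $s$ of the bush at $p_1$ containing at least $N^{2/3-}$ points of $\mathcal P'$ has at least $N^{1-}$ lines of $\mathcal L$ incident to at least one point of the sector.
   Context: Conventions: $N$ is a large parameter and $\epsilon_0>0$ a fixed small exponent. For nonnegative $A,B$, $A\lesssim B$ means $A\le CB$ with $C$ independent of $N$; $A\sim B$ means $A\lesssim B\lesssim A$. $N^{a+}$ (resp. $N^{a-}$) denotes $N^{a+\epsilon}$ (resp. $N^{a-\epsilon}$) for some $0\le\epsilon\lesssim\epsilon_0$, possibly different at each occurrence. A configuration $(\mathcal L,\mathcal P)$ is a set $\mathcal L$ of lines and a set $\mathcal P$ of points in $\mathbb R^2$ with $N^{1-}\lesssim|\mathcal L|,|\mathcal P|\le N$; $I(\mathcal L,\mathcal P)$ is the set of incident pairs; it is extremal if $|I(\mathcal L,\mathcal P)|\gtrsim N^{4/3-}$. A partition of $\mathcal P$ into $r^2$ disjoint subsets (cells) is a point weighted cell decomposition if no line of $\mathcal L$ is incident to points in $\gtrsim r$ cells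 and no cell contains $\gtrsim N^{1+}/r^2$ points of $\mathcal P$. A set $\mathcal Q$ of at least $N^{2/3-}$ points is structured if there is a set of at most $N^{1/3+}$ lines such that each point of $\mathcal Q$ lies on at least two of them. Given lines $l_1,\dots,l_M$ through a point $p$, ordered by direction, the sector between consecutive lines $l_j,l_{j+1}$ is the double wedge at $p$ bounded by $l_j$ and $l_{j+1}$ containing no other $l_i$. A point $p\in\mathcal P$ is organizing (for $\mathcal L$) if there are lines $l_1,\dots,l_M$ of $\mathcal L$ incident to $p$, $M\gtrsim N^{1/3-}$, ordered by direction, such that each sector between consecutive $l_j,l_{j+1}$ contains a structured set of $\gtrsim N^{2/3-}$ points of $\mathcal P$; these lines form the bush at $p$. *)

theory Defs
  imports "HOL-Analysis.Analysis"
begin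

text \<open>
  Asymptotic notation. The parameter \<open>e\<close> is the small exponent \<open>\<epsilon>\<^sub>0\<close>, \<open>K\<close> bounds the constant
  implicit in the exponent loss \<open>0 \<le> \<epsilon> \<lesssim> \<epsilon>\<^sub>0\<close> hidden in \<open>N\<^sup>a\<^sup>+\<close>, \<open>N\<^sup>a\<^sup>-\<close>, and \<open>C\<close> is the
  multiplicative constant of \<open>\<lesssim>\<close>. Thus, for \<open>N \<ge> 1\<close>, \<open>X \<gtrsim> N\<^sup>a\<^sup>-\<close> reads
  \<open>X \<ge> N powr (a - K * e) / C\<close>, and \<open>X \<lesssim> N\<^sup>a\<^sup>+\<close> reads \<open>X \<le> C * N powr (a + K * e)\<close>.
  Where the source has a plain inequality (``at least'', ``at most'') there is no factor \<open>C\<close>.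
\<close>

type_synonym point = "real^2"

definition is_line :: "point set \<Rightarrow> bool" where
  "is_line l \<longleftrightarrow> affine l \<and> aff_dim l = 1"

definition incidences :: "point set set \<Rightarrow> point set \<Rightarrow> (point set \<times> point) set" where
  "incidences L P = {(l, p). l \<in> L \<and> p \<in> P \<and> p \<in> l}"

definition configuration ::
    "real \<Rightarrow> real \<Rightarrow> real \<Rightarrow> real \<Rightarrow> point set set \<Rightarrow> point set \<Rightarrow> bool" where
  "configuration K C e N L P \<longleftrightarrow>
     finite L \<and> finite P \<and> (\<forall>l\<in>L. is_line l) \<and>
     N powr (1 - K * e) / C \<le> real (card L) \<and> real (card L) \<le> N \<and>
     N powr (1 - K * e) / C \<le> real (card P) \<and> real (card P) \<le> N"

definition extremal ::
    "real \<Rightarrow> real \<Rightarrow> real \<Rightarrow> real \<Rightarrow> point set set \<Rightarrow> point set \<Rightarrow> bool" where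
  "extremal K C e N L P \<longleftrightarrow>
     configuration K C e N L P \<and>
     N powr (4/3 - K * e) / C \<le> real (card (incidences L P))"

text \<open>
  A family of cells indexed by \<open>I\<close>; cells may be empty, so that the number \<open>r\<^sup>2\<close> of cells
  is the number of indices.
\<close>

definition point_weighted_cell_decomposition ::
    "real \<Rightarrow> real \<Rightarrow> real \<Rightarrow> real \<Rightarrow> point set set \<Rightarrow> point set \<Rightarrow>
     real \<Rightarrow> 'i set \<Rightarrow> ('i \<Rightarrow> point set) \<Rightarrow> bool" where
  "point_weighted_cell_decomposition K C e N L P r I cell \<longleftrightarrow>
     finite I \<and> real (card I) = r^2 \<and>
     disjoint_family_on cell I \<and> (\<Union>i\<in>I. cell i) = P \<and>
     (\<forall>l\<in>L. real (card {i\<in>I. cell i \<inter> l \<noteq> {}}) \<le> C * r) \<and>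
     (\<forall>i\<in>I. real (card (cell i)) \<le> C * (N powr (1 + K * e) / r^2))"

text \<open>The covering lines are arbitrary lines of the plane, not necessarily lines of the configuration.\<close>

definition structured :: "real \<Rightarrow> real \<Rightarrow> real \<Rightarrow> point set \<Rightarrow> bool" where
  "structured K e N Q \<longleftrightarrow>
     finite Q \<and> N powr (2/3 - K * e) \<le> real (card Q) \<and>
     (\<exists>A. finite A \<and> (\<forall>l\<in>A. is_line l) \<and> real (card A) \<le> N powr (1/3 + K * e) \<and>
        (\<forall>q\<in>Q. \<exists>l\<in>A. \<exists>l'\<in>A. l \<noteq> l' \<and> q \<in> l \<and> q \<in> l'))"

definition direction :: "real \<Rightarrow> point" where
  "direction t = vector [cos t, sin t]"

definition line_at :: "point \<Rightarrow> real \<Rightarrow> point set" where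
  "line_at p t = {p + s *\<^sub>R direction t | s. True}"

text \<open>The open double wedge at \<open>p\<close> swept out by the lines of angle strictly between \<open>a\<close> and \<open>b\<close>.\<close>

definition double_wedge :: "point \<Rightarrow> real \<Rightarrow> real \<Rightarrow> point set" where
  "double_wedge p a b = {p + s *\<^sub>R direction t | s t. s \<noteq> 0 \<and> a < t \<and> t < b}"

text \<open>
  Lines through \<open>p\<close> ordered by direction are given by their angles
  \<open>0 \<le> \<theta> 0 < \<dots> < \<theta> (M - 1) < \<pi>\<close>. Directions are ordered cyclically, so the last line and the
  first one are consecutive too, and \<open>M\<close> lines bound exactly \<open>M\<close> sectors.
\<close>

definition ordered_angles :: "nat \<Rightarrow> (nat \<Rightarrow> real) \<Rightarrow> bool" where
  "ordered_angles M \<theta> \<longleftrightarrow> strict_mono_on {..<M} \<theta> \<and> (\<forall>j<M. 0 \<le> \<theta> j \<and> \<theta> j < pi)"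

definition sector :: "point \<Rightarrow> nat \<Rightarrow> (nat \<Rightarrow> real) \<Rightarrow> nat \<Rightarrow> point set" where
  "sector p M \<theta> j =
     double_wedge p (\<theta> j) (if Suc j < M then \<theta> (Suc j) else \<theta> 0 + pi)"

definition bush ::
    "real \<Rightarrow> real \<Rightarrow> real \<Rightarrow> real \<Rightarrow> point set set \<Rightarrow> point set \<Rightarrow>
     point \<Rightarrow> nat \<Rightarrow> (nat \<Rightarrow> real) \<Rightarrow> bool" where
  "bush K C e N L P p M \<theta> \<longleftrightarrow>
     ordered_angles M \<theta> \<and> (\<forall>j<M. line_at p (\<theta> j) \<in> L) \<and>
     N powr (1/3 - K * e) / C \<le> real M \<and>
     (\<forall>j<M. \<exists>Q. Q \<subseteq> P \<inter> sector p M \<theta> j \<and> structured K e N Q \<and>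
        N powr (2/3 - K * e) / C \<le> real (card Q))"

definition organizing ::
    "real \<Rightarrow> real \<Rightarrow> real \<Rightarrow> real \<Rightarrow> point set set \<Rightarrow> point set \<Rightarrow> point \<Rightarrow> bool" where
  "organizing K C e N L P p \<longleftrightarrow> p \<in> P \<and> (\<exists>M \<theta>. bush K C e N L P p M \<theta>)"

text \<open>
  A refinement keeps all but a factor \<open>N\<^sup>0\<^sup>+\<close> of the points and of the incidences, i.e. the
  configuration stays extremal (with worse constants).
\<close>

definition refinement ::
    "real \<Rightarrow> real \<Rightarrow> real \<Rightarrow> real \<Rightarrow> point set set \<Rightarrow> point set \<Rightarrow> point set \<Rightarrow> bool" where
  "refinement K C e N L P P' \<longleftrightarrow> P' \<subseteq> P \<and> extremal K C e N L P'"

text \<open>The lines of \<open>L\<close> incident to at least one point of \<open>Q\<close>.\<close>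

definition lines_meeting :: "point set set \<Rightarrow> point set \<Rightarrow> point set set" where
  "lines_meeting L Q = {l \<in> L. \<exists>q\<in>Q. q \<in> l}"

end

theory Submission imports Defs
begin

text \<open>
  Dualise: a point becomes a line, and a non-horizontal line of the configuration becomes a point.
  Sampling few of the dual lines (a greedy hitting set) yields a cutting into \<open>N\<^sup>2\<^sup>/\<^sup>3\<close> convex cells,
  almost all incidences survive in cells that the dual lines meet in at least two points, and each
  cell contains about \<open>N\<^sup>1\<^sup>/\<^sup>3\<close> dual points. The cutting gives a weak Szemeredi--Trotter bound,
  and extremality makes everything tight up to factors \<open>N\<^sup>\<epsilon>\<close>.

  Inside a cell the crossing lemma produces many crossings of dual lines at which both lines carry
  two points of the cell. A dual line \<open>p\<close> that has \<open>N\<^sup>2\<^sup>/\<^sup>3\<close> crossings in each of \<open>N\<^sup>1\<^sup>/\<^sup>3\<close> cells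
  along it is an organizing point: the cells along \<open>p\<close> are ordered by direction at \<open>p\<close>, the lines
  crossing \<open>p\<close> in one cell form a structured set lying in one sector, and a dual point of \<open>p\<close>
  in the cell serves as a bush line.

  Two such lines \<open>p1\<close>, \<open>p2\<close> are found by averaging. The intersection of two sectors contains few
  points because of a mixing estimate: through a typical dual point \<open>z\<close>, only few lines share
  a given further cell \<open>A\<close> with \<open>z\<close>. Indeed, by convexity the lines through \<open>z\<close> that meet \<open>A\<close> are
  consecutive in the order of slopes, so otherwise many pairs of close lines through \<open>z\<close> would
  share cells, which the Szemeredi--Trotter bound excludes. The same estimate, applied to the lines
  of a sector, shows that the sector meets many lines of the configuration.
\<close>

section \<open>Incidences between points and non-vertical lines\<close>

text \<open>With s = N^(1/3) and powers of \<mu> ignored, there are s^3 lines, s^3 points and s^2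
  cells; a cell holds s points and s^2 lines with two points in it, and a line has two points in s
  cells. Every count is tight in its power of s, so only powers of \<mu> may be lost. The obstacle
  is transversality: two bushes may each be fine and yet a sector of one may hold the same points as
  a sector of the other. Call an incidence of z with a line good in A heavy if more than T lines
  through z are good in A. Over all A there are trivially s^5 incidences of this kind; s^5 / D heavy
  ones would produce close pairs with T s^5 / D^2 shared cells in total, whereas pairs sharing at
  most s / E cells account for only T s^5 / E, and the others for a bound without T. With E above
  D^2 and T above a power of D this is a contradiction. Choosing the two points costs \<mu>^46
  against the trivial bounds, so D = \<mu>^50 and T = \<mu>^425. Finally \<mu> = \<nu>^40, where
  \<nu> pays for the constant and the logarithm of the incidence bound, and pruning and cutting lose
  less than \<nu>^40.\<close>

definition val :: "real \<times> real \<Rightarrow> real \<Rightarrow> real" where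
  "val q x = fst q * x + snd q"

definition on :: "real \<times> real \<Rightarrow> real \<times> real \<Rightarrow> bool" where
  "on z q \<longleftrightarrow> snd z = val q (fst z)"

definition incs :: "(real \<times> real) set \<Rightarrow> (real \<times> real) set \<Rightarrow> ((real \<times> real) \<times> (real \<times> real)) set" where
  "incs Z Q = {(z, q). z \<in> Z \<and> q \<in> Q \<and> on z q}"

lemma val_eq_imp_eq:
  assumes "val q x = val q' x" "val q y = val q' y" "x \<noteq> y"
  shows "q = q'"
proof -
  have "(fst q - fst q') * (x - y) = 0" using assms by (simp add: val_def algebra_simps)
  then have "fst q = fst q'" using assms(3) by simp
  then show ?thesis using assms(1) by (simp add: val_def prod_eq_iff)
qed

lemma on_fst_inj: "on z q \<Longrightarrow> on z' q \<Longrightarrow> fst z = fst z' \<Longrightarrow> z = z'"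
  by (simp add: on_def prod_eq_iff)

lemma on_slope_inj: "on z q \<Longrightarrow> on z q' \<Longrightarrow> fst q = fst q' \<Longrightarrow> q = q'"
  by (simp add: on_def val_def prod_eq_iff)

lemma on_unique:
  assumes "on z q" "on z q'" "on z' q" "on z' q'" "z \<noteq> z'"
  shows "q = q'"
  using assms val_eq_imp_eq on_fst_inj unfolding on_def by metis

lemma incs_eq_Sigma: "incs Z Q = (SIGMA z:Z. {q\<in>Q. on z q})"
  by (auto simp: incs_def)

lemma incs_eq_swap: "incs Z Q = prod.swap ` (SIGMA q:Q. {z\<in>Z. on z q})"
  by (auto simp: incs_def image_iff)

lemma finite_incs [simp]: "finite Z \<Longrightarrow> finite Q \<Longrightarrow> finite (incs Z Q)"
  by (simp add: incs_eq_Sigma)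

lemma card_incs_points: "finite Z \<Longrightarrow> finite Q \<Longrightarrow> card (incs Z Q) = (\<Sum>z\<in>Z. card {q\<in>Q. on z q})"
  by (simp add: incs_eq_Sigma)

lemma card_incs_lines: "finite Z \<Longrightarrow> finite Q \<Longrightarrow> card (incs Z Q) = (\<Sum>q\<in>Q. card {z\<in>Z. on z q})"
  by (simp add: incs_eq_swap card_image)

text \<open>An ordered pair of distinct points lies on at most one line; the diagonal pairs are the
  incidences.\<close>

lemma sum_square_degrees:
  assumes "finite Z" "finite Q"
  shows "(\<Sum>q\<in>Q. (card {z\<in>Z. on z q})\<^sup>2) \<le> (card Z)\<^sup>2 + card (incs Z Q)"
proof -
  let ?d = "\<lambda>q. {z\<in>Z. on z q}"
  let ?S = "SIGMA q:Q. ?d q \<times> ?d q"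
  let ?D = "{(q, z, z'). (q, z, z') \<in> ?S \<and> z = z'}" and ?E = "{(q, z, z'). (q, z, z') \<in> ?S \<and> z \<noteq> z'}"
  have fin: "finite ?S" using assms by auto
  have "(\<Sum>q\<in>Q. (card (?d q))\<^sup>2) = card ?S"
    using assms by (simp add: card_cartesian_product power2_eq_square)
  also have "?S = ?D \<union> ?E" by auto
  also have "card (?D \<union> ?E) \<le> card ?D + card ?E" by (rule card_Un_le)
  also have "card ?D \<le> card (incs Z Q)"
  proof (rule card_inj_on_le[where f = "\<lambda>(q, z, z'). (z, q)"])
    show "inj_on (\<lambda>(q, z, z'). (z, q)) ?D" by (auto simp: inj_on_def)
    show "(\<lambda>(q, z, z'). (z, q)) ` ?D \<subseteq> incs Z Q" by (auto simp: incs_def)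
  qed (use assms in simp)
  also have "card ?E \<le> card (Z \<times> Z)"
  proof (rule card_inj_on_le[where f = "\<lambda>(q, z, z'). (z, z')"])
    show "inj_on (\<lambda>(q, z, z'). (z, z')) ?E" by (auto simp: inj_on_def dest: on_unique)
    show "(\<lambda>(q, z, z'). (z, z')) ` ?E \<subseteq> Z \<times> Z" by auto
  qed (use assms in simp)
  finally show ?thesis by (simp add: card_cartesian_product power2_eq_square)
qed

text \<open>The Kovari-Sos-Turan bound. Cauchy-Schwarz and the second moment give I^2 <= l (v^2 +
  I), which fails as soon as I exceeds v sqrt l + l. It is applied inside single cells.\<close>

lemma incs_kst:
  assumes "finite Z" "finite Q"
  shows "real (card (incs Z Q)) \<le> real (card Z) * sqrt (real (card Q)) + real (card Q)"
proof (rule ccontr)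
  let ?I = "real (card (incs Z Q))" and ?v = "real (card Z)" and ?l = "real (card Q)"
  assume a: "\<not> ?thesis"
  have "?I\<^sup>2 = (\<Sum>q\<in>Q. 1 * real (card {z\<in>Z. on z q}))\<^sup>2"
    using assms by (simp add: card_incs_lines)
  also have "\<dots> \<le> (\<Sum>q\<in>Q. 1\<^sup>2) * (\<Sum>q\<in>Q. (real (card {z\<in>Z. on z q}))\<^sup>2)"
    by (rule Cauchy_Schwarz_ineq_sum)
  also have "(\<Sum>q\<in>Q. (real (card {z\<in>Z. on z q}))\<^sup>2) = real (\<Sum>q\<in>Q. (card {z\<in>Z. on z q})\<^sup>2)"
    by simp
  also have "\<dots> \<le> real ((card Z)\<^sup>2 + card (incs Z Q))"
    using sum_square_degrees[OF assms] by (simp only: of_nat_le_iff)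
  finally have h: "?I\<^sup>2 \<le> ?l * (?v\<^sup>2 + ?I)" by (simp add: mult_left_mono)
  have "?v * sqrt ?l * (?v * sqrt ?l) \<le> ?I * (?v * sqrt ?l)"
    using a by (intro mult_right_mono) (auto intro: order_trans[of _ "?v * sqrt ?l + ?l"])
  moreover have "?I * (?v * sqrt ?l) < ?I * (?I - ?l)"
  proof -
    have "0 \<le> ?v * sqrt ?l + ?l" by simp
    with a have "?I > 0" by linarith
    then show ?thesis using a by (intro mult_strict_left_mono) auto
  qed
  moreover have "?v * sqrt ?l * (?v * sqrt ?l) = ?v\<^sup>2 * ?l"
    by (simp add: power2_eq_square)
  ultimately show False using h by (simp add: power2_eq_square algebra_simps)
qed

text \<open>By averaging, some element lies in at least the fraction k / |Q| of the sets not yet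
  hit, so about (|Q| / k) ln |F| choices leave less than one set. This replaces a random
  sample.\<close>

lemma greedy_hitting:
  fixes k :: real
  assumes "finite F" "finite Q" "\<And>S. S \<in> F \<Longrightarrow> S \<subseteq> Q" "\<And>S. S \<in> F \<Longrightarrow> k \<le> real (card S)" "k > 0" "F \<noteq> {}"
  shows "\<exists>R\<subseteq>Q. (\<forall>S\<in>F. S \<inter> R \<noteq> {}) \<and> real (card R) \<le> real (card Q) / k * ln (real (card F)) + 1"
proof -
  let ?n = "real (card Q)"
  have kn: "k \<le> ?n"
  proof -
    from \<open>F \<noteq> {}\<close> obtain S where S: "S \<in> F" by blast
    then have "card S \<le> card Q" using assms(2,3) by (intro card_mono) auto
    then show ?thesis using assms(4)[OF S] by simp
  qed
  then have n0: "?n > 0" using assms(5) by simp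
  have step: "\<exists>a\<in>Q. real (card {S\<in>F'. a \<notin> S}) \<le> real (card F') * (1 - k / ?n)" if F': "F' \<subseteq> F" for F'
  proof (rule ccontr)
    assume "\<not> ?thesis"
    then have c: "real (card F') * (1 - k / ?n) < real (card {S\<in>F'. a \<notin> S})" if "a \<in> Q" for a
      using that by force
    have fF: "finite F'" using F' assms(1) finite_subset by blast
    have "Q \<noteq> {}" using n0 by auto
    then have "(\<Sum>a\<in>Q. real (card F') * (1 - k / ?n)) < (\<Sum>a\<in>Q. real (card {S\<in>F'. a \<notin> S}))"
      using c assms(2) by (intro sum_strict_mono) auto
    also have "\<dots> = (\<Sum>a\<in>Q. \<Sum>S\<in>F'. if a \<notin> S then 1 else (0::real))"
      using fF by (intro sum.cong refl) (simp add: sum.If_cases Int_def conj_commute)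
    also have "\<dots> = (\<Sum>S\<in>F'. \<Sum>a\<in>Q. if a \<notin> S then 1 else (0::real))" by (rule sum.swap)
    also have "\<dots> = (\<Sum>S\<in>F'. real (card (Q - S)))"
      using assms(2) by (intro sum.cong refl) (simp add: sum.If_cases Int_def set_diff_eq)
    also have "\<dots> \<le> (\<Sum>S\<in>F'. ?n - k)"
    proof (rule sum_mono)
      fix S assume "S \<in> F'"
      then have S: "S \<in> F" using F' by auto
      then have "card (Q - S) = card Q - card S" "card S \<le> card Q"
        using assms(2,3) by (auto intro!: card_Diff_subset card_mono intro: finite_subset)
      then show "real (card (Q - S)) \<le> ?n - k" using assms(4)[OF S] by (simp add: of_nat_diff)
    qed
    also have "\<dots> = real (card F') * (?n - k)" by simp
    finally show False using n0 by (simp add: field_simps)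
  qed
  have iter: "\<exists>R\<subseteq>Q. card R \<le> j \<and> real (card {S\<in>F. S \<inter> R = {}}) \<le> real (card F) * (1 - k / ?n) ^ j" for j
  proof (induction j)
    case 0 show ?case by (rule exI[of _ "{}"]) simp
  next
    case (Suc j)
    then obtain R where R: "R \<subseteq> Q" "card R \<le> j" "real (card {S\<in>F. S \<inter> R = {}}) \<le> real (card F) * (1 - k / ?n) ^ j" by blast
    obtain a where a: "a \<in> Q" "real (card {S\<in>{S\<in>F. S \<inter> R = {}}. a \<notin> S}) \<le> real (card {S\<in>F. S \<inter> R = {}}) * (1 - k / ?n)"
      using step[of "{S\<in>F. S \<inter> R = {}}"] by blast
    have "{S\<in>F. S \<inter> insert a R = {}} = {S\<in>{S\<in>F. S \<inter> R = {}}. a \<notin> S}" by auto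
    then have "real (card {S\<in>F. S \<inter> insert a R = {}}) \<le> real (card {S\<in>F. S \<inter> R = {}}) * (1 - k / ?n)"
      using a(2) by simp
    also have "\<dots> \<le> real (card F) * (1 - k / ?n) ^ j * (1 - k / ?n)"
      using R(3) kn n0 by (intro mult_right_mono) (auto simp: field_simps)
    finally have "real (card {S\<in>F. S \<inter> insert a R = {}}) \<le> real (card F) * (1 - k / ?n) ^ Suc j"
      by (simp add: algebra_simps)
    moreover have "card (insert a R) \<le> Suc j"
      using R(2) finite_subset[OF R(1) assms(2)] by (simp add: card_insert_if)
    ultimately show ?case using R(1) a(1) by (intro exI[of _ "insert a R"]) auto
  qed
  let ?t = "?n / k * ln (real (card F))"
  have F1: "real (card F) \<ge> 1" using assms(1,6) by (simp add: Suc_leI card_gt_0_iff)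
  have t0: "?t \<ge> 0" using F1 n0 assms(5) by simp
  \<comment> \<open>The strict inequality j > t makes the number of missed sets smaller than 1,
    hence 0; rounding up costs the final summand 1.\<close>
  define j where "j = nat \<lfloor>?t\<rfloor> + 1"
  have jt: "real j > ?t" "real j \<le> ?t + 1" using t0 unfolding j_def by linarith+
  obtain R where R: "R \<subseteq> Q" "card R \<le> j" "real (card {S\<in>F. S \<inter> R = {}}) \<le> real (card F) * (1 - k / ?n) ^ j"
    using iter by blast
  have "(1 - k / ?n) ^ j \<le> exp (- (k / ?n)) ^ j"
    using kn n0 exp_ge_add_one_self[of "- (k / ?n)"] by (intro power_mono) (auto simp: field_simps)
  also have "\<dots> = exp (- (real j * (k / ?n)))" by (simp add: exp_of_nat_mult[symmetric])
  also have "\<dots> < exp (- ln (real (card F)))"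
    using jt(1) n0 assms(5) by (simp add: field_simps)
  also have "\<dots> = 1 / real (card F)" using F1 by (simp add: exp_minus field_simps)
  finally have "real (card F) * (1 - k / ?n) ^ j < 1" using F1 by (simp add: field_simps)
  with R(3) have "card {S\<in>F. S \<inter> R = {}} = 0" by linarith
  then have "{S\<in>F. S \<inter> R = {}} = {}" using assms(1) by simp
  moreover have "real (card R) \<le> ?t + 1" using R(2) jt(2) by linarith
  ultimately show ?thesis using R(1) by (intro exI[of _ R]) auto
qed

section \<open>Cuttings from vertical decompositions\<close>

text \<open>The abscissa at which \<open>u\<close> and \<open>g\<close> cross; meaningful only for
  distinct slopes, hence the guard in \<open>crs\<close>.\<close>

definition cross_x :: "real \<times> real \<Rightarrow> real \<times> real \<Rightarrow> real" where
  "cross_x u g = (snd g - snd u) / (fst u - fst g)"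

text \<open>The vertical order of two lines immediately to the right of \<open>x\<close>; it breaks the ties at \<open>x\<close> itself.\<close>

definition lless :: "real \<Rightarrow> real \<times> real \<Rightarrow> real \<times> real \<Rightarrow> bool" where
  "lless x g h \<longleftrightarrow> val g x < val h x \<or> (val g x = val h x \<and> fst g < fst h)"

lemma lless_irrefl [simp]: "\<not> lless x g g" by (simp add: lless_def)

lemma lless_trans: "lless x f g \<Longrightarrow> lless x g h \<Longrightarrow> lless x f h" by (auto simp: lless_def)

lemma lless_total: "g \<noteq> h \<Longrightarrow> lless x g h \<or> lless x h g"
  by (cases "fst g = fst h") (auto simp: lless_def val_def prod_eq_iff)

lemma not_lless_iff: "u \<noteq> g \<Longrightarrow> \<not> lless x g u \<longleftrightarrow> lless x u g"
  using lless_total lless_trans lless_irrefl by blast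

lemma lless_imp_le: "lless x g h \<Longrightarrow> val g x \<le> val h x" by (auto simp: lless_def)

lemma val_diff_cross:
  assumes "fst g \<noteq> fst u"
  shows "val u x - val g x = (fst u - fst g) * (x - cross_x u g)"
  using assms by (simp add: val_def cross_x_def field_simps)

lemma lless_cross_iff:
  assumes "fst g \<noteq> fst u"
  shows "lless x g u \<longleftrightarrow> (if fst g < fst u then cross_x u g \<le> x else x < cross_x u g)"
proof -
  have "val g x < val u x \<longleftrightarrow> 0 < (fst u - fst g) * (x - cross_x u g)"
    and "val g x = val u x \<longleftrightarrow> (fst u - fst g) * (x - cross_x u g) = 0"
    using val_diff_cross[OF assms, of x] by linarith+
  then show ?thesis using assms by (auto simp: lless_def zero_less_mult_iff)
qed

lemma lless_parallel: "fst g = fst u \<Longrightarrow> lless x g u \<longleftrightarrow> lless x' g u"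
  by (simp add: lless_def val_def)

text \<open>The number of crossings on \<open>u\<close> up to x stays the same between neighbouring
  crossings. It is therefore a discrete address of an interval of \<open>u\<close>, with no need to
  name end points or infinity.\<close>

definition crs :: "(real \<times> real) set \<Rightarrow> real \<times> real \<Rightarrow> real \<Rightarrow> (real \<times> real) set" where
  "crs R u x = {g\<in>R. fst g \<noteq> fst u \<and> cross_x u g \<le> x}"

lemma crs_mono: "x \<le> x' \<Longrightarrow> crs R u x \<subseteq> crs R u x'" by (auto simp: crs_def)

lemma finite_crs [simp]: "finite R \<Longrightarrow> finite (crs R u x)" by (simp add: crs_def)

lemma card_crs_mono: "finite R \<Longrightarrow> x \<le> x' \<Longrightarrow> card (crs R u x) \<le> card (crs R u x')"
  by (intro card_mono crs_mono) auto

lemma crs_between: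
  assumes "finite R" "x \<le> x'" "x' \<le> x''" "card (crs R u x) = card (crs R u x'')"
  shows "card (crs R u x') = card (crs R u x)"
  using card_crs_mono[OF assms(1), of x x' u] card_crs_mono[OF assms(1), of x' x'' u] assms by linarith

text \<open>The sets increase with x, so equal cardinalities force equal sets.\<close>

lemma crs_eqI:
  assumes "finite R" "card (crs R u x) = card (crs R u x')"
  shows "crs R u x = crs R u x'"
proof (cases "x \<le> x'")
  case True
  then show ?thesis using assms by (intro card_subset_eq crs_mono) auto
next
  case False
  then have "crs R u x' = crs R u x" using assms by (intro card_subset_eq crs_mono) auto
  then show ?thesis by simp
qed

text \<open>The order of \<open>g\<close> and \<open>u\<close> changes only at their crossing, and
  equal counts mean that no line of \<open>R\<close> crosses \<open>u\<close> on the way.\<close>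

lemma lless_persist:
  assumes "finite R" "g \<in> R" "card (crs R u x) = card (crs R u x')"
  shows "lless x g u \<longleftrightarrow> lless x' g u"
proof (cases "fst g = fst u")
  case False
  have "cross_x u g \<le> x \<longleftrightarrow> cross_x u g \<le> x'"
    using crs_eqI[OF assms(1,3)] assms(2) False by (auto simp: crs_def)
  then show ?thesis using False by (auto simp: lless_cross_iff)
qed (rule lless_parallel)

lemma lless_persist':
  assumes "finite R" "g \<in> R" "card (crs R u x) = card (crs R u x')"
  shows "lless x u g \<longleftrightarrow> lless x' u g"
proof (cases "u = g")
  case False
  then show ?thesis using lless_persist[OF assms] not_lless_iff[OF False, of x] not_lless_iff[OF False, of x'] by argo
qed simp

lemma finite_max_lless:
  assumes "finite S" "S \<noteq> {}"
  shows "\<exists>u\<in>S. \<forall>g\<in>S. g = u \<or> lless x g u"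
  using assms
proof (induction rule: finite_ne_induct)
  case (insert f S)
  then obtain u where u: "u \<in> S" "\<And>g. g \<in> S \<Longrightarrow> g = u \<or> lless x g u" by blast
  show ?case
  proof (cases "lless x u f")
    case True
    then have "\<forall>g\<in>insert f S. g = f \<or> lless x g f" using u(2) lless_trans by blast
    then show ?thesis by blast
  next
    case False
    then have "f = u \<or> lless x f u" using lless_total by blast
    then have "\<forall>g\<in>insert f S. g = u \<or> lless x g u" using u(2) by blast
    then show ?thesis using u(1) by blast
  qed
qed simp

lemma finite_min_lless:
  assumes "finite S" "S \<noteq> {}"
  shows "\<exists>u\<in>S. \<forall>g\<in>S. g = u \<or> lless x u g"
  using assms
proof (induction rule: finite_ne_induct)
  case (insert f S)
  then obtain u where u: "u \<in> S" "\<And>g. g \<in> S \<Longrightarrow> g = u \<or> lless x u g" by blast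
  show ?case
  proof (cases "lless x f u")
    case True
    then have "\<forall>g\<in>insert f S. g = f \<or> lless x f g" using u(2) lless_trans by blast
    then show ?thesis by blast
  next
    case False
    then have "f = u \<or> lless x u f" using lless_total by blast
    then have "\<forall>g\<in>insert f S. g = u \<or> lless x u g" using u(2) by blast
    then show ?thesis using u(1) by blast
  qed
qed simp

text \<open>The trapezoids of the vertical decomposition of the arrangement of \<open>R\<close>: the floor is \<open>u\<close>, the
  ceiling is \<open>w\<close>, and the numbers of crossings on \<open>u\<close> and \<open>w\<close> to the left locate the walls.\<close>

definition trapezoid :: "(real \<times> real) set \<Rightarrow> (real \<times> real) \<times> nat \<times> (real \<times> real) \<times> nat \<Rightarrow> (real \<times> real) set" where
  "trapezoid R = (\<lambda>(u, i, w, j). {z. u \<in> R \<and> w \<in> R \<and> val u (fst z) < snd z \<and> snd z < val w (fst z) \<and>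
      (\<forall>g\<in>R. g = u \<or> lless (fst z) g u \<or> g = w \<or> lless (fst z) w g) \<and>
      card (crs R u (fst z)) = i \<and> card (crs R w (fst z)) = j})"

lemma trapezoidD:
  assumes "z \<in> trapezoid R (u, i, w, j)"
  shows "u \<in> R" "w \<in> R" "val u (fst z) < snd z" "snd z < val w (fst z)"
    "card (crs R u (fst z)) = i" "card (crs R w (fst z)) = j"
    "\<And>g. g \<in> R \<Longrightarrow> g = u \<or> lless (fst z) g u \<or> g = w \<or> lless (fst z) w g"
  using assms by (simp_all add: trapezoid_def)

text \<open>Both floors lie strictly below z, so each equals or precedes the other in the order at
  the abscissa of z; ceilings are treated alike.\<close>

lemma trapezoid_disjoint:
  assumes "z \<in> trapezoid R \<kappa>" "z \<in> trapezoid R \<kappa>'"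
  shows "\<kappa> = \<kappa>'"
proof -
  obtain u i w j u' i' w' j' where k: "\<kappa> = (u, i, w, j)" "\<kappa>' = (u', i', w', j')" by (metis prod_cases4)
  have z: "u \<in> R" "w \<in> R" "val u (fst z) < snd z" "snd z < val w (fst z)"
     "\<And>g. g \<in> R \<Longrightarrow> g = u \<or> lless (fst z) g u \<or> g = w \<or> lless (fst z) w g"
    and z': "u' \<in> R" "w' \<in> R" "val u' (fst z) < snd z" "snd z < val w' (fst z)"
     "\<And>g. g \<in> R \<Longrightarrow> g = u' \<or> lless (fst z) g u' \<or> g = w' \<or> lless (fst z) w' g"
    by (fact trapezoidD[OF assms(1)[unfolded k]] trapezoidD[OF assms(2)[unfolded k]])+
  have "u' = u \<or> lless (fst z) u' u" "u = u' \<or> lless (fst z) u u'"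
    using z(5)[OF z'(1)] z'(5)[OF z(1)] z(1-4) z'(1-4) by (auto dest!: lless_imp_le)
  then have "u = u'" using lless_trans lless_irrefl by blast
  moreover have "w' = w \<or> lless (fst z) w w'" "w = w' \<or> lless (fst z) w' w"
    using z(5)[OF z'(2)] z'(5)[OF z(2)] z(1-4) z'(1-4) by (auto dest!: lless_imp_le)
  then have "w = w'" using lless_trans lless_irrefl by blast
  ultimately show ?thesis using assms unfolding k trapezoid_def by auto
qed

text \<open>The crossing counts of floor and ceiling agree at both given points, hence in between,
  and so no line of \<open>R\<close> can enter the space between floor and ceiling.\<close>

lemma trapezoid_slice:
  assumes "finite R" "z1 \<in> trapezoid R (u, i, w, j)" "z2 \<in> trapezoid R (u, i, w, j)"
    and "fst z1 \<le> x" "x \<le> fst z2" "val u x < y" "y < val w x"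
  shows "(x, y) \<in> trapezoid R (u, i, w, j)"
proof -
  have a: "u \<in> R" "w \<in> R" "card (crs R u (fst z1)) = i" "card (crs R w (fst z1)) = j"
    "card (crs R u (fst z2)) = i" "card (crs R w (fst z2)) = j"
    "\<And>g. g \<in> R \<Longrightarrow> g = u \<or> lless (fst z1) g u \<or> g = w \<or> lless (fst z1) w g"
    by (fact trapezoidD[OF assms(2)] trapezoidD[OF assms(3)])+
  have u: "card (crs R u x) = i" and w: "card (crs R w x) = j"
    using crs_between[OF assms(1,4,5)] a by auto
  have "g = u \<or> lless x g u \<or> g = w \<or> lless x w g" if "g \<in> R" for g
    using a(7)[OF that] lless_persist[OF assms(1) that, of u x "fst z1"]
      lless_persist'[OF assms(1) that, of w x "fst z1"] a u w by auto
  then show ?thesis using a u w assms(6,7) by (auto simp: trapezoid_def)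
qed

lemma val_convex_comb: "s + t = 1 \<Longrightarrow> val u (s * x + t * y) = s * val u x + t * val u y"
proof -
  assume "s + t = 1"
  then have "snd u = s * snd u + t * snd u" by (simp add: distrib_right[symmetric])
  then show ?thesis by (simp add: val_def algebra_simps)
qed

lemma convex_trapezoid:
  assumes "finite R"
  shows "convex (trapezoid R \<kappa>)"
proof -
  obtain u i w j where k: "\<kappa> = (u, i, w, j)" by (metis prod_cases4)
  have main: "s *\<^sub>R z1 + t *\<^sub>R z2 \<in> trapezoid R \<kappa>"
    if z: "z1 \<in> trapezoid R \<kappa>" "z2 \<in> trapezoid R \<kappa>" and le: "fst z1 \<le> fst z2"
      and st: "0 \<le> s" "0 \<le> t" "s + t = 1" for z1 z2 s t
  proof -
    let ?x = "s * fst z1 + t * fst z2" and ?y = "s * snd z1 + t * snd z2"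
    have "fst z1 = s * fst z1 + t * fst z1" "fst z2 = s * fst z2 + t * fst z2"
      using st(3) by (simp_all add: distrib_right[symmetric])
    then have x: "fst z1 \<le> ?x" "?x \<le> fst z2"
      using le st(1,2) mult_left_mono[OF le] by (smt (verit))+
    have v: "val u (fst z1) < snd z1" "val u (fst z2) < snd z2" "snd z1 < val w (fst z1)" "snd z2 < val w (fst z2)"
      using z unfolding k trapezoid_def by auto
    have lt: "s * a + t * b < s * c + t * d" if "a < c" "b < d" for a b c d :: real
    proof (cases "s = 0")
      case True then show ?thesis using st that by simp
    next
      case False
      then have "s * a < s * c" "t * b \<le> t * d" using st that by (auto intro: mult_left_mono)
      then show ?thesis by linarith
    qed
    have "(?x, ?y) \<in> trapezoid R (u, i, w, j)"
      using x v lt val_convex_comb[OF st(3)]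
      by (intro trapezoid_slice[OF assms z[unfolded k]]) auto
    moreover have "s *\<^sub>R z1 + t *\<^sub>R z2 = (?x, ?y)" by (simp add: prod_eq_iff)
    ultimately show ?thesis unfolding k by simp
  qed
  show ?thesis
  proof (rule convexI)
    fix z1 z2 and s t :: real
    assume a: "z1 \<in> trapezoid R \<kappa>" "z2 \<in> trapezoid R \<kappa>" "0 \<le> s" "0 \<le> t" "s + t = 1"
    show "s *\<^sub>R z1 + t *\<^sub>R z2 \<in> trapezoid R \<kappa>"
    proof (cases "fst z1 \<le> fst z2")
      case True then show ?thesis using main a by blast
    next
      case False then show ?thesis using main[of z2 z1 t s] a by (simp add: add.commute)
    qed
  qed
qed

text \<open>Floor and ceiling are the highest line of \<open>R\<close> below z and the lowest one
  above it. Since z lies on no line of \<open>R\<close>, there is no third kind.\<close>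

lemma trapezoid_cover:
  assumes "finite R" "\<forall>g\<in>R. \<not> on z g" "g1 \<in> R" "val g1 (fst z) < snd z" "g2 \<in> R" "snd z < val g2 (fst z)"
  shows "\<exists>\<kappa>. z \<in> trapezoid R \<kappa>"
proof -
  let ?x = "fst z"
  let ?B = "{g\<in>R. val g ?x < snd z}" and ?A = "{g\<in>R. snd z < val g ?x}"
  have f: "finite ?B" "finite ?A" using assms(1) by simp_all
  have ne: "?B \<noteq> {}" "?A \<noteq> {}" using assms(3-6) by blast+
  from finite_max_lless[OF f(1) ne(1)] obtain u where u: "u \<in> ?B" "\<forall>g\<in>?B. g = u \<or> lless ?x g u" by (rule bexE)
  from finite_min_lless[OF f(2) ne(2)] obtain w where w: "w \<in> ?A" "\<forall>g\<in>?A. g = w \<or> lless ?x w g" by (rule bexE)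
  have "g = u \<or> lless ?x g u \<or> g = w \<or> lless ?x w g" if "g \<in> R" for g
  proof -
    have "g \<in> ?B \<or> g \<in> ?A" using assms(2) that unfolding on_def by (metis (mono_tags, lifting) linorder_less_linear mem_Collect_eq)
    then show ?thesis using u(2) w(2) by blast
  qed
  then have "z \<in> trapezoid R (u, card (crs R u ?x), w, card (crs R w ?x))"
    using u(1) w(1) by (simp add: trapezoid_def)
  then show ?thesis by (rule exI)
qed

text \<open>A trapezoid is determined by its floor and the left end of the floor's interval, or by its ceiling and
  the left end of the ceiling's interval, according to which of the two intervals starts further right.\<close>

lemma card_trapezoids:
  assumes "finite R"
  shows "finite {\<kappa>. trapezoid R \<kappa> \<noteq> {}}" "card {\<kappa>. trapezoid R \<kappa> \<noteq> {}} \<le> 2 * (card R * (card R + 1))"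
proof -
  let ?K = "{\<kappa>. trapezoid R \<kappa> \<noteq> {}}"
  define A where "A = {(u, i, w, j). \<exists>z\<in>trapezoid R (u, i, w, j).
     \<forall>x'\<le>fst z. card (crs R u x') = i \<longrightarrow> card (crs R w x') = j}"
  define B where "B = {(u, i, w, j). \<exists>z\<in>trapezoid R (u, i, w, j).
     \<forall>x'\<le>fst z. card (crs R w x') = j \<longrightarrow> card (crs R u x') = i}"
  have KAB: "?K \<subseteq> A \<union> B"
  proof
    fix \<kappa> assume "\<kappa> \<in> ?K"
    then obtain z where z0: "z \<in> trapezoid R \<kappa>" by blast
    obtain u i w j where k: "\<kappa> = (u, i, w, j)" by (metis prod_cases4)
    have z: "z \<in> trapezoid R (u, i, w, j)" using z0 k by simp
    have c: "card (crs R u (fst z)) = i" "card (crs R w (fst z)) = j" using z by (auto simp: trapezoid_def)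
    show "\<kappa> \<in> A \<union> B"
    proof (rule ccontr)
      assume "\<kappa> \<notin> A \<union> B"
      then obtain x' x'' where x: "x' \<le> fst z" "card (crs R u x') = i" "card (crs R w x') \<noteq> j"
        "x'' \<le> fst z" "card (crs R w x'') = j" "card (crs R u x'') \<noteq> i"
        using z unfolding A_def B_def k by blast
      show False
      proof (cases "x' \<le> x''")
        case True
        then show False using crs_between[OF assms True x(4), of u] x c by simp
      next
        case False
        then have le: "x'' \<le> x'" by simp
        show False using crs_between[OF assms le x(1), of w] x c by simp
      qed
    qed
  qed
  have A: "(\<kappa> = \<kappa>')" if AA: "\<kappa> \<in> A" "\<kappa>' \<in> A" and "fst \<kappa> = fst \<kappa>'" "fst (snd \<kappa>) = fst (snd \<kappa>')" for \<kappa> \<kappa>'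
  proof -
    have main: "w = w' \<and> j = j'"
      if z: "z \<in> trapezoid R (u, i, w, j)" and z': "z' \<in> trapezoid R (u, i, w', j')"
        and t: "\<forall>x'\<le>fst z'. card (crs R u x') = i \<longrightarrow> card (crs R w' x') = j'"
        and le: "fst z \<le> fst z'" for u i w w' j j' z z'
    proof -
      have a: "u \<in> R" "w \<in> R" "card (crs R u (fst z)) = i" "card (crs R w (fst z)) = j"
        "val u (fst z) < snd z" "snd z < val w (fst z)"
        "\<And>g. g \<in> R \<Longrightarrow> g = u \<or> lless (fst z) g u \<or> g = w \<or> lless (fst z) w g"
        by (fact trapezoidD[OF z])+
      have a': "w' \<in> R" "card (crs R u (fst z')) = i" "card (crs R w' (fst z')) = j'"
        "val u (fst z') < snd z'" "snd z' < val w' (fst z')"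
        "\<And>g. g \<in> R \<Longrightarrow> g = u \<or> lless (fst z') g u \<or> g = w' \<or> lless (fst z') w' g"
        by (fact trapezoidD[OF z'])+
      \<comment> \<open>Membership of the right trapezoid in \<open>A\<close> carries its ceiling
        count left to the abscissa of z, where both \<open>w\<close> and \<open>w'\<close> are then
        the first line above the common floor.\<close>
      have e: "card (crs R w' (fst z)) = j'" using t le a(3) by blast
      have b: "g = u \<or> lless (fst z) g u \<or> g = w' \<or> lless (fst z) w' g" if "g \<in> R" for g
        using a'(6)[OF that] lless_persist[OF assms that, of u "fst z" "fst z'"]
          lless_persist'[OF assms that, of w' "fst z" "fst z'"] a a' e by auto
      have "lless (fst z') u w'" using a' unfolding lless_def by linarith
      then have uw': "lless (fst z) u w'"
        using lless_persist'[OF assms a'(1), of u "fst z" "fst z'"] a a' by simp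
      have uw: "lless (fst z) u w" using a unfolding lless_def by linarith
      have "w = w' \<or> lless (fst z) w' w" using b[OF a(2)] uw lless_trans lless_irrefl by blast
      moreover have "w' = w \<or> lless (fst z) w w'" using a(7)[OF a'(1)] uw' lless_trans lless_irrefl by blast
      ultimately have "w = w'" using lless_trans lless_irrefl by blast
      then show ?thesis using e a(4) by simp
    qed
    obtain u i w j u' i' w' j' where k: "\<kappa> = (u, i, w, j)" "\<kappa>' = (u', i', w', j')" by (metis prod_cases4)
    have e: "u' = u" "i' = i" using that(3,4) by (simp_all add: k)
    obtain z z' where z: "z \<in> trapezoid R (u, i, w, j)" "\<forall>x'\<le>fst z. card (crs R u x') = i \<longrightarrow> card (crs R w x') = j"
      and z': "z' \<in> trapezoid R (u, i, w', j')" "\<forall>x'\<le>fst z'. card (crs R u x') = i \<longrightarrow> card (crs R w' x') = j'"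
      using AA unfolding A_def k e by blast
    show ?thesis using main[OF z(1) z'(1) z'(2)] main[OF z'(1) z(1) z(2)] unfolding k e by force
  qed
  have B: "(\<kappa> = \<kappa>')" if BB: "\<kappa> \<in> B" "\<kappa>' \<in> B" and "fst (snd (snd \<kappa>)) = fst (snd (snd \<kappa>'))" "snd (snd (snd \<kappa>)) = snd (snd (snd \<kappa>'))" for \<kappa> \<kappa>'
  proof -
    have main: "u = u' \<and> i = i'"
      if z: "z \<in> trapezoid R (u, i, w, j)" and z': "z' \<in> trapezoid R (u', i', w, j)"
        and t: "\<forall>x'\<le>fst z'. card (crs R w x') = j \<longrightarrow> card (crs R u' x') = i'"
        and le: "fst z \<le> fst z'" for u u' i i' w j z z'
    proof -
      have a: "u \<in> R" "w \<in> R" "card (crs R u (fst z)) = i" "card (crs R w (fst z)) = j"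
        "val u (fst z) < snd z" "snd z < val w (fst z)"
        "\<And>g. g \<in> R \<Longrightarrow> g = u \<or> lless (fst z) g u \<or> g = w \<or> lless (fst z) w g"
        by (fact trapezoidD[OF z])+
      have a': "u' \<in> R" "card (crs R w (fst z')) = j" "card (crs R u' (fst z')) = i'"
        "val u' (fst z') < snd z'" "snd z' < val w (fst z')"
        "\<And>g. g \<in> R \<Longrightarrow> g = u' \<or> lless (fst z') g u' \<or> g = w \<or> lless (fst z') w g"
        by (fact trapezoidD[OF z'])+
      have e: "card (crs R u' (fst z)) = i'" using t le a(4) by blast
      have b: "g = u' \<or> lless (fst z) g u' \<or> g = w \<or> lless (fst z) w g" if "g \<in> R" for g
        using a'(6)[OF that] lless_persist[OF assms that, of u' "fst z" "fst z'"]
          lless_persist'[OF assms that, of w "fst z" "fst z'"] a a' e by auto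
      have "lless (fst z') u' w" using a' unfolding lless_def by linarith
      then have uw': "lless (fst z) u' w"
        using lless_persist[OF assms a'(1), of w "fst z" "fst z'"] a a' by simp
      have uw: "lless (fst z) u w" using a unfolding lless_def by linarith
      have "u = u' \<or> lless (fst z) u u'" using b[OF a(1)] uw lless_trans lless_irrefl by blast
      moreover have "u' = u \<or> lless (fst z) u' u" using a(7)[OF a'(1)] uw' lless_trans lless_irrefl by blast
      ultimately have "u = u'" using lless_trans lless_irrefl by blast
      then show ?thesis using e a(3) by simp
    qed
    obtain u i w j u' i' w' j' where k: "\<kappa> = (u, i, w, j)" "\<kappa>' = (u', i', w', j')" by (metis prod_cases4)
    have e: "w' = w" "j' = j" using that(3,4) by (simp_all add: k)
    obtain z z' where z: "z \<in> trapezoid R (u, i, w, j)" "\<forall>x'\<le>fst z. card (crs R w x') = j \<longrightarrow> card (crs R u x') = i"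
      and z': "z' \<in> trapezoid R (u', i', w, j)" "\<forall>x'\<le>fst z'. card (crs R w x') = j \<longrightarrow> card (crs R u' x') = i'"
      using BB unfolding B_def k e by blast
    show ?thesis using main[OF z(1) z'(1) z'(2)] main[OF z'(1) z(1) z(2)] unfolding k e by force
  qed
  let ?T = "R \<times> {0..card R}"
  have fT: "finite ?T" and cT: "card ?T = card R * (card R + 1)" using assms by (auto simp: card_cartesian_product)
  have cle: "card (crs R u x) \<le> card R" for u x using assms by (intro card_mono) (auto simp: crs_def)
  have iA: "inj_on (\<lambda>\<kappa>. (fst \<kappa>, fst (snd \<kappa>))) A" using A by (auto intro!: inj_onI)
  have sA: "(\<lambda>\<kappa>. (fst \<kappa>, fst (snd \<kappa>))) ` A \<subseteq> ?T"
  proof (rule image_subsetI)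
    fix \<kappa> assume a: "\<kappa> \<in> A"
    obtain u i w j where k: "\<kappa> = (u, i, w, j)" by (metis prod_cases4)
    obtain z where z: "z \<in> trapezoid R (u, i, w, j)" using a unfolding A_def k by blast
    show "(fst \<kappa>, fst (snd \<kappa>)) \<in> ?T"
      using trapezoidD(1)[OF z] trapezoidD(5)[OF z] cle[of u "fst z"] by (simp add: k)
  qed
  have iB: "inj_on (\<lambda>\<kappa>. (fst (snd (snd \<kappa>)), snd (snd (snd \<kappa>)))) B" using B by (auto intro!: inj_onI)
  have sB: "(\<lambda>\<kappa>. (fst (snd (snd \<kappa>)), snd (snd (snd \<kappa>)))) ` B \<subseteq> ?T"
  proof (rule image_subsetI)
    fix \<kappa> assume a: "\<kappa> \<in> B"
    obtain u i w j where k: "\<kappa> = (u, i, w, j)" by (metis prod_cases4)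
    obtain z where z: "z \<in> trapezoid R (u, i, w, j)" using a unfolding B_def k by blast
    show "(fst (snd (snd \<kappa>)), snd (snd (snd \<kappa>))) \<in> ?T"
      using trapezoidD(2)[OF z] trapezoidD(6)[OF z] cle[of w "fst z"] by (simp add: k)
  qed
  have fA: "finite A" "card A \<le> card ?T" using iA sA fT by (auto intro: inj_on_finite card_inj_on_le)
  have fB: "finite B" "card B \<le> card ?T" using iB sB fT by (auto intro: inj_on_finite card_inj_on_le)
  show "finite ?K" using KAB fA fB finite_subset by blast
  have "card ?K \<le> card (A \<union> B)" using KAB fA fB by (intro card_mono) auto
  also have "\<dots> \<le> card A + card B" by (rule card_Un_le)
  finally show "card ?K \<le> 2 * (card R * (card R + 1))" using fA fB cT by linarith
qed

text \<open>A cell is described by its floor, its ceiling and the extreme abscissae of its points of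
  \<open>Z\<close>, so there are only polynomially many candidates, and a small \<open>R\<close>
  hits every candidate that k or more lines enter. A trapezoid of \<open>R\<close>, truncated to the
  abscissae of its points, is entered by no line of \<open>R\<close>, hence by fewer than k lines of
  \<open>Q\<close>. The truncation is what makes the walls range over a finite set known in
  advance.\<close>

lemma cutting:
  fixes k :: real
  assumes Q: "finite Q" and Z: "finite Z" and k: "k > 0"
  shows "\<exists>R CC. R \<subseteq> Q \<and> finite CC \<and>
     real (card R) \<le> real (card Q) / k * (2 * ln (real (card Q + 2) * real (card Z + 1))) + 1 \<and>
     card CC \<le> 2 * ((card R + 2) * (card R + 3)) \<and> disjoint CC \<and> (\<forall>A\<in>CC. convex A) \<and>
     (\<forall>A\<in>CC. real (card {q\<in>Q. \<exists>z\<in>A. on z q}) < k) \<and>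
     (\<forall>z\<in>Z. (\<forall>g\<in>R. \<not> on z g) \<longrightarrow> (\<exists>A\<in>CC. z \<in> A))"
proof -
  \<comment> \<open>The horizontal lines at heights -Y and Y run strictly below and above all points
    of \<open>Z\<close> and provide every point with a floor and a ceiling. They are the 2 added to
    \<open>card R\<close> in the number of cells.\<close>
  define Y where "Y = (\<Sum>z\<in>Z. \<bar>snd z\<bar>) + 1"
  have Y: "\<bar>snd z\<bar> < Y" if "z \<in> Z" for z
    using member_le_sum[OF that, of "\<lambda>z. \<bar>snd z\<bar>"] Z unfolding Y_def by simp
  define W where "W = Q \<union> {(0, -Y), (0, Y)}"
  define hit where "hit = (\<lambda>(u, w, x1, x2). {q\<in>Q. \<exists>x. x1 \<le> x \<and> x \<le> x2 \<and> val u x < val q x \<and> val q x < val w x})"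
  define Par where "Par = W \<times> W \<times> fst ` Z \<times> fst ` Z"
  define F where "F = {S \<in> hit ` Par. k \<le> real (card S)}"
  have fW: "finite W" "card W \<le> card Q + 2"
    unfolding W_def using Q by (auto intro!: order_trans[OF card_Un_le] add_left_mono simp: card_insert_if)
  have fP: "finite Par" unfolding Par_def using fW Z by auto
  have "card Par = card W * (card W * (card (fst ` Z) * card (fst ` Z)))"
    unfolding Par_def by (simp add: card_cartesian_product)
  also have "\<dots> \<le> (card Q + 2) * ((card Q + 2) * ((card Z + 1) * (card Z + 1)))"
    using fW card_image_le[OF Z, of fst] by (intro mult_mono) auto
  finally have cP: "card Par \<le> ((card Q + 2) * (card Z + 1))\<^sup>2" by (simp add: power2_eq_square algebra_simps)
  have fF: "finite F" "card F \<le> card Par"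
    unfolding F_def using fP by (auto intro: order_trans[OF card_mono card_image_le])
  let ?l = "2 * ln (real (card Q + 2) * real (card Z + 1))"
  have l0: "?l \<ge> 0"
  proof -
    have "1 * 1 \<le> real (card Q + 2) * real (card Z + 1)" by (intro mult_mono) auto
    then show ?thesis by simp
  qed
  have "\<exists>R\<subseteq>Q. (\<forall>S\<in>F. S \<inter> R \<noteq> {}) \<and> real (card R) \<le> real (card Q) / k * ?l + 1"
  proof (cases "F = {}")
    case True
    then show ?thesis using l0 k by (intro exI[of _ "{}"]) auto
  next
    case False
    have "S \<subseteq> Q" "k \<le> real (card S)" if "S \<in> F" for S
      using that by (auto simp: F_def hit_def)
    then obtain R where R: "R \<subseteq> Q" "\<forall>S\<in>F. S \<inter> R \<noteq> {}" "real (card R) \<le> real (card Q) / k * ln (real (card F)) + 1"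
      using greedy_hitting[OF fF(1) Q _ _ k False] by blast
    have F1: "card F > 0" using False fF by (simp add: card_gt_0_iff)
    have "real (card F) \<le> real (((card Q + 2) * (card Z + 1))\<^sup>2)"
      using fF(2) cP by (simp only: of_nat_le_iff)
    also have "\<dots> = (real (card Q + 2) * real (card Z + 1))\<^sup>2" by (simp only: of_nat_mult of_nat_power)
    finally have "ln (real (card F)) \<le> ln ((real (card Q + 2) * real (card Z + 1))\<^sup>2)"
      using F1 by (intro ln_mono) auto
    also have "\<dots> = ?l" by (simp add: ln_realpow)
    finally have "real (card Q) / k * ln (real (card F)) \<le> real (card Q) / k * ?l"
      using k by (intro mult_left_mono) auto
    then show ?thesis using R by (intro exI[of _ R]) auto
  qed
  then obtain R where R: "R \<subseteq> Q" "\<And>S. S \<in> F \<Longrightarrow> S \<inter> R \<noteq> {}" "real (card R) \<le> real (card Q) / k * ?l + 1" by blast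
  define R' where "R' = R \<union> {(0, -Y), (0, Y)}"
  have fR: "finite R" using R(1) Q finite_subset by blast
  have fR': "finite R'" "card R' \<le> card R + 2" "R' \<subseteq> W"
    unfolding R'_def W_def using fR R(1) by (auto intro!: order_trans[OF card_Un_le] add_left_mono simp: card_insert_if)
  define KK where "KK = {\<kappa>. trapezoid R' \<kappa> \<inter> Z \<noteq> {}}"
  define lo hi where "lo = (\<lambda>\<kappa>. Min (fst ` (trapezoid R' \<kappa> \<inter> Z)))" and "hi = (\<lambda>\<kappa>. Max (fst ` (trapezoid R' \<kappa> \<inter> Z)))"
  define T where "T = (\<lambda>\<kappa>. trapezoid R' \<kappa> \<inter> {z. lo \<kappa> \<le> fst z \<and> fst z \<le> hi \<kappa>})"
  have KK: "KK \<subseteq> {\<kappa>. trapezoid R' \<kappa> \<noteq> {}}" unfolding KK_def by auto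
  have fKK: "finite KK" using KK card_trapezoids(1)[OF fR'(1)] finite_subset by blast
  have "card (T ` KK) \<le> card KK" by (rule card_image_le[OF fKK])
  also have "\<dots> \<le> 2 * (card R' * (card R' + 1))"
    using card_trapezoids[OF fR'(1)] card_mono[OF _ KK] by linarith
  also have "\<dots> \<le> 2 * ((card R + 2) * (card R + 3))" using fR'(2) by (intro mult_left_mono mult_mono) auto
  finally have c: "card (T ` KK) \<le> 2 * ((card R + 2) * (card R + 3))" .
  have dis: "disjoint (T ` KK)"
  proof (rule disjointI)
    fix A B assume "A \<in> T ` KK" "B \<in> T ` KK" and ne: "A \<noteq> B"
    then obtain \<kappa> \<kappa>' where k: "A = T \<kappa>" "B = T \<kappa>'" by blast
    then have "\<kappa> \<noteq> \<kappa>'" using ne by blast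
    then show "A \<inter> B = {}" using trapezoid_disjoint unfolding k T_def by blast
  qed
  have "convex {z::real\<times>real. a \<le> fst z \<and> fst z \<le> b}" for a b
  proof -
    have "{z::real\<times>real. a \<le> fst z \<and> fst z \<le> b} = {a..b} \<times> UNIV" by (auto simp: mem_Times_iff)
    then show ?thesis by (simp add: convex_Times)
  qed
  then have conv: "\<forall>A\<in>T ` KK. convex A"
    unfolding T_def using convex_trapezoid[OF fR'(1)] by (auto intro: convex_Int)
  have cov: "\<exists>A\<in>T ` KK. z \<in> A" if z: "z \<in> Z" "\<forall>g\<in>R. \<not> on z g" for z
  proof -
    have "\<forall>g\<in>R'. \<not> on z g" using z(2) Y[OF z(1)] unfolding R'_def by (auto simp: on_def val_def)
    moreover have "val (0, -Y) (fst z) < snd z" "snd z < val (0, Y) (fst z)" using Y[OF z(1)] by (auto simp: val_def)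
    moreover have "(0, -Y) \<in> R'" "(0, Y) \<in> R'" by (simp_all add: R'_def)
    ultimately obtain \<kappa> where k: "z \<in> trapezoid R' \<kappa>"
      using trapezoid_cover[OF fR'(1)] by blast
    have m: "fst z \<in> fst ` (trapezoid R' \<kappa> \<inter> Z)" and f: "finite (fst ` (trapezoid R' \<kappa> \<inter> Z))"
      using k z(1) Z by auto
    have "lo \<kappa> \<le> fst z" "fst z \<le> hi \<kappa>"
      unfolding lo_def hi_def by (rule Min_le[OF f m], rule Max_ge[OF f m])
    moreover have "\<kappa> \<in> KK" using k z(1) unfolding KK_def by blast
    ultimately have "z \<in> T \<kappa>" "T \<kappa> \<in> T ` KK" using k by (simp_all add: T_def)
    then show ?thesis by (rule bexI)
  qed
  have hits: "real (card {q\<in>Q. \<exists>z\<in>A. on z q}) < k" if "A \<in> T ` KK" for A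
  proof -
    from that obtain \<kappa> where \<kappa>: "\<kappa> \<in> KK" "A = T \<kappa>" by blast
    obtain u i w j where kk: "\<kappa> = (u, i, w, j)" by (metis prod_cases4)
    have ne: "fst ` (trapezoid R' \<kappa> \<inter> Z) \<noteq> {}" "finite (fst ` (trapezoid R' \<kappa> \<inter> Z))"
      using \<kappa>(1) Z unfolding KK_def by blast+
    obtain z1 where "lo \<kappa> = fst z1" "z1 \<in> trapezoid R' \<kappa> \<inter> Z"
      using Min_in[OF ne(2,1)] unfolding lo_def by (rule imageE)
    then have z1: "z1 \<in> trapezoid R' \<kappa>" "z1 \<in> Z" "fst z1 = lo \<kappa>" by simp_all
    obtain z2 where "hi \<kappa> = fst z2" "z2 \<in> trapezoid R' \<kappa> \<inter> Z"
      using Max_in[OF ne(2,1)] unfolding hi_def by (rule imageE)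
    then have z2: "z2 \<in> trapezoid R' \<kappa>" "z2 \<in> Z" "fst z2 = hi \<kappa>" by simp_all
    have uw: "u \<in> W" "w \<in> W" using trapezoidD(1,2)[OF z1(1)[unfolded kk]] fR'(3) by blast+
    let ?p = "(u, w, lo \<kappa>, hi \<kappa>)"
    have pp: "?p \<in> Par" unfolding Par_def using uw z1 z2 by (metis SigmaI imageI)
    have sub: "{q\<in>Q. \<exists>z\<in>A. on z q} \<subseteq> hit ?p"
    proof
      fix q assume "q \<in> {q\<in>Q. \<exists>z\<in>A. on z q}"
      then obtain z where z: "q \<in> Q" "z \<in> trapezoid R' (u, i, w, j)" "lo \<kappa> \<le> fst z" "fst z \<le> hi \<kappa>" "on z q"
        unfolding \<kappa>(2) T_def kk by blast
      then show "q \<in> hit ?p" using trapezoidD(3,4)[OF z(2)] unfolding hit_def on_def by auto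
    qed
    \<comment> \<open>A line of \<open>R\<close> entering the region would pass through a point of
      the trapezoid, where every line of \<open>R\<close> is at most the floor or at least the
      ceiling.\<close>
    have nR: "hit ?p \<inter> R = {}"
    proof (rule ccontr)
      assume "hit ?p \<inter> R \<noteq> {}"
      then obtain g x where g: "g \<in> R" "lo \<kappa> \<le> x" "x \<le> hi \<kappa>" "val u x < val g x" "val g x < val w x"
        unfolding hit_def by auto
      have "(x, val g x) \<in> trapezoid R' (u, i, w, j)"
        using z1 z2 g unfolding kk by (intro trapezoid_slice[OF fR'(1), of z1 u i w j z2]) auto
      then have "g = u \<or> lless x g u \<or> g = w \<or> lless x w g"
        using trapezoidD(7)[of "(x, val g x)" R' u i w j g] g(1) unfolding R'_def by simp
      then show False using g(4,5) by (auto dest: lless_imp_le)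
    qed
    have fh: "finite (hit ?p)" unfolding hit_def using Q by auto
    have "\<not> k \<le> real (card (hit ?p))"
    proof
      assume "k \<le> real (card (hit ?p))"
      then have "hit ?p \<in> F" unfolding F_def using pp by blast
      then show False using R(2) nR by blast
    qed
    moreover have "card {q\<in>Q. \<exists>z\<in>A. on z q} \<le> card (hit ?p)" using sub fh by (rule card_mono[rotated])
    ultimately show ?thesis by linarith
  qed
  show ?thesis
  proof (intro exI conjI)
    show "R \<subseteq> Q" "real (card R) \<le> real (card Q) / k * ?l + 1"
      "card (T ` KK) \<le> 2 * ((card R + 2) * (card R + 3))" "disjoint (T ` KK)" "\<forall>A\<in>T ` KK. convex A"
      by fact+
    show "finite (T ` KK)" using fKK by (rule finite_imageI)
    show "\<forall>A\<in>T ` KK. real (card {q\<in>Q. \<exists>z\<in>A. on z q}) < k" using hits by (rule ballI)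
    show "\<forall>z\<in>Z. (\<forall>g\<in>R. \<not> on z g) \<longrightarrow> (\<exists>A\<in>T ` KK. z \<in> A)"
      using cov by blast
  qed
qed

section \<open>A weak Szemeredi--Trotter bound\<close>

text \<open>If a sampled line other than the line of the incidence passes through the point, the two
  lines determine the point; otherwise the point determines the line, the only sampled one through
  it.\<close>

lemma incs_on_sample:
  assumes "finite Z" "finite Q" "R \<subseteq> Q"
  shows "card {p\<in>incs Z Q. \<exists>g\<in>R. on (fst p) g} \<le> card R * card Q + card Z"
proof -
  let ?I = "{p\<in>incs Z Q. \<exists>g\<in>R. on (fst p) g}"
  let ?A = "{p \<in> ?I. \<exists>g\<in>R. on (fst p) g \<and> g \<noteq> snd p}" and ?B = "{p \<in> ?I. \<forall>g\<in>R. on (fst p) g \<longrightarrow> g = snd p}"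
  define G where "G = (\<lambda>p. SOME g. g \<in> R \<and> on (fst p) g \<and> g \<noteq> snd p)"
  have fR: "finite R" using assms finite_subset by blast
  have G: "G p \<in> R" "on (fst p) (G p)" "G p \<noteq> snd p" "on (fst p) (snd p)" "snd p \<in> Q" if "p \<in> ?A" for p
  proof -
    have "\<exists>g. g \<in> R \<and> on (fst p) g \<and> g \<noteq> snd p" using that by blast
    from someI_ex[OF this] show "G p \<in> R" "on (fst p) (G p)" "G p \<noteq> snd p" unfolding G_def by blast+
    show "on (fst p) (snd p)" "snd p \<in> Q" using that by (auto simp: incs_def)
  qed
  have "card ?A \<le> card (R \<times> Q)"
  proof (rule card_inj_on_le[where f = "\<lambda>p. (G p, snd p)"])
    show "inj_on (\<lambda>p. (G p, snd p)) ?A"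
    proof (rule inj_onI)
      fix p p' assume p: "p \<in> ?A" "p' \<in> ?A" and e: "(G p, snd p) = (G p', snd p')"
      have "fst p = fst p'"
        using on_unique[of "fst p" "G p" "snd p" "fst p'"] G[OF p(1)] G[OF p(2)] e by fastforce
      then show "p = p'" using e by (simp add: prod_eq_iff)
    qed
    show "(\<lambda>p. (G p, snd p)) ` ?A \<subseteq> R \<times> Q"
    proof (rule image_subsetI)
      fix p assume "p \<in> ?A"
      from G(1,5)[OF this] show "(G p, snd p) \<in> R \<times> Q" by simp
    qed
    show "finite (R \<times> Q)" using fR assms by simp
  qed
  moreover have "card ?B \<le> card Z"
  proof (rule card_inj_on_le[where f = fst])
    show "inj_on fst ?B"
    proof (rule inj_onI)
      fix p p' assume p: "p \<in> ?B" "p' \<in> ?B" and e: "fst p = fst p'"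
      from p(1) obtain g where g: "g \<in> R" "on (fst p) g" by blast
      have "g = snd p" using p(1) g by blast
      moreover have "g = snd p'" using p(2) g unfolding e by blast
      ultimately have "snd p = snd p'" by simp
      then show "p = p'" using e by (simp add: prod_eq_iff)
    qed
    show "fst ` ?B \<subseteq> Z" by (auto simp: incs_def)
  qed (use assms in simp)
  moreover have "card ?I = card (?A \<union> ?B)" by (rule arg_cong[where f = card]) blast
  moreover have "card (?A \<union> ?B) \<le> card ?A + card ?B" by (rule card_Un_le)
  ultimately show ?thesis unfolding card_cartesian_product by linarith
qed

lemma incs_in_cells:
  fixes Z Q :: "(real \<times> real) set"
  assumes "finite Z" "finite Q" "finite CC" "disjoint CC"
  shows "card {p\<in>incs Z Q. \<exists>A\<in>CC. fst p \<in> A} = (\<Sum>A\<in>CC. card (incs (Z \<inter> A) {q\<in>Q. \<exists>z\<in>A. on z q}))"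
proof -
  have e: "{p\<in>incs Z Q. \<exists>A\<in>CC. fst p \<in> A} = (\<Union>A\<in>CC. incs (Z \<inter> A) {q\<in>Q. \<exists>z\<in>A. on z q})"
  proof (rule set_eqI)
    fix p :: "(real \<times> real) \<times> (real \<times> real)"
    obtain z q where p: "p = (z, q)" by (cases p)
    show "p \<in> {p\<in>incs Z Q. \<exists>A\<in>CC. fst p \<in> A} \<longleftrightarrow> p \<in> (\<Union>A\<in>CC. incs (Z \<inter> A) {q\<in>Q. \<exists>z\<in>A. on z q})"
      by (simp add: p incs_def) blast
  qed
  show ?thesis unfolding e
  proof (rule card_UN_disjoint)
    show "\<forall>A\<in>CC. finite (incs (Z \<inter> A) {q \<in> Q. \<exists>z\<in>A. on z q})" using assms by simp
    show "\<forall>A\<in>CC. \<forall>B\<in>CC. A \<noteq> B \<longrightarrow> incs (Z \<inter> A) {q \<in> Q. \<exists>z\<in>A. on z q} \<inter> incs (Z \<inter> B) {q \<in> Q. \<exists>z\<in>B. on z q} = {}"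
      using assms(4) unfolding disjoint_def incs_def by blast
  qed fact
qed

lemma sum_card_cells_le:
  assumes "finite Z" "finite CC" "disjoint CC"
  shows "(\<Sum>A\<in>CC. card (Z \<inter> A)) \<le> card Z"
proof -
  have "(\<Sum>A\<in>CC. card (Z \<inter> A)) = card (\<Union>A\<in>CC. Z \<inter> A)"
    using assms unfolding disjoint_def by (intro card_UN_disjoint[symmetric]) auto
  also have "\<dots> \<le> card Z" using assms by (intro card_mono) auto
  finally show ?thesis .
qed

text \<open>A weak Szemeredi--Trotter bound: the logarithmic factor is harmless here, since a factor
  \<open>N\<^sup>\<epsilon>\<close> may be lost at every step.\<close>

lemma szemeredi_trotter:
  fixes \<rho> :: real
  assumes Z: "finite Z" and Q: "finite Q" and l1: "\<rho> \<ge> 1"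
    and l2: "\<rho> \<ge> 2 * ln (real (card Q + 2) * real (card Z + 1))"
  shows "\<exists>X\<ge>0. X ^ 3 = (real (card Z) * real (card Q))\<^sup>2 \<and>
     real (card (incs Z Q)) \<le> 43 * \<rho> * (X + real (card Z) + real (card Q))"
proof -
  let ?m = "real (card Z)" and ?n = "real (card Q)" and ?I = "real (card (incs Z Q))"
  define X where "X = root 3 ((?m * ?n)\<^sup>2)"
  have X: "X \<ge> 0" "X ^ 3 = (?m * ?n)\<^sup>2" unfolding X_def by (simp_all add: odd_real_root_pow)
  \<comment> \<open>With so few points the bound inside a single cell is already linear in the
    number of lines. Beyond this case r > 1 below, and a cutting with about r sampled lines makes
    sense.\<close>
  show ?thesis
  proof (cases "?m\<^sup>2 \<le> ?n")
    case True
    have "?m \<le> sqrt ?n" using True by (rule real_le_rsqrt)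
    then have "?m * sqrt ?n \<le> sqrt ?n * sqrt ?n" by (rule mult_right_mono) simp
    then have "?I \<le> 2 * ?n" using incs_kst[OF Z Q] by simp
    also have "\<dots> \<le> 43 * 1 * (X + ?m + ?n)" using X by simp
    also have "\<dots> \<le> 43 * \<rho> * (X + ?m + ?n)" using l1 X by (intro mult_right_mono) auto
    finally show ?thesis using X by blast
  next
    case False
    show ?thesis
    proof (cases "?n = 0")
      case True
      then have "?I = 0" using Q by (simp add: incs_def)
      then show ?thesis using X l1 by (intro exI[of _ X]) auto
    next
      case n0: False
      then have n: "?n > 0" by simp
      define r where "r = root 3 (?m\<^sup>2 / ?n)"
      have "?m\<^sup>2 / ?n > 1" using False n by simp
      then have r1: "r > 1" unfolding r_def by simp
      have r3: "r ^ 3 = ?m\<^sup>2 / ?n" unfolding r_def by (simp add: odd_real_root_pow)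
      have "X ^ 3 = (r * ?n) ^ 3" unfolding X(2) power_mult_distrib r3 using n by (simp add: power2_eq_square power3_eq_cube)
      then have Xr: "X = r * ?n" using X(1) r1 n by (intro power_eq_imp_eq_base[of X 3]) auto
      \<comment> \<open>This k makes the sample at most 2 r lines and balances the sum over the
        cells: since r^3 = m^2 / n, the terms m sqrt k and r^2 k are both at most \<rho> X, where X
        = r n.\<close>
      define k where "k = ?n * \<rho> / r"
      have k: "k > 0" unfolding k_def using n l1 r1 by simp
      obtain R CC where RC: "R \<subseteq> Q" "finite CC"
        "real (card R) \<le> ?n / k * (2 * ln (real (card Q + 2) * real (card Z + 1))) + 1"
        "card CC \<le> 2 * ((card R + 2) * (card R + 3))" "disjoint CC"
        "\<And>A. A \<in> CC \<Longrightarrow> real (card {q\<in>Q. \<exists>z\<in>A. on z q}) < k"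
        "\<And>z. z \<in> Z \<Longrightarrow> \<forall>g\<in>R. \<not> on z g \<Longrightarrow> \<exists>A\<in>CC. z \<in> A"
        using cutting[OF Q Z k] by (elim exE conjE) (rule that, auto)
      have "?n / k * (2 * ln (real (card Q + 2) * real (card Z + 1))) \<le> ?n / k * \<rho>"
        using l2 k n by (intro mult_left_mono) auto
      also have "?n / k * \<rho> = r" unfolding k_def using n l1 r1 by simp
      finally have cR: "real (card R) \<le> 2 * r" using RC(3) r1 by linarith
      have "real (card CC) \<le> real (2 * ((card R + 2) * (card R + 3)))" using RC(4) by (simp only: of_nat_le_iff)
      also have "\<dots> = 2 * ((real (card R) + 2) * (real (card R) + 3))" by (simp add: algebra_simps)
      also have "\<dots> \<le> 2 * ((4 * r) * (5 * r))" using cR r1 by (intro mult_left_mono mult_mono) auto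
      finally have cC: "real (card CC) \<le> 40 * r\<^sup>2" by (simp add: power2_eq_square)
      let ?QA = "\<lambda>A. {q\<in>Q. \<exists>z\<in>A. on z q}"
      let ?I1 = "{p\<in>incs Z Q. \<exists>g\<in>R. on (fst p) g}" and ?I2 = "{p\<in>incs Z Q. \<exists>A\<in>CC. fst p \<in> A}"
      have fI: "finite (incs Z Q)" using Z Q by simp
      have f2: "finite ?I1" "finite ?I2" by (rule finite_subset[OF _ fI], blast)+
      have sub: "incs Z Q \<subseteq> ?I1 \<union> ?I2"
      proof
        fix p assume p: "p \<in> incs Z Q"
        obtain z q where pe: "p = (z, q)" by (cases p)
        have "z \<in> Z" using p unfolding pe incs_def by simp
        then have "(\<exists>g\<in>R. on z g) \<or> (\<exists>A\<in>CC. z \<in> A)" using RC(7)[of z] by (cases "\<forall>g\<in>R. \<not> on z g") simp_all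
        then show "p \<in> ?I1 \<union> ?I2" using p by (simp add: pe)
      qed
      have "card (incs Z Q) \<le> card (?I1 \<union> ?I2)"
        using sub f2 by (intro card_mono) auto
      also have "\<dots> \<le> card ?I1 + card ?I2" by (rule card_Un_le)
      finally have "?I \<le> real (card ?I1) + real (card ?I2)" by linarith
      moreover have "real (card ?I1) \<le> real (card R * card Q + card Z)"
        using incs_on_sample[OF Z Q RC(1)] by (simp only: of_nat_le_iff)
      moreover have "real (card R * card Q + card Z) \<le> 2 * r * ?n + ?m"
        using cR by (simp add: mult_right_mono)
      moreover have "real (card ?I2) \<le> ?m * sqrt k + 40 * r\<^sup>2 * k"
      proof -
        have "real (card ?I2) = (\<Sum>A\<in>CC. real (card (incs (Z \<inter> A) (?QA A))))"
          using incs_in_cells[OF Z Q RC(2,5)] by simp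
        also have "\<dots> \<le> (\<Sum>A\<in>CC. real (card (Z \<inter> A)) * sqrt k + k)"
        proof (rule sum_mono)
          fix A assume A: "A \<in> CC"
          have "real (card (incs (Z \<inter> A) (?QA A))) \<le> real (card (Z \<inter> A)) * sqrt (real (card (?QA A))) + real (card (?QA A))"
            using Z Q by (intro incs_kst) auto
          also have "\<dots> \<le> real (card (Z \<inter> A)) * sqrt k + k"
            using RC(6)[OF A] by (intro add_mono mult_left_mono) auto
          finally show "real (card (incs (Z \<inter> A) (?QA A))) \<le> real (card (Z \<inter> A)) * sqrt k + k" .
        qed
        also have "\<dots> = real (\<Sum>A\<in>CC. card (Z \<inter> A)) * sqrt k + real (card CC) * k"
          by (simp add: sum.distrib sum_distrib_right)
        also have "\<dots> \<le> ?m * sqrt k + 40 * r\<^sup>2 * k"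
          using sum_card_cells_le[OF Z RC(2,5)] cC k by (intro add_mono mult_right_mono) (simp_all only: of_nat_le_iff, auto)
        finally show ?thesis .
      qed
      moreover have "40 * r\<^sup>2 * k = 40 * \<rho> * X" unfolding k_def Xr using r1 by (simp add: power2_eq_square)
      moreover have "?m * sqrt k \<le> \<rho> * X"
      proof (rule power2_le_imp_le)
        have "?m\<^sup>2 = r ^ 3 * ?n" using r3 n by simp
        moreover have "(?m * sqrt k)\<^sup>2 = ?m\<^sup>2 * k" using k by (simp add: power_mult_distrib)
        ultimately have "(?m * sqrt k)\<^sup>2 = r ^ 3 * ?n * (?n * \<rho> / r)" by (simp add: k_def)
        also have "\<dots> = \<rho> * X\<^sup>2"
          unfolding Xr using r1 by (simp add: power2_eq_square power3_eq_cube)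
        also have "\<dots> \<le> \<rho>\<^sup>2 * X\<^sup>2" using l1 by (intro mult_right_mono) (auto simp: power2_eq_square)
        finally show "(?m * sqrt k)\<^sup>2 \<le> (\<rho> * X)\<^sup>2" by (simp add: power_mult_distrib)
        show "0 \<le> \<rho> * X" using l1 X by simp
      qed
      moreover have "2 * r * ?n = 2 * X" unfolding Xr by simp
      ultimately have "?I \<le> 2 * X + ?m + \<rho> * X + 40 * \<rho> * X" by linarith
      also have "\<dots> \<le> 43 * \<rho> * (X + ?m + ?n)"
      proof -
        have "X \<le> \<rho> * X" "?m \<le> \<rho> * ?m" "0 \<le> \<rho> * ?n" "0 \<le> \<rho> * ?m"
          using mult_right_mono[OF l1] X l1 by auto
        then show ?thesis by (simp add: algebra_simps)
      qed
      finally show ?thesis using X by blast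
    qed
  qed
qed

text \<open>\<open>\<nu>\<close> stands for 43 \<rho>, so the two conditions are the lower bounds on
  \<rho> in \<open>szemeredi_trotter\<close>, made uniform over all sets of size at most S.\<close>

definition st_const :: "real \<Rightarrow> real \<Rightarrow> bool" where
  "st_const S \<nu> \<longleftrightarrow> 43 \<le> \<nu> \<and> 86 * ln ((S + 2) * (S + 1)) \<le> \<nu>"

lemma szemeredi_trotter_const:
  assumes "st_const S \<nu>" "finite Z" "finite Q" "real (card Z) \<le> S" "real (card Q) \<le> S"
  shows "\<exists>X\<ge>0. X ^ 3 = (real (card Z) * real (card Q))\<^sup>2 \<and>
     real (card (incs Z Q)) \<le> \<nu> * (X + real (card Z) + real (card Q))"
proof -
  have S: "S \<ge> 0" using assms(4) by linarith
  have "real (card Q + 2) * real (card Z + 1) \<le> (S + 2) * (S + 1)"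
    using assms S by (intro mult_mono) auto
  then have "ln (real (card Q + 2) * real (card Z + 1)) \<le> ln ((S + 2) * (S + 1))"
    by (intro ln_mono) (auto intro!: mult_pos_pos)
  then have "2 * ln (real (card Q + 2) * real (card Z + 1)) \<le> \<nu> / 43" "1 \<le> \<nu> / 43"
    using assms(1) unfolding st_const_def by linarith+
  from szemeredi_trotter[OF assms(2,3) this(2,1)] show ?thesis by simp
qed

text \<open>The largest of X, m and h is at least a third of the sum. If it is X, cubing and
  cancelling h^2 gives the first term; if it is m, the bound is linear; if it is h, then D > 3 \<nu>
  forces h = 0.\<close>

lemma rich_bound:
  fixes h D m X \<nu> :: real
  assumes "h * D \<le> \<nu> * (X + m + h)" "X ^ 3 = (m * h)\<^sup>2" "D > 3 * \<nu>" "\<nu> > 0" "m \<ge> 0" "h \<ge> 0" "X \<ge> 0"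
  shows "h \<le> 27 * \<nu> ^ 3 * m\<^sup>2 / D ^ 3 + 3 * \<nu> * m / D"
proof -
  have D: "D > 0" using assms(3,4) by linarith
  have nn: "27 * \<nu> ^ 3 * m\<^sup>2 / D ^ 3 \<ge> 0" "3 * \<nu> * m / D \<ge> 0" using D assms by auto
  consider "m \<le> X" "h \<le> X" | "X \<le> m" "h \<le> m" | "X \<le> h" "m \<le> h" by linarith
  then show ?thesis
  proof cases
    case 1
    then have "\<nu> * (X + m + h) \<le> \<nu> * (3 * X)" using assms(4) by (intro mult_left_mono) auto
    then have "h * D \<le> 3 * \<nu> * X" using assms(1) by (simp add: mult_ac)
    then have "(h * D) ^ 3 \<le> (3 * \<nu> * X) ^ 3" using assms D by (intro power_mono) auto
    also have "\<dots> = 27 * \<nu> ^ 3 * (m\<^sup>2 * h\<^sup>2)" using assms(2) by (simp add: power_mult_distrib)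
    finally have "h\<^sup>2 * (h * D ^ 3) \<le> h\<^sup>2 * (27 * \<nu> ^ 3 * m\<^sup>2)"
      by (simp add: power_mult_distrib power2_eq_square power3_eq_cube mult_ac)
    then have "h = 0 \<or> h * D ^ 3 \<le> 27 * \<nu> ^ 3 * m\<^sup>2"
      using mult_le_cancel_left_pos[of "h\<^sup>2"] by (cases "h = 0") auto
    then have "h \<le> 27 * \<nu> ^ 3 * m\<^sup>2 / D ^ 3" using D nn by (auto simp: field_simps)
    then show ?thesis using nn by linarith
  next
    case 2
    then have "\<nu> * (X + m + h) \<le> \<nu> * (3 * m)" using assms(4) by (intro mult_left_mono) auto
    then have "h * D \<le> 3 * \<nu> * m" using assms(1) by (simp add: mult_ac)
    then have "h \<le> 3 * \<nu> * m / D" using D by (simp add: field_simps)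
    then show ?thesis using nn by linarith
  next
    case 3
    then have "\<nu> * (X + m + h) \<le> \<nu> * (3 * h)" using assms(4) by (intro mult_left_mono) auto
    then have "h * D \<le> h * (3 * \<nu>)" using assms(1) by (simp add: mult_ac)
    then have "h = 0" using assms(3,6) by (smt (verit) mult_strict_left_mono)
    then show ?thesis using nn by linarith
  qed
qed

lemma rich_lines_bound:
  fixes D :: real
  assumes "st_const S \<nu>" "finite Z" "finite Q" "real (card Z) \<le> S" "real (card Q) \<le> S"
    and "\<And>q. q \<in> Q \<Longrightarrow> D \<le> real (card {z\<in>Z. on z q})" "D > 3 * \<nu>"
  shows "real (card Q) \<le> 27 * \<nu> ^ 3 * (real (card Z))\<^sup>2 / D ^ 3 + 3 * \<nu> * real (card Z) / D"
proof -
  obtain X where X: "X \<ge> 0" "X ^ 3 = (real (card Z) * real (card Q))\<^sup>2"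
     "real (card (incs Z Q)) \<le> \<nu> * (X + real (card Z) + real (card Q))"
    using szemeredi_trotter_const[OF assms(1-5)] by blast
  have "real (card Q) * D = (\<Sum>q\<in>Q. D)" by simp
  also have "\<dots> \<le> (\<Sum>q\<in>Q. real (card {z\<in>Z. on z q}))" by (intro sum_mono assms(6))
  also have "\<dots> = real (card (incs Z Q))" using assms by (simp add: card_incs_lines)
  finally show ?thesis using X assms(1,7) by (intro rich_bound) (auto simp: st_const_def)
qed

lemma rich_points_bound:
  fixes D :: real
  assumes "st_const S \<nu>" "finite Z" "finite Q" "real (card Z) \<le> S" "real (card Q) \<le> S"
    and "\<And>z. z \<in> Z \<Longrightarrow> D \<le> real (card {q\<in>Q. on z q})" "D > 3 * \<nu>"
  shows "real (card Z) \<le> 27 * \<nu> ^ 3 * (real (card Q))\<^sup>2 / D ^ 3 + 3 * \<nu> * real (card Q) / D"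
proof -
  obtain X where X: "X \<ge> 0" "X ^ 3 = (real (card Z) * real (card Q))\<^sup>2"
     "real (card (incs Z Q)) \<le> \<nu> * (X + real (card Z) + real (card Q))"
    using szemeredi_trotter_const[OF assms(1-5)] by blast
  have "real (card Z) * D = (\<Sum>z\<in>Z. D)" by simp
  also have "\<dots> \<le> (\<Sum>z\<in>Z. real (card {q\<in>Q. on z q}))" by (intro sum_mono assms(6))
  also have "\<dots> = real (card (incs Z Q))" using assms by (simp add: card_incs_points)
  finally show ?thesis using X assms(1,7) by (intro rich_bound) (auto simp: st_const_def mult.commute add_ac)
qed

section \<open>A crossing lemma for segments across a vertical line\<close>

lemma sorted_enumeration:
  fixes v :: "'a \<Rightarrow> real"
  assumes "finite E" "inj_on v E"
  shows "\<exists>f. bij_betw f {..<card E} E \<and> (\<forall>i j. i < j \<longrightarrow> j < card E \<longrightarrow> v (f i) < v (f j))"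
proof -
  let ?xs = "sorted_list_of_set (v ` E)"
  have len: "length ?xs = card E" using assms by (simp add: card_image)
  have set: "set ?xs = v ` E" using assms by simp
  define f where "f = (\<lambda>i. inv_into E v (?xs ! i))"
  have vf: "v (f i) = ?xs ! i" "f i \<in> E" if "i < card E" for i
  proof -
    have "?xs ! i \<in> v ` E" using set len that nth_mem by metis
    then show "v (f i) = ?xs ! i" "f i \<in> E" unfolding f_def by (auto simp: f_inv_into_f inv_into_into)
  qed
  have mono: "v (f i) < v (f j)" if "i < j" "j < card E" for i j
    using sorted_wrt_nth_less[OF strict_sorted_list_of_set[of "v ` E"] that(1)] that len vf by simp
  have inj: "inj_on f {..<card E}"
  proof (rule inj_onI)
    fix i j assume "i \<in> {..<card E}" "j \<in> {..<card E}" "f i = f j"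
    then show "i = j" using mono[of i j] mono[of j i] by (cases i j rule: linorder_cases) auto
  qed
  moreover have "f ` {..<card E} = E"
    using inj vf assms(1) by (intro card_subset_eq) (auto simp: card_image)
  ultimately show ?thesis using mono unfolding bij_betw_def by blast
qed

lemma lines_meet_between:
  assumes "val p x \<le> val q x" "val q y \<le> val p y" "x \<le> y"
  shows "\<exists>t. x \<le> t \<and> t \<le> y \<and> val p t = val q t"
proof -
  have "\<exists>t\<ge>x. t \<le> y \<and> val p t - val q t = 0"
    by (rule IVT') (use assms in \<open>auto simp: val_def intro!: continuous_intros\<close>)
  then show ?thesis by auto
qed

text \<open>A drawing whose edges all cross one vertical line. The linear order of the edges along
  that line takes the place of planarity and Euler's formula.\<close>

locale edges =
  fixes E :: "(real \<times> real) set" and a b :: "real \<times> real \<Rightarrow> real \<times> real" and A B :: "(real \<times> real) set" and \<xi> :: real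
  assumes fin: "finite E" "finite A" "finite B"
    and a: "q \<in> E \<Longrightarrow> a q \<in> A" "q \<in> E \<Longrightarrow> on (a q) q"
    and b: "q \<in> E \<Longrightarrow> b q \<in> B" "q \<in> E \<Longrightarrow> on (b q) q"
    and sep: "x \<in> A \<Longrightarrow> fst x < \<xi>" "x \<in> B \<Longrightarrow> \<xi> < fst x"

text \<open>Both pairs of end points must differ, so that a crossing has four distinct vertices and
  survives a vertex sample with the fourth power of the probability.\<close>

definition crosses :: "(real \<times> real \<Rightarrow> real \<times> real) \<Rightarrow> (real \<times> real \<Rightarrow> real \<times> real) \<Rightarrow> real \<times> real \<Rightarrow> real \<times> real \<Rightarrow> bool" where
  "crosses a b q q' \<longleftrightarrow> a q \<noteq> a q' \<and> b q \<noteq> b q' \<and>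
     (\<exists>x. fst (a q) \<le> x \<and> fst (a q') \<le> x \<and> x \<le> fst (b q) \<and> x \<le> fst (b q') \<and> val q x = val q' x)"

lemma (in edges) subedges:
  assumes s: "E' \<subseteq> E" "A' \<subseteq> A" "B' \<subseteq> B" and ab: "\<And>q. q \<in> E' \<Longrightarrow> a q \<in> A'" "\<And>q. q \<in> E' \<Longrightarrow> b q \<in> B'"
  shows "edges E' a b A' B' \<xi>"
proof
  show "finite E'" "finite A'" "finite B'" by (rule finite_subset[OF s(1) fin(1)] finite_subset[OF s(2) fin(2)] finite_subset[OF s(3) fin(3)])+
  show "a q \<in> A'" "b q \<in> B'" "on (a q) q" "on (b q) q" if "q \<in> E'" for q
    using ab[OF that] a(2)[OF subsetD[OF s(1) that]] b(2)[OF subsetD[OF s(1) that]] by simp_all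
  show "fst x < \<xi>" if "x \<in> A'" for x using sep(1)[OF subsetD[OF s(2) that]] .
  show "\<xi> < fst x" if "x \<in> B'" for x using sep(2)[OF subsetD[OF s(3) that]] .
qed

context edges
begin

lemma ends: "q \<in> E \<Longrightarrow> fst (a q) < \<xi>" "q \<in> E \<Longrightarrow> \<xi> < fst (b q)"
  using sep a b by auto

lemma same_left: "q \<in> E \<Longrightarrow> q' \<in> E \<Longrightarrow> a q = a q' \<Longrightarrow> val q t = val q' t \<Longrightarrow> \<xi> \<le> t \<Longrightarrow> q = q'"
  using a(2)[of q] a(2)[of q'] ends(1)[of q] val_eq_imp_eq[of q t q' "fst (a q)"] by (auto simp: on_def)

lemma same_right: "q \<in> E \<Longrightarrow> q' \<in> E \<Longrightarrow> b q = b q' \<Longrightarrow> val q t = val q' t \<Longrightarrow> t \<le> \<xi> \<Longrightarrow> q = q'"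
  using b(2)[of q] b(2)[of q'] ends(2)[of q] val_eq_imp_eq[of q t q' "fst (b q)"] by (auto simp: on_def)

lemma crosses_left:
  assumes "q \<in> E" "q' \<in> E" "q \<noteq> q'" "a q \<noteq> a q'" "val q t = val q' t" "fst (a q) \<le> t" "fst (a q') \<le> t" "t \<le> \<xi>"
  shows "crosses a b q q'"
proof -
  have "b q \<noteq> b q'" using same_right assms by blast
  moreover have "t \<le> fst (b q)" "t \<le> fst (b q')"
    using ends(2)[OF assms(1)] ends(2)[OF assms(2)] assms(8) by linarith+
  ultimately show ?thesis using assms(4-7) unfolding crosses_def by blast
qed

lemma crosses_right:
  assumes "q \<in> E" "q' \<in> E" "q \<noteq> q'" "b q \<noteq> b q'" "val q t = val q' t" "t \<le> fst (b q)" "t \<le> fst (b q')" "\<xi> \<le> t"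
  shows "crosses a b q q'"
proof -
  have "a q \<noteq> a q'" using same_left assms by blast
  moreover have "fst (a q) \<le> t" "fst (a q') \<le> t"
    using ends(1)[OF assms(1)] ends(1)[OF assms(2)] assms(8) by linarith+
  ultimately show ?thesis using assms(4-7) unfolding crosses_def by blast
qed

text \<open>The left endpoints, read off along the vertical line at \<open>\<xi>\<close>, contain no alternation \<open>\<alpha> \<beta> \<alpha> \<beta>\<close>:
  of the two points, the one closer to the line is the apex of a triangle that an edge of the
  other one can only leave by crossing.\<close>

lemma no_alternation_left:
  assumes E: "u1 \<in> E" "w1 \<in> E" "u2 \<in> E" "w2 \<in> E" and e: "a u1 = a u2" "a w1 = a w2" "a u1 \<noteq> a w1"
    and v: "val u1 \<xi> < val w1 \<xi>" "val w1 \<xi> < val u2 \<xi>" "val u2 \<xi> < val w2 \<xi>"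
  shows "\<exists>q\<in>E. \<exists>q'\<in>E. crosses a b q q'"
proof -
  have main: "\<exists>q\<in>E. \<exists>q'\<in>E. crosses a b q q'"
    if E: "l \<in> E" "m \<in> E" "h \<in> E" and e: "a l = a h" "a l \<noteq> a m" "fst (a m) \<le> fst (a l)"
      and v: "val l \<xi> < val m \<xi>" "val m \<xi> < val h \<xi>" for l m h
  proof -
    let ?x = "fst (a l)"
    have eq: "val l ?x = val h ?x" using a(2)[OF E(1)] a(2)[OF E(3)] e(1) by (simp add: on_def)
    have x: "?x \<le> \<xi>" using ends(1)[OF E(1)] by simp
    show ?thesis
    proof (cases "val m ?x \<le> val l ?x")
      case True
      then obtain t where "?x \<le> t" "t \<le> \<xi>" "val m t = val l t"
        using lines_meet_between[of m ?x l \<xi>] v x by auto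
      then have "crosses a b m l" using E e v by (intro crosses_left[of m l t]) auto
      then show ?thesis using E by blast
    next
      case False
      then obtain t where "?x \<le> t" "t \<le> \<xi>" "val h t = val m t"
        using lines_meet_between[of h ?x m \<xi>] v x eq by auto
      then have "crosses a b h m" using E e v by (intro crosses_left[of h m t]) auto
      then show ?thesis using E by blast
    qed
  qed
  show ?thesis
  proof (cases "fst (a w1) \<le> fst (a u1)")
    case True
    then show ?thesis using main[OF E(1,2,3)] e v by auto
  next
    case False
    then show ?thesis using main[OF E(2,3,4)] e v by auto
  qed
qed

lemma no_alternation_right:
  assumes E: "u1 \<in> E" "w1 \<in> E" "u2 \<in> E" "w2 \<in> E" and e: "b u1 = b u2" "b w1 = b w2" "b u1 \<noteq> b w1"
    and v: "val u1 \<xi> < val w1 \<xi>" "val w1 \<xi> < val u2 \<xi>" "val u2 \<xi> < val w2 \<xi>"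
  shows "\<exists>q\<in>E. \<exists>q'\<in>E. crosses a b q q'"
proof -
  have main: "\<exists>q\<in>E. \<exists>q'\<in>E. crosses a b q q'"
    if E: "l \<in> E" "m \<in> E" "h \<in> E" and e: "b l = b h" "b l \<noteq> b m" "fst (b l) \<le> fst (b m)"
      and v: "val l \<xi> < val m \<xi>" "val m \<xi> < val h \<xi>" for l m h
  proof -
    let ?x = "fst (b l)"
    have eq: "val l ?x = val h ?x" using b(2)[OF E(1)] b(2)[OF E(3)] e(1) by (simp add: on_def)
    have x: "\<xi> \<le> ?x" using ends(2)[OF E(1)] by simp
    show ?thesis
    proof (cases "val m ?x \<le> val l ?x")
      case True
      then obtain t where "\<xi> \<le> t" "t \<le> ?x" "val l t = val m t"
        using lines_meet_between[of l \<xi> m ?x] v x by auto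
      then have "crosses a b l m" using E e v by (intro crosses_right[of l m t]) auto
      then show ?thesis using E by blast
    next
      case False
      then obtain t where "\<xi> \<le> t" "t \<le> ?x" "val m t = val h t"
        using lines_meet_between[of m \<xi> h ?x] v x eq by auto
      then have "crosses a b m h" using E e v by (intro crosses_right[of m h t]) auto
      then show ?thesis using E by blast
    qed
  qed
  show ?thesis
  proof (cases "fst (b u1) \<le> fst (b w1)")
    case True
    then show ?thesis using main[OF E(1,2,3)] e v by auto
  next
    case False
    then show ?thesis using main[OF E(2,3,4)] e v by auto
  qed
qed

text \<open>Without crossings, the left and the right end points read along the line are
  Davenport-Schinzel sequences. Neighbouring edges differ in one of the two end points; as nothing
  alternates, the lower edge is then the highest at its end point, or the upper edge is the lowest
  at its own. Each end point allows at most two such places, so there are at most 2 |A| + 2 |B|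
  neighbouring pairs.\<close>

lemma exists_crossing:
  assumes "card E > 2 * card A + 2 * card B + 1"
  shows "\<exists>q\<in>E. \<exists>q'\<in>E. crosses a b q q'"
proof (rule ccontr)
  assume nc: "\<not> ?thesis"
  have inj: "inj_on (\<lambda>q. val q \<xi>) E"
  proof (rule inj_onI, rule ccontr)
    fix q q' assume q: "q \<in> E" "q' \<in> E" "val q \<xi> = val q' \<xi>" "q \<noteq> q'"
    then have "a q \<noteq> a q'" using same_left by blast
    then have "crosses a b q q'" using q ends(1)[OF q(1)] ends(1)[OF q(2)] by (intro crosses_left[of q q' \<xi>]) simp_all
    then show False using nc q by blast
  qed
  let ?n = "card E"
  obtain f where f: "bij_betw f {..<?n} E" "\<And>i j. i < j \<Longrightarrow> j < ?n \<Longrightarrow> val (f i) \<xi> < val (f j) \<xi>"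
    using sorted_enumeration[OF fin(1) inj] by blast
  have fE: "f i \<in> E" if "i < ?n" for i using f(1) that by (auto simp: bij_betw_def)
  define Top where "Top = (\<lambda>c. {i. i < ?n \<and> (\<forall>j. i < j \<longrightarrow> j < ?n \<longrightarrow> c (f j) \<noteq> (c (f i)::real\<times>real))})"
  define Bot where "Bot = (\<lambda>c. {i. i < ?n \<and> (\<forall>j<i. c (f j) \<noteq> (c (f i)::real\<times>real))})"
  have fTB: "finite (Top c)" "finite (Bot c)" for c unfolding Top_def Bot_def by auto
  have cT: "card (Top c) \<le> card S" "card {i. Suc i \<in> Bot c} \<le> card S"
    if "\<And>q. q \<in> E \<Longrightarrow> c q \<in> S" "finite S" for c S
  proof -
    have "inj_on (\<lambda>i. c (f i)) (Top c)"
    proof (rule inj_onI)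
      fix i j assume "i \<in> Top c" "j \<in> Top c" "c (f i) = c (f j)"
      then have "\<not> i < j" "\<not> j < i" by (auto simp: Top_def)
      then show "i = j" by simp
    qed
    then show "card (Top c) \<le> card S"
    proof (rule card_inj_on_le[OF _ _ that(2)])
      show "(\<lambda>i. c (f i)) ` Top c \<subseteq> S"
        by (rule image_subsetI, rule that(1), rule fE) (simp add: Top_def)
    qed
    have "card {i. Suc i \<in> Bot c} \<le> card (Bot c)"
      using fTB by (intro card_inj_on_le[of Suc]) auto
    also have "inj_on (\<lambda>i. c (f i)) (Bot c)"
    proof (rule inj_onI)
      fix i j assume "i \<in> Bot c" "j \<in> Bot c" "c (f i) = c (f j)"
      then have "\<not> i < j" "\<not> j < i" by (auto simp: Bot_def)
      then show "i = j" by simp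
    qed
    then have "card (Bot c) \<le> card S"
    proof (rule card_inj_on_le[OF _ _ that(2)])
      show "(\<lambda>i. c (f i)) ` Bot c \<subseteq> S"
        by (rule image_subsetI, rule that(1), rule fE) (simp add: Bot_def)
    qed
    finally show "card {i. Suc i \<in> Bot c} \<le> card S" .
  qed
  have cover: "{..<?n - 1} \<subseteq> (Top a \<union> {i. Suc i \<in> Bot a}) \<union> (Top b \<union> {i. Suc i \<in> Bot b})"
  proof
    fix i assume "i \<in> {..<?n - 1}"
    then have i: "Suc i < ?n" by auto
    show "i \<in> (Top a \<union> {i. Suc i \<in> Bot a}) \<union> (Top b \<union> {i. Suc i \<in> Bot b})"
    proof (rule ccontr)
      assume n: "i \<notin> (Top a \<union> {i. Suc i \<in> Bot a}) \<union> (Top b \<union> {i. Suc i \<in> Bot b})"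
      have alt: "\<exists>j k. k < i \<and> Suc i < j \<and> j < ?n \<and> c (f j) = c (f i) \<and> c (f k) = c (f (Suc i))"
        if nt: "i \<notin> Top c" and nb: "Suc i \<notin> Bot c" and d: "c (f i) \<noteq> c (f (Suc i))" for c :: "real \<times> real \<Rightarrow> real \<times> real"
      proof -
        obtain j where j: "i < j" "j < ?n" "c (f j) = c (f i)" using nt i unfolding Top_def by auto
        obtain k where k: "k < Suc i" "c (f k) = c (f (Suc i))" using nb i unfolding Bot_def by auto
        have "j \<noteq> Suc i" "k \<noteq> i" using j k d by auto
        then show ?thesis using j k by (intro exI[of _ j] exI[of _ k]) auto
      qed
      have ab: "a (f i) = a (f (Suc i))"
      proof (rule ccontr)
        assume d: "a (f i) \<noteq> a (f (Suc i))"
        then obtain j k where jk: "k < i" "Suc i < j" "j < ?n" "a (f j) = a (f i)" "a (f k) = a (f (Suc i))"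
          using alt[of a] n by auto
        have "\<exists>q\<in>E. \<exists>q'\<in>E. crosses a b q q'"
          by (rule no_alternation_left[of "f k" "f i" "f (Suc i)" "f j"]) (use jk i d fE f(2) in auto)
        then show False using nc by blast
      qed
      have "b (f i) = b (f (Suc i))"
      proof (rule ccontr)
        assume d: "b (f i) \<noteq> b (f (Suc i))"
        then obtain j k where jk: "k < i" "Suc i < j" "j < ?n" "b (f j) = b (f i)" "b (f k) = b (f (Suc i))"
          using alt[of b] n by auto
        have "\<exists>q\<in>E. \<exists>q'\<in>E. crosses a b q q'"
          by (rule no_alternation_right[of "f k" "f i" "f (Suc i)" "f j"]) (use jk i d fE f(2) in auto)
        then show False using nc by blast
      qed
      then have "f i = f (Suc i)"
        using ab a(2)[of "f i"] a(2)[of "f (Suc i)"] b(2)[of "f i"] b(2)[of "f (Suc i)"] fE i ends[of "f i"]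
          on_unique[of "a (f i)" "f i" "f (Suc i)" "b (f i)"] by fastforce
      then show False using f(2)[of i "Suc i"] i by simp
    qed
  qed
  have fS: "finite {i. Suc i \<in> Bot c}" for c
    by (rule finite_subset[of _ "{..<?n}"]) (auto simp: Bot_def)
  have "?n - 1 = card {..<?n - 1}" by simp
  also have "\<dots> \<le> card ((Top a \<union> {i. Suc i \<in> Bot a}) \<union> (Top b \<union> {i. Suc i \<in> Bot b}))"
    using cover fTB fS by (intro card_mono) auto
  also have "\<dots> \<le> (card (Top a) + card {i. Suc i \<in> Bot a}) + (card (Top b) + card {i. Suc i \<in> Bot b})"
    by (intro order_trans[OF card_Un_le] add_mono card_Un_le)
  also have "\<dots> \<le> (card A + card A) + (card B + card B)"
    by (intro add_mono cT a(1) b(1) fin)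
  finally show False using assms by linarith
qed

end

section \<open>Counting crossings: deletion of edges and sampling of vertices\<close>

definition crossing_pairs where
  "crossing_pairs a b E = {(q, q'). q \<in> E \<and> q' \<in> E \<and> crosses a b q q'}"

lemma finite_crossing_pairs: "finite E \<Longrightarrow> finite (crossing_pairs a b E)"
  by (rule finite_subset[of _ "E \<times> E"]) (auto simp: crossing_pairs_def)

text \<open>Deleting an edge that takes part in a crossing removes at least one crossing pair, and
  this can be repeated as long as \<open>exists_crossing\<close> applies.\<close>

lemma crossing_pairs_lower:
  assumes "edges E a b A B \<xi>"
  shows "card E \<le> card (crossing_pairs a b E) + (2 * card A + 2 * card B + 1)"
  using assms
proof (induction "card E" arbitrary: E)
  case 0 then show ?case by simp
next
  case (Suc n)
  interpret edges E a b A B \<xi> by fact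
  show ?case
  proof (cases "card E > 2 * card A + 2 * card B + 1")
    case True
    then obtain q q' where q: "q \<in> E" "q' \<in> E" "crosses a b q q'" using exists_crossing by blast
    have "edges (E - {q}) a b A B \<xi>" by (rule subedges) (use a b in auto)
    moreover have c: "card (E - {q}) = n" using q(1) Suc(2) fin by simp
    ultimately have IH: "n \<le> card (crossing_pairs a b (E - {q})) + (2 * card A + 2 * card B + 1)"
      using Suc(1)[of "E - {q}"] by simp
    have "insert (q, q') (crossing_pairs a b (E - {q})) \<subseteq> crossing_pairs a b E"
      using q by (auto simp: crossing_pairs_def)
    then have "card (insert (q, q') (crossing_pairs a b (E - {q}))) \<le> card (crossing_pairs a b E)"
      using fin by (intro card_mono finite_crossing_pairs)
    moreover have "(q, q') \<notin> crossing_pairs a b (E - {q})" by (simp add: crossing_pairs_def)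
    ultimately have "Suc (card (crossing_pairs a b (E - {q}))) \<le> card (crossing_pairs a b E)"
      using fin by (simp add: finite_crossing_pairs)
    then show ?thesis using IH Suc(2) by linarith
  qed simp
qed

lemma double_count:
  assumes "finite X" "finite Y"
  shows "(\<Sum>x\<in>X. card {y\<in>Y. P x y}) = (\<Sum>y\<in>Y. card {x\<in>X. P x y})"
proof -
  have "(\<Sum>x\<in>X. card {y\<in>Y. P x y}) = (\<Sum>x\<in>X. \<Sum>y\<in>Y. if P x y then 1 else 0)"
    using assms by (intro sum.cong refl) (simp add: sum.If_cases Int_def)
  also have "\<dots> = (\<Sum>y\<in>Y. \<Sum>x\<in>X. if P x y then 1 else 0)" by (rule sum.swap)
  also have "\<dots> = (\<Sum>y\<in>Y. card {x\<in>X. P x y})"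
    using assms by (intro sum.cong refl) (simp add: sum.If_cases Int_def)
  finally show ?thesis .
qed

text \<open>A vertex sample of probability 1 / k, expressed by counting: the colour 0 marks the
  chosen vertices, independently of each other.\<close>

lemma card_colourings_zero:
  fixes k :: nat
  assumes "finite V" "F \<subseteq> V" "k \<ge> 1"
  shows "real (card {\<phi> \<in> PiE V (\<lambda>_. {..<k}). \<forall>x\<in>F. \<phi> x = 0}) = real k ^ card V / real k ^ card F"
proof -
  have "{\<phi> \<in> PiE V (\<lambda>_. {..<k}). \<forall>x\<in>F. \<phi> x = 0} = PiE V (\<lambda>x. if x \<in> F then {0} else {..<k})"
    (is "?l = PiE V ?c")
  proof (rule set_eqI, rule iffI)
    fix \<phi> assume p: "\<phi> \<in> ?l"
    show "\<phi> \<in> PiE V ?c"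
    proof (rule PiE_I)
      fix x assume "x \<in> V"
      then show "\<phi> x \<in> ?c x" using p PiE_mem[of \<phi> V "\<lambda>_. {..<k}" x] by simp
    next
      fix x assume "x \<notin> V"
      then show "\<phi> x = undefined" using p PiE_arb[of \<phi> V "\<lambda>_. {..<k}" x] by simp
    qed
  next
    fix \<phi> assume p: "\<phi> \<in> PiE V ?c"
    have "\<phi> \<in> PiE V (\<lambda>_. {..<k})"
    proof (rule PiE_I)
      fix x assume "x \<in> V"
      then show "\<phi> x \<in> {..<k}" using PiE_mem[OF p, of x] assms(3) by (simp split: if_splits)
    next
      fix x assume "x \<notin> V"
      then show "\<phi> x = undefined" using PiE_arb[OF p] by simp
    qed
    moreover have "\<phi> x = 0" if "x \<in> F" for x
      using PiE_mem[OF p, of x] that assms(2) by auto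
    ultimately show "\<phi> \<in> ?l" by simp
  qed
  then have "card {\<phi> \<in> PiE V (\<lambda>_. {..<k}). \<forall>x\<in>F. \<phi> x = 0} = (\<Prod>x\<in>V. card (if x \<in> F then {0} else {..<k}))"
    using assms(1) by (simp add: card_PiE)
  also have "\<dots> = (\<Prod>x\<in>V. if x \<in> F then 1 else k)" by (intro prod.cong) auto
  also have "\<dots> = k ^ card (V - F)"
    using assms(1) by (simp add: prod.If_cases set_diff_eq Int_def)
  also have "card (V - F) = card V - card F"
    using assms finite_subset by (intro card_Diff_subset) auto
  finally have "real (card {\<phi> \<in> PiE V (\<lambda>_. {..<k}). \<forall>x\<in>F. \<phi> x = 0}) = real k ^ (card V - card F)" by simp
  also have "\<dots> = real k ^ card V / real k ^ card F"
    using assms by (intro power_diff) (auto intro: card_mono)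
  finally show ?thesis .
qed

text \<open>The linear bound is averaged over the subgraphs spanned by the vertices of colour 0. A
  vertex survives with probability 1/k, an edge with 1/k^2, a crossing with 1/k^4; multiplication by
  k^4 clears the denominators.\<close>

lemma (in edges) crossing_pairs_amplified:
  fixes k :: nat
  assumes k: "k \<ge> 1"
  shows "real k ^ 2 * real (card E) \<le> real (card (crossing_pairs a b E)) + 2 * (real (card A) + real (card B)) * real k ^ 3 + real k ^ 4"
proof -
  define V where "V = A \<union> B"
  define \<Phi> where "\<Phi> = PiE V (\<lambda>_. {..<k})"
  let ?C = "crossing_pairs a b E"
  let ?W = "real k ^ card V"
  have fV: "finite V" unfolding V_def using fin by simp
  have f\<Phi>: "finite \<Phi>" unfolding \<Phi>_def using fV by (intro finite_PiE) auto
  have fC: "finite ?C" using fin by (intro finite_crossing_pairs)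
  have cnt: "real (card {\<phi>\<in>\<Phi>. \<forall>x\<in>F. \<phi> x = 0}) = ?W / real k ^ card F" if "F \<subseteq> V" for F
    unfolding \<Phi>_def by (rule card_colourings_zero[OF fV that k])
  have dis: "A \<inter> B = {}" using sep by (metis disjoint_iff less_asym)
  \<comment> \<open>Phrasing the conditions as quantifiers over explicit sets of vertices lets the
    single count \<open>cnt\<close> serve for vertices, edges and crossings.\<close>
  let ?PE = "\<lambda>\<phi> q. \<forall>x\<in>{a q, b q}. \<phi> x = (0::nat)" and ?PC = "\<lambda>\<phi> p. \<forall>x\<in>{a (fst p), b (fst p), a (snd p), b (snd p)}. \<phi> x = (0::nat)"
  have one: "card {q\<in>E. ?PE \<phi> q} \<le> card {p\<in>?C. ?PC \<phi> p} + (2 * card {x\<in>A. \<forall>y\<in>{x}. \<phi> y = 0} + 2 * card {x\<in>B. \<forall>y\<in>{x}. \<phi> y = 0} + 1)"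
    (is "?l \<le> _") for \<phi>
  proof -
    have "edges {q\<in>E. ?PE \<phi> q} a b {x\<in>A. \<forall>y\<in>{x}. \<phi> y = 0} {x\<in>B. \<forall>y\<in>{x}. \<phi> y = 0} \<xi>"
      using a b by (intro subedges) auto
    from crossing_pairs_lower[OF this]
    have "?l \<le> card (crossing_pairs a b {q\<in>E. ?PE \<phi> q}) + (2 * card {x\<in>A. \<forall>y\<in>{x}. \<phi> y = 0} + 2 * card {x\<in>B. \<forall>y\<in>{x}. \<phi> y = 0} + 1)" .
    moreover have "crossing_pairs a b {q\<in>E. ?PE \<phi> q} = {p\<in>?C. ?PC \<phi> p}"
      unfolding crossing_pairs_def by auto
    ultimately show ?thesis by simp
  qed
  have "(\<Sum>\<phi>\<in>\<Phi>. card {q\<in>E. ?PE \<phi> q}) \<le> (\<Sum>\<phi>\<in>\<Phi>. card {p\<in>?C. ?PC \<phi> p}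
     + (2 * card {x\<in>A. \<forall>y\<in>{x}. \<phi> y = 0} + 2 * card {x\<in>B. \<forall>y\<in>{x}. \<phi> y = 0} + 1))"
    by (intro sum_mono one)
  also have "\<dots> = (\<Sum>\<phi>\<in>\<Phi>. card {p\<in>?C. ?PC \<phi> p}) + 2 * (\<Sum>\<phi>\<in>\<Phi>. card {x\<in>A. \<forall>y\<in>{x}. \<phi> y = 0})
     + 2 * (\<Sum>\<phi>\<in>\<Phi>. card {x\<in>B. \<forall>y\<in>{x}. \<phi> y = 0}) + card \<Phi>"
    by (simp only: sum.distrib sum_distrib_left) simp
  finally have S0: "real (\<Sum>\<phi>\<in>\<Phi>. card {q\<in>E. ?PE \<phi> q}) \<le> real ((\<Sum>\<phi>\<in>\<Phi>. card {p\<in>?C. ?PC \<phi> p}) + 2 * (\<Sum>\<phi>\<in>\<Phi>. card {x\<in>A. \<forall>y\<in>{x}. \<phi> y = 0})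
     + 2 * (\<Sum>\<phi>\<in>\<Phi>. card {x\<in>B. \<forall>y\<in>{x}. \<phi> y = 0}) + card \<Phi>)"
    by (simp only: of_nat_le_iff)
  have SE: "real (\<Sum>\<phi>\<in>\<Phi>. card {q\<in>E. ?PE \<phi> q}) = real (card E) * (?W / real k ^ 2)"
  proof -
    have "real (\<Sum>\<phi>\<in>\<Phi>. card {q\<in>E. ?PE \<phi> q}) = (\<Sum>q\<in>E. real (card {\<phi>\<in>\<Phi>. ?PE \<phi> q}))"
      using double_count[OF f\<Phi> fin(1), of ?PE] by simp
    also have "\<dots> = (\<Sum>q\<in>E. ?W / real k ^ 2)"
    proof (intro sum.cong refl)
      fix q assume q: "q \<in> E"
      have "a q \<noteq> b q" using ends[OF q] by auto
      then have c: "card {a q, b q} = 2" by simp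
      have "{a q, b q} \<subseteq> V" using a(1)[OF q] b(1)[OF q] unfolding V_def by simp
      from cnt[OF this, unfolded c] show "real (card {\<phi>\<in>\<Phi>. ?PE \<phi> q}) = ?W / real k ^ 2" .
    qed
    finally show ?thesis by simp
  qed
  have SC: "real (\<Sum>\<phi>\<in>\<Phi>. card {p\<in>?C. ?PC \<phi> p}) = real (card ?C) * (?W / real k ^ 4)"
  proof -
    have "real (\<Sum>\<phi>\<in>\<Phi>. card {p\<in>?C. ?PC \<phi> p}) = (\<Sum>p\<in>?C. real (card {\<phi>\<in>\<Phi>. ?PC \<phi> p}))"
      using double_count[OF f\<Phi> fC, of ?PC] by simp
    also have "\<dots> = (\<Sum>p\<in>?C. ?W / real k ^ 4)"
    proof (intro sum.cong refl)
      fix p assume p: "p \<in> ?C"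
      then have q: "fst p \<in> E" "snd p \<in> E" "a (fst p) \<noteq> a (snd p)" "b (fst p) \<noteq> b (snd p)"
        by (auto simp: crossing_pairs_def crosses_def)
      then have "a (fst p) \<noteq> b (fst p)" "a (fst p) \<noteq> b (snd p)" "a (snd p) \<noteq> b (fst p)" "a (snd p) \<noteq> b (snd p)"
        using ends[OF q(1)] ends[OF q(2)] by auto
      then have c: "card {a (fst p), b (fst p), a (snd p), b (snd p)} = 4" using q by auto
      have "{a (fst p), b (fst p), a (snd p), b (snd p)} \<subseteq> V" using a(1) b(1) q unfolding V_def by simp
      from cnt[OF this, unfolded c] show "real (card {\<phi>\<in>\<Phi>. ?PC \<phi> p}) = ?W / real k ^ 4" .
    qed
    finally show ?thesis by simp
  qed
  have SS: "real (\<Sum>\<phi>\<in>\<Phi>. card {x\<in>S. \<forall>y\<in>{x}. \<phi> y = 0}) = real (card S) * (?W / real k)" if "S \<subseteq> V" for S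
  proof -
    have fS: "finite S" using that fV finite_subset by blast
    have "real (\<Sum>\<phi>\<in>\<Phi>. card {x\<in>S. \<forall>y\<in>{x}. \<phi> y = 0}) = (\<Sum>x\<in>S. real (card {\<phi>\<in>\<Phi>. \<forall>y\<in>{x}. \<phi> y = 0}))"
      using double_count[OF f\<Phi> fS, of "\<lambda>\<phi> x. \<forall>y\<in>{x}. \<phi> y = 0"] by simp
    also have "\<dots> = (\<Sum>x\<in>S. ?W / real k)"
      using that by (intro sum.cong refl) (subst cnt, auto)
    finally show ?thesis by simp
  qed
  have S1: "real (card \<Phi>) = ?W" using cnt[of "{}"] by simp
  have AV: "A \<subseteq> V" "B \<subseteq> V" by (auto simp: V_def)
  have main: "real (card E) * (?W / real k ^ 2) \<le> real (card ?C) * (?W / real k ^ 4)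
      + 2 * (real (card A) * (?W / real k)) + 2 * (real (card B) * (?W / real k)) + ?W"
    using S0 unfolding of_nat_add of_nat_mult of_nat_numeral SE SC SS[OF AV(1)] SS[OF AV(2)] S1 .
  define t where "t = ?W / real k ^ 4"
  have w: "?W / real k ^ 2 = t * real k ^ 2" "?W / real k = t * real k ^ 3" and w4: "?W = t * real k ^ 4"
    using k unfolding t_def by (simp_all add: power2_eq_square power3_eq_cube power4_eq_xxxx)
  have "t * (real k ^ 2 * real (card E)) \<le> t * (real (card ?C) + 2 * (real (card A) + real (card B)) * real k ^ 3 + real k ^ 4)"
    using main[unfolded w t_def[symmetric], unfolded w4] by (simp add: algebra_simps)
  moreover have "t > 0" unfolding t_def using k by simp
  ultimately show ?thesis by (simp only: mult_le_cancel_left_pos)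
qed

text \<open>For k close to e / (8 v) each error term is at most k^2 e / 4, which leaves k^2 e / 2;
  the term k^4 is that small because edges are determined by their end points, so that e <= v^2.
  After rounding k is still at least e / (16 v), and 2 * 16^2 = 512.\<close>

lemma (in edges) crossing_pairs_many:
  fixes v :: real
  assumes v: "real (card A) + real (card B) \<le> v" and E: "8 * v \<le> real (card E)" and E0: "E \<noteq> {}"
  shows "real (card E) ^ 3 / (512 * v\<^sup>2) \<le> real (card (crossing_pairs a b E))"
proof -
  let ?e = "real (card E)"
  have e0: "?e > 0" using E0 fin by (simp add: card_gt_0_iff)
  have "card E \<le> card (A \<times> B)"
  proof (rule card_inj_on_le[where f = "\<lambda>q. (a q, b q)"])
    show "inj_on (\<lambda>q. (a q, b q)) E"
    proof (rule inj_onI)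
      fix q q' assume q: "q \<in> E" "q' \<in> E" and e: "(a q, b q) = (a q', b q')"
      have "a q \<noteq> b q" using ends[OF q(1)] by auto
      then show "q = q'" using on_unique[of "a q" q q' "b q"] a(2) b(2) q e by auto
    qed
    show "(\<lambda>q. (a q, b q)) ` E \<subseteq> A \<times> B" by (rule image_subsetI) (simp add: a b)
  qed (use fin in simp)
  then have "?e \<le> real (card A) * real (card B)"
    by (simp only: card_cartesian_product flip: of_nat_mult)
  also have "\<dots> \<le> v * v" using v by (intro mult_mono) auto
  finally have ev: "?e \<le> v * v" .
  have v0: "v > 0" using ev e0 v by (smt (verit) mult_nonneg_nonpos of_nat_0_le_iff mult_eq_0_iff)
  define k where "k = nat \<lfloor>?e / (8 * v)\<rfloor>"
  have q1: "?e / (8 * v) \<ge> 1" using E v0 by simp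
  have k: "k \<ge> 1" "real k \<le> ?e / (8 * v)" "real k \<ge> ?e / (16 * v)"
  proof -
    show "k \<ge> 1" unfolding k_def using q1 by linarith
    show "real k \<le> ?e / (8 * v)" unfolding k_def using q1 by linarith
    have "y / 2 \<le> real (nat \<lfloor>y\<rfloor>)" if "1 \<le> y" for y :: real
    proof -
      have "1 \<le> \<lfloor>y\<rfloor>" using that by simp
      then have "real (nat \<lfloor>y\<rfloor>) = of_int \<lfloor>y\<rfloor>" "1 \<le> real_of_int \<lfloor>y\<rfloor>" by simp_all
      then show ?thesis using floor_correct[of y] by linarith
    qed
    from this[OF q1] have "real k \<ge> ?e / (8 * v) / 2" unfolding k_def .
    then show "real k \<ge> ?e / (16 * v)" by simp
  qed
  have kv: "8 * v * real k \<le> ?e" using k(2) v0 by (simp add: field_simps)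
  have "(8 * v * real k)\<^sup>2 \<le> ?e\<^sup>2" using kv v0 by (intro power_mono) auto
  also have "\<dots> \<le> ?e * v\<^sup>2" using ev e0 by (simp add: power2_eq_square)
  finally have "64 * (real k)\<^sup>2 \<le> ?e" using v0 by (simp add: power_mult_distrib)
  then have "real k ^ 2 * real k ^ 2 \<le> real k ^ 2 * (?e / 4)" by (intro mult_left_mono) auto
  then have t1: "real k ^ 4 \<le> real k ^ 2 * ?e / 4" by (simp add: power2_eq_square power4_eq_xxxx)
  have "2 * (real (card A) + real (card B)) * real k ^ 3 \<le> 2 * v * real k ^ 3"
    using v by (intro mult_right_mono) auto
  also have "\<dots> = real k ^ 2 * (8 * v * real k) / 4" by (simp add: power2_eq_square power3_eq_cube)
  also have "\<dots> \<le> real k ^ 2 * ?e / 4" using kv by (intro divide_right_mono mult_left_mono) auto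
  finally have t2: "2 * (real (card A) + real (card B)) * real k ^ 3 \<le> real k ^ 2 * ?e / 4" .
  have "(?e / (16 * v)) ^ 2 \<le> real k ^ 2" using k(3) v0 e0 by (intro power_mono) auto
  then have "(?e / (16 * v)) ^ 2 * ?e / 2 \<le> real k ^ 2 * ?e / 2" by (intro divide_right_mono mult_right_mono) auto
  also have "\<dots> \<le> real (card (crossing_pairs a b E))"
    using crossing_pairs_amplified[OF k(1)] t1 t2 by linarith
  also have "(?e / (16 * v)) ^ 2 * ?e / 2 = ?e ^ 3 / (512 * v\<^sup>2)"
    by (simp add: power2_eq_square power3_eq_cube)
  finally show ?thesis .
qed

text \<open>Call an edge short if its span contains at most g / (2 v) points. Short edges with a
  common right end point have their left end points within the span of the widest of them, so there
  are at most g / 2 short edges. The others span many points, and by averaging some point lies in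
  the span of g^2 / (4 v^2) edges; the threshold is placed just to the right of it.\<close>

lemma halving_threshold:
  fixes G :: "(real \<times> real) set"
  assumes fin: "finite G" "finite Z" and Z: "Z \<noteq> {}"
    and ab: "\<And>q. q \<in> G \<Longrightarrow> a q \<in> Z \<and> b q \<in> Z \<and> on (a q) q \<and> on (b q) q \<and> fst (a q) < fst (b q)"
  shows "\<exists>\<xi>. (\<forall>z\<in>Z. fst z \<noteq> \<xi>) \<and> (real (card G))\<^sup>2 / (4 * (real (card Z))\<^sup>2) \<le> real (card {q\<in>G. fst (a q) < \<xi> \<and> \<xi> < fst (b q)})"
proof -
  let ?v = "real (card Z)" and ?g = "real (card G)"
  define m where "m = (\<lambda>q. {c\<in>Z. fst (a q) \<le> fst c \<and> fst c < fst (b q)})"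
  define w where "w = ?g / (2 * ?v)"
  have v0: "?v > 0" using Z fin by (simp add: card_gt_0_iff)
  have w0: "w \<ge> 0" unfolding w_def using v0 by simp
  let ?S = "{q\<in>G. real (card (m q)) \<le> w}"
  have short: "real (card ?S) \<le> ?v * w"
  proof -
    have e: "?S = (\<Union>z\<in>Z. {q\<in>?S. b q = z})" using ab by blast
    have "card ?S \<le> (\<Sum>z\<in>Z. card {q\<in>?S. b q = z})"
      by (subst e) (rule card_UN_le[OF fin(2)])
    then have "real (card ?S) \<le> (\<Sum>z\<in>Z. real (card {q\<in>?S. b q = z}))" by (metis (mono_tags) of_nat_le_iff of_nat_sum)
    also have "\<dots> \<le> (\<Sum>z\<in>Z. w)"
    proof (rule sum_mono)
      fix z assume "z \<in> Z"
      let ?B = "{q\<in>?S. b q = z}"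
      show "real (card ?B) \<le> w"
      proof (cases "?B = {}")
        case True
        then show ?thesis using w0 by (simp only: card.empty)
      next
        case False
        have fB: "finite ?B" using fin by simp
        let ?q0 = "arg_min_on (\<lambda>q. fst (a q)) ?B"
        have "?q0 \<in> ?B" "\<And>q. q \<in> ?B \<Longrightarrow> fst (a ?q0) \<le> fst (a q)"
          by (rule arg_min_if_finite(1)[OF fB False]) (rule arg_min_least[OF fB False])
        then obtain q0 where q0: "q0 \<in> ?B" "\<And>q. q \<in> ?B \<Longrightarrow> fst (a q0) \<le> fst (a q)" by (rule that)
        have "card ?B \<le> card (m q0)"
        proof (rule card_inj_on_le[where f = a])
          show "inj_on a ?B"
          proof (rule inj_onI)
            fix q q' assume q: "q \<in> ?B" "q' \<in> ?B" "a q = a q'"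
            then have h: "q \<in> G" "q' \<in> G" "b q = b q'" by auto
            have "a q \<noteq> b q" using ab[OF h(1)] by auto
            then show "q = q'" using on_unique[of "a q" q q' "b q"] ab[OF h(1)] ab[OF h(2)] h(3) q(3) by simp
          qed
          show "a ` ?B \<subseteq> m q0"
          proof (rule image_subsetI)
            fix q assume q: "q \<in> ?B"
            then have "q \<in> G" "b q = b q0" using q0(1) by auto
            then show "a q \<in> m q0" using ab[of q] q0(2)[OF q] by (simp add: m_def)
          qed
          show "finite (m q0)" using fin by (simp add: m_def)
        qed
        then show ?thesis using q0(1) by simp
      qed
    qed
    finally show ?thesis by simp
  qed
  let ?L = "{q\<in>G. w < real (card (m q))}"
  have "card G \<le> card ?S + card ?L"
    by (rule order_trans[OF card_mono[of "?S \<union> ?L"] card_Un_le]) (use fin in auto)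
  then have L: "real (card ?L) \<ge> ?g / 2" using short v0 unfolding w_def by simp
  have "\<exists>c\<in>Z. ?g\<^sup>2 / (4 * ?v\<^sup>2) \<le> real (card {q\<in>G. c \<in> m q})"
  proof (rule ccontr)
    assume "\<not> ?thesis"
    then have lt: "real (card {q\<in>G. c \<in> m q}) < ?g\<^sup>2 / (4 * ?v\<^sup>2)" if "c \<in> Z" for c using that by force
    have "?g / 2 * w \<le> real (card ?L) * w" using L w0 by (intro mult_right_mono)
    also have "\<dots> = (\<Sum>q\<in>?L. w)" by simp
    also have "\<dots> \<le> (\<Sum>q\<in>?L. real (card (m q)))" by (intro sum_mono) auto
    also have "\<dots> \<le> (\<Sum>q\<in>G. real (card (m q)))" using fin by (intro sum_mono2) auto
    also have "\<dots> = (\<Sum>q\<in>G. real (card {c\<in>Z. c \<in> m q}))"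
    proof -
      have "{c\<in>Z. c \<in> m q} = m q" for q unfolding m_def by simp
      then show ?thesis by (simp only:)
    qed
    also have "\<dots> = (\<Sum>c\<in>Z. real (card {q\<in>G. c \<in> m q}))"
      using arg_cong[OF double_count[OF fin, of "\<lambda>q c. c \<in> m q"], of real] by simp
    also have "\<dots> < (\<Sum>c\<in>Z. ?g\<^sup>2 / (4 * ?v\<^sup>2))" using lt fin Z by (intro sum_strict_mono) auto
    also have "\<dots> = ?g / 2 * w" unfolding w_def using v0 by (simp add: power2_eq_square)
    finally show False by simp
  qed
  then obtain c where c: "c \<in> Z" "?g\<^sup>2 / (4 * ?v\<^sup>2) \<le> real (card {q\<in>G. c \<in> m q})" by blast
  obtain \<xi> where \<xi>: "fst c < \<xi>" "\<And>z. z \<in> Z \<Longrightarrow> fst c < fst z \<Longrightarrow> \<xi> < fst z"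
  proof (cases "{z\<in>Z. fst c < fst z} = {}")
    case True
    then have "fst c + 1 < fst z" if "z \<in> Z" "fst c < fst z" for z using that by blast
    then show ?thesis using that[of "fst c + 1"] by simp
  next
    case False
    let ?M = "Min (fst ` {z\<in>Z. fst c < fst z})"
    have f: "finite (fst ` {z\<in>Z. fst c < fst z})" using fin by simp
    have "?M \<in> fst ` {z\<in>Z. fst c < fst z}" by (rule Min_in[OF f]) (simp only: image_is_empty False not_False_eq_True)
    then obtain z0 where "?M = fst z0" "z0 \<in> {z\<in>Z. fst c < fst z}" by (rule imageE)
    then have "fst c < ?M" by simp
    moreover have "?M \<le> fst z" if "z \<in> Z" "fst c < fst z" for z using that f by (intro Min_le) auto
    ultimately have "fst c < (fst c + ?M) / 2" "\<And>z. z \<in> Z \<Longrightarrow> fst c < fst z \<Longrightarrow> (fst c + ?M) / 2 < fst z"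
      by force+
    then show ?thesis by (rule that)
  qed
  have "{q\<in>G. c \<in> m q} \<subseteq> {q\<in>G. fst (a q) < \<xi> \<and> \<xi> < fst (b q)}"
  proof
    fix q assume q: "q \<in> {q\<in>G. c \<in> m q}"
    then have "fst (a q) \<le> fst c" "fst c < fst (b q)" "q \<in> G" by (simp_all add: m_def)
    then show "q \<in> {q\<in>G. fst (a q) < \<xi> \<and> \<xi> < fst (b q)}" using \<xi> ab[of q] by auto
  qed
  then have "card {q\<in>G. c \<in> m q} \<le> card {q\<in>G. fst (a q) < \<xi> \<and> \<xi> < fst (b q)}"
    using fin by (intro card_mono) auto
  moreover have "fst z \<noteq> \<xi>" if "z \<in> Z" for z using \<xi>(1) \<xi>(2)[OF that] by fastforce
  ultimately show ?thesis using c(2) by (intro exI[of _ \<xi>]) auto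
qed

text \<open>A threshold keeps g^2 / (4 v^2) of the g lines and the cubic crossing bound turns this
  into g^6 / v^8. For g of order v^2, the case of interest, that is v^4, the order of all pairs of
  lines, so the crude threshold costs no power. Crossings lie between points of \<open>Z\<close> on
  the line, hence in the convex region.\<close>

lemma meeting_pairs_in_cell:
  fixes G Z O' :: "(real \<times> real) set"
  assumes fG: "finite G" "finite Z" and O: "convex O'" "Z \<subseteq> O'"
    and two: "\<And>q. q \<in> G \<Longrightarrow> 2 \<le> card {z\<in>Z. on z q}"
    and v: "real (card Z) \<le> v" and big: "32 * v ^ 3 \<le> (real (card G))\<^sup>2" and v0: "v > 0"
  shows "(real (card G)) ^ 6 / (2 ^ 15 * v ^ 8) \<le> real (card {(p, q). p \<in> G \<and> q \<in> G \<and> p \<noteq> q \<and> (\<exists>z\<in>O'. on z p \<and> on z q)})"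
proof -
  have G0: "card G > 0"
  proof (rule ccontr)
    assume "\<not> card G > 0"
    then have "32 * v ^ 3 \<le> 0" using big by simp
    then show False using v0 by (simp add: zero_less_power not_le)
  qed
  have "\<exists>x y. x \<in> Z \<and> y \<in> Z \<and> on x q \<and> on y q \<and> fst x < fst y" if q: "q \<in> G" for q
  proof -
    obtain x y where xy: "x \<in> Z" "y \<in> Z" "on x q" "on y q" "x \<noteq> y"
    proof -
      have "\<not> card {z\<in>Z. on z q} \<le> Suc 0" using two[OF q] by simp
      then show ?thesis using that fG by (auto simp: card_le_Suc0_iff_eq)
    qed
    then have "fst x \<noteq> fst y" using on_fst_inj by blast
    then show ?thesis using xy by (metis linorder_neqE_linordered_idom)
  qed
  then obtain a b where ab: "\<And>q. q \<in> G \<Longrightarrow> a q \<in> Z \<and> b q \<in> Z \<and> on (a q) q \<and> on (b q) q \<and> fst (a q) < fst (b q)"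
    by metis
  have Z0: "Z \<noteq> {}" using G0 ab by (metis card_gt_0_iff empty_iff ex_in_conv)
  obtain \<xi> where \<xi>: "\<forall>z\<in>Z. fst z \<noteq> \<xi>" "(real (card G))\<^sup>2 / (4 * (real (card Z))\<^sup>2) \<le> real (card {q\<in>G. fst (a q) < \<xi> \<and> \<xi> < fst (b q)})"
    using halving_threshold[OF fG Z0 ab] by blast
  define E where "E = {q\<in>G. fst (a q) < \<xi> \<and> \<xi> < fst (b q)}"
  let ?A = "{z\<in>Z. fst z < \<xi>}" and ?B = "{z\<in>Z. \<xi> < fst z}"
  interpret edges E a b ?A ?B \<xi>
    by unfold_locales (use ab fG in \<open>auto simp: E_def\<close>)
  have cAB: "real (card ?A) + real (card ?B) \<le> v"
  proof -
    have "card ?A + card ?B = card (?A \<union> ?B)" using fG by (intro card_Un_disjoint[symmetric]) auto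
    also have "\<dots> \<le> card Z" using fG by (intro card_mono) auto
    finally show ?thesis using v by linarith
  qed
  have Zp: "real (card Z) > 0" using Z0 fG by (simp add: card_gt_0_iff)
  have "(real (card G))\<^sup>2 / (4 * v\<^sup>2) \<le> (real (card G))\<^sup>2 / (4 * (real (card Z))\<^sup>2)"
    using v Zp by (intro divide_left_mono mult_left_mono power_mono) auto
  then have Eg: "(real (card G))\<^sup>2 / (4 * v\<^sup>2) \<le> real (card E)" using \<xi>(2) unfolding E_def by linarith
  moreover have "8 * v \<le> (real (card G))\<^sup>2 / (4 * v\<^sup>2)"
    using big v0 by (simp add: field_simps power2_eq_square power3_eq_cube)
  ultimately have E8: "8 * v \<le> real (card E)" by linarith
  then have "E \<noteq> {}" using v0 by auto
  have "((real (card G))\<^sup>2 / (4 * v\<^sup>2)) ^ 3 / (512 * v\<^sup>2) \<le> real (card E) ^ 3 / (512 * v\<^sup>2)"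
    using Eg by (intro divide_right_mono power_mono) auto
  also have "\<dots> \<le> real (card (crossing_pairs a b E))"
    by (rule crossing_pairs_many[OF cAB E8 \<open>E \<noteq> {}\<close>])
  also have "\<dots> \<le> real (card {(p, q). p \<in> G \<and> q \<in> G \<and> p \<noteq> q \<and> (\<exists>z\<in>O'. on z p \<and> on z q)})"
  proof -
    have "crossing_pairs a b E \<subseteq> {(p, q). p \<in> G \<and> q \<in> G \<and> p \<noteq> q \<and> (\<exists>z\<in>O'. on z p \<and> on z q)}" (is "_ \<subseteq> ?P")
    proof
      fix r assume r: "r \<in> crossing_pairs a b E"
      obtain p q where pq: "r = (p, q)" by (cases r)
      have E: "p \<in> E" "q \<in> E" "crosses a b p q" using r by (auto simp: pq crossing_pairs_def)
      then obtain x where x: "fst (a p) \<le> x" "x \<le> fst (b p)" "val p x = val q x" "p \<noteq> q"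
        unfolding crosses_def by blast
      have pG: "p \<in> G" "q \<in> G" using E by (auto simp: E_def)
      have ins: "a p \<in> O'" "b p \<in> O'" using ab[OF pG(1)] O(2) by auto
      define t where "t = (x - fst (a p)) / (fst (b p) - fst (a p))"
      have d: "fst (b p) - fst (a p) > 0" using ab[OF pG(1)] by simp
      have t: "0 \<le> t" "t \<le> 1" unfolding t_def using x d by (auto simp: field_simps)
      have "t * (fst (b p) - fst (a p)) = x - fst (a p)" unfolding t_def using d by simp
      then have xt: "x = (1 - t) * fst (a p) + t * fst (b p)" by (simp add: algebra_simps)
      have "(1 - t) *\<^sub>R a p + t *\<^sub>R b p \<in> O'" using convexD[OF O(1) ins, of "1 - t" t] t by simp
      moreover have "(1 - t) *\<^sub>R a p + t *\<^sub>R b p = (x, val p x)"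
        using ab[OF pG(1)] val_convex_comb[of "1 - t" t p "fst (a p)" "fst (b p)"] xt
        by (simp add: prod_eq_iff on_def)
      ultimately have "(x, val p x) \<in> O'" by simp
      moreover have "on (x, val p x) p" "on (x, val p x) q" using x(3) by (simp_all add: on_def)
      ultimately show "r \<in> ?P" using pG x(4) pq by blast
    qed
    moreover have "finite ?P" by (rule finite_subset[of _ "G \<times> G"]) (use fG in auto)
    ultimately show ?thesis using card_mono by (simp only: of_nat_le_iff)
  qed
  also have "((real (card G))\<^sup>2 / (4 * v\<^sup>2)) ^ 3 / (512 * v\<^sup>2) = (real (card G)) ^ 6 / (2 ^ 15 * v ^ 8)"
    by (simp add: power_divide power_mult_distrib power_mult[symmetric] mult.assoc power_add[symmetric])
  finally show ?thesis .
qed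

section \<open>Cells rich in pairs of points on a common line\<close>

text \<open>Cauchy-Schwarz over the fibres of \<open>f\<close>.\<close>

lemma same_value_pairs:
  fixes f :: "'a \<Rightarrow> 'b"
  assumes "finite S"
  shows "(card S)\<^sup>2 \<le> card (f ` S) * card {p\<in>S \<times> S. f (fst p) = f (snd p)}"
proof -
  let ?g = "\<lambda>b. card {q\<in>S. f q = b}"
  have fin: "finite (f ` S)" using assms by simp
  have "card S = card (\<Union>b\<in>f ` S. {q\<in>S. f q = b})" by (rule arg_cong[where f = card]) blast
  also have "\<dots> = (\<Sum>b\<in>f ` S. ?g b)" using assms by (intro card_UN_disjoint) auto
  finally have c: "card S = (\<Sum>b\<in>f ` S. ?g b)" .
  have "{p\<in>S \<times> S. f (fst p) = f (snd p)} = (\<Union>b\<in>f ` S. {q\<in>S. f q = b} \<times> {q\<in>S. f q = b})" by auto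
  also have "card \<dots> = (\<Sum>b\<in>f ` S. card ({q\<in>S. f q = b} \<times> {q\<in>S. f q = b}))"
    using assms by (intro card_UN_disjoint) auto
  finally have p: "card {p\<in>S \<times> S. f (fst p) = f (snd p)} = (\<Sum>b\<in>f ` S. (?g b)\<^sup>2)"
    by (simp add: card_cartesian_product power2_eq_square)
  have "(real (card S))\<^sup>2 = (\<Sum>b\<in>f ` S. 1 * real (?g b))\<^sup>2" by (subst c) simp
  also have "\<dots> \<le> (\<Sum>b\<in>f ` S. 1\<^sup>2) * (\<Sum>b\<in>f ` S. (real (?g b))\<^sup>2)" by (rule Cauchy_Schwarz_ineq_sum)
  also have "\<dots> = real (card (f ` S) * card {p\<in>S \<times> S. f (fst p) = f (snd p)})" by (simp add: p)
  finally show ?thesis by (simp only: of_nat_power[symmetric] of_nat_le_iff)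
qed

text \<open>In the application \<open>s = N\<^sup>1\<^sup>/\<^sup>3\<close>, and \<open>\<mu>\<close> is a small power of \<open>N\<close> that absorbs constants and logarithms.
  An element of \<open>Q\<close> is the line with that slope and intercept; an element of \<open>Z\<close> is a point.\<close>

locale cells =
  fixes Q Z :: "(real \<times> real) set" and CC :: "(real \<times> real) set set" and s \<mu> :: real
  assumes finQ: "finite Q" and finZ: "finite Z" and finC: "finite CC"
    and disj: "disjoint CC" and conv: "A \<in> CC \<Longrightarrow> convex A"
    and cardQ: "real (card Q) \<le> s ^ 3" and cardZ: "real (card Z) \<le> s ^ 3"
    and deg_lo: "q \<in> Q \<Longrightarrow> s / \<mu> \<le> real (card {z\<in>Z. on z q})"
    and deg_hi: "q \<in> Q \<Longrightarrow> real (card {z\<in>Z. on z q}) \<le> s * \<mu>"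
    and cell_points: "A \<in> CC \<Longrightarrow> real (card (Z \<inter> A)) \<le> s * \<mu>"
    and cardC: "real (card CC) \<le> s\<^sup>2"
    and hits: "(\<Sum>A\<in>CC. real (card {q\<in>Q. \<exists>z\<in>A. on z q})) \<le> s ^ 4 * \<mu>"
    and st: "st_const (s ^ 3) \<mu>"
    and \<mu>1000: "\<mu> \<ge> 1000" and s_large: "s \<ge> \<mu> ^ 200"
begin

definition good :: "real \<times> real \<Rightarrow> (real \<times> real) set \<Rightarrow> bool" where
  "good q A \<longleftrightarrow> q \<in> Q \<and> A \<in> CC \<and> 2 \<le> card {z\<in>Z \<inter> A. on z q}"

definition star :: "real \<times> real \<Rightarrow> (real \<times> real) set" where
  "star z = {q\<in>Q. on z q}"

definition t :: "real \<times> real \<Rightarrow> (real \<times> real) set \<Rightarrow> nat" where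
  "t z A = card {q\<in>star z. good q A}"

definition GA :: "(real \<times> real) set \<Rightarrow> (real \<times> real) set" where
  "GA A = {q. good q A}"

lemma s_pos: "s > 0" "s \<ge> 1" "\<mu> > 0" "\<mu> \<ge> 1"
proof -
  show "\<mu> > 0" "\<mu> \<ge> 1" using \<mu>1000 by auto
  then have "1 \<le> \<mu> ^ 200" by simp
  then show "s > 0" "s \<ge> 1" using s_large by linarith+
qed

lemma finite_star [simp]: "finite (star z)" using finQ by (simp add: star_def)

lemma GA_sub: "GA A \<subseteq> Q" by (auto simp: GA_def good_def)

lemma finite_GA [simp]: "finite (GA A)" using GA_sub finQ by (rule finite_subset)

lemma good_points:
  assumes "good q A"
  shows "\<exists>x y. x \<in> Z \<inter> A \<and> y \<in> Z \<inter> A \<and> on x q \<and> on y q \<and> fst x < fst y"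
proof -
  have f: "finite {z\<in>Z \<inter> A. on z q}" using finZ by simp
  have "\<not> card {z\<in>Z \<inter> A. on z q} \<le> Suc 0" using assms by (simp add: good_def)
  then obtain x y where xy: "x \<in> {z\<in>Z \<inter> A. on z q}" "y \<in> {z\<in>Z \<inter> A. on z q}" "x \<noteq> y"
    using card_le_Suc0_iff_eq[OF f] by blast
  then have "on x q" "on y q" by simp_all
  then have "fst x \<noteq> fst y" using on_fst_inj xy(3) by blast
  then consider "fst x < fst y" | "fst y < fst x" by linarith
  then show ?thesis
  proof cases
    case 1 then show ?thesis using xy(1,2) by blast
  next
    case 2 then show ?thesis using xy(1,2) by blast
  qed
qed

text \<open>A good line takes up at least two ordered pairs of distinct points of the cell, and
  different lines take different pairs.\<close>

lemma card_GA: "A \<in> CC \<Longrightarrow> real (card (GA A)) \<le> (s * \<mu>)\<^sup>2"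
proof -
  assume A: "A \<in> CC"
  let ?d = "\<lambda>q. card {z\<in>Z \<inter> A. on z q}"
  have "(\<Sum>q\<in>GA A. ?d q + 2) \<le> (\<Sum>q\<in>GA A. (?d q)\<^sup>2)"
  proof (rule sum_mono)
    fix q assume "q \<in> GA A"
    then have "2 \<le> ?d q" by (simp add: GA_def good_def)
    then have "2 * ?d q \<le> ?d q * ?d q" by (rule mult_le_mono1)
    then show "?d q + 2 \<le> (?d q)\<^sup>2" using \<open>2 \<le> ?d q\<close> unfolding power2_eq_square by linarith
  qed
  also have "\<dots> \<le> (card (Z \<inter> A))\<^sup>2 + card (incs (Z \<inter> A) (GA A))"
    using finZ by (intro sum_square_degrees) auto
  also have "card (incs (Z \<inter> A) (GA A)) = (\<Sum>q\<in>GA A. ?d q)" using finZ by (intro card_incs_lines) auto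
  finally have "2 * card (GA A) \<le> (card (Z \<inter> A))\<^sup>2" unfolding sum.distrib by simp
  then have "real (2 * card (GA A)) \<le> real ((card (Z \<inter> A))\<^sup>2)" by (simp only: of_nat_le_iff)
  also have "\<dots> = (real (card (Z \<inter> A)))\<^sup>2" by simp
  also have "\<dots> \<le> (s * \<mu>)\<^sup>2" using cell_points[OF A] by (intro power_mono) auto
  finally show ?thesis by simp
qed

text \<open>The cells are disjoint, and each one in which q is good uses up two of its
  points.\<close>

lemma card_cells_of_line:
  assumes "q \<in> Q"
  shows "real (card {A\<in>CC. good q A}) \<le> s * \<mu>"
proof -
  let ?C = "{A\<in>CC. good q A}"
  have "2 * card ?C = (\<Sum>A\<in>?C. 2)" by simp
  also have "\<dots> \<le> (\<Sum>A\<in>?C. card ({z\<in>Z. on z q} \<inter> A))"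
  proof (rule sum_mono)
    fix A assume "A \<in> ?C"
    moreover have "{z\<in>Z. on z q} \<inter> A = {z\<in>Z \<inter> A. on z q}" by blast
    ultimately show "2 \<le> card ({z\<in>Z. on z q} \<inter> A)" by (simp add: good_def)
  qed
  also have "\<dots> \<le> card {z\<in>Z. on z q}"
    using finZ finC disj by (intro sum_card_cells_le) (auto simp: disjoint_def)
  finally show ?thesis using deg_hi[OF assms] by linarith
qed

lemma star_slope_inj: "inj_on fst (star z)"
proof (rule inj_onI)
  fix q q' assume "q \<in> star z" "q' \<in> star z" "fst q = fst q'"
  then show "q = q'" using on_slope_inj[of z q q'] by (simp add: star_def)
qed

lemma sum_card_star: "(\<Sum>z\<in>Z. real (card (star z))) \<le> s ^ 4 * \<mu>"
proof -
  have "(\<Sum>z\<in>Z. card (star z)) = (\<Sum>q\<in>Q. card {z\<in>Z. on z q})"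
    unfolding star_def using double_count[OF finZ finQ, of on] .
  then have "(\<Sum>z\<in>Z. real (card (star z))) = (\<Sum>q\<in>Q. real (card {z\<in>Z. on z q}))"
    by (simp flip: of_nat_sum)
  also have "\<dots> \<le> (\<Sum>q\<in>Q. s * \<mu>)" by (intro sum_mono deg_hi)
  also have "\<dots> = real (card Q) * (s * \<mu>)" by simp
  also have "\<dots> \<le> s ^ 3 * (s * \<mu>)" using cardQ s_pos by (intro mult_right_mono) auto
  finally show ?thesis by (simp add: power4_eq_xxxx power3_eq_cube)
qed

section \<open>Lines through a point in the order of their slopes\<close>

definition rank :: "real \<times> real \<Rightarrow> real \<times> real \<Rightarrow> nat" where
  "rank z q = card {q'\<in>star z. fst q' < fst q}"

lemma rank_less:
  assumes "q \<in> star z" "fst q < fst q'"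
  shows "rank z q < rank z q'"
  unfolding rank_def using assms by (intro psubset_card_mono) auto

lemma rank_inj: "inj_on (rank z) (star z)"
proof (rule inj_onI)
  fix q q' assume q: "q \<in> star z" "q' \<in> star z" "rank z q = rank z q'"
  then have "fst q = fst q'"
    using rank_less[OF q(1), of q'] rank_less[OF q(2), of q] by (cases "fst q" "fst q'" rule: linorder_cases) simp_all
  then show "q = q'" using inj_onD[OF star_slope_inj _ q(1,2)] by simp
qed

lemma rank_mono: "fst q \<le> fst q' \<Longrightarrow> rank z q \<le> rank z q'"
  unfolding rank_def by (intro card_mono) auto

lemma card_block:
  fixes T :: nat
  assumes "T \<ge> 1"
  shows "card {q\<in>star z. rank z q div T = b} \<le> T"
proof -
  have "card {q\<in>star z. rank z q div T = b} \<le> card {b * T..<b * T + T}"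
  proof (rule card_inj_on_le[of "rank z"])
    show "inj_on (rank z) {q\<in>star z. rank z q div T = b}" using rank_inj by (rule inj_on_subset) auto
    show "rank z ` {q \<in> star z. rank z q div T = b} \<subseteq> {b * T..<b * T + T}"
    proof (rule image_subsetI)
      fix q assume "q \<in> {q \<in> star z. rank z q div T = b}"
      then have b: "b = rank z q div T" by simp
      have "rank z q = b * T + rank z q mod T" unfolding b by simp
      moreover have "rank z q mod T < T" using assms by simp
      ultimately show "rank z q \<in> {b * T..<b * T + T}" unfolding atLeastLessThan_iff by linarith
    qed
  qed simp
  then show ?thesis by simp
qed

text \<open>\<open>?f\<close> is the height above \<open>q2\<close>. On a line through z it is the
  difference of slopes times the distance to z, so at z1 and z3, which are on the same side of z, it
  has opposite signs; the segment between them stays in A and meets \<open>q2\<close>.\<close>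

lemma hit_between:
  assumes A: "A \<in> CC" and q: "on z q1" "on z q2" "on z q3" "fst q1 \<le> fst q2" "fst q2 \<le> fst q3"
    and z1: "z1 \<in> A" "on z1 q1" and z3: "z3 \<in> A" "on z3 q3"
    and side: "(fst z \<le> fst z1 \<and> fst z \<le> fst z3) \<or> (fst z1 \<le> fst z \<and> fst z3 \<le> fst z)"
  shows "\<exists>z'\<in>A. on z' q2"
proof -
  let ?f = "\<lambda>x. snd x - val q2 (fst x)"
  have f: "?f x = (fst q - fst q2) * (fst x - fst z)" if "on z q" "on x q" for x q
    using that q(2) by (simp add: on_def val_def algebra_simps)
  have sgn: "(?f z1 \<le> 0 \<and> 0 \<le> ?f z3) \<or> (?f z3 \<le> 0 \<and> 0 \<le> ?f z1)"
    unfolding f[OF q(1) z1(2)] f[OF q(3) z3(2)] using side q(4,5)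
    by (auto simp: mult_nonneg_nonneg mult_nonpos_nonneg mult_nonneg_nonpos mult_nonpos_nonpos)
  have main: "\<exists>z'\<in>A. on z' q2" if x: "x \<in> A" "?f x \<le> 0" and y: "y \<in> A" "0 \<le> ?f y" for x y
  proof (cases "?f x = ?f y")
    case True
    then have "?f x = 0" using x y by linarith
    then show ?thesis using x(1) by (intro bexI[of _ x]) (simp_all add: on_def)
  next
    case False
    then have d: "?f y - ?f x > 0" using x y by linarith
    define r where "r = - ?f x / (?f y - ?f x)"
    have r: "0 \<le> r" "r \<le> 1" unfolding r_def using d x(2) y(2) by (auto simp: field_simps)
    have re: "r * (?f y - ?f x) = - ?f x" unfolding r_def using d by simp
    let ?w = "(1 - r) *\<^sub>R x + r *\<^sub>R y"
    have "?w \<in> A" using convexD[OF conv[OF A] x(1) y(1), of "1 - r" r] r by simp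
    moreover have "?f ?w = (1 - r) * ?f x + r * ?f y"
      using val_convex_comb[of "1 - r" r q2 "fst x" "fst y"] by (simp add: algebra_simps)
    then have "?f ?w = 0" using re by (simp add: algebra_simps)
    ultimately show ?thesis by (intro bexI[of _ ?w]) (simp_all add: on_def)
  qed
  show ?thesis using sgn main[OF z1(1) _ z3(1)] main[OF z3(1) _ z1(1)] by blast
qed

definition hit :: "real \<times> real \<Rightarrow> (real \<times> real) set \<Rightarrow> (real \<times> real) set" where
  "hit z A = {q\<in>star z. \<exists>z'\<in>A. on z' q}"

lemma finite_hit [simp]: "finite (hit z A)" by (simp add: hit_def)

text \<open>The lines through \<open>z\<close> that meet the convex cell \<open>A\<close> on one side of \<open>z\<close> are consecutive in the
  order of slopes, so they occupy few blocks of consecutive lines.\<close>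

lemma blocks_of_side:
  fixes T :: nat
  assumes T: "T \<ge> 1" and A: "A \<in> CC" and S: "S \<subseteq> star z" "S \<noteq> {}"
    and side: "(\<forall>q\<in>S. \<exists>z'\<in>A. on z' q \<and> fst z \<le> fst z') \<or> (\<forall>q\<in>S. \<exists>z'\<in>A. on z' q \<and> fst z' \<le> fst z)"
  shows "real (card ((\<lambda>q. rank z q div T) ` S)) \<le> real (card (hit z A)) / real T + 2"
proof -
  have fS: "finite S" using S(1) finite_star by (rule finite_subset)
  define q1 where "q1 = arg_min_on fst S"
  have q1: "q1 \<in> S" "\<And>q. q \<in> S \<Longrightarrow> fst q1 \<le> fst q"
    unfolding q1_def by (rule arg_min_if_finite(1)[OF fS S(2)]) (rule arg_min_least[OF fS S(2)])
  obtain q3 where q3: "q3 \<in> S" "\<And>q. q \<in> S \<Longrightarrow> fst q \<le> fst q3"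
  proof -
    have m: "Max (fst ` S) \<in> fst ` S" using fS S(2) by (intro Max_in) auto
    then obtain q where "Max (fst ` S) = fst q" "q \<in> S" by (rule imageE)
    moreover have "fst q' \<le> Max (fst ` S)" if "q' \<in> S" for q' using that fS by (intro Max_ge) auto
    ultimately show ?thesis using that[of q] by simp
  qed
  have onz: "on z q" if "q \<in> star z" for q using that by (simp add: star_def)
  \<comment> \<open>With this half-open range, the lines counted by the rank of \<open>q3\<close>
    are those counted by the rank of \<open>q1\<close> together with \<open>?M\<close>.\<close>
  let ?M = "{q\<in>star z. fst q1 \<le> fst q \<and> fst q < fst q3}"
  have "?M \<subseteq> hit z A"
  proof
    fix q assume q: "q \<in> ?M"
    have "\<exists>z'\<in>A. on z' q"
    proof -
      obtain z1 z3 where z13: "z1 \<in> A" "on z1 q1" "z3 \<in> A" "on z3 q3"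
        "(fst z \<le> fst z1 \<and> fst z \<le> fst z3) \<or> (fst z1 \<le> fst z \<and> fst z3 \<le> fst z)"
      proof (cases "\<forall>q\<in>S. \<exists>z'\<in>A. on z' q \<and> fst z \<le> fst z'")
        case True
        from bspec[OF True q1(1)] obtain z1 where "z1 \<in> A" "on z1 q1" "fst z \<le> fst z1" by (elim bexE conjE)
        moreover from bspec[OF True q3(1)] obtain z3 where "z3 \<in> A" "on z3 q3" "fst z \<le> fst z3" by (elim bexE conjE)
        ultimately show ?thesis using that[of z1 z3] by simp
      next
        case False
        then have L: "\<forall>q\<in>S. \<exists>z'\<in>A. on z' q \<and> fst z' \<le> fst z" using side by argo
        from bspec[OF L q1(1)] obtain z1 where "z1 \<in> A" "on z1 q1" "fst z1 \<le> fst z" by (elim bexE conjE)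
        moreover from bspec[OF L q3(1)] obtain z3 where "z3 \<in> A" "on z3 q3" "fst z3 \<le> fst z" by (elim bexE conjE)
        ultimately show ?thesis using that[of z1 z3] by simp
      qed
      show ?thesis
      proof (rule hit_between[OF A _ _ _ _ _ z13(1,2,3,4,5)])
        show "on z q1" "on z q3" using onz S(1) q1(1) q3(1) by blast+
        show "on z q" "fst q1 \<le> fst q" "fst q \<le> fst q3" using q by (simp_all add: star_def)
      qed
    qed
    then show "q \<in> hit z A" using q by (simp add: hit_def)
  qed
  then have M: "card ?M \<le> card (hit z A)" by (intro card_mono) auto
  have "{q\<in>star z. fst q < fst q3} = {q\<in>star z. fst q < fst q1} \<union> ?M"
    using q3(2)[OF q1(1)] by auto
  then have "rank z q3 = card ({q\<in>star z. fst q < fst q1} \<union> ?M)" by (simp only: rank_def)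
  also have "\<dots> \<le> rank z q1 + card ?M" unfolding rank_def by (rule card_Un_le)
  finally have r: "rank z q3 \<le> rank z q1 + card (hit z A)" using M by linarith
  have "(\<lambda>q. rank z q div T) ` S \<subseteq> {rank z q1 div T..rank z q3 div T}"
  proof (rule image_subsetI)
    fix q assume "q \<in> S"
    then show "rank z q div T \<in> {rank z q1 div T..rank z q3 div T}"
      using q1(2) q3(2) by (simp add: div_le_mono rank_mono)
  qed
  then have "card ((\<lambda>q. rank z q div T) ` S) \<le> card {rank z q1 div T..rank z q3 div T}"
    by (rule card_mono[rotated]) simp
  also have "\<dots> = Suc (rank z q3 div T) - rank z q1 div T" by simp
  finally have c: "real (card ((\<lambda>q. rank z q div T) ` S)) \<le> real (Suc (rank z q3 div T) - rank z q1 div T)"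
    by (simp only: of_nat_le_iff)
  have "rank z q1 div T \<le> rank z q3 div T" using q3(2)[OF q1(1)] by (intro div_le_mono rank_mono)
  then have c2: "real (Suc (rank z q3 div T) - rank z q1 div T) = real (rank z q3 div T) + 1 - real (rank z q1 div T)"
    by (simp add: of_nat_diff)
  have u: "real (rank z q3 div T) \<le> real (rank z q3) / real T"
  proof -
    have "rank z q3 div T * T \<le> rank z q3" by simp
    then have "real (rank z q3 div T * T) \<le> real (rank z q3)" by (simp only: of_nat_le_iff)
    then show ?thesis using T by (simp add: field_simps)
  qed
  have l: "real (rank z q1) / real T \<le> real (rank z q1 div T) + 1"
  proof -
    have "rank z q1 = (rank z q1 div T) * T + rank z q1 mod T" by simp
    moreover have "rank z q1 mod T < T" using T by simp
    ultimately have "rank z q1 \<le> (rank z q1 div T) * T + T" by linarith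
    then have "real (rank z q1) \<le> real ((rank z q1 div T) * T + T)" by (simp only: of_nat_le_iff)
    then show ?thesis using T by (simp add: field_simps)
  qed
  have "real (rank z q3) / real T \<le> (real (rank z q1) + real (card (hit z A))) / real T"
    using r by (intro divide_right_mono) auto
  then show ?thesis using c c2 u l by (simp add: add_divide_distrib)
qed

text \<open>Lying in one block of T consecutive ranks replaces having ranks that differ by less than
  T: it is an equivalence relation, so that Cauchy-Schwarz over the blocks finds close
  pairs.\<close>

definition close_pairs :: "nat \<Rightarrow> real \<times> real \<Rightarrow> ((real \<times> real) \<times> (real \<times> real)) set" where
  "close_pairs T z = {p\<in>star z \<times> star z. rank z (fst p) div T = rank z (snd p) div T}"

lemma finite_close_pairs [simp]: "finite (close_pairs T z)" by (simp add: close_pairs_def)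

lemma card_close_pairs:
  assumes "T \<ge> 1"
  shows "card (close_pairs T z) \<le> card (star z) * T"
proof -
  have "close_pairs T z = (SIGMA q:star z. {q'\<in>star z. rank z q' div T = rank z q div T})"
    by (auto simp: close_pairs_def)
  then have "card (close_pairs T z) = (\<Sum>q\<in>star z. card {q'\<in>star z. rank z q' div T = rank z q div T})"
    by simp
  also have "\<dots> \<le> (\<Sum>q\<in>star z. T)" by (intro sum_mono card_block assms)
  finally show ?thesis by simp
qed

text \<open>Half of the t good lines meet A on one side of z. With h lines through z meeting A they
  occupy at most 3 h / T blocks, so Cauchy-Schwarz yields T t^2 / (12 h) close pairs. Since t^2 / h
  >= 2 c t - c^2 h for every c, the bound is stated linearly in t and h; summing it over z and A
  then needs only the totals of t and h.\<close>

lemma close_pairs_lower: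
  fixes T :: nat and c :: real
  assumes T: "T \<ge> 1" and A: "A \<in> CC" and heavy: "T < t z A"
  shows "real T / 12 * (2 * c * real (t z A) - c\<^sup>2 * real (card (hit z A)))
    \<le> real (card {p\<in>close_pairs T z. good (fst p) A \<and> good (snd p) A})"
proof -
  let ?S = "{q\<in>star z. good q A}"
  let ?R = "{q\<in>?S. \<exists>z'\<in>A. on z' q \<and> fst z \<le> fst z'}" and ?L = "{q\<in>?S. \<exists>z'\<in>A. on z' q \<and> fst z' \<le> fst z}"
  let ?h = "real (card (hit z A))"
  have SRL: "?S \<subseteq> ?R \<union> ?L"
  proof
    fix q assume q: "q \<in> ?S"
    then obtain x where "x \<in> A" "on x q" using good_points[of q A] by blast
    then show "q \<in> ?R \<union> ?L" using q linear[of "fst z" "fst x"] by blast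
  qed
  have "t z A \<le> card (?R \<union> ?L)" unfolding t_def using SRL by (intro card_mono) auto
  also have "\<dots> \<le> card ?R + card ?L" by (rule card_Un_le)
  finally have "t z A \<le> 2 * card ?R \<or> t z A \<le> 2 * card ?L" by linarith
  then obtain S where S: "S = ?R \<or> S = ?L" "t z A \<le> 2 * card S" by blast
  have Ss: "S \<subseteq> ?S" using S(1) by blast
  then have Sst: "S \<subseteq> star z" by blast
  have fS: "finite S" using Sst finite_star by (rule finite_subset)
  have "card S \<noteq> 0" using S(2) heavy by linarith
  then have Sne: "S \<noteq> {}" by auto
  have side: "(\<forall>q\<in>S. \<exists>z'\<in>A. on z' q \<and> fst z \<le> fst z') \<or> (\<forall>q\<in>S. \<exists>z'\<in>A. on z' q \<and> fst z' \<le> fst z)"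
    using S(1) by blast
  have "?S \<subseteq> hit z A"
  proof
    fix q assume q: "q \<in> ?S"
    then obtain x where "x \<in> A" "on x q" using good_points[of q A] by blast
    then show "q \<in> hit z A" using q by (auto simp: hit_def)
  qed
  then have "t z A \<le> card (hit z A)" unfolding t_def by (intro card_mono) auto
  then have hT: "?h > real T" using heavy by linarith
  then have h0: "?h > 0" by linarith
  have Tr: "real T \<ge> 1" using T by simp
  let ?B = "(\<lambda>q. rank z q div T) ` S"
  let ?P = "{p\<in>S \<times> S. rank z (fst p) div T = rank z (snd p) div T}"
  have b: "real (card ?B) \<le> ?h / real T + 2" by (rule blocks_of_side[OF T A Sst Sne side])
  \<comment> \<open>The summand 2 is absorbed because T < t <= h.\<close>
  also have "\<dots> \<le> 3 * ?h / real T" using hT Tr by (simp add: field_simps)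
  finally have b3: "real (card ?B) \<le> 3 * ?h / real T" .
  have "(card S)\<^sup>2 \<le> card ?B * card ?P" by (rule same_value_pairs[OF fS])
  then have "real ((card S)\<^sup>2) \<le> real (card ?B * card ?P)" by (simp only: of_nat_le_iff)
  then have "(real (card S))\<^sup>2 \<le> real (card ?B) * real (card ?P)" by simp
  also have "\<dots> \<le> 3 * ?h / real T * real (card ?P)" using b3 by (intro mult_right_mono) auto
  finally have sq: "(real (card S))\<^sup>2 \<le> 3 * ?h / real T * real (card ?P)" .
  have "real (t z A) \<le> 2 * real (card S)" using S(2) by linarith
  then have "(real (t z A))\<^sup>2 \<le> (2 * real (card S))\<^sup>2" by (intro power_mono) auto
  also have "\<dots> \<le> 12 * ?h / real T * real (card ?P)" using sq by (simp add: power_mult_distrib)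
  finally have "(real (t z A))\<^sup>2 \<le> 12 * ?h / real T * real (card ?P)" .
  moreover have "0 \<le> (real (t z A) - c * ?h)\<^sup>2" by simp
  then have "(2 * c * real (t z A) - c\<^sup>2 * ?h) * ?h \<le> (real (t z A))\<^sup>2"
    by (simp add: power2_eq_square algebra_simps)
  ultimately have "(2 * c * real (t z A) - c\<^sup>2 * ?h) * ?h \<le> (12 / real T * real (card ?P)) * ?h" by (simp add: field_simps)
  then have "2 * c * real (t z A) - c\<^sup>2 * ?h \<le> 12 / real T * real (card ?P)" using h0 by (simp only: mult_le_cancel_right_pos)
  then have "real T / 12 * (2 * c * real (t z A) - c\<^sup>2 * ?h) \<le> real (card ?P)" using Tr by (simp add: field_simps)
  also have "card ?P \<le> card {p\<in>close_pairs T z. good (fst p) A \<and> good (snd p) A}"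
    using Ss by (intro card_mono) (auto simp: close_pairs_def)
  then have "real (card ?P) \<le> real (card {p\<in>close_pairs T z. good (fst p) A \<and> good (snd p) A})" by simp
  finally show ?thesis .
qed

end

section \<open>Star mixing\<close>

context cells
begin

definition shared :: "real \<times> real \<Rightarrow> real \<times> real \<Rightarrow> nat" where
  "shared q q' = card {A\<in>CC. good q A \<and> good q' A}"

lemma shared_le:
  assumes "q \<in> Q"
  shows "real (shared q q') \<le> s * \<mu>"
proof -
  have "shared q q' \<le> card {A\<in>CC. good q A}"
    unfolding shared_def using finC by (intro card_mono) auto
  then show ?thesis using card_cells_of_line[OF assms] by linarith
qed

text \<open>A line sharing more than s / E cells with q has that many points in the cells in which q
  is good. There are at most s \<mu> such cells, with at most s^2 \<mu>^2 points of \<open>Z\<close>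
  among them, and the bound for rich lines leaves about s partners.\<close>

lemma card_rich_partners:
  assumes q: "q \<in> Q" and E: "E > 0" and sE: "s / E > 3 * \<mu>"
  shows "real (card {q'\<in>Q. s / E < real (shared q q')}) \<le> s * (27 * \<mu> ^ 7 * E ^ 3 + 3 * \<mu> ^ 3 * E)"
proof -
  let ?C = "{A\<in>CC. good q A}" and ?R = "{q'\<in>Q. s / E < real (shared q q')}"
  define W where "W = Z \<inter> \<Union> ?C"
  have fW: "finite W" unfolding W_def using finZ by simp
  have "W = (\<Union>A\<in>?C. Z \<inter> A)" unfolding W_def by blast
  then have "card W \<le> (\<Sum>A\<in>?C. card (Z \<inter> A))" using finC by (simp only:) (intro card_UN_le, simp)
  then have "real (card W) \<le> (\<Sum>A\<in>?C. real (card (Z \<inter> A)))" by (simp flip: of_nat_sum)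
  also have "\<dots> \<le> (\<Sum>A\<in>?C. s * \<mu>)" by (intro sum_mono cell_points) simp
  also have "\<dots> = real (card ?C) * (s * \<mu>)" by simp
  also have "\<dots> \<le> s * \<mu> * (s * \<mu>)" using card_cells_of_line[OF q] s_pos by (intro mult_right_mono) auto
  finally have cW: "real (card W) \<le> s\<^sup>2 * \<mu>\<^sup>2" by (simp add: power2_eq_square mult_ac)
  have "card W \<le> card Z" unfolding W_def using finZ by (intro card_mono) auto
  then have W3: "real (card W) \<le> s ^ 3" using cardZ by linarith
  have "card ?R \<le> card Q" using finQ by (intro card_mono) auto
  then have R3: "real (card ?R) \<le> s ^ 3" using cardQ by linarith
  have rich: "s / E \<le> real (card {z\<in>W. on z q'})" if q': "q' \<in> ?R" for q'
  proof -
    let ?D = "{A\<in>CC. good q A \<and> good q' A}"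
    have "shared q q' = (\<Sum>A\<in>?D. 1)" by (simp add: shared_def)
    also have "\<dots> \<le> (\<Sum>A\<in>?D. card ({z\<in>W. on z q'} \<inter> A))"
    proof (rule sum_mono)
      fix A assume A: "A \<in> ?D"
      have "{z\<in>Z \<inter> A. on z q'} \<subseteq> {z\<in>W. on z q'} \<inter> A" using A unfolding W_def by blast
      then have "card {z\<in>Z \<inter> A. on z q'} \<le> card ({z\<in>W. on z q'} \<inter> A)" using fW by (intro card_mono) auto
      then show "1 \<le> card ({z\<in>W. on z q'} \<inter> A)" using A by (simp add: good_def)
    qed
    also have "\<dots> \<le> card {z\<in>W. on z q'}"
      using fW finC disj by (intro sum_card_cells_le) (auto simp: disjoint_def)
    finally show ?thesis using q' by simp
  qed
  have "real (card ?R) \<le> 27 * \<mu> ^ 3 * (real (card W))\<^sup>2 / (s / E) ^ 3 + 3 * \<mu> * real (card W) / (s / E)"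
    using finQ by (intro rich_lines_bound[OF st fW _ W3 R3 rich sE]) auto
  also have "\<dots> \<le> 27 * \<mu> ^ 3 * (s\<^sup>2 * \<mu>\<^sup>2)\<^sup>2 / (s / E) ^ 3 + 3 * \<mu> * (s\<^sup>2 * \<mu>\<^sup>2) / (s / E)"
    using cW s_pos E by (intro add_mono divide_right_mono mult_left_mono power_mono) auto
  also have "\<dots> = s * (27 * \<mu> ^ 7 * E ^ 3 + 3 * \<mu> ^ 3 * E)"
  proof -
    have "27 * \<mu> ^ 3 * (s\<^sup>2 * \<mu>\<^sup>2)\<^sup>2 / (s / E) ^ 3 = s * (27 * \<mu> ^ 7 * E ^ 3)"
    proof -
      have "27 * \<mu> ^ 3 * (s\<^sup>2 * \<mu>\<^sup>2)\<^sup>2 = s * (27 * \<mu> ^ 7) * s ^ 3"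
        by (simp add: power2_eq_square power3_eq_cube eval_nat_numeral mult_ac)
      then have "27 * \<mu> ^ 3 * (s\<^sup>2 * \<mu>\<^sup>2)\<^sup>2 / (s / E) ^ 3 = s * (27 * \<mu> ^ 7) * s ^ 3 / (s / E) ^ 3" by (simp only:)
      also have "\<dots> = s * (27 * \<mu> ^ 7 * E ^ 3)" using s_pos E by (simp add: power_divide)
      finally show ?thesis .
    qed
    moreover have "3 * \<mu> * (s\<^sup>2 * \<mu>\<^sup>2) / (s / E) = s * (3 * \<mu> ^ 3 * E)"
      using s_pos E by (simp add: power2_eq_square power3_eq_cube)
    ultimately show ?thesis by (simp add: distrib_left)
  qed
  finally show ?thesis .
qed

text \<open>Equal pairs, pairs sharing at most s / E cells and rich pairs are counted separately.
  Distinct lines meet in one point only, so a rich pair occurs for at most one z and the rich pairs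
  of all z are bounded together by the number of rich partners.\<close>

lemma close_pairs_upper:
  assumes T: "T \<ge> 1" and E: "E > 0" and sE: "s / E > 3 * \<mu>"
  shows "(\<Sum>z\<in>Z. \<Sum>p\<in>close_pairs T z. real (shared (fst p) (snd p)))
    \<le> s ^ 5 * \<mu>\<^sup>2 + s ^ 5 * \<mu> * real T / E + s ^ 5 * \<mu> * (27 * \<mu> ^ 7 * E ^ 3 + 3 * \<mu> ^ 3 * E)"
proof -
  let ?B = "27 * \<mu> ^ 7 * E ^ 3 + 3 * \<mu> ^ 3 * E"
  let ?rich = "\<lambda>p. fst p \<noteq> snd p \<and> s / E < real (shared (fst p) (snd p))"
  have pQ: "fst p \<in> Q" "snd p \<in> Q" "on z (fst p)" "on z (snd p)" if "p \<in> close_pairs T z" for p z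
    using that by (auto simp: close_pairs_def star_def)
  have sm: "0 \<le> s * \<mu>" "0 \<le> s / E" using s_pos E by auto
  have "(\<Sum>z\<in>Z. \<Sum>p\<in>close_pairs T z. real (shared (fst p) (snd p)))
     \<le> (\<Sum>z\<in>Z. \<Sum>p\<in>close_pairs T z. (if fst p = snd p then s * \<mu> else 0) + s / E + (if ?rich p then s * \<mu> else 0))"
  proof (intro sum_mono)
    fix z p assume "p \<in> close_pairs T z"
    from shared_le[OF pQ(1)[OF this], of "snd p"] sm
    show "real (shared (fst p) (snd p)) \<le> (if fst p = snd p then s * \<mu> else 0) + s / E + (if ?rich p then s * \<mu> else 0)"
      by (cases "fst p = snd p"; cases "s / E < real (shared (fst p) (snd p))") auto
  qed
  also have "\<dots> = (\<Sum>z\<in>Z. real (card {p\<in>close_pairs T z. fst p = snd p}) * (s * \<mu>)) + (\<Sum>z\<in>Z. real (card (close_pairs T z)) * (s / E))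
      + (\<Sum>z\<in>Z. real (card {p\<in>close_pairs T z. ?rich p}) * (s * \<mu>))"
    by (simp add: sum.distrib sum.If_cases Int_def)
  also have "(\<Sum>z\<in>Z. real (card {p\<in>close_pairs T z. fst p = snd p}) * (s * \<mu>)) \<le> s ^ 5 * \<mu>\<^sup>2"
  proof -
    have "card {p\<in>close_pairs T z. fst p = snd p} \<le> card (star z)" for z
    proof (rule card_inj_on_le[of fst])
      show "inj_on fst {p\<in>close_pairs T z. fst p = snd p}" by (rule inj_onI) (simp add: prod_eq_iff)
      show "fst ` {p\<in>close_pairs T z. fst p = snd p} \<subseteq> star z" by (auto simp: close_pairs_def)
    qed simp
    then have "(\<Sum>z\<in>Z. real (card {p\<in>close_pairs T z. fst p = snd p}) * (s * \<mu>)) \<le> (\<Sum>z\<in>Z. real (card (star z)) * (s * \<mu>))"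
      using sm by (intro sum_mono mult_right_mono) auto
    also have "\<dots> = (\<Sum>z\<in>Z. real (card (star z))) * (s * \<mu>)" by (simp add: sum_distrib_right)
    also have "\<dots> \<le> s ^ 4 * \<mu> * (s * \<mu>)" using sum_card_star sm by (intro mult_right_mono) auto
    finally show ?thesis by (simp add: power2_eq_square eval_nat_numeral mult_ac)
  qed
  also have "(\<Sum>z\<in>Z. real (card (close_pairs T z)) * (s / E)) \<le> s ^ 5 * \<mu> * real T / E"
  proof -
    have "(\<Sum>z\<in>Z. real (card (close_pairs T z)) * (s / E)) \<le> (\<Sum>z\<in>Z. real (card (star z) * T) * (s / E))"
      using sm card_close_pairs[OF T] by (intro sum_mono mult_right_mono) (simp_all only: of_nat_le_iff)
    also have "\<dots> = (\<Sum>z\<in>Z. real (card (star z))) * (real T * (s / E))"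
      unfolding sum_distrib_right by (intro sum.cong refl) simp
    also have "\<dots> \<le> s ^ 4 * \<mu> * (real T * (s / E))"
      by (rule mult_right_mono[OF sum_card_star mult_nonneg_nonneg[OF _ sm(2)]]) simp
    finally show ?thesis by (simp add: eval_nat_numeral mult_ac)
  qed
  also have "(\<Sum>z\<in>Z. real (card {p\<in>close_pairs T z. ?rich p}) * (s * \<mu>)) \<le> s ^ 5 * \<mu> * ?B"
  proof -
    let ?RP = "SIGMA q:Q. {q'\<in>Q. s / E < real (shared q q')}"
    have fRP: "finite ?RP" using finQ by auto
    have dis: "{p\<in>close_pairs T z. ?rich p} \<inter> {p\<in>close_pairs T z'. ?rich p} = {}" if "z \<noteq> z'" for z z'
    proof (rule equals0I)
      fix p assume p: "p \<in> {p\<in>close_pairs T z. ?rich p} \<inter> {p\<in>close_pairs T z'. ?rich p}"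
      have "p \<in> close_pairs T z" "p \<in> close_pairs T z'" "fst p \<noteq> snd p" using p by simp_all
      then show False using on_unique[OF pQ(3)[of p z] pQ(4)[of p z] pQ(3)[of p z'] pQ(4)[of p z'] that] by simp
    qed
    have "(\<Sum>z\<in>Z. card {p\<in>close_pairs T z. ?rich p}) = card (\<Union>z\<in>Z. {p\<in>close_pairs T z. ?rich p})"
      using finZ dis by (intro card_UN_disjoint[symmetric]) auto
    also have "\<dots> \<le> card ?RP"
    proof (rule card_mono[OF fRP])
      show "(\<Union>z\<in>Z. {p\<in>close_pairs T z. ?rich p}) \<subseteq> ?RP"
      proof
        fix p assume "p \<in> (\<Union>z\<in>Z. {p\<in>close_pairs T z. ?rich p})"
        then obtain z where "p \<in> close_pairs T z" "s / E < real (shared (fst p) (snd p))" by blast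
        then show "p \<in> ?RP" using pQ(1)[of p z] pQ(2)[of p z] by (cases p) simp
      qed
    qed
    also have "card ?RP = (\<Sum>q\<in>Q. card {q'\<in>Q. s / E < real (shared q q')})" using finQ by simp
    finally have "real (\<Sum>z\<in>Z. card {p\<in>close_pairs T z. ?rich p}) \<le> real (\<Sum>q\<in>Q. card {q'\<in>Q. s / E < real (shared q q')})"
      by (simp only: of_nat_le_iff)
    also have "\<dots> = (\<Sum>q\<in>Q. real (card {q'\<in>Q. s / E < real (shared q q')}))" by simp
    also have "\<dots> \<le> (\<Sum>q\<in>Q. s * ?B)" by (intro sum_mono card_rich_partners E sE)
    also have "\<dots> = real (card Q) * (s * ?B)" by simp
    also have "\<dots> \<le> s ^ 3 * (s * ?B)" using cardQ s_pos E by (intro mult_right_mono) auto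
    finally have "real (\<Sum>z\<in>Z. card {p\<in>close_pairs T z. ?rich p}) * (s * \<mu>) \<le> s ^ 3 * (s * ?B) * (s * \<mu>)"
      using sm by (intro mult_right_mono)
    moreover have "s ^ 3 * (s * b) * (s * \<mu>) = s ^ 5 * \<mu> * b" for b by (simp add: eval_nat_numeral mult_ac)
    ultimately show ?thesis by (simp only: sum_distrib_right of_nat_sum)
  qed
  finally show ?thesis by linarith
qed

lemma sum_card_hit: "(\<Sum>A\<in>CC. \<Sum>z\<in>Z. real (card (hit z A))) \<le> s ^ 5 * \<mu>\<^sup>2"
proof -
  have "(\<Sum>A\<in>CC. \<Sum>z\<in>Z. real (card (hit z A))) \<le> (\<Sum>A\<in>CC. real (card {q\<in>Q. \<exists>z\<in>A. on z q}) * (s * \<mu>))"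
  proof (rule sum_mono)
    fix A assume "A \<in> CC"
    let ?H = "{q\<in>Q. \<exists>z\<in>A. on z q}"
    have "hit z A = {q\<in>?H. on z q}" for z by (auto simp: hit_def star_def)
    then have "(\<Sum>z\<in>Z. card (hit z A)) = (\<Sum>q\<in>?H. card {z\<in>Z. on z q})"
      using double_count[OF finZ, of ?H on] finQ by simp
    then have "(\<Sum>z\<in>Z. real (card (hit z A))) = (\<Sum>q\<in>?H. real (card {z\<in>Z. on z q}))"
      by (simp flip: of_nat_sum)
    also have "\<dots> \<le> (\<Sum>q\<in>?H. s * \<mu>)" by (intro sum_mono deg_hi) simp
    finally show "(\<Sum>z\<in>Z. real (card (hit z A))) \<le> real (card ?H) * (s * \<mu>)" by simp
  qed
  also have "\<dots> = (\<Sum>A\<in>CC. real (card {q\<in>Q. \<exists>z\<in>A. on z q})) * (s * \<mu>)" by (simp add: sum_distrib_right)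
  also have "\<dots> \<le> s ^ 4 * \<mu> * (s * \<mu>)" using hits s_pos by (intro mult_right_mono) auto
  finally show ?thesis by (simp add: power2_eq_square eval_nat_numeral mult_ac)
qed

text \<open>The trivial bound is s^5 \<mu>^2, so the gain is essentially the factor D. If it failed,
  the lower and the upper bound for close pairs weighted by shared cells would contradict each
  other, as only a small multiple of T occurs in the upper one.\<close>

lemma star_mixing_sum:
  fixes T :: nat and D :: real
  assumes D: "D \<ge> 1" and T: "real T \<ge> D ^ 8 * \<mu> ^ 25" and sD: "s / (D\<^sup>2 * \<mu> ^ 4) > 3 * \<mu>"
  shows "(\<Sum>A\<in>CC. \<Sum>z\<in>{z\<in>Z. T < t z A}. real (t z A)) \<le> s ^ 5 / D"
proof (rule ccontr)
  let ?H = "\<Sum>A\<in>CC. \<Sum>z\<in>{z\<in>Z. T < t z A}. real (t z A)"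
  assume "\<not> ?thesis"
  then have H: "?H > s ^ 5 / D" by simp
  have "1 * 1 \<le> D ^ 8 * \<mu> ^ 25" using D s_pos by (intro mult_mono) auto
  then have T1: "T \<ge> 1" using T by simp
  \<comment> \<open>After multiplication by 12 D^2 \<mu>^2 the term of the upper bound that contains
    T becomes 12 T / \<mu>, at most T / 2. The price is D^2 E^3 in the rich pairs, which is the
    source of D^8 and of \<mu>^22.\<close>
  define E where "E = D\<^sup>2 * \<mu> ^ 4"
  have E0: "E > 0" unfolding E_def using D s_pos by simp
  \<comment> \<open>This maximises 2 c / D - c^2 \<mu>^2, the lower bound per unit of s^5 T /
    12.\<close>
  define c where "c = 1 / (D * \<mu>\<^sup>2)"
  have c0: "c > 0" unfolding c_def using D s_pos by simp
  let ?P = "\<lambda>z A. real (card {p\<in>close_pairs T z. good (fst p) A \<and> good (snd p) A})"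
  have "real T / 12 * (2 * c * (s ^ 5 / D) - c\<^sup>2 * (s ^ 5 * \<mu>\<^sup>2)) \<le> real T / 12 * (2 * c * ?H - c\<^sup>2 * (\<Sum>A\<in>CC. \<Sum>z\<in>Z. real (card (hit z A))))"
    using H sum_card_hit c0 by (intro mult_left_mono diff_mono) auto
  also have "\<dots> \<le> real T / 12 * (2 * c * ?H - c\<^sup>2 * (\<Sum>A\<in>CC. \<Sum>z\<in>{z\<in>Z. T < t z A}. real (card (hit z A))))"
    using finZ c0 by (intro mult_left_mono diff_mono sum_mono sum_mono2) auto
  also have "\<dots> = (\<Sum>A\<in>CC. \<Sum>z\<in>{z\<in>Z. T < t z A}. real T / 12 * (2 * c * real (t z A) - c\<^sup>2 * real (card (hit z A))))"
    by (simp only: sum_distrib_left right_diff_distrib sum_subtractf)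
  also have "\<dots> \<le> (\<Sum>A\<in>CC. \<Sum>z\<in>{z\<in>Z. T < t z A}. ?P z A)"
    by (intro sum_mono close_pairs_lower T1) simp_all
  also have "\<dots> \<le> (\<Sum>A\<in>CC. \<Sum>z\<in>Z. ?P z A)" using finZ by (intro sum_mono sum_mono2) auto
  also have "\<dots> = (\<Sum>z\<in>Z. \<Sum>A\<in>CC. ?P z A)" by (rule sum.swap)
  also have "\<dots> = (\<Sum>z\<in>Z. \<Sum>p\<in>close_pairs T z. real (shared (fst p) (snd p)))"
  proof (intro sum.cong refl)
    fix z
    have "(\<Sum>A\<in>CC. card {p\<in>close_pairs T z. good (fst p) A \<and> good (snd p) A}) = (\<Sum>p\<in>close_pairs T z. shared (fst p) (snd p))"
      unfolding shared_def using double_count[OF finC finite_close_pairs, where P = "\<lambda>A p. good (fst p) A \<and> good (snd p) A"] .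
    then show "(\<Sum>A\<in>CC. ?P z A) = (\<Sum>p\<in>close_pairs T z. real (shared (fst p) (snd p)))" by (simp flip: of_nat_sum)
  qed
  also have "\<dots> \<le> s ^ 5 * \<mu>\<^sup>2 + s ^ 5 * \<mu> * real T / E + s ^ 5 * \<mu> * (27 * \<mu> ^ 7 * E ^ 3 + 3 * \<mu> ^ 3 * E)"
    using sD by (intro close_pairs_upper T1 E0) (simp add: E_def)
  finally have "real T / 12 * (2 * c * (s ^ 5 / D) - c\<^sup>2 * (s ^ 5 * \<mu>\<^sup>2))
     \<le> s ^ 5 * (\<mu>\<^sup>2 + \<mu> * real T / E + \<mu> * (27 * \<mu> ^ 7 * E ^ 3 + 3 * \<mu> ^ 3 * E))" by (simp add: algebra_simps)
  moreover have "real T / 12 * (2 * c * (s ^ 5 / D) - c\<^sup>2 * (s ^ 5 * \<mu>\<^sup>2)) = s ^ 5 * (real T / (12 * D\<^sup>2 * \<mu>\<^sup>2))"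
    unfolding c_def using D s_pos by (simp add: field_simps power2_eq_square)
  ultimately have "s ^ 5 * (real T / (12 * D\<^sup>2 * \<mu>\<^sup>2)) \<le> s ^ 5 * (\<mu>\<^sup>2 + \<mu> * real T / E + \<mu> * (27 * \<mu> ^ 7 * E ^ 3 + 3 * \<mu> ^ 3 * E))"
    by linarith
  then have "real T / (12 * D\<^sup>2 * \<mu>\<^sup>2) \<le> \<mu>\<^sup>2 + \<mu> * real T / E + \<mu> * (27 * \<mu> ^ 7 * E ^ 3 + 3 * \<mu> ^ 3 * E)"
    using s_pos(1) by (simp only: mult_le_cancel_left_pos zero_less_power)
  then have "12 * D\<^sup>2 * \<mu>\<^sup>2 * (real T / (12 * D\<^sup>2 * \<mu>\<^sup>2)) \<le> 12 * D\<^sup>2 * \<mu>\<^sup>2 * (\<mu>\<^sup>2 + \<mu> * real T / E + \<mu> * (27 * \<mu> ^ 7 * E ^ 3 + 3 * \<mu> ^ 3 * E))"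
    using D s_pos by (intro mult_left_mono) auto
  moreover have "12 * D\<^sup>2 * \<mu>\<^sup>2 * (real T / (12 * D\<^sup>2 * \<mu>\<^sup>2)) = real T" using D s_pos by simp
  moreover have "12 * D\<^sup>2 * \<mu>\<^sup>2 * (\<mu>\<^sup>2 + \<mu> * real T / E + \<mu> * (27 * \<mu> ^ 7 * E ^ 3 + 3 * \<mu> ^ 3 * E))
     = 12 * D\<^sup>2 * \<mu> ^ 4 + 12 * real T / \<mu> + (324 * D ^ 8 * \<mu> ^ 22 + 36 * D ^ 4 * \<mu> ^ 10)"
  proof -
    have "12 * D\<^sup>2 * \<mu>\<^sup>2 * (\<mu> * real T / E) = 12 * real T / \<mu>"
      unfolding E_def using D s_pos by (simp add: power2_eq_square power4_eq_xxxx)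
    moreover have "12 * D\<^sup>2 * \<mu>\<^sup>2 * (\<mu> * (27 * \<mu> ^ 7 * E ^ 3 + 3 * \<mu> ^ 3 * E)) = 324 * D ^ 8 * \<mu> ^ 22 + 36 * D ^ 4 * \<mu> ^ 10"
      unfolding E_def by (simp add: eval_nat_numeral algebra_simps)
    moreover have "12 * D\<^sup>2 * \<mu>\<^sup>2 * \<mu>\<^sup>2 = 12 * D\<^sup>2 * \<mu> ^ 4" by (simp add: eval_nat_numeral)
    ultimately show ?thesis by (simp only: distrib_left)
  qed
  ultimately have "real T \<le> 12 * D\<^sup>2 * \<mu> ^ 4 + 12 * real T / \<mu> + (324 * D ^ 8 * \<mu> ^ 22 + 36 * D ^ 4 * \<mu> ^ 10)" by linarith
  moreover have "12 * real T / \<mu> \<le> real T / 2"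
  proof -
    have "24 * real T \<le> \<mu> * real T" using \<mu>1000 by (intro mult_right_mono) auto
    then show ?thesis using s_pos by (simp add: field_simps)
  qed
  moreover have "D\<^sup>2 * \<mu> ^ 4 \<le> D ^ 8 * \<mu> ^ 22" "D ^ 4 * \<mu> ^ 10 \<le> D ^ 8 * \<mu> ^ 22"
    using D s_pos by (auto intro!: mult_mono power_increasing)
  ultimately have "real T \<le> 744 * (D ^ 8 * \<mu> ^ 22)" by linarith
  moreover have "744 * (D ^ 8 * \<mu> ^ 22) < D ^ 8 * \<mu> ^ 25"
  proof -
    have "\<mu> ^ 1 \<le> \<mu> ^ 3" using s_pos by (intro power_increasing) auto
    then have "744 < \<mu> ^ 3" using \<mu>1000 by simp
    then have "744 * (D ^ 8 * \<mu> ^ 22) < \<mu> ^ 3 * (D ^ 8 * \<mu> ^ 22)" using D s_pos by (intro mult_strict_right_mono) auto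
    also have "\<dots> = D ^ 8 * (\<mu> ^ 3 * \<mu> ^ 22)" by simp
    also have "\<mu> ^ 3 * \<mu> ^ 22 = \<mu> ^ 25" by (simp flip: power_add)
    finally show ?thesis .
  qed
  ultimately show False using T by linarith
qed

text \<open>The same sum arranged by lines: it counts, on lines good in A, the points that are heavy
  towards A. In this form it bounds how often \<open>light\<close> and \<open>nice\<close>
  fail.\<close>

lemma star_mixing:
  fixes T :: nat and D :: real
  assumes "D \<ge> 1" "real T \<ge> D ^ 8 * \<mu> ^ 25" "s / (D\<^sup>2 * \<mu> ^ 4) > 3 * \<mu>"
  shows "(\<Sum>A\<in>CC. \<Sum>q\<in>GA A. real (card {z\<in>Z. on z q \<and> T < t z A})) \<le> s ^ 5 / D"
proof -
  have "(\<Sum>q\<in>GA A. real (card {z\<in>Z. on z q \<and> T < t z A})) = (\<Sum>z\<in>{z\<in>Z. T < t z A}. real (t z A))" for A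
  proof -
    have e: "{z\<in>Z. on z q \<and> T < t z A} = {z\<in>{z\<in>Z. T < t z A}. on z q}" for q by blast
    have "t z A = card {q\<in>GA A. on z q}" for z
      unfolding t_def star_def GA_def good_def by (rule arg_cong[where f = card]) blast
    then have "(\<Sum>q\<in>GA A. card {z\<in>Z. on z q \<and> T < t z A}) = (\<Sum>z\<in>{z\<in>Z. T < t z A}. t z A)"
      unfolding e using double_count[of "GA A" "{z\<in>Z. T < t z A}" "\<lambda>q z. on z q"] finZ by simp
    then show ?thesis by (simp flip: of_nat_sum)
  qed
  then show ?thesis using star_mixing_sum[OF assms] by simp
qed

end

section \<open>Crossings inside cells\<close>

context cells
begin

definition meets :: "(real \<times> real) set \<Rightarrow> real \<times> real \<Rightarrow> real \<times> real \<Rightarrow> bool" where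
  "meets A p q \<longleftrightarrow> p \<noteq> q \<and> good p A \<and> good q A \<and> (\<exists>z\<in>A. on z p \<and> on z q)"

definition cr :: "real \<times> real \<Rightarrow> (real \<times> real) set \<Rightarrow> nat" where
  "cr p A = card {q. meets A p q}"

text \<open>Serves to bound the overlap of a sector at the first point with one at the second. A
  single witness suffices: \<open>A1\<close> has few points, and through each one that is light
  towards \<open>A2\<close> only T lines are good in \<open>A2\<close>.\<close>

definition light :: "nat \<Rightarrow> real \<times> real \<Rightarrow> (real \<times> real) set \<Rightarrow> (real \<times> real) set \<Rightarrow> bool" where
  "light T q A1 A2 \<longleftrightarrow> (\<exists>z\<in>Z \<inter> A1. on z q \<and> t z A2 \<le> T)"

text \<open>Serves to show that a sector at the first point meets many lines. Half of the guaranteed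
  s / \<mu> points of q must be light towards A, so that many nice lines good in A cannot
  concentrate on few points.\<close>

definition nice :: "nat \<Rightarrow> real \<times> real \<Rightarrow> (real \<times> real) set \<Rightarrow> bool" where
  "nice T q A \<longleftrightarrow> s / (2 * \<mu>) \<le> real (card {z\<in>Z. on z q \<and> t z A \<le> T})"

lemma goodD: "good q A \<Longrightarrow> q \<in> Q" "good q A \<Longrightarrow> A \<in> CC"
  by (simp_all add: good_def)

lemma meets_sub: "{q. meets A p q} \<subseteq> GA A"
  unfolding meets_def GA_def by blast

lemma finite_meets [simp]: "finite {q. meets A p q}"
  using meets_sub finite_GA by (rule finite_subset)

text \<open>Distinct lines have only one common point, and it lies in only one cell.\<close>

lemma meets_unique_cell:
  assumes "meets A p q" "meets A' p q"
  shows "A = A'"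
proof -
  obtain z where z: "z \<in> A" "on z p" "on z q" using assms(1) unfolding meets_def by blast
  obtain z' where z': "z' \<in> A'" "on z' p" "on z' q" using assms(2) unfolding meets_def by blast
  have "p \<noteq> q" using assms(1) unfolding meets_def by blast
  then have "z = z'" using on_unique[OF z(2,3) z'(2,3)] by blast
  moreover have "A \<in> CC" "A' \<in> CC" using assms goodD(2) unfolding meets_def by blast+
  ultimately show ?thesis using disj z(1) z'(1) unfolding disjoint_def by blast
qed

lemma cell_unique: "A \<in> CC \<Longrightarrow> A' \<in> CC \<Longrightarrow> z \<in> A \<Longrightarrow> z \<in> A' \<Longrightarrow> A = A'"
  using disj unfolding disjoint_def by blast

lemma \<mu>_power: "i \<le> j \<Longrightarrow> \<mu> ^ i \<le> \<mu> ^ j"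
  using s_pos by (intro power_increasing) auto

lemma s_ge: "i \<le> 200 \<Longrightarrow> \<mu> ^ i \<le> s"
  using \<mu>_power[of i 200] s_large by linarith

lemma sum_card_GA: "(\<Sum>A\<in>CC. real (card (GA A))) \<le> s ^ 4 * \<mu>"
proof -
  have "(\<Sum>A\<in>CC. card {q\<in>Q. good q A}) = (\<Sum>q\<in>Q. card {A\<in>CC. good q A})"
    by (rule double_count[OF finC finQ])
  moreover have "GA A = {q\<in>Q. good q A}" for A using goodD(1) unfolding GA_def by blast
  ultimately have "(\<Sum>A\<in>CC. real (card (GA A))) = (\<Sum>q\<in>Q. real (card {A\<in>CC. good q A}))"
    by (simp flip: of_nat_sum)
  also have "\<dots> \<le> (\<Sum>q\<in>Q. s * \<mu>)" by (intro sum_mono card_cells_of_line)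
  also have "\<dots> = real (card Q) * (s * \<mu>)" by simp
  also have "\<dots> \<le> s ^ 3 * (s * \<mu>)" using cardQ s_pos by (intro mult_right_mono) auto
  finally show ?thesis by (simp add: eval_nat_numeral mult_ac)
qed

lemma light_count:
  assumes A1: "A1 \<in> CC"
  shows "real (card {q. light T q A1 A2 \<and> good q A2}) \<le> s * \<mu> * real T"
proof -
  let ?W = "{z\<in>Z \<inter> A1. t z A2 \<le> T}"
  have fW: "finite ?W" using finZ by simp
  have "{q. light T q A1 A2 \<and> good q A2} \<subseteq> (\<Union>z\<in>?W. {q\<in>star z. good q A2})"
    unfolding light_def star_def using goodD(1) by blast
  then have "card {q. light T q A1 A2 \<and> good q A2} \<le> card (\<Union>z\<in>?W. {q\<in>star z. good q A2})"
    using fW by (intro card_mono) auto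
  also have "\<dots> \<le> (\<Sum>z\<in>?W. card {q\<in>star z. good q A2})" by (rule card_UN_le[OF fW])
  also have "\<dots> = (\<Sum>z\<in>?W. t z A2)" by (rule sum.cong[OF refl]) (rule t_def[symmetric])
  also have "\<dots> \<le> (\<Sum>z\<in>?W. T)" by (intro sum_mono) simp
  also have "\<dots> = card ?W * T" by simp
  also have "\<dots> \<le> card (Z \<inter> A1) * T" using finZ by (intro mult_right_mono card_mono) auto
  finally have "real (card {q. light T q A1 A2 \<and> good q A2}) \<le> real (card (Z \<inter> A1) * T)" by (simp only: of_nat_le_iff)
  also have "\<dots> \<le> s * \<mu> * real T" using cell_points[OF A1] by (simp add: mult_right_mono)
  finally show ?thesis .
qed

text \<open>A point that is light towards A lies on at most T members of \<open>Y\<close>, since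
  these are all good in A; now count incidences with light points.\<close>

lemma nice_count:
  assumes Y: "finite Y" "\<And>q. q \<in> Y \<Longrightarrow> good q A \<and> nice T q A"
  shows "real (card Y) * (s / (2 * \<mu>)) \<le> real (card {z\<in>Z. \<exists>q\<in>Y. on z q}) * real T"
proof -
  let ?W = "{z\<in>Z. \<exists>q\<in>Y. on z q}" and ?V = "{z\<in>Z. (\<exists>q\<in>Y. on z q) \<and> t z A \<le> T}"
  have fV: "finite ?V" using finZ by simp
  have "real (card Y) * (s / (2 * \<mu>)) = (\<Sum>q\<in>Y. s / (2 * \<mu>))" by simp
  also have "\<dots> \<le> (\<Sum>q\<in>Y. real (card {z\<in>Z. on z q \<and> t z A \<le> T}))"
    using Y(2) by (intro sum_mono) (simp add: nice_def)
  also have "\<dots> = (\<Sum>q\<in>Y. real (card {z\<in>?V. on z q}))"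
    by (intro sum.cong refl arg_cong[where f = "\<lambda>S. real (card S)"]) blast
  also have "\<dots> = (\<Sum>z\<in>?V. real (card {q\<in>Y. on z q}))"
    using arg_cong[OF double_count[OF Y(1) fV, of "\<lambda>q z. on z q"], of real] by simp
  also have "\<dots> \<le> (\<Sum>z\<in>?V. real T)"
  proof (rule sum_mono)
    fix z assume z: "z \<in> ?V"
    have "{q\<in>Y. on z q} \<subseteq> {q\<in>star z. good q A}" using Y(2) goodD(1) unfolding star_def by blast
    then have "card {q\<in>Y. on z q} \<le> t z A" unfolding t_def by (intro card_mono) auto
    then show "real (card {q\<in>Y. on z q}) \<le> real T" using z by simp
  qed
  also have "\<dots> = real (card ?V) * real T" by simp
  also have "\<dots> \<le> real (card ?W) * real T"
  proof -
    have "card ?V \<le> card ?W" using finZ by (intro card_mono) auto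
    then show ?thesis by (intro mult_right_mono) auto
  qed
  finally show ?thesis .
qed

text \<open>Lines through z that are good in A are told apart by a second point of \<open>Z\<close>
  in A. This bounds the points lost because they lie on a bush line.\<close>

lemma good_through_point:
  assumes z: "z \<in> Z \<inter> A" and A: "A \<in> CC"
  shows "real (card {q. good q A \<and> on z q}) \<le> s * \<mu>"
proof -
  have "\<exists>x. x \<in> Z \<inter> A \<and> on x q \<and> x \<noteq> z" if "good q A" for q
  proof -
    obtain x y where xy: "x \<in> Z \<inter> A" "y \<in> Z \<inter> A" "on x q" "on y q" "fst x < fst y"
      using good_points[OF \<open>good q A\<close>] by blast
    then have "x \<noteq> y" by auto
    then show ?thesis using xy by (cases "x = z") blast+
  qed
  then obtain f where f: "\<And>q. good q A \<Longrightarrow> f q \<in> Z \<inter> A \<and> on (f q) q \<and> f q \<noteq> z" by metis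
  have "card {q. good q A \<and> on z q} \<le> card (Z \<inter> A)"
  proof (rule card_inj_on_le[of f])
    show "inj_on f {q. good q A \<and> on z q}"
    proof (rule inj_onI)
      fix q q' assume q: "q \<in> {q. good q A \<and> on z q}" "q' \<in> {q. good q A \<and> on z q}" "f q = f q'"
      then have "good q A" "on z q" "good q' A" "on z q'" by simp_all
      then show "q = q'" using f[of q] f[of q'] q(3) on_unique[of z q q' "f q"] by metis
    qed
    show "f ` {q. good q A \<and> on z q} \<subseteq> Z \<inter> A" by (rule image_subsetI) (use f in simp)
  qed (use finZ in simp)
  then show ?thesis using cell_points[OF A] by linarith
qed

text \<open>A cell where lightness fails contains a point of q that is heavy towards
  \<open>A2\<close>, and disjoint cells give different points.\<close>

lemma nonlight_count:
  assumes q: "q \<in> Q"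
  shows "card {A1\<in>CC. good q A1 \<and> \<not> light T q A1 A2} \<le> card {z\<in>Z. on z q \<and> T < t z A2}"
proof -
  let ?S = "{A1\<in>CC. good q A1 \<and> \<not> light T q A1 A2}"
  have "\<exists>z. z \<in> Z \<inter> A \<and> on z q \<and> T < t z A2" if A: "A \<in> ?S" for A
  proof -
    have "good q A" using A by simp
    then obtain z where z: "z \<in> Z \<inter> A" "on z q" using good_points by blast
    have "\<not> t z A2 \<le> T" using A z unfolding light_def by blast
    then have "T < t z A2" by simp
    then show ?thesis using z by blast
  qed
  then have "\<forall>A\<in>?S. \<exists>z. z \<in> Z \<inter> A \<and> on z q \<and> T < t z A2" by (rule ballI)
  from bchoice[OF this] obtain f where f: "\<forall>A\<in>?S. f A \<in> Z \<inter> A \<and> on (f A) q \<and> T < t (f A) A2" by (rule exE)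
  show ?thesis
  proof (rule card_inj_on_le[of f])
    show "inj_on f ?S"
    proof (rule inj_onI)
      fix A A' assume A: "A \<in> ?S" "A' \<in> ?S" "f A = f A'"
      then show "A = A'" using bspec[OF f A(1)] bspec[OF f A(2)] cell_unique[of A A' "f A"] by simp
    qed
    show "f ` ?S \<subseteq> {z\<in>Z. on z q \<and> T < t z A2}" by (rule image_subsetI) (use f in simp)
  qed (use finZ in simp)
qed

lemma nonnice_count:
  assumes q: "q \<in> Q" and n: "\<not> nice T q A"
  shows "s / (2 * \<mu>) \<le> real (card {z\<in>Z. on z q \<and> T < t z A})"
proof -
  have "{z\<in>Z. on z q} = {z\<in>Z. on z q \<and> t z A \<le> T} \<union> {z\<in>Z. on z q \<and> T < t z A}" by auto
  then have "card {z\<in>Z. on z q} \<le> card {z\<in>Z. on z q \<and> t z A \<le> T} + card {z\<in>Z. on z q \<and> T < t z A}"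
    by (simp only: card_Un_le)
  then have "s / \<mu> \<le> real (card {z\<in>Z. on z q \<and> t z A \<le> T}) + real (card {z\<in>Z. on z q \<and> T < t z A})"
    using deg_lo[OF q] by linarith
  moreover have "s / \<mu> = s / (2 * \<mu>) + s / (2 * \<mu>)" using s_pos by simp
  ultimately show ?thesis using n unfolding nice_def by linarith
qed

text \<open>The sixth power is replaced by a linear lower bound that is negative below s^2 / (2
  \<mu>) good lines. It can be summed over all cells knowing only the total number of good pairs,
  and poor cells need no separate treatment.\<close>

lemma cell_crossings:
  assumes A: "A \<in> CC"
  shows "(real (card (GA A)) - s\<^sup>2 / (2 * \<mu>)) * (s\<^sup>2 / (2 ^ 20 * \<mu> ^ 13)) \<le> (\<Sum>p\<in>GA A. real (cr p A))"
proof (cases "s\<^sup>2 / (2 * \<mu>) \<le> real (card (GA A))")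
  case False
  then have "(real (card (GA A)) - s\<^sup>2 / (2 * \<mu>)) * (s\<^sup>2 / (2 ^ 20 * \<mu> ^ 13)) \<le> 0"
    using s_pos by (intro mult_nonpos_nonneg) auto
  also have "0 \<le> (\<Sum>p\<in>GA A. real (cr p A))" by (intro sum_nonneg) auto
  finally show ?thesis .
next
  case True
  let ?e = "real (card (GA A))"
  have "(\<Sum>p\<in>GA A. real (cr p A)) = real (\<Sum>p\<in>GA A. card {q. meets A p q})" by (simp add: cr_def)
  also have "(\<Sum>p\<in>GA A. card {q. meets A p q}) = card (SIGMA p:GA A. {q. meets A p q})" by simp
  also have "(SIGMA p:GA A. {q. meets A p q}) = {(p, q). p \<in> GA A \<and> q \<in> GA A \<and> p \<noteq> q \<and> (\<exists>z\<in>A. on z p \<and> on z q)}" (is "_ = ?M")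
    by (rule set_eqI, simp only: mem_Sigma_iff split_paired_all mem_Collect_eq prod.case meets_def GA_def) blast
  finally have M: "(\<Sum>p\<in>GA A. real (cr p A)) = real (card ?M)" .
  have v0: "s * \<mu> > 0" using s_pos by simp
  have big: "32 * (s * \<mu>) ^ 3 \<le> ?e\<^sup>2"
  proof -
    have "128 * \<mu> ^ 5 \<le> \<mu> * \<mu> ^ 5" using \<mu>1000 s_pos by (intro mult_right_mono) auto
    also have "\<dots> = \<mu> ^ 6" by (simp add: eval_nat_numeral)
    also have "\<dots> \<le> s" by (rule s_ge) simp
    finally have "128 * \<mu> ^ 5 * s ^ 3 \<le> s * s ^ 3" using s_pos by (intro mult_right_mono) auto
    then have "32 * (s * \<mu>) ^ 3 \<le> (s\<^sup>2 / (2 * \<mu>))\<^sup>2" using s_pos by (simp add: field_simps eval_nat_numeral)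
    also have "\<dots> \<le> ?e\<^sup>2" using True s_pos by (intro power_mono) auto
    finally show ?thesis .
  qed
  have "?e ^ 6 / (2 ^ 15 * (s * \<mu>) ^ 8) \<le> real (card ?M)"
  proof (rule meeting_pairs_in_cell[OF finite_GA _ conv[OF A] _ _ cell_points[OF A] big v0])
    show "2 \<le> card {z\<in>Z \<inter> A. on z q}" if "q \<in> GA A" for q using that by (simp add: GA_def good_def)
  qed (use finZ in auto)
  moreover have "(?e - s\<^sup>2 / (2 * \<mu>)) * (s\<^sup>2 / (2 ^ 20 * \<mu> ^ 13)) \<le> ?e ^ 6 / (2 ^ 15 * (s * \<mu>) ^ 8)"
  proof -
    have k: "s\<^sup>2 / (2 ^ 20 * \<mu> ^ 13) = (s\<^sup>2 / (2 * \<mu>)) ^ 5 / (2 ^ 15 * (s * \<mu>) ^ 8)"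
    proof -
      have "(s\<^sup>2 / (2 * \<mu>)) ^ 5 = s ^ 10 / (2 ^ 5 * \<mu> ^ 5)" by (simp add: power_divide power_mult_distrib flip: power_mult)
      moreover have "s ^ 10 = s\<^sup>2 * s ^ 8" "\<mu> ^ 13 = \<mu> ^ 5 * \<mu> ^ 8" by (simp_all flip: power_add)
      moreover have "x / (2 ^ 20 * (b * c)) = (x * a) / (2 ^ 5 * b) / (2 ^ 15 * (a * c))" if "a \<noteq> 0" for x a b c :: real
        using that by simp
      moreover have "s ^ 8 \<noteq> 0" using s_pos by simp
      ultimately show ?thesis by (simp only: power_mult_distrib[of s \<mu>])
    qed
    have "(?e - s\<^sup>2 / (2 * \<mu>)) * (s\<^sup>2 / (2 ^ 20 * \<mu> ^ 13)) \<le> ?e * (s\<^sup>2 / (2 ^ 20 * \<mu> ^ 13))"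
      using s_pos by (intro mult_right_mono) auto
    also have "\<dots> = ?e * ((s\<^sup>2 / (2 * \<mu>)) ^ 5 / (2 ^ 15 * (s * \<mu>) ^ 8))" by (simp only: k)
    also have "\<dots> \<le> ?e * (?e ^ 5 / (2 ^ 15 * (s * \<mu>) ^ 8))"
      using True s_pos by (intro mult_left_mono divide_right_mono power_mono) auto
    also have "\<dots> = ?e ^ 6 / (2 ^ 15 * (s * \<mu>) ^ 8)" by (simp add: eval_nat_numeral)
    finally show ?thesis .
  qed
  ultimately show ?thesis unfolding M by linarith
qed

text \<open>Pairs of a line and a cell with fewer than \<open>c0\<close> crossings contribute at
  most s^4 \<mu> \<open>c0\<close> = s^6 / (2 \<mu>^20) crossings, half of the lower bound for all
  crossings.\<close>

definition c0 :: real where "c0 = s\<^sup>2 / (2 * \<mu> ^ 21)"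

text \<open>The candidates for an organizing point seen from q: lines crossing q in A for which A is
  rich. The two points are later chosen as two such candidates of many common q.\<close>

definition src :: "real \<times> real \<Rightarrow> (real \<times> real) set \<Rightarrow> (real \<times> real) set" where
  "src q A = {p. meets A p q \<and> c0 \<le> real (cr p A)}"

lemma src_sub: "src q A \<subseteq> GA A"
  unfolding src_def meets_def GA_def by blast

lemma finite_src [simp]: "finite (src q A)"
  using src_sub finite_GA by (rule finite_subset)

lemma src_empty: "\<not> good q A \<Longrightarrow> src q A = {}"
  unfolding src_def meets_def by blast

lemma card_src: "A \<in> CC \<Longrightarrow> real (card (src q A)) \<le> (s * \<mu>)\<^sup>2"
  using card_GA[of A] card_mono[OF finite_GA src_sub, of q A] by linarith

lemma sum_src:
  assumes many: "s ^ 4 / \<mu> \<le> (\<Sum>A\<in>CC. real (card (GA A)))"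
  shows "s ^ 6 / (2 * \<mu> ^ 20) \<le> (\<Sum>q\<in>Q. \<Sum>A\<in>CC. real (card (src q A)))"
proof -
  have "(\<Sum>q\<in>Q. \<Sum>A\<in>CC. real (card (src q A))) = (\<Sum>A\<in>CC. \<Sum>q\<in>Q. real (card (src q A)))" by (rule sum.swap)
  also have "\<dots> = (\<Sum>A\<in>CC. \<Sum>p\<in>{p\<in>GA A. c0 \<le> real (cr p A)}. real (cr p A))"
  proof (rule sum.cong[OF refl])
    fix A
    let ?G = "{p\<in>GA A. c0 \<le> real (cr p A)}"
    have fG: "finite ?G" by simp
    have 1: "src q A = {p\<in>?G. meets A p q}" for q unfolding src_def meets_def GA_def by blast
    have 2: "{q. meets A p q} = {q\<in>Q. meets A p q}" for p using goodD(1) unfolding meets_def by blast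
    have "(\<Sum>q\<in>Q. card {p\<in>?G. meets A p q}) = (\<Sum>p\<in>?G. card {q\<in>Q. meets A p q})"
      by (rule double_count[OF finQ fG])
    then have "(\<Sum>q\<in>Q. card (src q A)) = (\<Sum>p\<in>?G. cr p A)" unfolding 1 cr_def 2[symmetric] .
    then show "(\<Sum>q\<in>Q. real (card (src q A))) = (\<Sum>p\<in>?G. real (cr p A))" by (simp flip: of_nat_sum)
  qed
  also have "\<dots> \<ge> (\<Sum>A\<in>CC. (\<Sum>p\<in>GA A. real (cr p A)) - real (card (GA A)) * c0)"
  proof (rule sum_mono)
    fix A
    have c0p: "c0 \<ge> 0" unfolding c0_def using s_pos by simp
    have "(\<Sum>p\<in>GA A. real (cr p A)) \<le> (\<Sum>p\<in>GA A. (if c0 \<le> real (cr p A) then real (cr p A) else 0) + c0)"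
      using c0p by (intro sum_mono) auto
    also have "\<dots> = (\<Sum>p\<in>{p\<in>GA A. c0 \<le> real (cr p A)}. real (cr p A)) + real (card (GA A)) * c0"
      by (simp add: sum.distrib sum.inter_filter)
    finally show "(\<Sum>p\<in>GA A. real (cr p A)) - real (card (GA A)) * c0 \<le> (\<Sum>p\<in>{p\<in>GA A. c0 \<le> real (cr p A)}. real (cr p A))" by linarith
  qed
  moreover have "s ^ 6 / (2 * \<mu> ^ 20) \<le> (\<Sum>A\<in>CC. (\<Sum>p\<in>GA A. real (cr p A)) - real (card (GA A)) * c0)"
  proof -
    let ?k = "s\<^sup>2 / (2 ^ 20 * \<mu> ^ 13)"
    have k0: "?k \<ge> 0" using s_pos by simp
    have "s ^ 6 / \<mu> ^ 20 \<le> s ^ 6 / (2 ^ 21 * \<mu> ^ 14)"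
    proof -
      have "(2::real) ^ 21 \<le> 1000 ^ 6" by simp
      also have "\<dots> \<le> \<mu> ^ 6" using \<mu>1000 by (intro power_mono) auto
      finally have "2 ^ 21 * \<mu> ^ 14 \<le> \<mu> ^ 6 * \<mu> ^ 14" using s_pos by (intro mult_right_mono) auto
      then have "2 ^ 21 * \<mu> ^ 14 \<le> \<mu> ^ 20" by (simp flip: power_add)
      then show ?thesis using s_pos by (intro divide_left_mono) auto
    qed
    also have "\<dots> = (s ^ 4 / \<mu> - s\<^sup>2 * (s\<^sup>2 / (2 * \<mu>))) * ?k"
      using s_pos by (simp add: field_simps eval_nat_numeral)
    also have "\<dots> \<le> ((\<Sum>A\<in>CC. real (card (GA A))) - real (card CC) * (s\<^sup>2 / (2 * \<mu>))) * ?k"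
      using many cardC s_pos k0 by (intro mult_right_mono diff_mono) auto
    also have "\<dots> = (\<Sum>A\<in>CC. (real (card (GA A)) - s\<^sup>2 / (2 * \<mu>)) * ?k)"
      by (simp only: sum_distrib_right[symmetric] sum_subtractf sum_constant)
    also have "\<dots> \<le> (\<Sum>A\<in>CC. \<Sum>p\<in>GA A. real (cr p A))" by (intro sum_mono cell_crossings)
    finally have a: "s ^ 6 / \<mu> ^ 20 \<le> (\<Sum>A\<in>CC. \<Sum>p\<in>GA A. real (cr p A))" .
    have "(\<Sum>A\<in>CC. real (card (GA A)) * c0) = (\<Sum>A\<in>CC. real (card (GA A))) * c0" by (simp only: sum_distrib_right)
    also have "\<dots> \<le> s ^ 4 * \<mu> * c0" using sum_card_GA s_pos by (intro mult_right_mono) (auto simp: c0_def)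
    also have "\<dots> = s ^ 6 / (2 * \<mu> ^ 20)"
    proof -
      have "\<mu> ^ 21 = \<mu> * \<mu> ^ 20" "s ^ 6 = s ^ 4 * s\<^sup>2" by (simp_all flip: power_Suc power_add)
      then show ?thesis unfolding c0_def using s_pos by simp
    qed
    finally have b: "(\<Sum>A\<in>CC. real (card (GA A)) * c0) \<le> s ^ 6 / (2 * \<mu> ^ 20)" .
    have "s ^ 6 / \<mu> ^ 20 = s ^ 6 / (2 * \<mu> ^ 20) + s ^ 6 / (2 * \<mu> ^ 20)" by simp
    then show ?thesis using a b unfolding sum_subtractf by linarith
  qed
  ultimately show ?thesis by linarith
qed

end

section \<open>Choosing the two organizing points\<close>

context cells
begin

definition T0 :: nat where "T0 = nat \<lceil>\<mu> ^ 425\<rceil>"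

lemma T0_bounds: "\<mu> ^ 425 \<le> real T0" "real T0 \<le> \<mu> ^ 426"
proof -
  have p: "1 \<le> \<mu> ^ 425" using s_pos by simp
  show "\<mu> ^ 425 \<le> real T0" unfolding T0_def using p by linarith
  have "real T0 \<le> \<mu> ^ 425 + 1" unfolding T0_def using p by linarith
  also have "\<dots> \<le> 2 * \<mu> ^ 425" using p by simp
  also have "\<dots> \<le> \<mu> * \<mu> ^ 425" using \<mu>1000 p by (intro mult_right_mono) auto
  also have "\<dots> = \<mu> ^ 426" by (simp flip: power_Suc)
  finally show "real T0 \<le> \<mu> ^ 426" .
qed

lemma star_mixing_T0: "(\<Sum>A\<in>CC. \<Sum>q\<in>GA A. real (card {z\<in>Z. on z q \<and> T0 < t z A})) \<le> s ^ 5 / \<mu> ^ 50"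
proof (rule star_mixing)
  show "1 \<le> \<mu> ^ 50" using s_pos by simp
  have "(\<mu> ^ 50) ^ 8 * \<mu> ^ 25 = \<mu> ^ 425" by (simp flip: power_mult power_add)
  then show "(\<mu> ^ 50) ^ 8 * \<mu> ^ 25 \<le> real T0" using T0_bounds by simp
  have e: "(\<mu> ^ 50)\<^sup>2 * \<mu> ^ 4 = \<mu> ^ 104" by (simp flip: power_mult power_add)
  have "3 * \<mu> * \<mu> ^ 104 < \<mu> * \<mu> * \<mu> ^ 104" using \<mu>1000 s_pos by (intro mult_strict_right_mono) auto
  also have "\<dots> = \<mu> ^ 106" by (simp add: mult.assoc flip: power_Suc)
  also have "\<dots> \<le> s" by (rule s_ge) simp
  finally show "3 * \<mu> < s / ((\<mu> ^ 50)\<^sup>2 * \<mu> ^ 4)" unfolding e using s_pos by (simp add: pos_less_divide_eq)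
qed

abbreviation "a \<equiv> \<lambda>q A. real (card (src q A))"

definition V2 :: real where "V2 = (s * \<mu>)\<^sup>2"

lemma V2_nonneg: "V2 \<ge> 0" by (simp add: V2_def)

lemma a_le: "A \<in> CC \<Longrightarrow> a q A \<le> V2" unfolding V2_def by (rule card_src)

lemma sum_restrict_good:
  fixes f :: "(real \<times> real) set \<Rightarrow> real"
  assumes "\<And>A. \<not> good q A \<Longrightarrow> f A = 0"
  shows "(\<Sum>A\<in>{A\<in>CC. P A}. f A) = (\<Sum>A\<in>{A\<in>CC. good q A \<and> P A}. f A)"
proof (rule sum.mono_neutral_right)
  show "\<forall>A\<in>{A\<in>CC. P A} - {A\<in>CC. good q A \<and> P A}. f A = 0"
  proof
    fix A assume "A \<in> {A\<in>CC. P A} - {A\<in>CC. good q A \<and> P A}"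
    then have "\<not> good q A" by blast
    then show "f A = 0" by (rule assms)
  qed
qed (use finC in auto)

lemma sum_a_le:
  assumes "q \<in> Q"
  shows "(\<Sum>A\<in>CC. a q A) \<le> s * \<mu> * V2"
proof -
  have "(\<Sum>A\<in>CC. a q A) = (\<Sum>A\<in>{A\<in>CC. good q A}. a q A)"
    using sum_restrict_good[of q "a q" "\<lambda>_. True"] by (simp add: src_empty)
  also have "\<dots> \<le> (\<Sum>A\<in>{A\<in>CC. good q A}. V2)" by (intro sum_mono a_le) simp
  also have "\<dots> = real (card {A\<in>CC. good q A}) * V2" by simp
  also have "\<dots> \<le> s * \<mu> * V2" using card_cells_of_line[OF assms] V2_nonneg by (intro mult_right_mono) auto
  finally show ?thesis .
qed

lemma sum_lines_cells_swap:
  fixes f :: "(real \<times> real) \<Rightarrow> (real \<times> real) set \<Rightarrow> real"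
  shows "(\<Sum>A\<in>CC. \<Sum>q\<in>GA A. f q A) = (\<Sum>q\<in>Q. \<Sum>A\<in>{A\<in>CC. good q A}. f q A)"
proof -
  have "(\<Sum>A\<in>CC. \<Sum>q\<in>GA A. f q A) = (\<Sum>A\<in>CC. \<Sum>q\<in>Q. if good q A then f q A else 0)"
  proof (rule sum.cong[OF refl])
    fix A
    have "GA A = {q\<in>Q. good q A}" using goodD(1) unfolding GA_def by blast
    then show "(\<Sum>q\<in>GA A. f q A) = (\<Sum>q\<in>Q. if good q A then f q A else 0)"
      using finQ by (simp add: sum.inter_filter)
  qed
  also have "\<dots> = (\<Sum>q\<in>Q. \<Sum>A\<in>CC. if good q A then f q A else 0)" by (rule sum.swap)
  also have "\<dots> = (\<Sum>q\<in>Q. \<Sum>A\<in>{A\<in>CC. good q A}. f q A)"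
    using finC by (simp add: sum.inter_filter)
  finally show ?thesis .
qed

text \<open>Each cell for which q is not nice accounts for s / (2 \<mu>) points of q heavy towards
  it, so mixing bounds the number of such cells. The remaining factors are estimated
  trivially.\<close>

lemma nonnice_sum:
  "(\<Sum>q\<in>Q. \<Sum>A1\<in>{A\<in>CC. \<not> nice T0 q A}. \<Sum>A2\<in>CC. a q A1 * a q A2) \<le> 2 * s ^ 9 * \<mu> ^ 6 / \<mu> ^ 50"
proof -
  let ?N = "\<lambda>q. {A\<in>CC. good q A \<and> \<not> nice T0 q A}"
  let ?h = "\<lambda>q A. real (card {z\<in>Z. on z q \<and> T0 < t z A})"
  let ?W = "V2 * (s * \<mu> * V2)"
  have W: "?W \<ge> 0" using V2_nonneg s_pos by simp
  have "(\<Sum>q\<in>Q. \<Sum>A1\<in>{A\<in>CC. \<not> nice T0 q A}. \<Sum>A2\<in>CC. a q A1 * a q A2) \<le> (\<Sum>q\<in>Q. \<Sum>A1\<in>{A\<in>CC. good q A}. ?h q A1 * (2 * \<mu> / s) * ?W)"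
  proof (rule sum_mono)
    fix q assume q: "q \<in> Q"
    have "(\<Sum>A1\<in>{A\<in>CC. \<not> nice T0 q A}. \<Sum>A2\<in>CC. a q A1 * a q A2) = (\<Sum>A1\<in>?N q. \<Sum>A2\<in>CC. a q A1 * a q A2)"
      by (rule sum_restrict_good) (simp add: src_empty)
    also have "\<dots> = (\<Sum>A1\<in>?N q. a q A1 * (\<Sum>A2\<in>CC. a q A2))" by (simp only: sum_distrib_left)
    also have "\<dots> \<le> (\<Sum>A1\<in>?N q. ?W)"
      using sum_a_le[OF q] a_le V2_nonneg by (intro sum_mono mult_mono) (auto intro: sum_nonneg)
    also have "\<dots> \<le> (\<Sum>A1\<in>?N q. ?h q A1 * (2 * \<mu> / s) * ?W)"
    proof (rule sum_mono)
      fix A assume "A \<in> ?N q"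
      then have "s / (2 * \<mu>) \<le> ?h q A" using nonnice_count[OF q] by simp
      then have "s / (2 * \<mu>) * (2 * \<mu> / s) \<le> ?h q A * (2 * \<mu> / s)" using s_pos by (intro mult_right_mono) auto
      then have "1 \<le> ?h q A * (2 * \<mu> / s)" using s_pos by simp
      then have "1 * ?W \<le> ?h q A * (2 * \<mu> / s) * ?W" using W by (intro mult_right_mono)
      then show "?W \<le> ?h q A * (2 * \<mu> / s) * ?W" by simp
    qed
    also have "\<dots> \<le> (\<Sum>A1\<in>{A\<in>CC. good q A}. ?h q A1 * (2 * \<mu> / s) * ?W)"
      using finC W s_pos by (intro sum_mono2) auto
    finally show "(\<Sum>A1\<in>{A\<in>CC. \<not> nice T0 q A}. \<Sum>A2\<in>CC. a q A1 * a q A2) \<le> (\<Sum>A1\<in>{A\<in>CC. good q A}. ?h q A1 * (2 * \<mu> / s) * ?W)" .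
  qed
  also have "\<dots> = (\<Sum>q\<in>Q. \<Sum>A1\<in>{A\<in>CC. good q A}. ?h q A1) * ((2 * \<mu> / s) * ?W)"
    by (simp only: sum_distrib_right mult.assoc)
  also have "\<dots> = (\<Sum>A\<in>CC. \<Sum>q\<in>GA A. ?h q A) * ((2 * \<mu> / s) * ?W)"
    by (simp only: sum_lines_cells_swap)
  also have "\<dots> \<le> s ^ 5 / \<mu> ^ 50 * ((2 * \<mu> / s) * ?W)"
    using star_mixing_T0 W s_pos by (intro mult_right_mono) auto
  also have "\<dots> = 2 * s ^ 9 * \<mu> ^ 6 / \<mu> ^ 50"
  proof -
    have "(2 * \<mu> / s) * ?W = 2 * (\<mu>\<^sup>2 * (V2 * V2))" using s_pos by (simp add: power2_eq_square)
    moreover have "s ^ 5 * (2 * (\<mu>\<^sup>2 * (V2 * V2))) = 2 * s ^ 9 * \<mu> ^ 6" by (simp add: V2_def eval_nat_numeral)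
    ultimately have "s ^ 5 * ((2 * \<mu> / s) * ?W) = 2 * s ^ 9 * \<mu> ^ 6" by (simp only:)
    then show ?thesis by simp
  qed
  finally show ?thesis .
qed

text \<open>For fixed \<open>A2\<close> each cell where lightness fails costs one point of q heavy
  towards \<open>A2\<close>. Hence \<open>A2\<close> is summed outermost, and mixing applies to
  it.\<close>

lemma nonlight_sum:
  "(\<Sum>q\<in>Q. \<Sum>A2\<in>CC. \<Sum>A1\<in>{A\<in>CC. \<not> light T0 q A A2}. a q A1 * a q A2) \<le> s ^ 9 * \<mu> ^ 4 / \<mu> ^ 50"
proof -
  let ?h = "\<lambda>q A. real (card {z\<in>Z. on z q \<and> T0 < t z A})"
  have VV: "V2 * V2 \<ge> 0" using V2_nonneg by simp
  have "(\<Sum>q\<in>Q. \<Sum>A2\<in>CC. \<Sum>A1\<in>{A\<in>CC. \<not> light T0 q A A2}. a q A1 * a q A2) \<le> (\<Sum>q\<in>Q. \<Sum>A2\<in>{A\<in>CC. good q A}. ?h q A2 * (V2 * V2))"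
  proof (rule sum_mono)
    fix q assume q: "q \<in> Q"
    have "(\<Sum>A2\<in>CC. \<Sum>A1\<in>{A\<in>CC. \<not> light T0 q A A2}. a q A1 * a q A2) = (\<Sum>A2\<in>{A\<in>CC. good q A}. \<Sum>A1\<in>{A\<in>CC. \<not> light T0 q A A2}. a q A1 * a q A2)"
      using sum_restrict_good[of q "\<lambda>A2. \<Sum>A1\<in>{A\<in>CC. \<not> light T0 q A A2}. a q A1 * a q A2" "\<lambda>_. True"] by (simp add: src_empty)
    also have "\<dots> \<le> (\<Sum>A2\<in>{A\<in>CC. good q A}. ?h q A2 * (V2 * V2))"
    proof (rule sum_mono)
      fix A2 assume A2: "A2 \<in> {A\<in>CC. good q A}"
      let ?S = "{A\<in>CC. good q A \<and> \<not> light T0 q A A2}"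
      have "(\<Sum>A1\<in>{A\<in>CC. \<not> light T0 q A A2}. a q A1 * a q A2) = (\<Sum>A1\<in>?S. a q A1 * a q A2)"
          by (rule sum_restrict_good) (simp add: src_empty)
      also have "\<dots> \<le> (\<Sum>A1\<in>?S. V2 * V2)"
        using a_le A2 V2_nonneg by (intro sum_mono mult_mono) auto
      also have "\<dots> = real (card ?S) * (V2 * V2)" by simp
      also have "\<dots> \<le> ?h q A2 * (V2 * V2)" using nonlight_count[OF q] VV by (intro mult_right_mono) auto
      finally show "(\<Sum>A1\<in>{A\<in>CC. \<not> light T0 q A A2}. a q A1 * a q A2) \<le> ?h q A2 * (V2 * V2)" .
    qed
    finally show "(\<Sum>A2\<in>CC. \<Sum>A1\<in>{A\<in>CC. \<not> light T0 q A A2}. a q A1 * a q A2) \<le> (\<Sum>A2\<in>{A\<in>CC. good q A}. ?h q A2 * (V2 * V2))" .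
  qed
  also have "\<dots> = (\<Sum>q\<in>Q. \<Sum>A1\<in>{A\<in>CC. good q A}. ?h q A1) * (V2 * V2)"
    by (simp only: sum_distrib_right)
  also have "\<dots> = (\<Sum>A\<in>CC. \<Sum>q\<in>GA A. ?h q A) * (V2 * V2)"
    by (simp only: sum_lines_cells_swap)
  also have "\<dots> \<le> s ^ 5 / \<mu> ^ 50 * (V2 * V2)"
    using star_mixing_T0 VV by (intro mult_right_mono) auto
  also have "\<dots> = s ^ 9 * \<mu> ^ 4 / \<mu> ^ 50"
  proof -
    have "s ^ 5 * (V2 * V2) = s ^ 9 * \<mu> ^ 4" by (simp add: V2_def eval_nat_numeral)
    then show ?thesis by simp
  qed
  finally show ?thesis .
qed

text \<open>Cauchy-Schwarz over the lines q gives s^9 / (4 \<mu>^40) for the unrestricted sum; the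
  pairs that fail niceness or lightness take away at most half of it.\<close>

lemma selected_sum:
  assumes many: "s ^ 4 / \<mu> \<le> (\<Sum>A\<in>CC. real (card (GA A)))"
  shows "s ^ 9 / (8 * \<mu> ^ 40) \<le> (\<Sum>q\<in>Q. \<Sum>A1\<in>{A\<in>CC. nice T0 q A}. \<Sum>A2\<in>{A\<in>CC. light T0 q A1 A}. a q A1 * a q A2)"
proof -
  let ?w = "\<lambda>q. \<Sum>A\<in>CC. a q A"
  let ?S = "\<lambda>q. \<Sum>A1\<in>{A\<in>CC. nice T0 q A}. \<Sum>A2\<in>{A\<in>CC. light T0 q A1 A}. a q A1 * a q A2"
  let ?N = "\<lambda>q. \<Sum>A1\<in>{A\<in>CC. \<not> nice T0 q A}. \<Sum>A2\<in>CC. a q A1 * a q A2"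
  let ?L = "\<lambda>q. \<Sum>A2\<in>CC. \<Sum>A1\<in>{A\<in>CC. \<not> light T0 q A A2}. a q A1 * a q A2"
  have w: "s ^ 6 / (2 * \<mu> ^ 20) \<le> (\<Sum>q\<in>Q. ?w q)" using sum_src[OF many] .
  have "(s ^ 6 / (2 * \<mu> ^ 20))\<^sup>2 \<le> (\<Sum>q\<in>Q. 1 * ?w q)\<^sup>2" using w s_pos by (intro power_mono) auto
  also have "\<dots> \<le> (\<Sum>q\<in>Q. 1\<^sup>2) * (\<Sum>q\<in>Q. (?w q)\<^sup>2)" by (rule Cauchy_Schwarz_ineq_sum)
  also have "\<dots> = real (card Q) * (\<Sum>q\<in>Q. (?w q)\<^sup>2)" by simp
  also have "\<dots> \<le> s ^ 3 * (\<Sum>q\<in>Q. (?w q)\<^sup>2)" using cardQ by (intro mult_right_mono) (auto intro: sum_nonneg)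
  finally have "(s ^ 6 / (2 * \<mu> ^ 20))\<^sup>2 \<le> s ^ 3 * (\<Sum>q\<in>Q. (?w q)\<^sup>2)" .
  moreover have "(s ^ 6 / (2 * \<mu> ^ 20))\<^sup>2 = s ^ 3 * (s ^ 9 / (4 * \<mu> ^ 40))"
    by (simp add: power_divide power_mult_distrib flip: power_mult power_add)
  ultimately have "s ^ 3 * (s ^ 9 / (4 * \<mu> ^ 40)) \<le> s ^ 3 * (\<Sum>q\<in>Q. (?w q)\<^sup>2)" by (simp only:)
  then have sq: "s ^ 9 / (4 * \<mu> ^ 40) \<le> (\<Sum>q\<in>Q. (?w q)\<^sup>2)"
    using s_pos(1) by (simp only: mult_le_cancel_left_pos zero_less_power)
  have "(\<Sum>q\<in>Q. (?w q)\<^sup>2) \<le> (\<Sum>q\<in>Q. ?S q + ?N q + ?L q)"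
  proof (rule sum_mono)
    fix q
    have S: "?S q = (\<Sum>A1\<in>CC. \<Sum>A2\<in>CC. if nice T0 q A1 then if light T0 q A1 A2 then a q A1 * a q A2 else 0 else 0)"
    proof -
      have "?S q = (\<Sum>A1\<in>CC. if nice T0 q A1 then \<Sum>A2\<in>CC. if light T0 q A1 A2 then a q A1 * a q A2 else 0 else 0)"
        using finC by (simp add: sum.inter_filter)
      also have "\<dots> = (\<Sum>A1\<in>CC. \<Sum>A2\<in>CC. if nice T0 q A1 then if light T0 q A1 A2 then a q A1 * a q A2 else 0 else 0)"
        by (intro sum.cong refl) simp
      finally show ?thesis .
    qed
    have N: "?N q = (\<Sum>A1\<in>CC. \<Sum>A2\<in>CC. if \<not> nice T0 q A1 then a q A1 * a q A2 else 0)"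
    proof -
      have "?N q = (\<Sum>A1\<in>CC. if \<not> nice T0 q A1 then \<Sum>A2\<in>CC. a q A1 * a q A2 else 0)"
        using finC by (rule sum.inter_filter)
      also have "\<dots> = (\<Sum>A1\<in>CC. \<Sum>A2\<in>CC. if \<not> nice T0 q A1 then a q A1 * a q A2 else 0)"
        by (intro sum.cong refl) simp
      finally show ?thesis .
    qed
    have L: "?L q = (\<Sum>A1\<in>CC. \<Sum>A2\<in>CC. if \<not> light T0 q A1 A2 then a q A1 * a q A2 else 0)"
      unfolding sum.inter_filter[OF finC] by (rule sum.swap)
    have "(?w q)\<^sup>2 = (\<Sum>A1\<in>CC. \<Sum>A2\<in>CC. a q A1 * a q A2)" by (simp only: power2_eq_square sum_product)
    also have "\<dots> \<le> (\<Sum>A1\<in>CC. \<Sum>A2\<in>CC. (if nice T0 q A1 then if light T0 q A1 A2 then a q A1 * a q A2 else 0 else 0)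
       + (if \<not> nice T0 q A1 then a q A1 * a q A2 else 0) + (if \<not> light T0 q A1 A2 then a q A1 * a q A2 else 0))"
      by (intro sum_mono) auto
    also have "\<dots> = ?S q + ?N q + ?L q" unfolding S N L by (simp only: sum.distrib)
    finally show "(?w q)\<^sup>2 \<le> ?S q + ?N q + ?L q" .
  qed
  also have "\<dots> = (\<Sum>q\<in>Q. ?S q) + (\<Sum>q\<in>Q. ?N q) + (\<Sum>q\<in>Q. ?L q)" by (simp only: sum.distrib)
  finally have "s ^ 9 / (4 * \<mu> ^ 40) \<le> (\<Sum>q\<in>Q. ?S q) + 2 * s ^ 9 * \<mu> ^ 6 / \<mu> ^ 50 + s ^ 9 * \<mu> ^ 4 / \<mu> ^ 50"
    using sq nonnice_sum nonlight_sum by linarith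
  moreover have "2 * s ^ 9 * \<mu> ^ 6 / \<mu> ^ 50 + s ^ 9 * \<mu> ^ 4 / \<mu> ^ 50 \<le> s ^ 9 / (8 * \<mu> ^ 40)"
  proof -
    have "s ^ 9 * \<mu> ^ 4 / \<mu> ^ 50 \<le> s ^ 9 * \<mu> ^ 6 / \<mu> ^ 50"
      using s_pos by (intro divide_right_mono mult_left_mono \<mu>_power) auto
    moreover have "s ^ 9 * \<mu> ^ 6 / \<mu> ^ 50 \<le> s ^ 9 / (24 * \<mu> ^ 40)"
    proof -
      have "24 * \<mu> ^ 46 \<le> \<mu> * \<mu> ^ 46" using \<mu>1000 s_pos by (intro mult_right_mono) auto
      also have "\<dots> = \<mu> ^ 47" by (simp flip: power_Suc)
      also have "\<dots> \<le> \<mu> ^ 50" by (intro \<mu>_power) simp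
      finally have "24 * (\<mu> ^ 6 * \<mu> ^ 40) \<le> \<mu> ^ 50" by (simp flip: power_add)
      then have "s ^ 9 * (24 * (\<mu> ^ 6 * \<mu> ^ 40)) \<le> s ^ 9 * \<mu> ^ 50" using s_pos by (intro mult_left_mono) auto
      then show ?thesis using s_pos by (simp only: frac_le_eq divide_le_eq le_divide_eq) (simp add: field_simps)
    qed
    moreover have "s ^ 9 / (8 * \<mu> ^ 40) = 3 * (s ^ 9 / (24 * \<mu> ^ 40))" by simp
    moreover have "2 * s ^ 9 * \<mu> ^ 6 / \<mu> ^ 50 = 2 * (s ^ 9 * \<mu> ^ 6 / \<mu> ^ 50)" by simp
    ultimately show ?thesis by linarith
  qed
  moreover have "s ^ 9 / (4 * \<mu> ^ 40) = s ^ 9 / (8 * \<mu> ^ 40) + s ^ 9 / (8 * \<mu> ^ 40)" by simp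
  ultimately show ?thesis by linarith
qed

definition sel :: "real \<times> real \<Rightarrow> real \<times> real \<Rightarrow> (real \<times> real) set" where
  "sel p1 p2 = {q\<in>Q. \<exists>A1 A2. meets A1 p1 q \<and> c0 \<le> real (cr p1 A1) \<and> meets A2 p2 q \<and> c0 \<le> real (cr p2 A2)
     \<and> light T0 q A1 A2 \<and> nice T0 q A1}"

text \<open>The selected tuples are averaged over the ordered pairs of lines. The cells of a tuple
  are determined by its crossings, so each q is counted once for a given pair; equal pairs
  contribute only s^6, which is negligible against s^9 / \<mu>^40.\<close>

lemma selected_pair:
  assumes many: "s ^ 4 / \<mu> \<le> (\<Sum>A\<in>CC. real (card (GA A)))"
  shows "\<exists>p1\<in>Q. \<exists>p2\<in>Q. p1 \<noteq> p2 \<and> s ^ 3 / \<mu> ^ 41 \<le> real (card (sel p1 p2))"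
proof (rule ccontr)
  assume neg: "\<not> ?thesis"
  let ?C1 = "\<lambda>q. {A\<in>CC. nice T0 q A}" and ?C2 = "\<lambda>q A1. {A\<in>CC. light T0 q A1 A}"
  define W where "W = (SIGMA q:Q. SIGMA A1:?C1 q. SIGMA A2:?C2 q A1. src q A1 \<times> src q A2)"
  have "real (card W) = (\<Sum>q\<in>Q. \<Sum>A1\<in>?C1 q. \<Sum>A2\<in>?C2 q A1. a q A1 * a q A2)"
    unfolding W_def using finQ finC by (simp add: card_cartesian_product)
  then have W: "s ^ 9 / (8 * \<mu> ^ 40) \<le> real (card W)" using selected_sum[OF many] by simp
  define f where "f = (\<lambda>(q, A1 :: (real \<times> real) set, A2 :: (real \<times> real) set, p1 :: real \<times> real, p2 :: real \<times> real). ((p1, p2), q :: real \<times> real))"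
  let ?I = "SIGMA pp:Q \<times> Q. sel (fst pp) (snd pp)"
  have fsel: "finite (sel p1 p2)" for p1 p2 unfolding sel_def using finQ by simp
  have WD: "q \<in> Q \<and> nice T0 q A1 \<and> light T0 q A1 A2 \<and> meets A1 p1 q \<and> c0 \<le> real (cr p1 A1) \<and> meets A2 p2 q \<and> c0 \<le> real (cr p2 A2)"
    if "(q, A1, A2, p1, p2) \<in> W" for q A1 A2 p1 p2
    using that by (simp add: W_def src_def)
  have "card W \<le> card ?I"
  proof (rule card_inj_on_le[of f])
    show "inj_on f W"
    proof (rule inj_onI)
      fix x y assume x: "x \<in> W" and y: "y \<in> W" and e: "f x = f y"
      obtain q A1 A2 p1 p2 where xe: "x = (q, A1, A2, p1, p2)" by (metis prod_cases5)
      obtain q' A1' A2' p1' p2' where ye: "y = (q', A1', A2', p1', p2')" by (metis prod_cases5)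
      have qe: "q' = q" "p1' = p1" "p2' = p2" using e by (simp_all add: f_def xe ye)
      have "meets A1 p1 q" "meets A2 p2 q" using WD[OF x[unfolded xe]] by blast+
      moreover have "meets A1' p1 q" "meets A2' p2 q" using WD[OF y[unfolded ye]] unfolding qe by blast+
      ultimately have "A1' = A1" "A2' = A2" using meets_unique_cell by blast+
      then show "x = y" using qe xe ye by simp
    qed
    show "f ` W \<subseteq> ?I"
    proof (rule image_subsetI)
      fix x assume x: "x \<in> W"
      obtain q A1 A2 p1 p2 where xe: "x = (q, A1, A2, p1, p2)" by (metis prod_cases5)
      note d = WD[OF x[unfolded xe]]
      have "q \<in> sel p1 p2" unfolding sel_def using d by blast
      moreover have "p1 \<in> Q" "p2 \<in> Q" using d goodD(1) unfolding meets_def by blast+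
      ultimately show "f x \<in> ?I" by (simp add: f_def xe)
    qed
    show "finite ?I" using finQ fsel by (intro finite_SigmaI) auto
  qed
  also have "card ?I = (\<Sum>pp\<in>Q \<times> Q. card (sel (fst pp) (snd pp)))" using finQ fsel by simp
  finally have "real (card W) \<le> real (\<Sum>pp\<in>Q \<times> Q. card (sel (fst pp) (snd pp)))" by (simp only: of_nat_le_iff)
  also have "\<dots> = (\<Sum>pp\<in>Q \<times> Q. real (card (sel (fst pp) (snd pp))))" by simp
  also have "\<dots> \<le> (\<Sum>pp\<in>Q \<times> Q. s ^ 3 / \<mu> ^ 41 + (if fst pp = snd pp then s ^ 3 else 0))"
  proof (rule sum_mono)
    fix pp assume pp: "pp \<in> Q \<times> Q"
    show "real (card (sel (fst pp) (snd pp))) \<le> s ^ 3 / \<mu> ^ 41 + (if fst pp = snd pp then s ^ 3 else 0)"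
    proof (cases "fst pp = snd pp")
      case True
      have "card (sel (fst pp) (snd pp)) \<le> card Q" unfolding sel_def using finQ by (intro card_mono) auto
      then have "real (card (sel (fst pp) (snd pp))) \<le> s ^ 3" using cardQ by linarith
      moreover have "0 \<le> s ^ 3 / \<mu> ^ 41" using s_pos by simp
      ultimately show ?thesis using True by simp
    next
      case False
      have "fst pp \<in> Q" "snd pp \<in> Q" using pp by (simp_all add: mem_Times_iff)
      then have "\<not> s ^ 3 / \<mu> ^ 41 \<le> real (card (sel (fst pp) (snd pp)))" using neg False by blast
      then show ?thesis using False by simp
    qed
  qed
  also have "\<dots> = real (card (Q \<times> Q)) * (s ^ 3 / \<mu> ^ 41) + real (card {pp\<in>Q \<times> Q. fst pp = snd pp}) * s ^ 3"
  proof -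
    have "(\<Sum>pp\<in>Q \<times> Q. if fst pp = snd pp then s ^ 3 else 0) = (\<Sum>pp\<in>{pp\<in>Q \<times> Q. fst pp = snd pp}. s ^ 3)"
      using finQ by (simp only: sum.inter_filter finite_cartesian_product)
    then show ?thesis by (simp only: sum.distrib sum_constant)
  qed
  also have "\<dots> \<le> s ^ 6 * (s ^ 3 / \<mu> ^ 41) + s ^ 3 * s ^ 3"
  proof -
    have "card {pp\<in>Q \<times> Q. fst pp = snd pp} \<le> card Q"
    proof (rule card_inj_on_le[of fst])
      show "inj_on fst {pp\<in>Q \<times> Q. fst pp = snd pp}" by (rule inj_onI) (simp add: prod_eq_iff)
      show "fst ` {pp\<in>Q \<times> Q. fst pp = snd pp} \<subseteq> Q" by (rule image_subsetI) (simp add: mem_Times_iff)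
    qed (use finQ in simp)
    then have "real (card {pp\<in>Q \<times> Q. fst pp = snd pp}) \<le> s ^ 3" using cardQ by linarith
    moreover have "real (card (Q \<times> Q)) \<le> s ^ 6"
    proof -
      have "real (card (Q \<times> Q)) = real (card Q) * real (card Q)" by (simp add: card_cartesian_product)
      also have "\<dots> \<le> s ^ 3 * s ^ 3" using cardQ s_pos by (intro mult_mono) auto
      finally show ?thesis by (simp flip: power_add)
    qed
    ultimately show ?thesis using s_pos by (intro add_mono mult_right_mono) auto
  qed
  finally have "s ^ 9 / (8 * \<mu> ^ 40) \<le> s ^ 9 / \<mu> ^ 41 + s ^ 6" using W by (simp flip: power_add)
  moreover have "s ^ 9 / \<mu> ^ 41 \<le> s ^ 9 / (8 * \<mu> ^ 40) / 2"
  proof -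
    have "16 * \<mu> ^ 40 \<le> \<mu> * \<mu> ^ 40" using \<mu>1000 s_pos by (intro mult_right_mono) auto
    then have "16 * \<mu> ^ 40 \<le> \<mu> ^ 41" by (simp flip: power_Suc)
    then have "s ^ 9 / \<mu> ^ 41 \<le> s ^ 9 / (16 * \<mu> ^ 40)" using s_pos by (intro divide_left_mono) auto
    then show ?thesis by simp
  qed
  moreover have "s ^ 6 < s ^ 9 / (8 * \<mu> ^ 40) / 2"
  proof -
    have "16 * \<mu> ^ 40 < \<mu> * \<mu> ^ 40" using \<mu>1000 s_pos by (intro mult_strict_right_mono) auto
    also have "\<dots> = \<mu> ^ 41" by (simp flip: power_Suc)
    also have "\<dots> \<le> s" by (rule s_ge) simp
    also have "s = s ^ 1" by simp
    also have "\<dots> \<le> s ^ 3" using s_pos by (intro power_increasing) auto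
    finally have "s ^ 6 * (16 * \<mu> ^ 40) < s ^ 6 * s ^ 3" using s_pos by (intro mult_strict_left_mono) auto
    also have "s ^ 6 * s ^ 3 = s ^ 9" by (simp flip: power_add)
    finally have "s ^ 6 < s ^ 9 / (16 * \<mu> ^ 40)" using s_pos by (subst pos_less_divide_eq) auto
    then show ?thesis by simp
  qed
  ultimately show False by linarith
qed

end

section \<open>Cells from an extremal configuration\<close>

text \<open>Of the s^4 / \<nu> incidences, points of low degree lose 1/4, lines of low degree 1/8
  and lines of excessive degree 1/4, which leaves 3/8. Excessive lines are few by the bound for rich
  lines, so a second use of the incidence bound makes their incidences small. One round suffices:
  later the degrees of points are needed only in all of \<open>Q\<close>, those of lines only in
  \<open>Z1\<close>.\<close>

lemma degree_refinement:
  fixes s \<nu> :: real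
  assumes Q: "finite Q" "real (card Q) \<le> s ^ 3" and Z: "finite Z" "real (card Z) \<le> s ^ 3"
    and I: "s ^ 4 / \<nu> \<le> real (card (incs Z Q))" and st: "st_const (s ^ 3) \<nu>"
    and \<nu>: "\<nu> \<ge> 1000" and s: "s \<ge> \<nu> ^ 10"
  defines "Z1 \<equiv> {z\<in>Z. s / (4 * \<nu>) \<le> real (card {q\<in>Q. on z q})}"
  defines "Q1 \<equiv> {q\<in>Q. s / (8 * \<nu>) \<le> real (card {z\<in>Z1. on z q}) \<and> real (card {z\<in>Z1. on z q}) \<le> s * \<nu> ^ 3}"
  shows "3 * s ^ 4 / (8 * \<nu>) \<le> real (card (incs Z1 Q1))"
proof -
  have \<nu>0: "\<nu> > 0" "\<nu> \<ge> 1" using \<nu> by auto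
  have p: "\<nu> ^ i \<le> \<nu> ^ j" if "i \<le> j" for i j using that \<nu>0 by (intro power_increasing) auto
  have s\<nu>: "s \<ge> \<nu> ^ i" if "i \<le> 10" for i using s p[OF that] by linarith
  have s1: "s \<ge> 1" using s\<nu>[of 0] by simp
  have s0: "s > 0" using s1 by simp
  have fZ1: "finite Z1" "Z1 \<subseteq> Z" unfolding Z1_def using Z by auto
  have cZ1: "real (card Z1) \<le> s ^ 3" using card_mono[OF Z(1) fZ1(2)] Z(2) by linarith
  have deg_le: "real (card (incs Zp Q)) \<le> real (card Zp) * c" if "finite Zp" "\<And>z. z \<in> Zp \<Longrightarrow> real (card {q\<in>Q. on z q}) \<le> c" for Zp c
  proof -
    have "real (card (incs Zp Q)) = (\<Sum>z\<in>Zp. real (card {q\<in>Q. on z q}))" using card_incs_points[OF that(1) Q(1)] by simp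
    also have "\<dots> \<le> (\<Sum>z\<in>Zp. c)" by (intro sum_mono that(2))
    finally show ?thesis by simp
  qed
  have deg_le': "real (card (incs Z1 Qp)) \<le> real (card Qp) * c" if "finite Qp" "\<And>q. q \<in> Qp \<Longrightarrow> real (card {z\<in>Z1. on z q}) \<le> c" for Qp c
  proof -
    have "real (card (incs Z1 Qp)) = (\<Sum>q\<in>Qp. real (card {z\<in>Z1. on z q}))" using card_incs_lines[OF fZ1(1) that(1)] by simp
    also have "\<dots> \<le> (\<Sum>q\<in>Qp. c)" by (intro sum_mono that(2))
    finally show ?thesis by simp
  qed
  have "real (card (incs (Z - Z1) Q)) \<le> real (card (Z - Z1)) * (s / (4 * \<nu>))"
    using Z(1) by (intro deg_le) (auto simp: Z1_def)
  also have "\<dots> \<le> s ^ 3 * (s / (4 * \<nu>))"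
    using card_mono[OF Z(1), of "Z - Z1"] Z(2) s0 \<nu>0 by (intro mult_right_mono) auto
  also have "\<dots> = s ^ 4 / (4 * \<nu>)" by (simp add: eval_nat_numeral)
  finally have i1: "real (card (incs (Z - Z1) Q)) \<le> s ^ 4 / (4 * \<nu>)" .
  have "incs Z Q = incs (Z - Z1) Q \<union> incs Z1 Q" using fZ1(2) unfolding incs_def by blast
  then have "card (incs Z Q) \<le> card (incs (Z - Z1) Q) + card (incs Z1 Q)" by (simp only: card_Un_le)
  moreover have "s ^ 4 / \<nu> = 4 * (s ^ 4 / (4 * \<nu>))" "3 * s ^ 4 / (4 * \<nu>) = 3 * (s ^ 4 / (4 * \<nu>))" by simp_all
  ultimately have I1: "3 * s ^ 4 / (4 * \<nu>) \<le> real (card (incs Z1 Q))" using I i1 by linarith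
  let ?H = "{q\<in>Q. s * \<nu> ^ 3 < real (card {z\<in>Z1. on z q})}" and ?L = "{q\<in>Q. real (card {z\<in>Z1. on z q}) < s / (8 * \<nu>)}"
  have fH: "finite ?H" "finite ?L" using Q by auto
  have cH: "real (card ?H) \<le> s ^ 3" "real (card ?L) \<le> s ^ 3"
    using card_mono[OF Q(1), of ?H] card_mono[OF Q(1), of ?L] Q(2) by auto
  have "real (card (incs Z1 ?L)) \<le> real (card ?L) * (s / (8 * \<nu>))" using fH by (intro deg_le') auto
  also have "\<dots> \<le> s ^ 3 * (s / (8 * \<nu>))" using cH s0 \<nu>0 by (intro mult_right_mono) auto
  also have "\<dots> = s ^ 4 / (8 * \<nu>)" by (simp add: eval_nat_numeral)
  finally have iL: "real (card (incs Z1 ?L)) \<le> s ^ 4 / (8 * \<nu>)" .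
  have D: "3 * \<nu> < s * \<nu> ^ 3"
  proof -
    have "3 * \<nu> < \<nu> * \<nu>" using \<nu> by (intro mult_strict_right_mono) auto
    also have "\<dots> = \<nu> ^ 2" by (simp add: power2_eq_square)
    also have "\<dots> \<le> \<nu> ^ 3" by (intro p) simp
    also have "\<dots> \<le> s * \<nu> ^ 3" using s1 \<nu>0 by simp
    finally show ?thesis .
  qed
  have "real (card ?H) \<le> 27 * \<nu> ^ 3 * (real (card Z1))\<^sup>2 / (s * \<nu> ^ 3) ^ 3 + 3 * \<nu> * real (card Z1) / (s * \<nu> ^ 3)"
    by (rule rich_lines_bound[OF st fZ1(1) fH(1) cZ1 cH(1) _ D]) auto
  also have "\<dots> \<le> 27 * \<nu> ^ 3 * (s ^ 3)\<^sup>2 / (s * \<nu> ^ 3) ^ 3 + 3 * \<nu> * s ^ 3 / (s * \<nu> ^ 3)"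
    using cZ1 s0 \<nu>0 by (intro add_mono divide_right_mono mult_left_mono power_mono) auto
  also have "\<dots> = 27 * s ^ 3 / \<nu> ^ 6 + 3 * s\<^sup>2 / \<nu>\<^sup>2"
    using s0 \<nu>0 by (simp add: field_simps eval_nat_numeral)
  also have "\<dots> \<le> 28 * s ^ 3 / \<nu> ^ 6"
  proof -
    have "3 * \<nu> ^ 4 \<le> \<nu> * \<nu> ^ 4" using \<nu> by (intro mult_right_mono) auto
    also have "\<dots> = \<nu> ^ 5" by (simp flip: power_Suc)
    also have "\<dots> \<le> s" by (rule s\<nu>) simp
    finally have "s\<^sup>2 * (3 * \<nu> ^ 4) \<le> s\<^sup>2 * s" by (intro mult_left_mono) auto
    then have "3 * s\<^sup>2 / \<nu>\<^sup>2 \<le> s ^ 3 / \<nu> ^ 6" using \<nu>0 by (simp add: field_simps eval_nat_numeral)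
    then show ?thesis by simp
  qed
  finally have h: "real (card ?H) \<le> 28 * s ^ 3 / \<nu> ^ 6" .
  obtain X where X: "X \<ge> 0" "X ^ 3 = (real (card Z1) * real (card ?H))\<^sup>2"
     "real (card (incs Z1 ?H)) \<le> \<nu> * (X + real (card Z1) + real (card ?H))"
    using szemeredi_trotter_const[OF st fZ1(1) fH(1) cZ1 cH(1)] by blast
  have "X ^ 3 \<le> (s ^ 3 * (28 * s ^ 3 / \<nu> ^ 6))\<^sup>2"
    unfolding X(2) using cZ1 h s0 by (intro power_mono mult_mono) auto
  also have "\<dots> = 784 * (s ^ 12 / \<nu> ^ 12)" by (simp add: power_divide power_mult_distrib flip: power_mult power_add)
  \<comment> \<open>784 = 28^2 is rounded up to the cube 10^3 so that a cube root can be
    taken.\<close>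
  also have "\<dots> \<le> 1000 * (s ^ 12 / \<nu> ^ 12)" using s0 \<nu>0 by (intro mult_right_mono) auto
  also have "\<dots> = (10 * s ^ 4 / \<nu> ^ 4) ^ 3" by (simp add: power_divide power_mult_distrib flip: power_mult power_add)
  finally have "X \<le> 10 * s ^ 4 / \<nu> ^ 4" using s0 \<nu>0 power_mono_iff[of X "10 * s ^ 4 / \<nu> ^ 4" 3] X(1) by simp
  then have "real (card (incs Z1 ?H)) \<le> \<nu> * (10 * s ^ 4 / \<nu> ^ 4 + s ^ 3 + s ^ 3)"
    using X(3) cZ1 cH(1) \<nu>0 by (elim order_trans) (intro mult_left_mono add_mono, auto)
  also have "\<dots> \<le> \<nu> * (12 * s ^ 4 / \<nu> ^ 4)"
  proof -
    have "s ^ 3 * \<nu> ^ 4 \<le> s ^ 3 * s" using s\<nu>[of 4] s0 by (intro mult_left_mono) auto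
    then have "s ^ 3 \<le> s ^ 4 / \<nu> ^ 4" using \<nu>0 by (simp add: field_simps eval_nat_numeral)
    then show ?thesis using \<nu>0 by (intro mult_left_mono) auto
  qed
  also have "\<dots> = 12 * s ^ 4 / \<nu> ^ 3" using \<nu>0 by (simp add: eval_nat_numeral)
  also have "\<dots> \<le> s ^ 4 / (4 * \<nu>)"
  proof -
    have "48 * \<nu> \<le> \<nu> * \<nu>" using \<nu> by (intro mult_right_mono) auto
    also have "\<dots> = \<nu> ^ 2" by (simp add: power2_eq_square)
    also have "\<dots> \<le> \<nu> ^ 3" by (intro p) simp
    finally have "s ^ 4 * (48 * \<nu>) \<le> s ^ 4 * \<nu> ^ 3" using s0 by (intro mult_left_mono) auto
    then show ?thesis using \<nu>0 by (simp add: field_simps)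
  qed
  finally have iH: "real (card (incs Z1 ?H)) \<le> s ^ 4 / (4 * \<nu>)" .
  have "incs Z1 Q \<subseteq> (incs Z1 ?L \<union> incs Z1 ?H) \<union> incs Z1 Q1"
    unfolding incs_def Q1_def by (auto simp: not_le)
  then have "card (incs Z1 Q) \<le> card ((incs Z1 ?L \<union> incs Z1 ?H) \<union> incs Z1 Q1)"
    using fZ1 Q(1) by (intro card_mono) (auto simp: Q1_def)
  also have "\<dots> \<le> card (incs Z1 ?L) + card (incs Z1 ?H) + card (incs Z1 Q1)"
    by (intro order_trans[OF card_Un_le] add_mono card_Un_le order_refl)
  finally have "real (card (incs Z1 Q)) \<le> real (card (incs Z1 ?L)) + real (card (incs Z1 ?H)) + real (card (incs Z1 Q1))" by linarith
  then have "3 * s ^ 4 / (4 * \<nu>) \<le> s ^ 4 / (8 * \<nu>) + s ^ 4 / (4 * \<nu>) + real (card (incs Z1 Q1))" using I1 iL iH by linarith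
  moreover have "3 * s ^ 4 / (4 * \<nu>) = 6 * (s ^ 4 / (8 * \<nu>))" "s ^ 4 / (4 * \<nu>) = 2 * (s ^ 4 / (8 * \<nu>))"
    "3 * s ^ 4 / (8 * \<nu>) = 3 * (s ^ 4 / (8 * \<nu>))" by simp_all
  ultimately show ?thesis by linarith
qed

text \<open>Most incidences are shown to belong to a line that is good in the cell of the point. The
  second moment of the number of points per line and cell keeps them from concentrating on few
  pairs, and this yields the number of good pairs.\<close>

lemma extremal_cells:
  fixes s \<nu> :: real
  assumes Q: "finite Q" "real (card Q) \<le> s ^ 3" and Z: "finite Z" "real (card Z) \<le> s ^ 3"
    and I: "s ^ 4 / \<nu> \<le> real (card (incs Z Q))" and st: "st_const (s ^ 3) \<nu>"
    and \<nu>: "\<nu> \<ge> 1000" and s: "s \<ge> (\<nu> ^ 40) ^ 200"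
  shows "\<exists>Q1 Z1 CC. Q1 \<subseteq> Q \<and> Z1 \<subseteq> Z \<and> cells Q1 Z1 CC s (\<nu> ^ 40) \<and>
     s ^ 4 / \<nu> ^ 40 \<le> (\<Sum>A\<in>CC. real (card (cells.GA Q1 Z1 CC A)))"
proof -
  have \<nu>0: "\<nu> > 0" "\<nu> \<ge> 1" using \<nu> by auto
  have p: "\<nu> ^ i \<le> \<nu> ^ j" if "i \<le> j" for i j using that \<nu>0 by (intro power_increasing) auto
  have s\<nu>: "s \<ge> \<nu> ^ i" if "i \<le> 100" for i
  proof -
    have "\<nu> ^ i \<le> \<nu> ^ (40 * 200)" using that by (intro p) simp
    then show ?thesis using s by (simp only: power_mult)
  qed
  have s1: "s \<ge> 1" using s\<nu>[of 0] by simp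
  have s0: "s > 0" using s1 by simp
  define Z1 where "Z1 = {z\<in>Z. s / (4 * \<nu>) \<le> real (card {q\<in>Q. on z q})}"
  define Q1 where "Q1 = {q\<in>Q. s / (8 * \<nu>) \<le> real (card {z\<in>Z1. on z q}) \<and> real (card {z\<in>Z1. on z q}) \<le> s * \<nu> ^ 3}"
  have sub: "Z1 \<subseteq> Z" "Q1 \<subseteq> Q" unfolding Z1_def Q1_def by auto
  have fin: "finite Z1" "finite Q1" using sub Z(1) Q(1) finite_subset by blast+
  have c1: "real (card Z1) \<le> s ^ 3" "real (card Q1) \<le> s ^ 3"
    using card_mono[OF Z(1) sub(1)] card_mono[OF Q(1) sub(2)] Z(2) Q(2) by linarith+
  have I1: "3 * s ^ 4 / (8 * \<nu>) \<le> real (card (incs Z1 Q1))"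
    unfolding Q1_def Z1_def by (rule degree_refinement[OF Q Z I st \<nu>]) (use s\<nu>[of 10] in simp)
  \<comment> \<open>Coarser than the natural size s^2 by \<nu>^5, so that the incidences on sampled
    lines and those of lines with one point in a cell, at most 3 s^4 / \<nu>^4 and 40 s^4 / \<nu>^3,
    are negligible against s^4 / \<nu>. The price is s \<nu>^18 instead of s points in a
    cell.\<close>
  define k where "k = s\<^sup>2 * \<nu> ^ 5"
  have k0: "k > 0" unfolding k_def using s0 \<nu>0 by simp
  obtain R CC where RC: "R \<subseteq> Q" "finite CC"
    "real (card R) \<le> real (card Q) / k * (2 * ln (real (card Q + 2) * real (card Z1 + 1))) + 1"
    "card CC \<le> 2 * ((card R + 2) * (card R + 3))" "disjoint CC" "\<forall>A\<in>CC. convex A"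
    "\<forall>A\<in>CC. real (card {q\<in>Q. \<exists>z\<in>A. on z q}) < k"
    "\<forall>z\<in>Z1. (\<forall>g\<in>R. \<not> on z g) \<longrightarrow> (\<exists>A\<in>CC. z \<in> A)"
    using cutting[OF Q(1) fin(1) k0] by (elim exE conjE) (rule that)
  have cR: "real (card R) \<le> 2 * (s / \<nu> ^ 4)"
  proof -
    have "real (card Q + 2) * real (card Z1 + 1) \<le> (s ^ 3 + 2) * (s ^ 3 + 1)"
      using Q(2) c1 s0 by (intro mult_mono) auto
    then have "ln (real (card Q + 2) * real (card Z1 + 1)) \<le> ln ((s ^ 3 + 2) * (s ^ 3 + 1))"
      by (intro ln_mono) (auto intro!: mult_pos_pos)
    moreover have "86 * ln ((s ^ 3 + 2) * (s ^ 3 + 1)) \<le> \<nu>" using st by (simp add: st_const_def)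
    moreover have "0 \<le> ln ((s ^ 3 + 2) * (s ^ 3 + 1))"
    proof -
      have "1 * 1 \<le> (s ^ 3 + 2) * (s ^ 3 + 1)" using s0 by (intro mult_mono) auto
      then show ?thesis by simp
    qed
    ultimately have l: "2 * ln (real (card Q + 2) * real (card Z1 + 1)) \<le> \<nu>" by linarith
    have "real (card Q) / k * (2 * ln (real (card Q + 2) * real (card Z1 + 1))) \<le> s ^ 3 / k * \<nu>"
    proof (rule order_trans[OF mult_left_mono[OF l]])
      show "real (card Q) / k * \<nu> \<le> s ^ 3 / k * \<nu>" using Q(2) k0 \<nu>0 by (intro mult_right_mono divide_right_mono) auto
    qed (use k0 in simp)
    also have "\<dots> = s / \<nu> ^ 4" unfolding k_def using s0 \<nu>0 by (simp add: eval_nat_numeral)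
    finally have "real (card R) \<le> s / \<nu> ^ 4 + 1" using RC(3) by linarith
    moreover have "1 \<le> s / \<nu> ^ 4" using s\<nu>[of 4] \<nu>0 by simp
    ultimately show ?thesis by simp
  qed
  have cC: "real (card CC) \<le> 40 * s\<^sup>2 / \<nu> ^ 8"
  proof -
    have r1: "1 \<le> s / \<nu> ^ 4" using s\<nu>[of 4] \<nu>0 by simp
    have "real (card CC) \<le> real (2 * ((card R + 2) * (card R + 3)))" using RC(4) by (simp only: of_nat_le_iff)
    also have "\<dots> = 2 * ((real (card R) + 2) * (real (card R) + 3))" by (simp add: algebra_simps)
    also have "\<dots> \<le> 2 * ((4 * (s / \<nu> ^ 4)) * (5 * (s / \<nu> ^ 4)))"
      by (intro mult_left_mono mult_mono) (use cR r1 in linarith)+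
    also have "\<dots> = 40 * s\<^sup>2 / \<nu> ^ 8" by (simp add: power2_eq_square flip: power_add)
    finally show ?thesis .
  qed
  have Ck: "real (card CC) * k \<le> 40 * s ^ 4 / \<nu> ^ 3"
  proof -
    have "real (card CC) * k \<le> 40 * s\<^sup>2 / \<nu> ^ 8 * k" using cC k0 by (intro mult_right_mono) auto
    also have "\<dots> = 40 * s ^ 4 / \<nu> ^ 3" unfolding k_def using \<nu>0 by (simp add: field_simps eval_nat_numeral)
    finally show ?thesis .
  qed
  have cell: "real (card (Z1 \<inter> A)) \<le> s * \<nu> ^ 18" if A: "A \<in> CC" for A
  proof -
    let ?QA = "{q\<in>Q. \<exists>z\<in>A. on z q}"
    have D: "3 * \<nu> < s / (4 * \<nu>)"
    proof -
      have "12 * \<nu>\<^sup>2 < \<nu> * \<nu>\<^sup>2" using \<nu> by (intro mult_strict_right_mono) auto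
      also have "\<dots> = \<nu> ^ 3" by (simp add: eval_nat_numeral)
      also have "\<dots> \<le> s" by (rule s\<nu>) simp
      finally show ?thesis using \<nu>0 by (simp add: field_simps power2_eq_square)
    qed
    have cQA: "real (card ?QA) \<le> s ^ 3" using card_mono[OF Q(1), of ?QA] Q(2) by auto
    have cZA: "real (card (Z1 \<inter> A)) \<le> s ^ 3" using card_mono[OF fin(1), of "Z1 \<inter> A"] c1 by auto
    \<comment> \<open>All lines of \<open>Q\<close> through a point of the cell meet the cell, so
      the point keeps its full degree among the few lines of \<open>?QA\<close> and the bound for
      rich points applies.\<close>
    have rich: "s / (4 * \<nu>) \<le> real (card {q\<in>?QA. on z q})" if z: "z \<in> Z1 \<inter> A" for z
    proof -
      have "{q\<in>?QA. on z q} = {q\<in>Q. on z q}" using z by blast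
      then show ?thesis using z by (simp add: Z1_def)
    qed
    have kA: "real (card ?QA) \<le> k" using RC(7) A by (simp add: less_imp_le)
    have "real (card (Z1 \<inter> A)) \<le> 27 * \<nu> ^ 3 * (real (card ?QA))\<^sup>2 / (s / (4 * \<nu>)) ^ 3 + 3 * \<nu> * real (card ?QA) / (s / (4 * \<nu>))"
      using fin(1) Q(1) by (intro rich_points_bound[OF st _ _ cZA cQA rich D]) auto
    also have "\<dots> \<le> 27 * \<nu> ^ 3 * k\<^sup>2 / (s / (4 * \<nu>)) ^ 3 + 3 * \<nu> * k / (s / (4 * \<nu>))"
      using kA s0 \<nu>0 by (intro add_mono divide_right_mono mult_left_mono power_mono) auto
    also have "\<dots> = 1728 * \<nu> ^ 16 * s + 12 * \<nu> ^ 7 * s"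
    proof -
      have "27 * \<nu> ^ 3 * k\<^sup>2 / (s / (4 * \<nu>)) ^ 3 = 1728 * \<nu> ^ 16 * s"
        unfolding k_def using s0 \<nu>0 by (simp add: field_simps eval_nat_numeral)
      moreover have "3 * \<nu> * k / (s / (4 * \<nu>)) = 12 * \<nu> ^ 7 * s"
        unfolding k_def using s0 \<nu>0 by (simp add: field_simps eval_nat_numeral)
      ultimately show ?thesis by simp
    qed
    also have "\<dots> \<le> s * \<nu> ^ 18"
    proof -
      have "12 * \<nu> ^ 7 * s \<le> 12 * \<nu> ^ 16 * s" using s0 p[of 7 16] by (intro mult_right_mono) auto
      moreover have "1740 \<le> \<nu>\<^sup>2" using power_mono[OF \<nu>, of 2] by simp
      then have "1740 * (\<nu> ^ 16 * s) \<le> \<nu>\<^sup>2 * (\<nu> ^ 16 * s)" using s0 \<nu>0 by (intro mult_right_mono) auto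
      moreover have "\<nu>\<^sup>2 * (\<nu> ^ 16 * s) = s * \<nu> ^ 18" by (simp add: mult.assoc[symmetric] mult.commute flip: power_add)
      ultimately show ?thesis by linarith
    qed
    finally show ?thesis .
  qed
  let ?hit = "\<lambda>A. {q\<in>Q1. \<exists>z\<in>A. on z q}"
  have hit_k: "real (card (?hit A)) \<le> k" if "A \<in> CC" for A
  proof -
    have "card (?hit A) \<le> card {q\<in>Q. \<exists>z\<in>A. on z q}" using Q(1) sub(2) by (intro card_mono) auto
    then show ?thesis using bspec[OF RC(7) that] by linarith
  qed
  have hits40: "(\<Sum>A\<in>CC. real (card (?hit A))) \<le> 40 * s ^ 4 / \<nu> ^ 3"
  proof -
    have "(\<Sum>A\<in>CC. real (card (?hit A))) \<le> (\<Sum>A\<in>CC. k)" by (intro sum_mono hit_k)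
    then show ?thesis using Ck by simp
  qed
  have n40: "\<nu> \<le> \<nu> ^ 40" using p[of 1 40] by simp
  have cl: "cells Q1 Z1 CC s (\<nu> ^ 40)"
  proof
    show "finite Q1" "finite Z1" "finite CC" "disjoint CC" "real (card Q1) \<le> s ^ 3" "real (card Z1) \<le> s ^ 3" by fact+
    show "convex A" if "A \<in> CC" for A using RC(6) that by blast
    show "s / \<nu> ^ 40 \<le> real (card {z\<in>Z1. on z q})" if "q \<in> Q1" for q
    proof -
      have "8 * \<nu> \<le> \<nu> * \<nu>" using \<nu> by (intro mult_right_mono) auto
      also have "\<dots> = \<nu>\<^sup>2" by (simp add: power2_eq_square)
      also have "\<dots> \<le> \<nu> ^ 40" by (intro p) simp
      finally have "s / \<nu> ^ 40 \<le> s / (8 * \<nu>)" using s0 \<nu>0 by (intro divide_left_mono) auto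
      then show ?thesis using that by (simp add: Q1_def)
    qed
    show "real (card {z\<in>Z1. on z q}) \<le> s * \<nu> ^ 40" if "q \<in> Q1" for q
    proof -
      have "s * \<nu> ^ 3 \<le> s * \<nu> ^ 40" using s0 by (intro mult_left_mono p) auto
      then show ?thesis using that by (simp add: Q1_def)
    qed
    show "real (card (Z1 \<inter> A)) \<le> s * \<nu> ^ 40" if "A \<in> CC" for A
    proof -
      have "s * \<nu> ^ 18 \<le> s * \<nu> ^ 40" using s0 by (intro mult_left_mono p) auto
      then show ?thesis using cell[OF that] by linarith
    qed
    show "real (card CC) \<le> s\<^sup>2"
    proof -
      have "40 \<le> \<nu> ^ 8" using p[of 1 8] \<nu> by simp
      then have "40 * s\<^sup>2 / \<nu> ^ 8 \<le> s\<^sup>2" using s0 \<nu>0 by (simp add: field_simps mult_right_mono)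
      then show ?thesis using cC by linarith
    qed
    show "(\<Sum>A\<in>CC. real (card (?hit A))) \<le> s ^ 4 * \<nu> ^ 40"
    proof -
      have "40 * s ^ 4 / \<nu> ^ 3 \<le> 40 * s ^ 4 / 1" using s0 \<nu>0 by (intro divide_left_mono) auto
      also have "\<dots> \<le> s ^ 4 * \<nu> ^ 40"
      proof -
        have "40 \<le> \<nu> ^ 40" using \<nu> n40 by linarith
        then have "s ^ 4 * 40 \<le> s ^ 4 * \<nu> ^ 40" using s0 by (intro mult_left_mono) auto
        then show ?thesis by simp
      qed
      finally show ?thesis using hits40 by linarith
    qed
    show "st_const (s ^ 3) (\<nu> ^ 40)" using st n40 unfolding st_const_def by linarith
    show "1000 \<le> \<nu> ^ 40" using \<nu> n40 by linarith
    show "(\<nu> ^ 40) ^ 200 \<le> s" by (rule s)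
  qed
  interpret cells Q1 Z1 CC s "\<nu> ^ 40" by (rule cl)
  let ?d = "\<lambda>A q. real (card {z\<in>Z1 \<inter> A. on z q})"
  have "incs Z1 Q1 \<subseteq> {p\<in>incs Z1 Q. \<exists>g\<in>R. on (fst p) g} \<union> {p\<in>incs Z1 Q1. \<exists>A\<in>CC. fst p \<in> A}" (is "_ \<subseteq> ?I1 \<union> ?I2")
  proof
    fix x assume x: "x \<in> incs Z1 Q1"
    then have "fst x \<in> Z1" "x \<in> incs Z1 Q" using sub(2) by (auto simp: incs_def)
    then show "x \<in> ?I1 \<union> ?I2" using RC(8) x by (cases "\<exists>g\<in>R. on (fst x) g") simp_all
  qed
  then have "card (incs Z1 Q1) \<le> card (?I1 \<union> ?I2)" using fin Q(1) by (intro card_mono) auto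
  also have "\<dots> \<le> card ?I1 + card ?I2" by (rule card_Un_le)
  finally have "real (card (incs Z1 Q1)) \<le> real (card ?I1) + real (card ?I2)" by linarith
  moreover have "real (card ?I1) \<le> 3 * s ^ 4 / \<nu> ^ 4"
  proof -
    have "real (card ?I1) \<le> real (card R * card Q + card Z1)"
      using incs_on_sample[OF fin(1) Q(1) RC(1)] by (simp only: of_nat_le_iff)
    also have "\<dots> = real (card R) * real (card Q) + real (card Z1)" by simp
    also have "\<dots> \<le> 2 * (s / \<nu> ^ 4) * s ^ 3 + s ^ 3"
      using cR Q(2) c1 s0 \<nu>0 by (intro add_mono mult_mono) auto
    also have "\<dots> \<le> 3 * s ^ 4 / \<nu> ^ 4"
    proof -
      have "s ^ 3 * \<nu> ^ 4 \<le> s ^ 3 * s" using s\<nu>[of 4] s0 by (intro mult_left_mono) auto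
      then show ?thesis using \<nu>0 by (simp add: field_simps eval_nat_numeral)
    qed
    finally show ?thesis .
  qed
  moreover have "real (card ?I2) \<le> 40 * s ^ 4 / \<nu> ^ 3 + (\<Sum>A\<in>CC. \<Sum>q\<in>GA A. ?d A q)"
  proof -
    have "real (card ?I2) = (\<Sum>A\<in>CC. real (card (incs (Z1 \<inter> A) (?hit A))))"
      using incs_in_cells[OF fin RC(2,5)] by simp
    also have "\<dots> \<le> (\<Sum>A\<in>CC. real (card (?hit A)) + (\<Sum>q\<in>GA A. ?d A q))"
    proof (rule sum_mono)
      fix A assume A: "A \<in> CC"
      have GAh: "GA A = {q\<in>?hit A. 2 \<le> card {z\<in>Z1 \<inter> A. on z q}}"
      proof (rule set_eqI)
        fix q
        show "q \<in> GA A \<longleftrightarrow> q \<in> {q\<in>?hit A. 2 \<le> card {z\<in>Z1 \<inter> A. on z q}}"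
        proof
          assume q: "q \<in> GA A"
          then have g: "good q A" by (simp add: GA_def)
          then obtain x where "x \<in> Z1 \<inter> A" "on x q" using good_points by blast
          then show "q \<in> {q\<in>?hit A. 2 \<le> card {z\<in>Z1 \<inter> A. on z q}}" using g unfolding good_def by blast
        next
          assume "q \<in> {q\<in>?hit A. 2 \<le> card {z\<in>Z1 \<inter> A. on z q}}"
          then show "q \<in> GA A" using A unfolding GA_def good_def by blast
        qed
      qed
      have fh: "finite (?hit A)" using fin by simp
      have "real (card (incs (Z1 \<inter> A) (?hit A))) = (\<Sum>q\<in>?hit A. ?d A q)"
        using card_incs_lines[of "Z1 \<inter> A" "?hit A"] fin by simp
      \<comment> \<open>A line that is not good in the cell has at most one incidence there, which
        is the summand 1.\<close>
      also have "\<dots> \<le> (\<Sum>q\<in>?hit A. 1 + (if 2 \<le> card {z\<in>Z1 \<inter> A. on z q} then ?d A q else 0))"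
        by (intro sum_mono) auto
      also have "\<dots> = real (card (?hit A)) + (\<Sum>q\<in>GA A. ?d A q)"
        unfolding GAh using fh by (simp only: sum.distrib sum.inter_filter[OF fh]) simp
      finally show "real (card (incs (Z1 \<inter> A) (?hit A))) \<le> real (card (?hit A)) + (\<Sum>q\<in>GA A. ?d A q)" .
    qed
    also have "\<dots> = (\<Sum>A\<in>CC. real (card (?hit A))) + (\<Sum>A\<in>CC. \<Sum>q\<in>GA A. ?d A q)" by (rule sum.distrib)
    finally show ?thesis using hits40 by linarith
  qed
  moreover have "3 * s ^ 4 / \<nu> ^ 4 + 40 * s ^ 4 / \<nu> ^ 3 \<le> s ^ 4 / (8 * \<nu>)"
  proof -
    have "3 * s ^ 4 / \<nu> ^ 4 \<le> 3 * s ^ 4 / \<nu> ^ 3" using s0 \<nu>0 p[of 3 4] by (intro divide_left_mono) auto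
    moreover have "43 * s ^ 4 / \<nu> ^ 3 \<le> s ^ 4 / (8 * \<nu>)"
    proof -
      have "344 * \<nu> \<le> \<nu> * \<nu>" using \<nu> by (intro mult_right_mono) auto
      also have "\<dots> = \<nu> ^ 2" by (simp add: power2_eq_square)
      also have "\<dots> \<le> \<nu> ^ 3" by (intro p) simp
      finally have "s ^ 4 * (344 * \<nu>) \<le> s ^ 4 * \<nu> ^ 3" using s0 by (intro mult_left_mono) auto
      then show ?thesis using \<nu>0 by (simp add: field_simps)
    qed
    moreover have "43 * s ^ 4 / \<nu> ^ 3 = 3 * s ^ 4 / \<nu> ^ 3 + 40 * s ^ 4 / \<nu> ^ 3" by (simp add: add_divide_distrib[symmetric])
    ultimately show ?thesis by linarith
  qed
  moreover have "3 * s ^ 4 / (8 * \<nu>) = s ^ 4 / (8 * \<nu>) + s ^ 4 / (4 * \<nu>)" using \<nu>0 by (simp add: field_simps)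
  ultimately have main: "s ^ 4 / (4 * \<nu>) \<le> (\<Sum>A\<in>CC. \<Sum>q\<in>GA A. ?d A q)" using I1 by linarith
  have sq: "(\<Sum>q\<in>GA A. (?d A q)\<^sup>2) \<le> 2 * (s * \<nu> ^ 18)\<^sup>2" if A: "A \<in> CC" for A
  proof -
    have "(\<Sum>q\<in>GA A. (card {z\<in>Z1 \<inter> A. on z q})\<^sup>2) \<le> (card (Z1 \<inter> A))\<^sup>2 + card (incs (Z1 \<inter> A) (GA A))"
      using fin by (intro sum_square_degrees) auto
    then have "real (\<Sum>q\<in>GA A. (card {z\<in>Z1 \<inter> A. on z q})\<^sup>2) \<le> real ((card (Z1 \<inter> A))\<^sup>2 + card (incs (Z1 \<inter> A) (GA A)))"
      by (simp only: of_nat_le_iff)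
    moreover have "real (card (incs (Z1 \<inter> A) (GA A))) = (\<Sum>q\<in>GA A. ?d A q)"
      using card_incs_lines[of "Z1 \<inter> A" "GA A"] fin by simp
    moreover have "(\<Sum>q\<in>GA A. ?d A q) \<le> (\<Sum>q\<in>GA A. (?d A q)\<^sup>2 / 2)"
    proof (rule sum_mono)
      fix q assume "q \<in> GA A"
      then have "2 \<le> card {z\<in>Z1 \<inter> A. on z q}" by (simp add: GA_def good_def)
      then have "2 \<le> ?d A q" by linarith
      then have "2 * ?d A q \<le> ?d A q * ?d A q" by (intro mult_right_mono) auto
      then show "?d A q \<le> (?d A q)\<^sup>2 / 2" by (simp add: power2_eq_square)
    qed
    moreover have "(\<Sum>q\<in>GA A. (?d A q)\<^sup>2 / 2) = (\<Sum>q\<in>GA A. (?d A q)\<^sup>2) / 2" by (simp only: sum_divide_distrib)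
    moreover have "(real (card (Z1 \<inter> A)))\<^sup>2 \<le> (s * \<nu> ^ 18)\<^sup>2" using cell[OF A] by (intro power_mono) auto
    ultimately show ?thesis by simp
  qed
  \<comment> \<open>The second moment term is at most s^4 \<nu>^36 / \<rho>; this \<rho> makes it
    s^4 / (8 \<nu>), half of the lower bound \<open>main\<close>.\<close>
  define \<rho> where "\<rho> = 8 * \<nu> ^ 37"
  have \<rho>0: "\<rho> > 0" unfolding \<rho>_def using \<nu>0 by simp
  have "(\<Sum>A\<in>CC. \<Sum>q\<in>GA A. ?d A q) \<le> (\<Sum>A\<in>CC. \<Sum>q\<in>GA A. \<rho> / 2 + (?d A q)\<^sup>2 / (2 * \<rho>))"
  proof (intro sum_mono)
    fix A q
    have "0 \<le> (\<rho> - ?d A q)\<^sup>2" by simp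
    then have "2 * \<rho> * ?d A q \<le> \<rho>\<^sup>2 + (?d A q)\<^sup>2" by (simp add: power2_eq_square algebra_simps)
    then show "?d A q \<le> \<rho> / 2 + (?d A q)\<^sup>2 / (2 * \<rho>)" using \<rho>0 by (simp add: field_simps power2_eq_square)
  qed
  also have "\<dots> = (\<Sum>A\<in>CC. real (card (GA A)) * (\<rho> / 2)) + (\<Sum>A\<in>CC. (\<Sum>q\<in>GA A. (?d A q)\<^sup>2) / (2 * \<rho>))"
    by (simp only: sum.distrib sum_constant sum_divide_distrib)
  also have "\<dots> \<le> (\<Sum>A\<in>CC. real (card (GA A))) * (\<rho> / 2) + (\<Sum>A\<in>CC. 2 * (s * \<nu> ^ 18)\<^sup>2 / (2 * \<rho>))"
    unfolding sum_distrib_right[symmetric] using sq \<rho>0 by (intro add_mono order_refl sum_mono divide_right_mono) auto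
  also have "(\<Sum>A\<in>CC. 2 * (s * \<nu> ^ 18)\<^sup>2 / (2 * \<rho>)) \<le> s ^ 4 / (8 * \<nu>)"
  proof -
    have "(\<Sum>A\<in>CC. 2 * (s * \<nu> ^ 18)\<^sup>2 / (2 * \<rho>)) = real (card CC) * ((s * \<nu> ^ 18)\<^sup>2 / \<rho>)" by simp
    also have "\<dots> \<le> s\<^sup>2 * ((s * \<nu> ^ 18)\<^sup>2 / \<rho>)" using cardC \<rho>0 by (intro mult_right_mono) auto
    also have "\<dots> = s ^ 4 / (8 * \<nu>)"
    proof -
      have "\<nu> ^ 37 = \<nu> * \<nu> ^ 36" "(\<nu> ^ 18)\<^sup>2 = \<nu> ^ 36" "s ^ 4 = s\<^sup>2 * s\<^sup>2" by (simp_all flip: power_Suc power_mult power_add)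
      then show ?thesis unfolding \<rho>_def using \<nu>0 by (simp add: power_mult_distrib)
    qed
    finally show ?thesis .
  qed
  finally have "s ^ 4 / (4 * \<nu>) \<le> (\<Sum>A\<in>CC. real (card (GA A))) * (\<rho> / 2) + s ^ 4 / (8 * \<nu>)" using main by linarith
  moreover have "s ^ 4 / (4 * \<nu>) = s ^ 4 / (8 * \<nu>) + s ^ 4 / (8 * \<nu>)" by simp
  ultimately have "s ^ 4 / (8 * \<nu>) \<le> (\<Sum>A\<in>CC. real (card (GA A))) * (\<rho> / 2)" by linarith
  moreover have "\<rho> / 2 = 4 * \<nu> ^ 37" by (simp add: \<rho>_def)
  ultimately have "s ^ 4 / (8 * \<nu>) \<le> (\<Sum>A\<in>CC. real (card (GA A))) * (4 * \<nu> ^ 37)" by (simp only:)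
  then have "s ^ 4 / (8 * \<nu>) / (4 * \<nu> ^ 37) \<le> (\<Sum>A\<in>CC. real (card (GA A)))" using \<nu>0 by (subst pos_divide_le_eq) auto
  moreover have "s ^ 4 / \<nu> ^ 40 \<le> s ^ 4 / (8 * \<nu>) / (4 * \<nu> ^ 37)"
  proof -
    have "32 * \<nu> ^ 38 \<le> \<nu> * \<nu> ^ 38" using \<nu> by (intro mult_right_mono) auto
    also have "\<dots> = \<nu> ^ 39" by (simp flip: power_Suc)
    also have "\<dots> \<le> \<nu> ^ 40" by (intro p) simp
    finally have "s ^ 4 / \<nu> ^ 40 \<le> s ^ 4 / (32 * \<nu> ^ 38)" using s0 \<nu>0 by (intro divide_left_mono) auto
    also have "32 * \<nu> ^ 38 = 8 * \<nu> * (4 * \<nu> ^ 37)" by (simp flip: power_Suc)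
    finally show ?thesis by simp
  qed
  ultimately have "s ^ 4 / \<nu> ^ 40 \<le> (\<Sum>A\<in>CC. real (card (GA A)))" by linarith
  then show ?thesis using sub cl by blast
qed

section \<open>Duality and sectors\<close>

text \<open>A point \<open>(x, y)\<close> is dual to the line of slope \<open>- y\<close> and intercept \<open>x\<close>, and the line
  \<open>x = m y + c\<close> is dual to the point \<open>(m, c)\<close>; horizontal lines have no dual.\<close>

definition dual :: "point \<Rightarrow> real \<times> real" where
  "dual p = (- p $ 2, p $ 1)"

definition dual_line :: "real \<times> real \<Rightarrow> point set" where
  "dual_line z = {p. p $ 1 = fst z * p $ 2 + snd z}"

lemma dual_inj: "inj dual"
  by (rule injI) (simp add: dual_def vec_eq_iff forall_2)

lemma on_dual: "on z (dual p) \<longleftrightarrow> p \<in> dual_line z"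
  by (auto simp: on_def dual_def dual_line_def val_def)

lemma dual_line_inj: "inj dual_line"
proof (rule injI)
  fix z z' assume e: "dual_line z = dual_line z'"
  have "vector [snd z, 0] \<in> dual_line z'" "vector [fst z + snd z, 1] \<in> dual_line z'"
    unfolding e[symmetric] by (simp_all add: dual_line_def)
  then show "z = z'" by (simp add: dual_line_def prod_eq_iff)
qed

lemma is_line_param:
  assumes "is_line l"
  obtains a b where "a \<noteq> b" "l = range (\<lambda>u. a + u *\<^sub>R (b - a))"
proof -
  have l: "affine l" "aff_dim l = 1" using assms by (auto simp: is_line_def)
  have "l \<noteq> {}" using l(2) by auto
  then obtain a where a: "a \<in> l" by blast
  have "l \<noteq> {a}" using l(2) by auto
  then obtain b where b: "b \<in> l" "a \<noteq> b" using a by blast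
  have "affine hull {a, b} \<subseteq> l" using a b l(1) by (intro hull_minimal) auto
  moreover have "aff_dim (affine hull {a, b}) = aff_dim l" using b(2) l(2) by simp
  ultimately have "affine hull {a, b} = l"
    using l(1) by (intro affine_dim_equal) auto
  then show ?thesis using that[of a b] b(2) by (simp add: affine_hull_2_alt)
qed

lemma is_line_cases:
  assumes "is_line l"
  shows "(\<exists>z. l = dual_line z) \<or> (\<exists>c. l = {p. p $ 2 = c})"
proof -
  obtain a b where ab: "a \<noteq> b" "l = range (\<lambda>u. a + u *\<^sub>R (b - a))" using is_line_param[OF assms] .
  show ?thesis
  proof (cases "a $ 2 = b $ 2")
    case True
    then have d: "b $ 1 - a $ 1 \<noteq> 0" using ab(1) by (auto simp: vec_eq_iff forall_2)
    have "l = {p. p $ 2 = a $ 2}"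
    proof (rule set_eqI)
      fix p
      show "p \<in> l \<longleftrightarrow> p \<in> {p. p $ 2 = a $ 2}"
      proof
        assume "p \<in> l" then show "p \<in> {p. p $ 2 = a $ 2}" using ab(2) True by auto
      next
        assume p: "p \<in> {p. p $ 2 = a $ 2}"
        have "p = a + ((p $ 1 - a $ 1) / (b $ 1 - a $ 1)) *\<^sub>R (b - a)"
          using p True d by (simp add: vec_eq_iff forall_2)
        then show "p \<in> l" unfolding ab(2) by (rule range_eqI)
      qed
    qed
    then show ?thesis by blast
  next
    case False
    then have d: "b $ 2 - a $ 2 \<noteq> 0" by simp
    define m where "m = (b $ 1 - a $ 1) / (b $ 2 - a $ 2)"
    have m: "m * (b $ 2 - a $ 2) = b $ 1 - a $ 1" unfolding m_def using d by simp
    have "l = dual_line (m, a $ 1 - m * a $ 2)"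
    proof (rule set_eqI)
      fix p
      show "p \<in> l \<longleftrightarrow> p \<in> dual_line (m, a $ 1 - m * a $ 2)"
      proof
        assume "p \<in> l"
        then obtain u where p: "p = a + u *\<^sub>R (b - a)" unfolding ab(2) by blast
        have "p $ 2 - a $ 2 = u * (b $ 2 - a $ 2)" using p by simp
        then have "m * (p $ 2 - a $ 2) = u * (m * (b $ 2 - a $ 2))" by simp
        also have "\<dots> = p $ 1 - a $ 1" using p m by simp
        finally show "p \<in> dual_line (m, a $ 1 - m * a $ 2)" by (simp add: dual_line_def algebra_simps)
      next
        assume p: "p \<in> dual_line (m, a $ 1 - m * a $ 2)"
        define u where "u = (p $ 2 - a $ 2) / (b $ 2 - a $ 2)"
        have u: "u * (b $ 2 - a $ 2) = p $ 2 - a $ 2" unfolding u_def using d by simp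
        have "u * (b $ 1 - a $ 1) = m * (u * (b $ 2 - a $ 2))" using m by (simp add: mult_ac flip: m)
        also have "\<dots> = p $ 1 - a $ 1" unfolding u using p by (simp add: dual_line_def algebra_simps)
        finally have "p = a + u *\<^sub>R (b - a)" using u by (simp add: vec_eq_iff forall_2)
        then show "p \<in> l" unfolding ab(2) by (rule range_eqI)
      qed
    qed
    then show ?thesis by blast
  qed
qed

text \<open>The angle of the lines x = m y + c. It decreases with m, so increasing directions at a
  point correspond to decreasing abscissae on its dual line.\<close>

definition ang :: "real \<Rightarrow> real" where
  "ang m = pi / 2 - arctan m"

lemma ang_bounds: "0 < ang m" "ang m < pi"
  using arctan_lbound[of m] arctan_ubound[of m] unfolding ang_def by linarith+

lemma ang_less_iff: "ang m < ang m' \<longleftrightarrow> m' < m"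
  by (simp add: ang_def arctan_less_iff)

lemma sin_ang_pos: "0 < sin (ang m)"
  using ang_bounds by (intro sin_gt_zero)

lemma cos_ang: "cos (ang m) = m * sin (ang m)"
proof -
  have "cos (ang m) = sin (arctan m)" "sin (ang m) = cos (arctan m)" unfolding ang_def by (simp_all add: cos_diff sin_diff)
  moreover have "sin (arctan m) = m * cos (arctan m)"
    using tan_arctan[of m] cos_arctan_not_zero[of m] by (simp add: tan_def field_simps)
  ultimately show ?thesis by simp
qed

lemma direction_nth [simp]: "direction t $ 1 = cos t" "direction t $ 2 = sin t"
  by (simp_all add: direction_def)

lemma line_at_ang:
  assumes "p \<in> dual_line z"
  shows "line_at p (ang (fst z)) = dual_line z"
proof (rule set_eqI)
  fix x
  let ?t = "ang (fst z)"
  show "x \<in> line_at p ?t \<longleftrightarrow> x \<in> dual_line z"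
  proof
    assume "x \<in> line_at p ?t"
    then obtain r where "x = p + r *\<^sub>R direction ?t" by (auto simp: line_at_def)
    then show "x \<in> dual_line z" using assms by (simp add: dual_line_def cos_ang algebra_simps)
  next
    assume x: "x \<in> dual_line z"
    define r where "r = (x $ 2 - p $ 2) / sin ?t"
    have r: "r * sin ?t = x $ 2 - p $ 2" unfolding r_def using sin_ang_pos[of "fst z"] by simp
    have "r * cos ?t = fst z * (r * sin ?t)" by (simp add: cos_ang)
    also have "\<dots> = x $ 1 - p $ 1" unfolding r using x assms by (simp add: dual_line_def algebra_simps)
    finally have "x = p + r *\<^sub>R direction ?t" using r by (simp add: vec_eq_iff forall_2)
    then show "x \<in> line_at p ?t" by (auto simp: line_at_def)
  qed
qed

text \<open>The signed distance of q from the line through p at angle t.\<close>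

definition side :: "real \<Rightarrow> point \<Rightarrow> point \<Rightarrow> real" where
  "side t p q = (q $ 1 - p $ 1) * sin t - (q $ 2 - p $ 2) * cos t"

lemma side_direction: "side a p (p + r *\<^sub>R direction t) = r * sin (a - t)"
  by (simp add: side_def sin_diff algebra_simps)

lemma side_add_pi: "side (t + pi) p q = - side t p q"
  by (simp add: side_def)

text \<open>The dictionary between the two planes: on which side of a line through p the point q
  lies is decided by which of their dual lines is higher at the abscissa m dual to that
  line.\<close>

lemma side_ang: "side (ang m) p q = sin (ang m) * (val (dual q) m - val (dual p) m)"
  by (simp add: side_def cos_ang val_def dual_def algebra_simps)

text \<open>If the signs differ, the side of q vanishes at an intermediate angle, which is the
  direction of q. Conversely the side is a multiple of the sine of an angle difference smaller than
  pi.\<close>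

lemma mem_double_wedge_iff:
  assumes "a < b" "b < a + pi"
  shows "q \<in> double_wedge p a b \<longleftrightarrow> side a p q * side b p q < 0"
proof
  assume "q \<in> double_wedge p a b"
  then obtain r t where q: "q = p + r *\<^sub>R direction t" "r \<noteq> 0" "a < t" "t < b" by (auto simp: double_wedge_def)
  have s: "sin (t - a) > 0" "sin (b - t) > 0" using q assms by (auto intro!: sin_gt_zero)
  have "0 < r * r" using q(2) by (auto simp: zero_less_mult_iff linorder_neq_iff)
  then have "0 < r * r * (sin (t - a) * sin (b - t))" by (rule mult_pos_pos[OF _ mult_pos_pos[OF s]])
  moreover have "sin (a - t) = - sin (t - a)" by (simp add: sin_diff)
  ultimately show "side a p q * side b p q < 0" unfolding q(1) side_direction by (simp add: mult_ac)
next
  assume neg: "side a p q * side b p q < 0"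
  let ?h = "\<lambda>t. side t p q"
  have cont: "continuous_on {a..b} ?h" unfolding side_def by (intro continuous_intros)
  have "\<exists>t. a \<le> t \<and> t \<le> b \<and> ?h t = 0"
  proof (cases "?h a < 0")
    case True
    then have "0 < ?h b" using neg by (simp add: mult_less_0_iff)
    then show ?thesis using IVT'[of ?h a 0 b] True cont assms(1) by auto
  next
    case False
    then have "?h a > 0" "?h b < 0" using neg by (auto simp: mult_less_0_iff)
    then show ?thesis using IVT2'[of ?h b 0 a] cont assms(1) by auto
  qed
  then obtain t where t: "a \<le> t" "t \<le> b" "?h t = 0" by blast
  have "t \<noteq> a" "t \<noteq> b" using neg t(3) by auto
  then have ab: "a < t" "t < b" using t by auto
  define x y where "x = q $ 1 - p $ 1" and "y = q $ 2 - p $ 2"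
  define r where "r = x * cos t + y * sin t"
  have e: "x * sin t = y * cos t" using t(3) by (simp add: side_def x_def y_def)
  have one: "cos t * cos t + sin t * sin t = 1" using sin_cos_squared_add2[of t] by (simp add: power2_eq_square)
  have "r * cos t = x * (cos t * cos t) + (y * cos t) * sin t" by (simp add: r_def algebra_simps)
  also have "\<dots> = x * (cos t * cos t) + (x * sin t) * sin t" by (simp only: e)
  also have "\<dots> = x * (cos t * cos t + sin t * sin t)" by (simp only: distrib_left mult.assoc)
  finally have rx: "r * cos t = x" unfolding one by simp
  have "r * sin t = (x * sin t) * cos t + y * (sin t * sin t)" by (simp add: r_def algebra_simps)
  also have "\<dots> = (y * cos t) * cos t + y * (sin t * sin t)" by (simp only: e)
  also have "\<dots> = y * (cos t * cos t + sin t * sin t)" by (simp only: distrib_left mult.assoc)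
  finally have ry: "r * sin t = y" unfolding one by simp
  have q: "q = p + r *\<^sub>R direction t" using rx ry by (simp add: vec_eq_iff forall_2 x_def y_def)
  have "r \<noteq> 0"
  proof
    assume "r = 0"
    then have "q = p" using q by simp
    then show False using neg by (simp add: side_def)
  qed
  then show "q \<in> double_wedge p a b" using q ab unfolding double_wedge_def by blast
qed

section \<open>Sectors as sign conditions\<close>

definition next_angle :: "nat \<Rightarrow> (nat \<Rightarrow> real) \<Rightarrow> nat \<Rightarrow> real" where
  "next_angle M \<theta> j = (if Suc j < M then \<theta> (Suc j) else \<theta> 0 + pi)"

lemma sector_next: "sector p M \<theta> j = double_wedge p (\<theta> j) (next_angle M \<theta> j)"
  by (simp add: sector_def next_angle_def)

lemma ordered_angles_less: "ordered_angles M \<theta> \<Longrightarrow> i < j \<Longrightarrow> j < M \<Longrightarrow> \<theta> i < \<theta> j"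
  using strict_mono_onD[of "{..<M}" \<theta> i j] unfolding ordered_angles_def by simp

lemma next_angle_bounds:
  assumes "ordered_angles M \<theta>" "2 \<le> M" "j < M"
  shows "\<theta> j < next_angle M \<theta> j" "next_angle M \<theta> j < \<theta> j + pi" "next_angle M \<theta> j \<le> \<theta> 0 + pi" "\<theta> 0 \<le> \<theta> j"
proof -
  have r: "0 \<le> \<theta> i" "\<theta> i < pi" if "i < M" for i using assms(1) that by (auto simp: ordered_angles_def)
  show "\<theta> 0 \<le> \<theta> j" using ordered_angles_less[OF assms(1), of 0 j] assms(3) by (cases j) auto
  show "\<theta> j < next_angle M \<theta> j"
    using ordered_angles_less[OF assms(1), of j "Suc j"] r(1)[of 0] r(2)[OF assms(3)] assms by (simp add: next_angle_def)
  show "next_angle M \<theta> j \<le> \<theta> 0 + pi"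
    using r(1)[of 0] r(2)[of "Suc j"] assms by (auto simp: next_angle_def)
  show "next_angle M \<theta> j < \<theta> j + pi"
  proof (cases "Suc j < M")
    case True
    then show ?thesis using r(2)[of "Suc j"] r(1)[OF assms(3)] by (simp add: next_angle_def)
  next
    case False
    then have "0 < j" using assms by simp
    then show ?thesis using ordered_angles_less[OF assms(1), of 0 j] assms(3) False by (simp add: next_angle_def)
  qed
qed

lemma mem_sector_iff:
  assumes "ordered_angles M \<theta>" "2 \<le> M" "j < M"
  shows "q \<in> sector p M \<theta> j \<longleftrightarrow> side (\<theta> j) p q * side (next_angle M \<theta> j) p q < 0"
  unfolding sector_next by (rule mem_double_wedge_iff[OF next_angle_bounds(1,2)[OF assms]])

text \<open>Only the signs of the sides enter. The upper angle of the last sector is the first angle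
  plus pi, which reverses the signs of both points together.\<close>

lemma sector_cong:
  assumes "ordered_angles M \<theta>" "2 \<le> M" "j < M"
    and "\<And>k. k < M \<Longrightarrow> 0 < side (\<theta> k) p q * side (\<theta> k) p q'" "q \<in> sector p M \<theta> j"
  shows "q' \<in> sector p M \<theta> j"
proof -
  have "0 < side (next_angle M \<theta> j) p q * side (next_angle M \<theta> j) p q'"
    using assms(4)[of "Suc j"] assms(4)[of 0] assms(2) by (auto simp: next_angle_def side_add_pi)
  moreover have "0 < side (\<theta> j) p q * side (\<theta> j) p q'" using assms(4)[OF assms(3)] .
  moreover have "side (\<theta> j) p q * side (next_angle M \<theta> j) p q < 0" using assms(5) mem_sector_iff[OF assms(1-3)] by simp
  ultimately have "side (\<theta> j) p q' * side (next_angle M \<theta> j) p q' < 0"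
    by (auto simp: zero_less_mult_iff mult_less_0_iff)
  then show ?thesis using mem_sector_iff[OF assms(1-3)] by simp
qed

text \<open>All sectors use angles from one open interval of length pi, in which the direction of q
  occurs only once.\<close>

lemma sector_unique:
  assumes o: "ordered_angles M \<theta>" "2 \<le> M" and ij: "i < M" "j < M"
    and q: "q \<in> sector p M \<theta> i" "q \<in> sector p M \<theta> j"
  shows "i = j"
proof -
  have main: False if ij: "i < j" "j < M" and q: "q \<in> sector p M \<theta> i" "q \<in> sector p M \<theta> j" for i j
  proof -
    obtain r t where r: "q = p + r *\<^sub>R direction t" "\<theta> i < t" "t < next_angle M \<theta> i"
      using q(1) by (auto simp: sector_next double_wedge_def)
    obtain r' t' where r': "q = p + r' *\<^sub>R direction t'" "r' \<noteq> 0" "\<theta> j < t'" "t' < next_angle M \<theta> j"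
      using q(2) by (auto simp: sector_next double_wedge_def)
    have "next_angle M \<theta> i = \<theta> (Suc i)" using ij by (simp add: next_angle_def)
    moreover have "\<theta> (Suc i) \<le> \<theta> j" using ordered_angles_less[OF o(1), of "Suc i" j] ij by (cases "Suc i = j") auto
    ultimately have tt: "t < t'" using r(3) r'(3) by linarith
    have "\<theta> 0 \<le> \<theta> i" using next_angle_bounds(4)[OF o, of i] ij by simp
    moreover have "next_angle M \<theta> j \<le> \<theta> 0 + pi" using next_angle_bounds(3)[OF o ij(2)] .
    ultimately have "t' - t < pi" using r(2) r'(4) by linarith
    then have s: "sin (t' - t) > 0" using tt by (intro sin_gt_zero) auto
    have "side t p q = 0" unfolding r(1) side_direction by simp
    moreover have "side t p q = r' * sin (t - t')" unfolding r'(1) side_direction ..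
    moreover have "sin (t - t') = - sin (t' - t)" by (simp add: sin_diff)
    ultimately show False using s r'(2) by simp
  qed
  show ?thesis using main[of i j] main[of j i] ij q by (cases i j rule: linorder_cases) auto
qed

text \<open>The zeros of |K| affine functions cut the line into at most |K| + 1 pieces with constant
  signs. A piece is encoded by the number of zeros below it, so intervals never have to be
  listed.\<close>

lemma sign_patterns:
  fixes A B :: "'k \<Rightarrow> real" and g :: "real \<Rightarrow> 'c"
  assumes "finite K" and nz: "\<And>k x. k \<in> K \<Longrightarrow> x \<in> T \<Longrightarrow> A k + B k * x \<noteq> 0"
    and g: "\<And>x y. x \<in> T \<Longrightarrow> y \<in> T \<Longrightarrow> (\<And>k. k \<in> K \<Longrightarrow> 0 < (A k + B k * x) * (A k + B k * y)) \<Longrightarrow> g x = g y"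
  shows "finite (g ` T)" "card (g ` T) \<le> card K + 1"
proof -
  \<comment> \<open>For a constant function the quotient takes the default value 0, a harmless
    additional break point.\<close>
  define R where "R = (\<lambda>k. - A k / B k) ` K"
  have fR: "finite R" "card R \<le> card K" unfolding R_def using assms(1) by (auto intro: card_image_le)
  define n where "n = (\<lambda>x. card {r\<in>R. r < x})"
  have key: "g x = g y" if xy: "x \<in> T" "y \<in> T" "x < y" "n x = n y" for x y
  proof (rule g[OF xy(1,2)])
    fix k assume k: "k \<in> K"
    have "{r\<in>R. r < x} = {r\<in>R. r < y}"
      using xy(3,4) fR(1) unfolding n_def by (intro card_subset_eq) auto
    then have nor: "\<not> (x \<le> r \<and> r < y)" if "r \<in> R" for r
      using that by (metis (mono_tags, lifting) mem_Collect_eq not_le)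
    show "0 < (A k + B k * x) * (A k + B k * y)"
    proof (rule ccontr)
      assume "\<not> ?thesis"
      then have neg: "(A k + B k * x) * (A k + B k * y) < 0" using nz[OF k xy(1)] nz[OF k xy(2)]
        by (metis linorder_neqE_linordered_idom mult_eq_0_iff)
      have B0: "B k \<noteq> 0"
      proof
        assume "B k = 0"
        then have "A k * A k < 0" using neg by simp
        then show False using zero_le_square[of "A k"] by linarith
      qed
      let ?r = "- A k / B k"
      have "A k + B k * x = B k * (x - ?r)" "A k + B k * y = B k * (y - ?r)" using B0 by (simp_all add: field_simps)
      then have "(B k * B k) * ((x - ?r) * (y - ?r)) < 0" using neg by (simp add: mult_ac)
      then have "(x - ?r) * (y - ?r) < 0" 
        using mult_less_cancel_left_pos[of "B k * B k" "(x - ?r) * (y - ?r)" 0] B0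
        by (auto simp: zero_less_mult_iff linorder_neq_iff)
      then have "x \<le> ?r \<and> ?r < y" using xy(3) by (auto simp: mult_less_0_iff)
      moreover have "?r \<in> R" unfolding R_def using k by blast
      ultimately show False using nor by blast
    qed
  qed
  have nle: "n x \<le> card K" for x
    unfolding n_def using card_mono[OF fR(1), of "{r\<in>R. r < x}"] fR(2) by auto
  have "\<exists>h. \<forall>x\<in>T. g x = h (n x)"
  proof (intro exI ballI)
    fix x assume x: "x \<in> T"
    let ?y = "SOME y. y \<in> T \<and> n y = n x"
    have y: "?y \<in> T \<and> n ?y = n x" using x by (intro someI[of "\<lambda>y. y \<in> T \<and> n y = n x" x]) simp
    have "g x = g ?y"
      using key[of x ?y] key[of ?y x] x y by (cases x ?y rule: linorder_cases) auto
    then show "g x = (\<lambda>i. g (SOME y. y \<in> T \<and> n y = i)) (n x)" by simp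
  qed
  then obtain h where h: "\<forall>x\<in>T. g x = h (n x)" by blast
  have sub: "g ` T \<subseteq> h ` {..card K}"
    using h nle by auto
  then show "finite (g ` T)" by (rule finite_subset) simp
  have "card (g ` T) \<le> card (h ` {..card K})" using sub by (intro card_mono) auto
  also have "\<dots> \<le> card {..card K}" by (intro card_image_le) simp
  finally show "card (g ` T) \<le> card K + 1" by simp
qed

text \<open>The 2 M bush lines break l into at most 2 M + 1 pieces, and points of P on the same
  piece lie in the same sectors, as P avoids the bush lines.\<close>

lemma card_cells_on_line:
  assumes o1: "ordered_angles M \<theta>1" and o2: "ordered_angles M \<theta>2" and M: "2 \<le> M" and l: "is_line l"
    and off: "\<And>q k. q \<in> P \<Longrightarrow> k < M \<Longrightarrow> side (\<theta>1 k) p1 q \<noteq> 0 \<and> side (\<theta>2 k) p2 q \<noteq> 0"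
  shows "card {i\<in>{..<M} \<times> {..<M}. P \<inter> sector p1 M \<theta>1 (fst i) \<inter> sector p2 M \<theta>2 (snd i) \<inter> l \<noteq> {}} \<le> 2 * M + 1"
proof -
  obtain a b where ab: "l = range (\<lambda>u. a + u *\<^sub>R (b - a))" using is_line_param[OF l] .
  let ?I = "{i\<in>{..<M} \<times> {..<M}. P \<inter> sector p1 M \<theta>1 (fst i) \<inter> sector p2 M \<theta>2 (snd i) \<inter> l \<noteq> {}}"
  let ?pt = "\<lambda>u. a + u *\<^sub>R (b - a)"
  define th where "th = (\<lambda>k. if k < M then (\<theta>1 k, p1) else (\<theta>2 (k - M), p2))"
  define A where "A = (\<lambda>k. side (fst (th k)) (snd (th k)) a)"
  define B where "B = (\<lambda>k. (b - a) $ 1 * sin (fst (th k)) - (b - a) $ 2 * cos (fst (th k)))"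
  have AB: "side (fst (th k)) (snd (th k)) (?pt u) = A k + B k * u" for k u
    by (simp add: side_def A_def B_def algebra_simps)
  let ?in = "\<lambda>i q. q \<in> P \<and> q \<in> sector p1 M \<theta>1 (fst i) \<and> q \<in> sector p2 M \<theta>2 (snd i)"
  define T where "T = {u. \<exists>i\<in>{..<M} \<times> {..<M}. ?in i (?pt u)}"
  define g where "g = (\<lambda>u. THE i. i \<in> {..<M} \<times> {..<M} \<and> ?in i (?pt u))"
  have uniq: "i = i'" if "i \<in> {..<M} \<times> {..<M}" "i' \<in> {..<M} \<times> {..<M}" "?in i q" "?in i' q" for i i' q
    using sector_unique[OF o1 M, of "fst i" "fst i'" q p1] sector_unique[OF o2 M, of "snd i" "snd i'" q p2] that
    by (auto simp: prod_eq_iff mem_Times_iff)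
  have gI: "g u = i" if "i \<in> {..<M} \<times> {..<M}" "?in i (?pt u)" for i u
    unfolding g_def using that uniq by (intro the_equality) auto
  have "?I \<subseteq> g ` T"
  proof
    fix i assume i: "i \<in> ?I"
    then obtain q where q: "?in i q" "q \<in> l" by blast
    then obtain u where u: "q = ?pt u" unfolding ab by blast
    have "i \<in> {..<M} \<times> {..<M}" using i by simp
    then have "g u = i" "u \<in> T" using gI q(1) unfolding u T_def by blast+
    then show "i \<in> g ` T" by blast
  qed
  moreover have "finite (g ` T) \<and> card (g ` T) \<le> card {..<2 * M} + 1"
  proof (intro conjI)
    have nz: "A k + B k * x \<noteq> 0" if k: "k \<in> {..<2 * M}" and x: "x \<in> T" for k x
    proof -
      have "?pt x \<in> P" using x by (auto simp: T_def)
      then show ?thesis using off[of "?pt x" k] off[of "?pt x" "k - M"] k unfolding AB[symmetric] th_def by auto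
    qed
    have gg: "g x = g y" if x: "x \<in> T" and y: "y \<in> T" and s: "\<And>k. k \<in> {..<2 * M} \<Longrightarrow> 0 < (A k + B k * x) * (A k + B k * y)" for x y
    proof -
      obtain i where i: "i \<in> {..<M} \<times> {..<M}" "?in i (?pt x)" using x by (auto simp: T_def)
      have yP: "?pt y \<in> P" using y by (auto simp: T_def)
      have s1: "0 < side (\<theta>1 k) p1 (?pt x) * side (\<theta>1 k) p1 (?pt y)" if "k < M" for k
        using s[of k] that unfolding AB[symmetric] th_def by simp
      have s2: "0 < side (\<theta>2 k) p2 (?pt x) * side (\<theta>2 k) p2 (?pt y)" if "k < M" for k
        using s[of "k + M"] that unfolding AB[symmetric] th_def by simp
      have "?pt y \<in> sector p1 M \<theta>1 (fst i)"
        by (rule sector_cong[OF o1 M _ s1]) (use i in \<open>auto simp: mem_Times_iff\<close>)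
      moreover have "?pt y \<in> sector p2 M \<theta>2 (snd i)"
        by (rule sector_cong[OF o2 M _ s2]) (use i in \<open>auto simp: mem_Times_iff\<close>)
      ultimately show ?thesis using gI[OF i] gI[OF i(1), of y] yP by simp
    qed
    show "finite (g ` T)" by (rule sign_patterns(1)[of "{..<2 * M}" T A B g, OF _ nz gg]) auto
    show "card (g ` T) \<le> card {..<2 * M} + 1" by (rule sign_patterns(2)[of "{..<2 * M}" T A B g, OF _ nz gg]) auto
  qed
  ultimately show ?thesis using card_mono[of "g ` T" ?I] by simp
qed

section \<open>The bush of an organizing point\<close>

lemma line_segment_in_convex:
  assumes A: "convex A" "z \<in> A" "w \<in> A" and p: "on z p" "on w p" and x: "fst z \<le> x" "x \<le> fst w"
  shows "(x, val p x) \<in> A"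
proof (cases "fst z = fst w")
  case True
  then have "x = fst z" using x by simp
  then have "(x, val p x) = z" using p(1) by (simp add: on_def prod_eq_iff)
  then show ?thesis using A(2) by simp
next
  case False
  then have d: "fst w - fst z > 0" using x by simp
  define r where "r = (x - fst z) / (fst w - fst z)"
  have r: "0 \<le> r" "r \<le> 1" unfolding r_def using x d by (auto simp: field_simps)
  have "r * (fst w - fst z) = x - fst z" unfolding r_def using d by simp
  then have xr: "x = (1 - r) * fst z + r * fst w" by (simp add: algebra_simps)
  have "(1 - r) *\<^sub>R z + r *\<^sub>R w \<in> A" using convexD[OF A, of "1 - r" r] r by simp
  moreover have "(1 - r) *\<^sub>R z + r *\<^sub>R w = (x, val p x)"
    using p val_convex_comb[of "1 - r" r p "fst z" "fst w"] xr by (simp add: prod_eq_iff on_def)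
  ultimately show ?thesis by simp
qed

context cells
begin

definition rich_cells :: "real \<times> real \<Rightarrow> (real \<times> real) set set" where
  "rich_cells p = {A\<in>CC. good p A \<and> c0 \<le> real (cr p A)}"

lemma finite_rich_cells [simp]: "finite (rich_cells p)"
  unfolding rich_cells_def using finC by simp

lemma card_rich_cells: "p \<in> Q \<Longrightarrow> real (card (rich_cells p)) \<le> s * \<mu>"
proof -
  assume p: "p \<in> Q"
  have "card (rich_cells p) \<le> card {A\<in>CC. good p A}" unfolding rich_cells_def using finC by (intro card_mono) auto
  then show ?thesis using card_cells_of_line[OF p] by linarith
qed

lemma meets_slope: "meets A p q \<Longrightarrow> fst q \<noteq> fst p"
  unfolding meets_def using on_slope_inj by blast

text \<open>The rich cells along the dual line of \<open>p\<close> are met in the order of the directions at \<open>p\<close>. Bush lines are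
  taken from every \<open>(m / M)\<close>-th cell, so that the cell after a bush line lies inside one sector.\<close>

lemma bush_from_cells:
  fixes p0 :: point and M :: nat
  defines "p \<equiv> dual p0"
  assumes M: "2 \<le> M" "2 * M \<le> card (rich_cells p)"
  shows "\<exists>\<theta> S bz bA. ordered_angles M \<theta> \<and>
     (\<forall>j<M. bz j \<in> Z \<inter> bA j \<and> on (bz j) p \<and> bA j \<in> CC \<and> \<theta> j = ang (fst (bz j))) \<and>
     (\<forall>j<M. \<exists>A\<in>rich_cells p. \<forall>q. meets A p (dual q) \<longrightarrow> q \<in> sector p0 M \<theta> j) \<and>
     (\<forall>j<M. S j \<subseteq> rich_cells p \<and> real (card (S j)) \<le> real (card (rich_cells p)) / real M + 4) \<and>
     (\<forall>j<M. \<forall>A\<in>rich_cells p. \<forall>q. meets A p (dual q) \<longrightarrow> q \<in> sector p0 M \<theta> j \<longrightarrow> A \<in> S j) \<and>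
     (\<forall>j<M. \<forall>A\<in>rich_cells p. \<forall>q. meets A p (dual q) \<longrightarrow> side (\<theta> j) p0 q = 0 \<longrightarrow> good (dual q) (bA j) \<and> on (bz j) (dual q)) \<and>
     (\<forall>A\<in>rich_cells p. \<forall>q. meets A p (dual q) \<longrightarrow> (\<forall>j<M. side (\<theta> j) p0 q \<noteq> 0) \<longrightarrow> (\<exists>j<M. q \<in> sector p0 M \<theta> j))"
proof -
  let ?O = "rich_cells p"
  let ?m = "card ?O"
  have OD: "A \<in> CC" "good p A" if "A \<in> ?O" for A using that by (simp_all add: rich_cells_def)
  have "\<exists>z. z \<in> Z \<inter> A \<and> on z p" if "A \<in> ?O" for A using good_points[OF OD(2)[OF that]] by blast
  then have "\<forall>A\<in>?O. \<exists>z. z \<in> Z \<inter> A \<and> on z p" by (rule ballI)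
  from bchoice[OF this] obtain \<rho> where \<rho>': "\<forall>A\<in>?O. \<rho> A \<in> Z \<inter> A \<and> on (\<rho> A) p" by (rule exE)
  have \<rho>: "\<rho> A \<in> Z" "\<rho> A \<in> A" "on (\<rho> A) p" if "A \<in> ?O" for A using bspec[OF \<rho>' that] by simp_all
  \<comment> \<open>The minus sign lists the cells by decreasing abscissa, that is by increasing
    angle at \<open>p0\<close>.\<close>
  have inj: "inj_on (\<lambda>A. - fst (\<rho> A)) ?O"
  proof (rule inj_onI)
    fix A B assume AB: "A \<in> ?O" "B \<in> ?O" "- fst (\<rho> A) = - fst (\<rho> B)"
    then have "\<rho> A = \<rho> B" using on_fst_inj[OF \<rho>(3)[OF AB(1)] \<rho>(3)[OF AB(2)]] by simp
    then show "A = B" using cell_unique[OF OD(1)[OF AB(1)] OD(1)[OF AB(2)] \<rho>(2)[OF AB(1)]] \<rho>(2)[OF AB(2)] by simp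
  qed
  obtain f where f: "bij_betw f {..<?m} ?O" "\<forall>i j. i < j \<longrightarrow> j < ?m \<longrightarrow> - fst (\<rho> (f i)) < - fst (\<rho> (f j))"
    using sorted_enumeration[OF finite_rich_cells inj] by blast
  have fO: "f i \<in> ?O" if "i < ?m" for i using f(1) that by (auto simp: bij_betw_def)
  \<comment> \<open>Disjoint convex cells cut the dual line of \<open>p0\<close> in disjoint
    intervals, so the order of the chosen points is the order of all points of that line in the
    cells.\<close>
  have order: "fst w < fst z"
    if ij: "i < j" "j < ?m" and z: "z \<in> f i" "on z p" and w: "w \<in> f j" "on w p" for i j z w
  proof (rule ccontr)
    assume "\<not> fst w < fst z"
    then have zw: "fst z \<le> fst w" by simp
    have i: "f i \<in> ?O" and j: "f j \<in> ?O" using fO ij by simp_all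
    have \<rho>ij: "fst (\<rho> (f j)) < fst (\<rho> (f i))" using f(2) ij by simp
    have "f i \<noteq> f j" using \<rho>ij by auto
    then have nb: "\<not> (x \<in> f i \<and> x \<in> f j)" for x using cell_unique[OF OD(1)[OF i] OD(1)[OF j]] by blast
    show False
    proof (cases "fst z \<le> fst (\<rho> (f j))")
      case True
      have "(fst (\<rho> (f j)), val p (fst (\<rho> (f j)))) \<in> f i"
        by (rule line_segment_in_convex[OF conv[OF OD(1)[OF i]] z(1) \<rho>(2)[OF i] z(2) \<rho>(3)[OF i]]) (use True \<rho>ij in auto)
      moreover have "(fst (\<rho> (f j)), val p (fst (\<rho> (f j)))) = \<rho> (f j)" using \<rho>(3)[OF j] by (simp add: on_def prod_eq_iff)
      ultimately show False using nb[of "\<rho> (f j)"] \<rho>(2)[OF j] by simp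
    next
      case False
      have "(fst z, val p (fst z)) \<in> f j"
        by (rule line_segment_in_convex[OF conv[OF OD(1)[OF j]] \<rho>(2)[OF j] w(1) \<rho>(3)[OF j] w(2)]) (use False zw in auto)
      moreover have "(fst z, val p (fst z)) = z" using z(2) by (simp add: on_def prod_eq_iff)
      ultimately show False using nb[of z] z(1) by simp
    qed
  qed
  \<comment> \<open>As there are at least 2 M cells, consecutive positions differ by at least 2, and
    the cell after a bush line lies strictly before the next one.\<close>
  define pos where "pos = (\<lambda>j. j * ?m div M)"
  have dv: "(x + y) div M \<le> x div M + y div M + 1" for x y :: nat
  proof -
    have "x mod M < M" "y mod M < M" using M(1) by simp_all
    then have "(x mod M + y mod M) div M < 2" by (intro less_mult_imp_div_less) linarith
    then show ?thesis using div_add1_eq[of x y M] by linarith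
  qed
  have pos_step: "pos j + 2 \<le> pos (Suc j)" "pos (Suc j) \<le> pos j + ?m div M + 1" for j
  proof -
    have "pos j + 2 = (j * ?m + 2 * M) div M" unfolding pos_def using M(1) by simp
    also have "\<dots> \<le> pos (Suc j)" unfolding pos_def using M(2) by (intro div_le_mono) simp
    finally show "pos j + 2 \<le> pos (Suc j)" .
    have "pos (Suc j) = (j * ?m + ?m) div M" unfolding pos_def by (simp add: add.commute)
    also have "\<dots> \<le> j * ?m div M + ?m div M + 1" by (rule dv)
    finally show "pos (Suc j) \<le> pos j + ?m div M + 1" unfolding pos_def .
  qed
  have pos_mono: "pos i \<le> pos j" if "i \<le> j" for i j unfolding pos_def using that by (intro div_le_mono mult_le_mono1)
  have pos_less: "pos i < pos j" if "i < j" for i j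
    using pos_step(1)[of i] pos_mono[of "Suc i" j] that by simp
  have posM: "pos M = ?m" unfolding pos_def using M(1) by simp
  have pos_m: "pos j + 2 \<le> ?m" if "j < M" for j
    using pos_step(1)[of j] pos_mono[of "Suc j" M] that posM by simp
  have pos0: "pos 0 = 0" by (simp add: pos_def)
  have posO: "f (pos j) \<in> ?O" if "j < M" for j using fO pos_m[OF that] by simp
  define bA where "bA = (\<lambda>j. f (pos j))"
  define bz where "bz = (\<lambda>j. \<rho> (bA j))"
  define X where "X = (\<lambda>j. fst (bz j))"
  define \<theta> where "\<theta> = (\<lambda>j. ang (X j))"
  have bz: "bz j \<in> Z" "bz j \<in> bA j" "on (bz j) p" "bA j \<in> CC" if "j < M" for j
    using \<rho>[OF posO[OF that]] OD[OF posO[OF that]] unfolding bz_def bA_def by simp_all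
  have Xless: "X j < X i" if "i < j" "j < M" for i j
    using f(2) pos_less[OF that(1)] pos_m[OF that(2)] unfolding X_def bz_def bA_def by simp
  have oa: "ordered_angles M \<theta>"
    unfolding ordered_angles_def
  proof (intro conjI allI impI)
    show "strict_mono_on {..<M} \<theta>"
      by (rule strict_mono_onI) (use Xless in \<open>simp add: \<theta>_def ang_less_iff\<close>)
    show "0 \<le> \<theta> j" "\<theta> j < pi" if "j < M" for j using ang_bounds[of "X j"] by (simp_all add: \<theta>_def)
  qed
  \<comment> \<open>If the dual lines of q and \<open>p0\<close> cross at z, the side of q at the
    k-th bush line is a fixed nonzero multiple of \<open>X k - fst z\<close>, up to a positive
    factor. The place of z among the \<open>X k\<close> therefore decides the sector.\<close>
  have sd: "\<exists>\<delta>. \<delta> \<noteq> 0 \<and> (\<forall>k. side (\<theta> k) p0 q = sin (\<theta> k) * \<delta> * (X k - fst z)) \<and> (\<forall>k. 0 < sin (\<theta> k))"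
    if z: "on z p" "on z (dual q)" and sl: "fst (dual q) \<noteq> fst p" for z q
  proof (intro exI conjI allI)
    show "fst (dual q) - fst p \<noteq> 0" using sl by simp
    fix k
    have "val (dual q) (X k) - val p (X k) = (fst (dual q) - fst p) * (X k - fst z)"
      using z by (simp add: on_def val_def algebra_simps)
    then show "side (\<theta> k) p0 q = sin (\<theta> k) * (fst (dual q) - fst p) * (X k - fst z)"
      unfolding \<theta>_def side_ang p_def by simp
    show "0 < sin (\<theta> k)" unfolding \<theta>_def by (rule sin_ang_pos)
  qed
  have prod_neg: "(a * d * x) * (b * d * y) < 0 \<longleftrightarrow> x * y < 0" if "0 < a" "0 < b" "d \<noteq> 0" for a b d x y :: real
  proof -
    have e: "(a * d * x) * (b * d * y) = (a * b * (d * d)) * (x * y)" by (simp add: mult_ac)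
    have "0 < a * b * (d * d)" using that by (auto simp: zero_less_mult_iff linorder_neq_iff)
    then show ?thesis unfolding e using mult_less_cancel_left_pos[of "a * b * (d * d)" "x * y" 0] by simp
  qed
  have sec: "q \<in> sector p0 M \<theta> j \<longleftrightarrow> (if Suc j < M then X (Suc j) < fst z \<and> fst z < X j else fst z < X j \<or> X 0 < fst z)"
    if j: "j < M" and z: "on z p" "on z (dual q)" and sl: "fst (dual q) \<noteq> fst p" for j z q
  proof -
    obtain \<delta> where \<delta>: "\<delta> \<noteq> 0" "\<And>k. side (\<theta> k) p0 q = sin (\<theta> k) * \<delta> * (X k - fst z)" "\<And>k. 0 < sin (\<theta> k)"
      using sd[OF z sl] by blast
    have mem: "q \<in> sector p0 M \<theta> j \<longleftrightarrow> side (\<theta> j) p0 q * side (next_angle M \<theta> j) p0 q < 0"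
      by (rule mem_sector_iff[OF oa M(1) j])
    show ?thesis
    proof (cases "Suc j < M")
      case True
      have "X (Suc j) < X j" using Xless[of j "Suc j"] True by simp
      then have "(X j - fst z) * (X (Suc j) - fst z) < 0 \<longleftrightarrow> X (Suc j) < fst z \<and> fst z < X j"
        by (auto simp: mult_less_0_iff)
      then show ?thesis using True mem prod_neg[OF \<delta>(3)[of j] \<delta>(3)[of "Suc j"] \<delta>(1)] by (simp add: next_angle_def \<delta>(2))
    next
      case False
      then have j0: "0 < j" using M(1) j by simp
      have "X j < X 0" using Xless[OF j0 j] .
      then have "(X j - fst z) * (fst z - X 0) < 0 \<longleftrightarrow> fst z < X j \<or> X 0 < fst z"
        by (auto simp: mult_less_0_iff)
      moreover have "side (next_angle M \<theta> j) p0 q = sin (\<theta> 0) * \<delta> * (fst z - X 0)"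
        using False unfolding next_angle_def by (simp add: side_add_pi \<delta>(2)) (simp add: algebra_simps)
      ultimately show ?thesis using False mem prod_neg[OF \<delta>(3)[of j] \<delta>(3)[of 0] \<delta>(1)] by (simp add: \<delta>(2))
    qed
  qed
  have idx: "\<exists>i<?m. A = f i" if "A \<in> ?O" for A
    using f(1) that by (auto simp: bij_betw_def)
  have cross: "\<exists>z. z \<in> A \<and> on z p \<and> on z (dual q)" if "meets A p (dual q)" for A q
    using that unfolding meets_def by blast
  have below: "fst z < X j" if "i < ?m" "pos j < i" "z \<in> f i" "on z p" "j < M" for i j z
    using order[OF that(2,1) _ _ that(3,4), of "bz j"] bz[OF that(5)] unfolding X_def bA_def by simp
  have above: "X j < fst z" if "i < pos j" "z \<in> f i" "on z p" "j < M" for i j z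
    using order[OF that(1) _ that(2,3), of "bz j"] bz[OF that(4)] pos_m[OF that(4)] unfolding X_def bA_def by simp
  \<comment> \<open>Cell 0 is added to every \<open>S j\<close>: the last sector wraps around and
    also contains crossings in the first cell that lie beyond the first bush line.\<close>
  define S where "S = (\<lambda>j. f ` ({i. i < ?m \<and> pos j \<le> i \<and> i \<le> pos (Suc j)} \<union> {0}))"
  have m0: "0 < ?m" using M by linarith
  show ?thesis
  proof (rule exI[of _ \<theta>], rule exI[of _ S], rule exI[of _ bz], rule exI[of _ bA], intro conjI allI impI ballI)
    show "ordered_angles M \<theta>" by (rule oa)
    fix j assume j: "j < M"
    show "bz j \<in> Z \<inter> bA j" "on (bz j) p" "bA j \<in> CC" "\<theta> j = ang (fst (bz j))"
      using bz[OF j] by (simp_all add: \<theta>_def X_def)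
    show "\<exists>A\<in>?O. \<forall>q. meets A p (dual q) \<longrightarrow> q \<in> sector p0 M \<theta> j"
    proof (intro bexI allI impI)
      have pm: "pos j + 1 < ?m" using pos_m[OF j] by simp
      then show "f (pos j + 1) \<in> ?O" by (rule fO)
      fix q assume q: "meets (f (pos j + 1)) p (dual q)"
      obtain z where z: "z \<in> f (pos j + 1)" "on z p" "on z (dual q)" using cross[OF q] by blast
      have b: "fst z < X j" using below[OF pm _ z(1,2) j] by simp
      moreover have "X (Suc j) < fst z" if "Suc j < M"
        using above[OF _ z(1,2) that] pos_step(1)[of j] by simp
      ultimately show "q \<in> sector p0 M \<theta> j" using sec[OF j z(2,3) meets_slope[OF q]] by simp
    qed
    show "S j \<subseteq> ?O" unfolding S_def using fO m0 by auto
    show "real (card (S j)) \<le> real ?m / real M + 4"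
    proof -
      have "card (S j) \<le> card ({i. i < ?m \<and> pos j \<le> i \<and> i \<le> pos (Suc j)} \<union> {0})" unfolding S_def by (rule card_image_le) auto
      also have "\<dots> \<le> card {i. i < ?m \<and> pos j \<le> i \<and> i \<le> pos (Suc j)} + 1" by (rule order_trans[OF card_Un_le]) simp
      also have "card {i. i < ?m \<and> pos j \<le> i \<and> i \<le> pos (Suc j)} \<le> card {pos j..pos (Suc j)}" by (intro card_mono) auto
      also have "card {pos j..pos (Suc j)} + 1 \<le> ?m div M + 3" using pos_step(2)[of j] by simp
      finally have "card (S j) \<le> ?m div M + 3" by simp
      moreover have "real (?m div M) \<le> real ?m / real M"
      proof -
        have "?m div M * M \<le> ?m" by simp
        then have "real (?m div M * M) \<le> real ?m" by (simp only: of_nat_le_iff)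
        then show ?thesis using M(1) by (simp add: field_simps)
      qed
      ultimately show ?thesis by linarith
    qed
  next
    fix j A q assume j: "j < M" and A: "A \<in> ?O" and q: "meets A p (dual q)" and s: "q \<in> sector p0 M \<theta> j"
    obtain i where i: "i < ?m" "A = f i" using idx[OF A] by blast
    obtain z where z: "z \<in> f i" "on z p" "on z (dual q)" using cross[OF q] i by blast
    have c: "if Suc j < M then X (Suc j) < fst z \<and> fst z < X j else fst z < X j \<or> X 0 < fst z"
      using sec[OF j z(2,3) meets_slope[OF q]] s by simp
    have "i = 0 \<or> (pos j \<le> i \<and> i \<le> pos (Suc j))"
    proof (rule ccontr)
      assume n: "\<not> ?thesis"
      then consider "i < pos j" "0 < i" | "pos (Suc j) < i" "0 < i" by linarith
      then show False
      proof cases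
        case 1
        have "X j < fst z" using above[OF 1(1) z(1,2) j] .
        moreover have "fst z < X 0" using below[OF i(1) _ z(1,2), of 0] 1(2) pos0 M(1) by simp
        ultimately show False using c by (auto split: if_splits)
      next
        case 2
        show False
        proof (cases "Suc j < M")
          case True
          then have "fst z < X (Suc j)" using below[OF i(1) 2(1) z(1,2) True] by simp
          then show False using c True by simp
        next
          case False
          then have "Suc j = M" using j by simp
          then show False using 2(1) i(1) posM by simp
        qed
      qed
    qed
    then show "A \<in> S j" unfolding S_def i(2) using i(1) by blast
  next
    fix j A q assume j: "j < M" and A: "A \<in> ?O" and q: "meets A p (dual q)" and s: "side (\<theta> j) p0 q = 0"
    obtain z where z: "z \<in> A" "on z p" "on z (dual q)" using cross[OF q] by blast
    obtain \<delta> where \<delta>: "\<delta> \<noteq> 0" "\<And>k. side (\<theta> k) p0 q = sin (\<theta> k) * \<delta> * (X k - fst z)" "\<And>k. 0 < sin (\<theta> k)"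
      using sd[OF z(2,3) meets_slope[OF q]] by blast
    have "X j = fst z" using s \<delta>(1) \<delta>(3)[of j] unfolding \<delta>(2) by auto
    then have "bz j = z" using on_fst_inj[OF bz(3)[OF j] z(2)] by (simp add: X_def)
    moreover have "bA j = A"
      using cell_unique[OF bz(4)[OF j] OD(1)[OF A] bz(2)[OF j]] z(1) calculation by simp
    ultimately show "good (dual q) (bA j)" "on (bz j) (dual q)" using q z(3) unfolding meets_def by simp_all
  next
    fix A q assume A: "A \<in> ?O" and q: "meets A p (dual q)" and s: "\<forall>j<M. side (\<theta> j) p0 q \<noteq> 0"
    obtain z where z: "z \<in> A" "on z p" "on z (dual q)" using cross[OF q] by blast
    obtain \<delta> where \<delta>: "\<And>k. side (\<theta> k) p0 q = sin (\<theta> k) * \<delta> * (X k - fst z)"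
      using sd[OF z(2,3) meets_slope[OF q]] by blast
    have nz: "X j \<noteq> fst z" if "j < M" for j using s that \<delta>[of j] by auto
    let ?l = "M - 1"
    have l: "?l < M" "\<not> Suc ?l < M" using M(1) by simp_all
    show "\<exists>j<M. q \<in> sector p0 M \<theta> j"
    proof (cases "fst z < X ?l \<or> X 0 < fst z")
      case True
      then have "q \<in> sector p0 M \<theta> ?l" using sec[OF l(1) z(2,3) meets_slope[OF q]] l(2) by simp
      then show ?thesis using l(1) by blast
    next
      case False
      then have b: "X ?l < fst z" "fst z < X 0" using nz[OF l(1)] nz[of 0] M(1) by auto
      let ?J = "{j. j < M \<and> fst z < X j}"
      have fJ: "finite ?J" "0 \<in> ?J" using b(2) M(1) by auto
      define j where "j = Max ?J"
      have jJ: "j \<in> ?J" unfolding j_def using fJ by (intro Max_in) auto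
      have jl: "j \<noteq> ?l" using jJ b(1) by auto
      then have Sj: "Suc j < M" using jJ by auto
      have "\<not> fst z < X (Suc j)"
      proof
        assume "fst z < X (Suc j)"
        then have "Suc j \<le> Max ?J" using Sj fJ by (intro Max_ge) auto
        then show False unfolding j_def[symmetric] by simp
      qed
      then have "X (Suc j) < fst z" using nz[OF Sj] by simp
      then have "q \<in> sector p0 M \<theta> j" using sec[OF _ z(2,3) meets_slope[OF q], of j] jJ Sj by simp
      then show ?thesis using jJ by blast
    qed
  qed
qed

end

text \<open>The sector clause of \<open>bush\<close> with explicit s and \<mu> in place of powers of
  N; here the covering lines can even be taken from L.\<close>

definition structured_sector ::
    "real \<Rightarrow> real \<Rightarrow> point set set \<Rightarrow> point set \<Rightarrow> point \<Rightarrow> nat \<Rightarrow> (nat \<Rightarrow> real) \<Rightarrow> nat \<Rightarrow> bool" where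
  "structured_sector s \<mu> L P p M \<theta> j \<longleftrightarrow> (\<exists>Q0\<subseteq>P \<inter> sector p M \<theta> j. s\<^sup>2 / (2 * \<mu> ^ 21) \<le> real (card Q0) \<and>
     (\<exists>A\<subseteq>L. finite A \<and> real (card A) \<le> s * \<mu> \<and> (\<forall>q\<in>Q0. \<exists>l\<in>A. \<exists>l'\<in>A. l \<noteq> l' \<and> q \<in> l \<and> q \<in> l')))"

context cells
begin

lemma card_dual_preimage:
  assumes "Y \<subseteq> dual ` P"
  shows "card {q\<in>P. dual q \<in> Y} = card Y"
proof -
  have "dual ` {q\<in>P. dual q \<in> Y} = Y" using assms by blast
  moreover have "card (dual ` {q\<in>P. dual q \<in> Y}) = card {q\<in>P. dual q \<in> Y}"
    by (rule card_image) (rule inj_on_subset[OF dual_inj], simp)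
  ultimately show ?thesis by simp
qed

lemma two_lines_through_good:
  assumes "good (dual q) A"
  shows "\<exists>l\<in>dual_line ` (Z \<inter> A). \<exists>l'\<in>dual_line ` (Z \<inter> A). l \<noteq> l' \<and> q \<in> l \<and> q \<in> l'"
proof -
  obtain x y where xy: "x \<in> Z \<inter> A" "y \<in> Z \<inter> A" "on x (dual q)" "on y (dual q)" "fst x < fst y"
    using good_points[OF assms] by blast
  have "dual_line x \<noteq> dual_line y" using xy(5) injD[OF dual_line_inj, of x y] by auto
  then show ?thesis using xy unfolding on_dual by blast
qed

text \<open>The points are those whose dual lines cross the dual line of p in A. Each of these is
  good in A, hence contains two points of \<open>Z\<close> there, and the lines dual to the at most
  s \<mu> points of the cell cover everything twice.\<close>

lemma structured_sectorI:
  assumes QP: "Q \<subseteq> dual ` P" and ZL: "dual_line ` Z \<subseteq> L" and A: "A \<in> rich_cells (dual p)"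
    and sec: "\<And>q. meets A (dual p) (dual q) \<Longrightarrow> q \<in> sector p M \<theta> j"
  shows "structured_sector s \<mu> L P p M \<theta> j"
proof -
  let ?Q0 = "{q\<in>P. dual q \<in> {q'. meets A (dual p) q'}}"
  have "{q'. meets A (dual p) q'} \<subseteq> dual ` P" using QP goodD(1) unfolding meets_def by blast
  from card_dual_preimage[OF this] have "card ?Q0 = cr (dual p) A" by (simp add: cr_def)
  then have "c0 \<le> real (card ?Q0)" using A by (simp add: rich_cells_def)
  moreover have "?Q0 \<subseteq> P \<inter> sector p M \<theta> j" using sec by blast
  moreover have "dual_line ` (Z \<inter> A) \<subseteq> L" "finite (dual_line ` (Z \<inter> A))" using ZL finZ by auto
  moreover have "real (card (dual_line ` (Z \<inter> A))) \<le> s * \<mu>"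
  proof -
    have "card (dual_line ` (Z \<inter> A)) \<le> card (Z \<inter> A)" using finZ by (intro card_image_le) simp
    moreover have "A \<in> CC" using A by (simp add: rich_cells_def)
    ultimately show ?thesis using cell_points[of A] by linarith
  qed
  moreover have "\<forall>q\<in>?Q0. \<exists>l\<in>dual_line ` (Z \<inter> A). \<exists>l'\<in>dual_line ` (Z \<inter> A). l \<noteq> l' \<and> q \<in> l \<and> q \<in> l'"
    using two_lines_through_good unfolding meets_def by blast
  ultimately show ?thesis unfolding structured_sector_def c0_def by blast
qed

lemma sel_rich:
  assumes "q \<in> sel p1 p2"
  shows "\<exists>A1\<in>rich_cells p1. \<exists>A2\<in>rich_cells p2. meets A1 p1 q \<and> meets A2 p2 q \<and> light T0 q A1 A2 \<and> nice T0 q A1"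
proof -
  obtain A1 A2 where A: "meets A1 p1 q" "c0 \<le> real (cr p1 A1)" "meets A2 p2 q" "c0 \<le> real (cr p2 A2)"
     "light T0 q A1 A2" "nice T0 q A1"
    using assms unfolding sel_def by blast
  have "A1 \<in> rich_cells p1" "A2 \<in> rich_cells p2"
    using A(1-4) goodD(2) unfolding meets_def rich_cells_def by blast+
  then show ?thesis using A by blast
qed

lemma sel_card_le:
  assumes "\<And>q. q \<in> Y \<Longrightarrow> \<exists>A\<in>rich_cells p. meets A p q"
  shows "real (card Y) \<le> real (card (rich_cells p)) * (s * \<mu>)\<^sup>2"
proof -
  have sub: "Y \<subseteq> (\<Union>A\<in>rich_cells p. GA A)" using assms unfolding meets_def GA_def by blast
  have "card Y \<le> card (\<Union>A\<in>rich_cells p. GA A)" using sub by (intro card_mono) auto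
  also have "\<dots> \<le> (\<Sum>A\<in>rich_cells p. card (GA A))" by (rule card_UN_le) simp
  finally have "real (card Y) \<le> (\<Sum>A\<in>rich_cells p. real (card (GA A)))" by (simp flip: of_nat_sum)
  also have "\<dots> \<le> (\<Sum>A\<in>rich_cells p. (s * \<mu>)\<^sup>2)" by (intro sum_mono card_GA) (simp add: rich_cells_def)
  finally show ?thesis by simp
qed

text \<open>Every member of Y is good in one of the rich cells, and a cell has at most (s \<mu>)^2
  good lines.\<close>

lemma rich_cells_many:
  assumes "\<And>q. q \<in> Y \<Longrightarrow> \<exists>A\<in>rich_cells p. meets A p q" "s ^ 3 / \<mu> ^ 41 \<le> real (card Y)"
  shows "s / \<mu> ^ 43 \<le> real (card (rich_cells p))"
proof -
  have "s ^ 3 / \<mu> ^ 41 \<le> real (card (rich_cells p)) * (s * \<mu>)\<^sup>2"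
    using sel_card_le[of Y p] assms by (metis order_trans)
  moreover have "s ^ 3 / \<mu> ^ 41 = s / \<mu> ^ 43 * (s * \<mu>)\<^sup>2"
  proof -
    have "\<mu> ^ 43 = \<mu> ^ 41 * \<mu>\<^sup>2" by (simp flip: power_add)
    then show ?thesis using s_pos by (simp add: power_mult_distrib power2_eq_square power3_eq_cube)
  qed
  ultimately have "s / \<mu> ^ 43 * (s * \<mu>)\<^sup>2 \<le> real (card (rich_cells p)) * (s * \<mu>)\<^sup>2" by simp
  moreover have "(s * \<mu>)\<^sup>2 > 0" using s_pos by simp
  ultimately show ?thesis by (simp only: mult_le_cancel_right_pos)
qed

text \<open>\<open>P'\<close> consists of the points whose dual lines are selected for the pair,
  apart from those on bush lines. A sector involves at most \<mu>^46 cells. Two such factors, the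
  factor \<mu> of the points of a cell and T0 <= \<mu>^426 give the exponent 519; one such factor,
  T0 and 2 \<mu> <= \<mu>^2 give 474.\<close>

theorem bushes_from_cells:
  assumes many: "s ^ 4 / \<mu> \<le> (\<Sum>A\<in>CC. real (card (GA A)))"
    and P: "finite P" "Q \<subseteq> dual ` P" and L: "finite L" "dual_line ` Z \<subseteq> L"
  shows "\<exists>p1 p2 M \<theta>1 \<theta>2 P'. p1 \<in> P \<and> p2 \<in> P \<and> p1 \<noteq> p2 \<and> 2 \<le> M \<and> s / \<mu> ^ 44 \<le> real M \<and> real M \<le> s * \<mu> \<and>
     ordered_angles M \<theta>1 \<and> ordered_angles M \<theta>2 \<and> (\<forall>j<M. line_at p1 (\<theta>1 j) \<in> L \<and> line_at p2 (\<theta>2 j) \<in> L) \<and>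
     (\<forall>j<M. structured_sector s \<mu> L P p1 M \<theta>1 j \<and> structured_sector s \<mu> L P p2 M \<theta>2 j) \<and>
     P' \<subseteq> P \<and> s ^ 3 / \<mu> ^ 42 \<le> real (card P') \<and> (\<forall>q\<in>P'. s / \<mu> \<le> real (card {l\<in>L. q \<in> l})) \<and>
     (\<forall>q\<in>P'. \<forall>k<M. side (\<theta>1 k) p1 q \<noteq> 0 \<and> side (\<theta>2 k) p2 q \<noteq> 0) \<and>
     (\<forall>q\<in>P'. (\<exists>i<M. q \<in> sector p1 M \<theta>1 i) \<and> (\<exists>j<M. q \<in> sector p2 M \<theta>2 j)) \<and>
     (\<forall>i<M. \<forall>j<M. real (card (P' \<inter> sector p1 M \<theta>1 i \<inter> sector p2 M \<theta>2 j)) \<le> s * \<mu> ^ 519) \<and>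
     (\<forall>j<M. real (card (P' \<inter> sector p1 M \<theta>1 j)) * s \<le> \<mu> ^ 474 * real (card (lines_meeting L (P' \<inter> sector p1 M \<theta>1 j))))"
proof -
  obtain d1 d2 where d: "d1 \<in> Q" "d2 \<in> Q" "d1 \<noteq> d2" "s ^ 3 / \<mu> ^ 41 \<le> real (card (sel d1 d2))"
    using selected_pair[OF many] by blast
  obtain p1 where p1: "p1 \<in> P" "d1 = dual p1" using d(1) P(2) by blast
  obtain p2 where p2: "p2 \<in> P" "d2 = dual p2" using d(2) P(2) by blast
  let ?O1 = "rich_cells (dual p1)" and ?O2 = "rich_cells (dual p2)"
  have selQ: "sel d1 d2 \<subseteq> Q" by (auto simp: sel_def)
  have sel1: "\<exists>A\<in>?O1. meets A (dual p1) q" and sel2: "\<exists>A\<in>?O2. meets A (dual p2) q" if "q \<in> sel d1 d2" for q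
    using sel_rich[OF that] unfolding p1(2) p2(2) by blast+
  have m: "s / \<mu> ^ 43 \<le> real (card ?O1)" "s / \<mu> ^ 43 \<le> real (card ?O2)"
    using rich_cells_many[OF sel1 d(4)] rich_cells_many[OF sel2 d(4)] by simp_all
  have mu: "real (card ?O1) \<le> s * \<mu>" "real (card ?O2) \<le> s * \<mu>"
    using card_rich_cells d(1,2) p1(2) p2(2) by simp_all
  \<comment> \<open>One M serves both bushes; halving provides the two cells per bush line that
    \<open>bush_from_cells\<close> requires.\<close>
  define M where "M = min (card ?O1) (card ?O2) div 2"
  have M2m: "2 * M \<le> card ?O1" "2 * M \<le> card ?O2" unfolding M_def by simp_all
  have Mlow: "s / \<mu> ^ 44 \<le> real M" "2 \<le> M"
  proof -
    have e: "\<mu> ^ 44 = \<mu> ^ 43 * \<mu>" by (simp flip: power_Suc2)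
    have "s / \<mu> ^ 44 = s / \<mu> ^ 43 / \<mu>" unfolding e by simp
    also have "\<dots> \<le> s / \<mu> ^ 43 / 4" using \<mu>1000 s_pos by (intro divide_left_mono) auto
    finally have q: "4 * (s / \<mu> ^ 44) \<le> s / \<mu> ^ 43" by simp
    have "2 * \<mu> ^ 44 \<le> \<mu> * \<mu> ^ 44" using \<mu>1000 s_pos by (intro mult_right_mono) auto
    also have "\<dots> = \<mu> ^ 45" by (simp flip: power_Suc)
    also have "\<dots> \<le> s" by (rule s_ge) simp
    finally have two: "2 \<le> s / \<mu> ^ 44" using s_pos by (simp add: pos_le_divide_eq)
    have "min (card ?O1) (card ?O2) \<le> 2 * M + 1" unfolding M_def by simp
    then have "real (min (card ?O1) (card ?O2)) \<le> 2 * real M + 1" by linarith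
    moreover have "s / \<mu> ^ 43 \<le> real (min (card ?O1) (card ?O2))" using m by (simp add: min_def)
    ultimately have "4 * (s / \<mu> ^ 44) \<le> 2 * real M + 1" using q by linarith
    then show "s / \<mu> ^ 44 \<le> real M" using two by linarith
    then show "2 \<le> M" using two by linarith
  qed
  have Mup: "real M \<le> s * \<mu>" using M2m(1) mu(1) by linarith
  obtain \<theta>1 S1 bz1 bA1 where b1: "ordered_angles M \<theta>1"
     "\<forall>j<M. bz1 j \<in> Z \<inter> bA1 j \<and> on (bz1 j) (dual p1) \<and> bA1 j \<in> CC \<and> \<theta>1 j = ang (fst (bz1 j))"
     "\<forall>j<M. \<exists>A\<in>?O1. \<forall>q. meets A (dual p1) (dual q) \<longrightarrow> q \<in> sector p1 M \<theta>1 j"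
     "\<forall>j<M. S1 j \<subseteq> ?O1 \<and> real (card (S1 j)) \<le> real (card ?O1) / real M + 4"
     "\<forall>j<M. \<forall>A\<in>?O1. \<forall>q. meets A (dual p1) (dual q) \<longrightarrow> q \<in> sector p1 M \<theta>1 j \<longrightarrow> A \<in> S1 j"
     "\<forall>j<M. \<forall>A\<in>?O1. \<forall>q. meets A (dual p1) (dual q) \<longrightarrow> side (\<theta>1 j) p1 q = 0 \<longrightarrow> good (dual q) (bA1 j) \<and> on (bz1 j) (dual q)"
     "\<forall>A\<in>?O1. \<forall>q. meets A (dual p1) (dual q) \<longrightarrow> (\<forall>j<M. side (\<theta>1 j) p1 q \<noteq> 0) \<longrightarrow> (\<exists>j<M. q \<in> sector p1 M \<theta>1 j)"
    using bush_from_cells[OF Mlow(2) M2m(1)] by (elim exE conjE) (rule that)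
  obtain \<theta>2 S2 bz2 bA2 where b2: "ordered_angles M \<theta>2"
     "\<forall>j<M. bz2 j \<in> Z \<inter> bA2 j \<and> on (bz2 j) (dual p2) \<and> bA2 j \<in> CC \<and> \<theta>2 j = ang (fst (bz2 j))"
     "\<forall>j<M. \<exists>A\<in>?O2. \<forall>q. meets A (dual p2) (dual q) \<longrightarrow> q \<in> sector p2 M \<theta>2 j"
     "\<forall>j<M. S2 j \<subseteq> ?O2 \<and> real (card (S2 j)) \<le> real (card ?O2) / real M + 4"
     "\<forall>j<M. \<forall>A\<in>?O2. \<forall>q. meets A (dual p2) (dual q) \<longrightarrow> q \<in> sector p2 M \<theta>2 j \<longrightarrow> A \<in> S2 j"
     "\<forall>j<M. \<forall>A\<in>?O2. \<forall>q. meets A (dual p2) (dual q) \<longrightarrow> side (\<theta>2 j) p2 q = 0 \<longrightarrow> good (dual q) (bA2 j) \<and> on (bz2 j) (dual q)"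
     "\<forall>A\<in>?O2. \<forall>q. meets A (dual p2) (dual q) \<longrightarrow> (\<forall>j<M. side (\<theta>2 j) p2 q \<noteq> 0) \<longrightarrow> (\<exists>j<M. q \<in> sector p2 M \<theta>2 j)"
    using bush_from_cells[OF Mlow(2) M2m(2)] by (elim exE conjE) (rule that)
  have ratio: "real n / real M + 4 \<le> \<mu> ^ 46" if "real n \<le> s * \<mu>" for n
  proof -
    have sp: "s / \<mu> ^ 44 > 0" using s_pos by simp
    have Mp: "real M > 0" using Mlow(2) by simp
    have "real n / real M \<le> s * \<mu> / real M" using that Mp by (intro divide_right_mono) auto
    also have "\<dots> \<le> s * \<mu> / (s / \<mu> ^ 44)" using Mlow(1) sp Mp s_pos by (intro divide_left_mono) auto
    also have "\<dots> = \<mu> ^ 45" using s_pos by (simp flip: power_Suc)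
    finally have "real n / real M \<le> \<mu> ^ 45" .
    moreover have "4 \<le> \<mu> ^ 45" using \<mu>_power[of 1 45] \<mu>1000 by simp
    moreover have "2 * \<mu> ^ 45 \<le> \<mu> * \<mu> ^ 45" using \<mu>1000 s_pos by (intro mult_right_mono) auto
    moreover have "\<mu> * \<mu> ^ 45 = \<mu> ^ 46" by (simp flip: power_Suc)
    ultimately show ?thesis by linarith
  qed
  have S1: "S1 j \<subseteq> ?O1" "finite (S1 j)" "real (card (S1 j)) \<le> \<mu> ^ 46" if j: "j < M" for j
  proof -
    have h: "S1 j \<subseteq> ?O1" "real (card (S1 j)) \<le> real (card ?O1) / real M + 4" using b1(4) j by blast+
    show "S1 j \<subseteq> ?O1" by (rule h(1))
    show "finite (S1 j)" by (rule finite_subset[OF h(1) finite_rich_cells])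
    show "real (card (S1 j)) \<le> \<mu> ^ 46" using h(2) ratio[OF mu(1)] by linarith
  qed
  have S2: "S2 j \<subseteq> ?O2" "finite (S2 j)" "real (card (S2 j)) \<le> \<mu> ^ 46" if j: "j < M" for j
  proof -
    have h: "S2 j \<subseteq> ?O2" "real (card (S2 j)) \<le> real (card ?O2) / real M + 4" using b2(4) j by blast+
    show "S2 j \<subseteq> ?O2" by (rule h(1))
    show "finite (S2 j)" by (rule finite_subset[OF h(1) finite_rich_cells])
    show "real (card (S2 j)) \<le> \<mu> ^ 46" using h(2) ratio[OF mu(2)] by linarith
  qed
  define P0 where "P0 = {q\<in>P. dual q \<in> sel d1 d2}"
  \<comment> \<open>Points on bush lines belong to no sector. For members of \<open>P0\<close> the
    dual line then passes through the point chosen for that bush line and is good in its cell, so at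
    most 2 s^2 \<mu>^2 points are lost.\<close>
  define P' where "P' = {q\<in>P0. \<forall>k<M. side (\<theta>1 k) p1 q \<noteq> 0 \<and> side (\<theta>2 k) p2 q \<noteq> 0}"
  have P0: "P0 \<subseteq> P" "finite P0" unfolding P0_def using P(1) by auto
  have P'0: "P' \<subseteq> P0" "finite P'" unfolding P'_def using P0(2) by auto
  have cP0: "card P0 = card (sel d1 d2)" unfolding P0_def by (rule card_dual_preimage) (use selQ P(2) in blast)
  have get: "\<exists>A1\<in>?O1. \<exists>A2\<in>?O2. meets A1 (dual p1) (dual q) \<and> meets A2 (dual p2) (dual q) \<and> light T0 (dual q) A1 A2 \<and> nice T0 (dual q) A1"
    if "q \<in> P0" for q
    using sel_rich[of "dual q" d1 d2] that unfolding P0_def p1(2) p2(2) by blast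
  let ?N1 = "\<lambda>k. {q\<in>P. good (dual q) (bA1 k) \<and> on (bz1 k) (dual q)}"
  let ?N2 = "\<lambda>k. {q\<in>P. good (dual q) (bA2 k) \<and> on (bz2 k) (dual q)}"
  have N: "real (card {q\<in>P. good (dual q) A \<and> on z (dual q)}) \<le> s * \<mu>" if "z \<in> Z \<inter> A" "A \<in> CC" for z A
  proof -
    have "{q\<in>P. good (dual q) A \<and> on z (dual q)} = {q\<in>P. dual q \<in> {q'. good q' A \<and> on z q'}}" by blast
    then have "card {q\<in>P. good (dual q) A \<and> on z (dual q)} = card {q'. good q' A \<and> on z q'}"
      using card_dual_preimage[of "{q'. good q' A \<and> on z q'}" P] P(2) goodD(1) by (simp only:) blast
    then show ?thesis using good_through_point[OF that] by simp
  qed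
  have cover: "P0 \<subseteq> P' \<union> ((\<Union>k<M. ?N1 k) \<union> (\<Union>k<M. ?N2 k))"
  proof
    fix q assume q: "q \<in> P0"
    show "q \<in> P' \<union> ((\<Union>k<M. ?N1 k) \<union> (\<Union>k<M. ?N2 k))"
    proof (cases "q \<in> P'")
      case False
      then obtain k where k: "k < M" "side (\<theta>1 k) p1 q = 0 \<or> side (\<theta>2 k) p2 q = 0" using q unfolding P'_def by blast
      obtain A1 A2 where A: "A1 \<in> ?O1" "A2 \<in> ?O2" "meets A1 (dual p1) (dual q)" "meets A2 (dual p2) (dual q)"
        using get[OF q] by blast
      have qP: "q \<in> P" using q P0(1) by blast
      from k(2) show ?thesis
      proof
        assume "side (\<theta>1 k) p1 q = 0"
        then have "q \<in> ?N1 k" using b1(6) k(1) A(1,3) qP by blast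
        then show ?thesis using k(1) by blast
      next
        assume "side (\<theta>2 k) p2 q = 0"
        then have "q \<in> ?N2 k" using b2(6) k(1) A(2,4) qP by blast
        then show ?thesis using k(1) by blast
      qed
    qed simp
  qed
  have cN: "real (card (\<Union>k<M. ?N1 k)) \<le> s * \<mu> * (s * \<mu>)" "real (card (\<Union>k<M. ?N2 k)) \<le> s * \<mu> * (s * \<mu>)"
  proof -
    have gen: "real (card (\<Union>k<M. F k)) \<le> s * \<mu> * (s * \<mu>)" if F: "\<And>k. k < M \<Longrightarrow> real (card (F k)) \<le> s * \<mu>" for F :: "nat \<Rightarrow> point set"
    proof -
      have "card (\<Union>k<M. F k) \<le> (\<Sum>k<M. card (F k))" by (rule card_UN_le) simp
      then have "real (card (\<Union>k<M. F k)) \<le> (\<Sum>k<M. real (card (F k)))" by (simp flip: of_nat_sum)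
      also have "\<dots> \<le> (\<Sum>k<M. s * \<mu>)" using F by (intro sum_mono) auto
      also have "\<dots> = real M * (s * \<mu>)" by simp
      also have "\<dots> \<le> s * \<mu> * (s * \<mu>)" using Mup s_pos by (intro mult_right_mono) auto
      finally show ?thesis .
    qed
    show "real (card (\<Union>k<M. ?N1 k)) \<le> s * \<mu> * (s * \<mu>)" by (rule gen, rule N) (use b1(2) in blast)+
    show "real (card (\<Union>k<M. ?N2 k)) \<le> s * \<mu> * (s * \<mu>)" by (rule gen, rule N) (use b2(2) in blast)+
  qed
  have cP': "s ^ 3 / \<mu> ^ 42 \<le> real (card P')"
  proof -
    have fN: "finite ((\<Union>k<M. ?N1 k) \<union> (\<Union>k<M. ?N2 k))" using P(1) by simp
    have "card P0 \<le> card (P' \<union> ((\<Union>k<M. ?N1 k) \<union> (\<Union>k<M. ?N2 k)))" using cover P'0(2) fN by (intro card_mono) auto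
    also have "\<dots> \<le> card P' + (card (\<Union>k<M. ?N1 k) + card (\<Union>k<M. ?N2 k))"
      by (intro order_trans[OF card_Un_le] add_mono card_Un_le order_refl)
    finally have "real (card P0) \<le> real (card P') + (real (card (\<Union>k<M. ?N1 k)) + real (card (\<Union>k<M. ?N2 k)))" by linarith
    then have "s ^ 3 / \<mu> ^ 41 \<le> real (card P') + 2 * (s * \<mu> * (s * \<mu>))" using cN d(4) cP0 by simp
    moreover have "2 * (s * \<mu> * (s * \<mu>)) \<le> s ^ 3 / \<mu> ^ 42"
    proof -
      have "2 * \<mu> ^ 44 \<le> \<mu> * \<mu> ^ 44" using \<mu>1000 s_pos by (intro mult_right_mono) auto
      also have "\<dots> = \<mu> ^ 45" by (simp flip: power_Suc)
      also have "\<dots> \<le> s" by (rule s_ge) simp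
      finally have "s\<^sup>2 * (2 * \<mu> ^ 44) \<le> s\<^sup>2 * s" by (intro mult_left_mono) auto
      moreover have "\<mu> ^ 44 = \<mu> * \<mu> * \<mu> ^ 42" by (simp add: mult.assoc flip: power_Suc)
      ultimately have "2 * (s * \<mu> * (s * \<mu>)) * \<mu> ^ 42 \<le> s ^ 3" by (simp add: power2_eq_square power3_eq_cube mult_ac)
      then show ?thesis using s_pos by (simp add: pos_le_divide_eq)
    qed
    moreover have "2 * (s ^ 3 / \<mu> ^ 42) \<le> s ^ 3 / \<mu> ^ 41"
    proof -
      have e: "\<mu> ^ 42 = \<mu> ^ 41 * \<mu>" by (simp flip: power_Suc2)
      have "s ^ 3 / \<mu> ^ 42 = s ^ 3 / \<mu> ^ 41 / \<mu>" unfolding e by simp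
      also have "\<dots> \<le> s ^ 3 / \<mu> ^ 41 / 2" using \<mu>1000 s_pos by (intro divide_left_mono) auto
      finally show ?thesis by simp
    qed
    ultimately show ?thesis by linarith
  qed
  have deg: "s / \<mu> \<le> real (card {l\<in>L. q \<in> l})" if q: "q \<in> P'" for q
  proof -
    have qQ: "dual q \<in> Q" using q P'0(1) selQ unfolding P0_def by blast
    have "card {z\<in>Z. on z (dual q)} = card (dual_line ` {z\<in>Z. on z (dual q)})"
      by (rule card_image[symmetric]) (rule inj_on_subset[OF dual_line_inj], simp)
    also have "\<dots> \<le> card {l\<in>L. q \<in> l}" using L unfolding on_dual by (intro card_mono) auto
    finally show ?thesis using deg_lo[OF qQ] by linarith
  qed
  have cellb: "real (card (P' \<inter> sector p1 M \<theta>1 i \<inter> sector p2 M \<theta>2 j)) \<le> s * \<mu> ^ 519" if ij: "i < M" "j < M" for i j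
  proof -
    let ?F = "\<lambda>A1 A2. {q\<in>P. dual q \<in> {q'. light T0 q' A1 A2 \<and> good q' A2}}"
    \<comment> \<open>The cells in which the dual line of q crosses those of \<open>p1\<close> and
      \<open>p2\<close> are confined to \<open>S1 i\<close> and \<open>S2 j\<close>, and for each
      pair of cells lightness bounds the number of q.\<close>
    have sub: "P' \<inter> sector p1 M \<theta>1 i \<inter> sector p2 M \<theta>2 j \<subseteq> (\<Union>A1\<in>S1 i. \<Union>A2\<in>S2 j. ?F A1 A2)"
    proof
      fix q assume q: "q \<in> P' \<inter> sector p1 M \<theta>1 i \<inter> sector p2 M \<theta>2 j"
      then have q0: "q \<in> P0" "q \<in> P" using P'0(1) P0(1) by blast+
      obtain A1 A2 where A: "A1 \<in> ?O1" "A2 \<in> ?O2" "meets A1 (dual p1) (dual q)" "meets A2 (dual p2) (dual q)" "light T0 (dual q) A1 A2"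
        using get[OF q0(1)] by blast
      have "A1 \<in> S1 i" using b1(5) ij(1) A(1,3) q by blast
      moreover have "A2 \<in> S2 j" using b2(5) ij(2) A(2,4) q by blast
      moreover have "good (dual q) A2" using A(4) unfolding meets_def by blast
      ultimately show "q \<in> (\<Union>A1\<in>S1 i. \<Union>A2\<in>S2 j. ?F A1 A2)" using A(5) q0(2) by blast
    qed
    have F: "real (card (?F A1 A2)) \<le> s * \<mu> * real T0" if "A1 \<in> S1 i" for A1 A2
    proof -
      have "A1 \<in> CC" using that S1(1)[OF ij(1)] unfolding rich_cells_def by blast
      moreover have "card (?F A1 A2) = card {q'. light T0 q' A1 A2 \<and> good q' A2}"
        by (rule card_dual_preimage) (use P(2) goodD(1) in blast)
      ultimately show ?thesis using light_count[of A1 T0 A2] by simp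
    qed
    have "card (P' \<inter> sector p1 M \<theta>1 i \<inter> sector p2 M \<theta>2 j) \<le> card (\<Union>A1\<in>S1 i. \<Union>A2\<in>S2 j. ?F A1 A2)"
      using sub P(1) S1(2)[OF ij(1)] S2(2)[OF ij(2)] by (intro card_mono) auto
    also have "\<dots> \<le> (\<Sum>A1\<in>S1 i. card (\<Union>A2\<in>S2 j. ?F A1 A2))" by (rule card_UN_le[OF S1(2)[OF ij(1)]])
    also have "\<dots> \<le> (\<Sum>A1\<in>S1 i. \<Sum>A2\<in>S2 j. card (?F A1 A2))" by (intro sum_mono card_UN_le S2(2) ij(2))
    finally have "real (card (P' \<inter> sector p1 M \<theta>1 i \<inter> sector p2 M \<theta>2 j)) \<le> real (\<Sum>A1\<in>S1 i. \<Sum>A2\<in>S2 j. card (?F A1 A2))"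
      by (simp only: of_nat_le_iff)
    also have "\<dots> = (\<Sum>A1\<in>S1 i. \<Sum>A2\<in>S2 j. real (card (?F A1 A2)))" by simp
    also have "\<dots> \<le> (\<Sum>A1\<in>S1 i. \<Sum>A2\<in>S2 j. s * \<mu> * real T0)" by (intro sum_mono F)
    also have "\<dots> = real (card (S1 i)) * (real (card (S2 j)) * (s * \<mu> * real T0))" by simp
    also have "\<dots> \<le> \<mu> ^ 46 * (\<mu> ^ 46 * (s * \<mu> * \<mu> ^ 426))"
      using S1(3)[OF ij(1)] S2(3)[OF ij(2)] T0_bounds(2) s_pos by (intro mult_mono) auto
    also have "\<dots> = s * (\<mu> ^ 46 * (\<mu> ^ 46 * (\<mu> ^ 1 * \<mu> ^ 426)))" by (simp add: mult_ac)
    also have "\<mu> ^ 46 * (\<mu> ^ 46 * (\<mu> ^ 1 * \<mu> ^ 426)) = \<mu> ^ 519" by (simp only: power_add[symmetric]) simp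
    finally show ?thesis .
  qed
  have lm: "real (card (P' \<inter> sector p1 M \<theta>1 j)) * s \<le> \<mu> ^ 474 * real (card (lines_meeting L (P' \<inter> sector p1 M \<theta>1 j)))" if j: "j < M" for j
  proof -
    let ?Y = "P' \<inter> sector p1 M \<theta>1 j" and ?LM = "lines_meeting L (P' \<inter> sector p1 M \<theta>1 j)"
    let ?F = "\<lambda>A. {q\<in>?Y. good (dual q) A \<and> nice T0 (dual q) A}"
    have fY: "finite ?Y" using P'0(2) by simp
    have sub: "?Y \<subseteq> (\<Union>A\<in>S1 j. ?F A)"
    proof
      fix q assume q: "q \<in> ?Y"
      then have q0: "q \<in> P0" using P'0(1) by blast
      obtain A1 where A: "A1 \<in> ?O1" "meets A1 (dual p1) (dual q)" "nice T0 (dual q) A1" using get[OF q0] by blast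
      have "A1 \<in> S1 j" using b1(5) j A(1,2) q by blast
      moreover have "good (dual q) A1" using A(2) unfolding meets_def by blast
      ultimately show "q \<in> (\<Union>A\<in>S1 j. ?F A)" using q A(3) by blast
    qed
    have fF: "finite (?F A)" for A by (rule finite_subset[OF _ fY]) blast
    have F: "real (card (?F A)) * (s / (2 * \<mu>)) \<le> real (card ?LM) * real T0" for A
    proof -
      have c: "card (dual ` ?F A) = card (?F A)" by (rule card_image) (rule inj_on_subset[OF dual_inj], simp)
      have "real (card (dual ` ?F A)) * (s / (2 * \<mu>)) \<le> real (card {z\<in>Z. \<exists>q\<in>dual ` ?F A. on z q}) * real T0"
        using fF by (intro nice_count[where A = A]) auto
      moreover have "card {z\<in>Z. \<exists>q\<in>dual ` ?F A. on z q} \<le> card ?LM"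
      proof (rule card_inj_on_le[of dual_line])
        show "inj_on dual_line {z\<in>Z. \<exists>q\<in>dual ` ?F A. on z q}" by (rule inj_on_subset[OF dual_line_inj]) simp
        show "dual_line ` {z\<in>Z. \<exists>q\<in>dual ` ?F A. on z q} \<subseteq> ?LM"
        proof (rule image_subsetI)
          fix z assume z: "z \<in> {z\<in>Z. \<exists>q\<in>dual ` ?F A. on z q}"
          then obtain q where "q \<in> ?Y" "on z (dual q)" by blast
          then show "dual_line z \<in> ?LM" using z L(2) unfolding lines_meeting_def on_dual by blast
        qed
        show "finite ?LM" using L(1) by (simp add: lines_meeting_def)
      qed
      then have "real (card {z\<in>Z. \<exists>q\<in>dual ` ?F A. on z q}) * real T0 \<le> real (card ?LM) * real T0"
        by (intro mult_right_mono) auto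
      ultimately show ?thesis unfolding c by linarith
    qed
    have "card ?Y \<le> card (\<Union>A\<in>S1 j. ?F A)" using S1(2)[OF j] fF by (intro card_mono[OF _ sub] finite_UN_I)
    also have "\<dots> \<le> (\<Sum>A\<in>S1 j. card (?F A))" by (rule card_UN_le[OF S1(2)[OF j]])
    finally have "real (card ?Y) \<le> real (\<Sum>A\<in>S1 j. card (?F A))" by (simp only: of_nat_le_iff)
    then have "real (card ?Y) * (s / (2 * \<mu>)) \<le> (\<Sum>A\<in>S1 j. real (card (?F A))) * (s / (2 * \<mu>))"
      using s_pos by (intro mult_right_mono) auto
    also have "\<dots> = (\<Sum>A\<in>S1 j. real (card (?F A)) * (s / (2 * \<mu>)))" by (simp only: sum_distrib_right)
    also have "\<dots> \<le> (\<Sum>A\<in>S1 j. real (card ?LM) * real T0)" by (intro sum_mono F)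
    also have "\<dots> = real (card (S1 j)) * (real (card ?LM) * real T0)" by simp
    also have "\<dots> \<le> \<mu> ^ 46 * (real (card ?LM) * \<mu> ^ 426)"
      using S1(3)[OF j] T0_bounds(2) s_pos by (intro mult_mono mult_left_mono) auto
    finally have "real (card ?Y) * (s / (2 * \<mu>)) * (2 * \<mu>) \<le> \<mu> ^ 46 * (real (card ?LM) * \<mu> ^ 426) * (2 * \<mu>)"
      using s_pos by (intro mult_right_mono) auto
    moreover have "real (card ?Y) * (s / (2 * \<mu>)) * (2 * \<mu>) = real (card ?Y) * s" using s_pos by simp
    moreover have "\<mu> ^ 46 * (real (card ?LM) * \<mu> ^ 426) * (2 * \<mu>) = 2 * (\<mu> ^ 46 * (\<mu> ^ 426 * \<mu> ^ 1)) * real (card ?LM)" by (simp add: mult_ac)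
    moreover have "\<mu> ^ 46 * (\<mu> ^ 426 * \<mu> ^ 1) = \<mu> ^ 473" by (simp only: power_add[symmetric]) simp
    moreover have "2 * \<mu> ^ 473 * real (card ?LM) \<le> \<mu> * \<mu> ^ 473 * real (card ?LM)"
      using \<mu>1000 s_pos by (intro mult_right_mono) auto
    moreover have "\<mu> * \<mu> ^ 473 = \<mu> ^ 474" by (simp only: power_Suc[symmetric]) simp
    ultimately show ?thesis by (simp only:)
  qed
  show ?thesis
  proof (rule exI[of _ p1], rule exI[of _ p2], rule exI[of _ M], rule exI[of _ \<theta>1], rule exI[of _ \<theta>2], rule exI[of _ P'], intro conjI allI impI ballI)
    show "p1 \<in> P" "p2 \<in> P" "2 \<le> M" "s / \<mu> ^ 44 \<le> real M" "real M \<le> s * \<mu>" "ordered_angles M \<theta>1" "ordered_angles M \<theta>2"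
      "s ^ 3 / \<mu> ^ 42 \<le> real (card P')"
      by fact+
    show "p1 \<noteq> p2" using d(3) p1(2) p2(2) by blast
    show "P' \<subseteq> P" using P'0(1) P0(1) by blast
    show "structured_sector s \<mu> L P p1 M \<theta>1 j" if "j < M" for j
      using b1(3) that structured_sectorI[OF P(2) L(2)] by blast
    show "structured_sector s \<mu> L P p2 M \<theta>2 j" if "j < M" for j
      using b2(3) that structured_sectorI[OF P(2) L(2)] by blast
    show "line_at p1 (\<theta>1 j) \<in> L" if "j < M" for j
    proof -
      have z: "bz1 j \<in> Z" "p1 \<in> dual_line (bz1 j)" "\<theta>1 j = ang (fst (bz1 j))" using b1(2) that unfolding on_dual by blast+
      show ?thesis unfolding z(3) line_at_ang[OF z(2)] using L(2) z(1) by blast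
    qed
    show "line_at p2 (\<theta>2 j) \<in> L" if "j < M" for j
    proof -
      have z: "bz2 j \<in> Z" "p2 \<in> dual_line (bz2 j)" "\<theta>2 j = ang (fst (bz2 j))" using b2(2) that unfolding on_dual by blast+
      show ?thesis unfolding z(3) line_at_ang[OF z(2)] using L(2) z(1) by blast
    qed
    show "s / \<mu> \<le> real (card {l\<in>L. q \<in> l})" if "q \<in> P'" for q by (rule deg[OF that])
    show "side (\<theta>1 k) p1 q \<noteq> 0" "side (\<theta>2 k) p2 q \<noteq> 0" if "q \<in> P'" "k < M" for q k using that unfolding P'_def by blast+
    show "\<exists>i<M. q \<in> sector p1 M \<theta>1 i" if q: "q \<in> P'" for q
    proof -
      have "q \<in> P0" using q P'0(1) by blast
      then obtain A1 where "A1 \<in> ?O1" "meets A1 (dual p1) (dual q)" using get by blast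
      then show ?thesis using b1(7) q unfolding P'_def by blast
    qed
    show "\<exists>j<M. q \<in> sector p2 M \<theta>2 j" if q: "q \<in> P'" for q
    proof -
      have "q \<in> P0" using q P'0(1) by blast
      then obtain A2 where "A2 \<in> ?O2" "meets A2 (dual p2) (dual q)" using get by blast
      then show ?thesis using b2(7) q unfolding P'_def by blast
    qed
    show "real (card (P' \<inter> sector p1 M \<theta>1 i \<inter> sector p2 M \<theta>2 j)) \<le> s * \<mu> ^ 519" if "i < M" "j < M" for i j
      by (rule cellb[OF that])
    show "real (card (P' \<inter> sector p1 M \<theta>1 j)) * s \<le> \<mu> ^ 474 * real (card (lines_meeting L (P' \<inter> sector p1 M \<theta>1 j)))" if "j < M" for j
      by (rule lm[OF that])
  qed
qed

end

section \<open>Asymptotics\<close>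

text \<open>A point lies on only one horizontal line, so the lines without a dual contribute at most
  |P| incidences.\<close>

lemma card_incidences_le:
  assumes "finite L" "finite P" "\<And>l. l \<in> L \<Longrightarrow> is_line l"
  shows "card (incidences L P) \<le> card (incs (dual_line -` L) (dual ` P)) + card P"
proof -
  let ?Z = "dual_line -` L" and ?f = "\<lambda>w. (dual_line (fst w), inv dual (snd w))"
    and ?h = "\<lambda>p :: point. ({x :: point. x $ 2 = p $ 2}, p)"
  have finZ: "finite ?Z" by (rule finite_vimageI[OF assms(1) dual_line_inj])
  have fin: "finite (incs ?Z (dual ` P))" using finZ assms(2) by simp
  have "incidences L P \<subseteq> ?f ` incs ?Z (dual ` P) \<union> ?h ` P"
  proof
    fix w assume "w \<in> incidences L P"
    then obtain l p where w: "w = (l, p)" "l \<in> L" "p \<in> P" "p \<in> l" unfolding incidences_def by blast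
    from is_line_cases[OF assms(3)[OF w(2)]] show "w \<in> ?f ` incs ?Z (dual ` P) \<union> ?h ` P"
    proof
      assume "\<exists>z. l = dual_line z"
      then obtain z where z: "l = dual_line z" by blast
      then have "on z (dual p)" using w(4) by (simp add: on_dual)
      then have "(z, dual p) \<in> incs ?Z (dual ` P)" using w z by (simp add: incs_def)
      moreover have "w = ?f (z, dual p)" using w(1) z by (simp add: inv_f_f[OF dual_inj])
      ultimately show ?thesis by (intro UnI1) (rule image_eqI)
    next
      assume "\<exists>c. l = {p. p $ 2 = c}"
      then have "w = ?h p" using w(1,4) by auto
      then show ?thesis using w(3) by (intro UnI2) (rule image_eqI)
    qed
  qed
  then have "card (incidences L P) \<le> card (?f ` incs ?Z (dual ` P) \<union> ?h ` P)"
    using fin assms(2) by (intro card_mono) auto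
  also have "\<dots> \<le> card (incs ?Z (dual ` P)) + card P"
    by (intro order_trans[OF card_Un_le] add_mono card_image_le fin assms(2))
  finally show ?thesis .
qed

lemma card_incidences:
  assumes "finite L" "finite P"
  shows "card (incidences L P) = (\<Sum>q\<in>P. card {l\<in>L. q \<in> l})"
proof -
  have "incidences L P = prod.swap ` (SIGMA q:P. {l\<in>L. q \<in> l})" by (auto simp: incidences_def image_iff)
  then show ?thesis using assms by (simp add: card_image)
qed

text \<open>The summand s^3 in the number of incidences pays for the horizontal lines, which are
  dropped in the dual plane.\<close>

lemma extremal_bushes:
  fixes s \<nu> :: real
  assumes L: "finite L" "\<forall>l\<in>L. is_line l" "real (card L) \<le> s ^ 3"
    and P: "finite P" "real (card P) \<le> s ^ 3"
    and I: "s ^ 4 / \<nu> + s ^ 3 \<le> real (card (incidences L P))" and st: "st_const (s ^ 3) \<nu>"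
    and \<nu>: "\<nu> \<ge> 1000" and s: "s \<ge> (\<nu> ^ 40) ^ 200" and \<mu>: "\<mu> = \<nu> ^ 40"
  shows "\<exists>p1 p2 M \<theta>1 \<theta>2 P'. p1 \<in> P \<and> p2 \<in> P \<and> p1 \<noteq> p2 \<and> 2 \<le> M \<and> s / \<mu> ^ 44 \<le> real M \<and> real M \<le> s * \<mu> \<and>
     ordered_angles M \<theta>1 \<and> ordered_angles M \<theta>2 \<and> (\<forall>j<M. line_at p1 (\<theta>1 j) \<in> L \<and> line_at p2 (\<theta>2 j) \<in> L) \<and>
     (\<forall>j<M. structured_sector s \<mu> L P p1 M \<theta>1 j \<and> structured_sector s \<mu> L P p2 M \<theta>2 j) \<and>
     P' \<subseteq> P \<and> s ^ 3 / \<mu> ^ 42 \<le> real (card P') \<and> (\<forall>q\<in>P'. s / \<mu> \<le> real (card {l\<in>L. q \<in> l})) \<and>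
     (\<forall>q\<in>P'. \<forall>k<M. side (\<theta>1 k) p1 q \<noteq> 0 \<and> side (\<theta>2 k) p2 q \<noteq> 0) \<and>
     (\<forall>q\<in>P'. (\<exists>i<M. q \<in> sector p1 M \<theta>1 i) \<and> (\<exists>j<M. q \<in> sector p2 M \<theta>2 j)) \<and>
     (\<forall>i<M. \<forall>j<M. real (card (P' \<inter> sector p1 M \<theta>1 i \<inter> sector p2 M \<theta>2 j)) \<le> s * \<mu> ^ 519) \<and>
     (\<forall>j<M. real (card (P' \<inter> sector p1 M \<theta>1 j)) * s \<le> \<mu> ^ 474 * real (card (lines_meeting L (P' \<inter> sector p1 M \<theta>1 j))))"
proof -
  let ?Z = "dual_line -` L" and ?Q = "dual ` P"
  have finZ: "finite ?Z" by (rule finite_vimageI[OF L(1) dual_line_inj])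
  have "card ?Z \<le> card L"
    by (rule card_inj_on_le[of dual_line]) (use L(1) in \<open>auto intro: inj_on_subset[OF dual_line_inj]\<close>)
  then have cZ: "real (card ?Z) \<le> s ^ 3" using L(3) by linarith
  have "card ?Q \<le> card P" by (rule card_image_le[OF P(1)])
  then have cQ: "real (card ?Q) \<le> s ^ 3" using P(2) by linarith
  have "s ^ 4 / \<nu> \<le> real (card (incs ?Z ?Q))"
    using I P(2) card_incidences_le[OF L(1) P(1) bspec[OF L(2)]] by linarith
  from extremal_cells[OF finite_imageI[OF P(1)] cQ finZ cZ this st \<nu> s]
  obtain Q1 Z1 CC where c: "Q1 \<subseteq> ?Q" "Z1 \<subseteq> ?Z" "cells Q1 Z1 CC s (\<nu> ^ 40)"
      "s ^ 4 / \<nu> ^ 40 \<le> (\<Sum>A\<in>CC. real (card (cells.GA Q1 Z1 CC A)))"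
    by (elim exE conjE) (rule that)
  have "dual_line ` Z1 \<subseteq> L" using c(2) by blast
  from cells.bushes_from_cells[OF c(3) c(4) P(1) c(1) L(1) this] show ?thesis unfolding \<mu> .
qed

text \<open>The logarithm in \<open>st_const\<close> is beaten by ln N <= N^a / a with a = D e / 2:
  of the two factors N^a available, one absorbs the constant over a.\<close>

lemma large_scale:
  assumes e: "0 < e" and D: "1 \<le> (D :: real)" and C: "1 \<le> C"
  shows "\<exists>N0\<ge>2. \<forall>N\<ge>N0. 1000 \<le> N powr (D * e) \<and> 2 * C \<le> N powr e \<and> st_const N (N powr (D * e))"
proof -
  \<comment> \<open>The logarithm of (N + 2) (N + 1) <= N^4 yields 86 * 4 = 344, and 688 / e is 344
    / a for the smallest possible a = e / 2.\<close>
  define B where "B = 1000 + 2 * C + 688 / e"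
  have "688 / e > 0" using e by simp
  then have B: "1000 \<le> B" "2 * C \<le> B" "688 / e \<le> B" unfolding B_def using C by linarith+
  define N0 where "N0 = max 2 (B powr (2 / e))"
  have "1000 \<le> N powr (D * e) \<and> 2 * C \<le> N powr e \<and> st_const N (N powr (D * e))" if N: "N0 \<le> N" for N
  proof -
    let ?a = "D * e / 2"
    have N2: "2 \<le> N" "B powr (2 / e) \<le> N" using N by (auto simp: N0_def)
    have ae: "e / 2 \<le> ?a" "0 < ?a" using e D by simp_all
    have "B = (B powr (2 / e)) powr (e / 2)" using B(1) e by (simp add: powr_powr)
    also have "\<dots> \<le> N powr (e / 2)" using N2(2) e by (intro powr_mono2) auto
    finally have b: "B \<le> N powr (e / 2)" .
    also have ba: "\<dots> \<le> N powr ?a" using ae N2(1) by (intro powr_mono) auto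
    finally have Ba: "B \<le> N powr ?a" .
    have a2: "?a \<le> D * e" using ae(2) by simp
    have aD: "N powr ?a \<le> N powr (D * e)" using a2 N2(1) by (intro powr_mono) auto
    have ee: "N powr (e / 2) \<le> N powr e" using e N2(1) by (intro powr_mono) auto
    have "2 \<le> N * N" using N2(1) mult_mono[of 2 N 1 N] by simp
    then have "4 \<le> N * N" using N2(1) mult_mono[of 2 N 2 N] by simp
    moreover have "3 * N \<le> 2 * (N * N)" using N2(1) mult_right_mono[of 2 N N] by simp
    ultimately have "(N + 2) * (N + 1) \<le> 4 * (N * N)" by (simp add: algebra_simps)
    also have "\<dots> \<le> (N * N) * (N * N)" using \<open>4 \<le> N * N\<close> by (intro mult_right_mono) auto
    also have "\<dots> = N ^ 4" by (simp add: power4_eq_xxxx mult.assoc)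
    finally have "ln ((N + 2) * (N + 1)) \<le> ln (N ^ 4)" using N2(1) by (intro ln_mono) auto
    also have "\<dots> = 4 * ln N" using N2(1) by (simp add: ln_realpow)
    also have "\<dots> \<le> 4 * (N powr ?a / ?a)" using ln_powr_bound[of N ?a] N2(1) ae(2) by simp
    finally have "86 * ln ((N + 2) * (N + 1)) \<le> (344 / ?a) * N powr ?a" by simp
    also have "\<dots> \<le> N powr ?a * N powr ?a"
    proof (rule mult_right_mono)
      have "344 / ?a \<le> 344 / (e / 2)" using ae e by (intro divide_left_mono) auto
      also have "\<dots> \<le> N powr ?a" using B(3) Ba by simp
      finally show "344 / ?a \<le> N powr ?a" .
    qed simp
    also have "\<dots> = N powr (D * e)" by (simp flip: powr_add)
    finally show ?thesis using b Ba aD ee B unfolding st_const_def by linarith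
  qed
  then show ?thesis by (intro exI[of _ N0]) (simp add: N0_def)
qed

text \<open>Each N^(a-) may hide its own multiple of e. The losses K' and g and the range of e are
  fixed in terms of K alone, while the multiplicative constant and the size of N may depend on e and
  C. In the last clause hypothesis and conclusion hide different losses, hence every k is answered
  by g k.\<close>

theorem theorem3p20:
  fixes K :: real
  assumes "K \<ge> 0"
  shows "\<exists>K'\<ge>0. \<exists>g :: real \<Rightarrow> real. \<exists>e1>0. \<forall>e. 0 < e \<and> e \<le> e1 \<longrightarrow>
    (\<forall>C\<ge>1. \<exists>C'\<ge>1. \<exists>N0\<ge>1. \<forall>N\<ge>N0. \<forall>L P.
      extremal K C e N L P \<longrightarrow>
      (\<exists>p1 p2 M1 M2 \<theta>1 \<theta>2 P'.
         p1 \<noteq> p2 \<and>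
         organizing K' C' e N L P p1 \<and> organizing K' C' e N L P p2 \<and>
         bush K' C' e N L P p1 M1 \<theta>1 \<and> bush K' C' e N L P p2 M2 \<theta>2 \<and>
         refinement K' C' e N L P P' \<and>
         point_weighted_cell_decomposition K' C' e N L P' (sqrt (real (M1 * M2)))
           ({..<M1} \<times> {..<M2})
           (\<lambda>(i, j). P' \<inter> sector p1 M1 \<theta>1 i \<inter> sector p2 M2 \<theta>2 j) \<and>
         (\<forall>k\<ge>0. \<forall>j<M1.
            real (card (P' \<inter> sector p1 M1 \<theta>1 j)) \<ge> N powr (2/3 - k * e) \<longrightarrow>
            real (card (lines_meeting L (P' \<inter> sector p1 M1 \<theta>1 j))) \<ge> N powr (1 - g k * e))))"
proof -
  \<comment> \<open>The unit added to K gives \<nu> = N^(D e) a spare factor N^e, which absorbs 2 C.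
    Then \<mu> = N^(40 D e), and 24000 = 40 * 600 leaves room for the largest exponent 521 of \<mu>
    that \<open>K'\<close> has to cover; 18960 = 40 * 474 is the loss in the count of lines. The
    bound e1 is what \<mu>^200 <= N^(1/3) requires.\<close>
  define D where "D = K + 1"
  define K' where "K' = 24000 * D"
  define g :: "real \<Rightarrow> real" where "g = (\<lambda>k. k + 18960 * D)"
  define e1 where "e1 = 1 / (24000 * D)"
  have D: "1 \<le> D" and KK: "K \<le> K'" "0 \<le> K'" and e1: "0 < e1" using assms by (auto simp: D_def K'_def e1_def)
  have main: "\<exists>p1 p2 M1 M2 \<theta>1 \<theta>2 P'.
         p1 \<noteq> p2 \<and>
         organizing K' (C + 3) e N L P p1 \<and> organizing K' (C + 3) e N L P p2 \<and>
         bush K' (C + 3) e N L P p1 M1 \<theta>1 \<and> bush K' (C + 3) e N L P p2 M2 \<theta>2 \<and>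
         refinement K' (C + 3) e N L P P' \<and>
         point_weighted_cell_decomposition K' (C + 3) e N L P' (sqrt (real (M1 * M2)))
           ({..<M1} \<times> {..<M2})
           (\<lambda>(i, j). P' \<inter> sector p1 M1 \<theta>1 i \<inter> sector p2 M2 \<theta>2 j) \<and>
         (\<forall>k\<ge>0. \<forall>j<M1.
            real (card (P' \<inter> sector p1 M1 \<theta>1 j)) \<ge> N powr (2/3 - k * e) \<longrightarrow>
            real (card (lines_meeting L (P' \<inter> sector p1 M1 \<theta>1 j))) \<ge> N powr (1 - g k * e))"
    if e: "0 < e" "e \<le> e1" and C: "1 \<le> C" and N2: "2 \<le> N" and big: "1000 \<le> N powr (D * e)" "2 * C \<le> N powr e"
      and st: "st_const N (N powr (D * e))" and ext: "extremal K C e N L P"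
    for e C N :: real and L P
  proof -
    define \<nu> where "\<nu> = N powr (D * e)"
    define d where "d = 40 * (D * e)"
    define \<mu> where "\<mu> = \<nu> ^ 40"
    define s where "s = N powr (1/3)"
    have conf: "finite L" "finite P" "\<And>l. l \<in> L \<Longrightarrow> is_line l" "N powr (1 - K * e) / C \<le> real (card L)" "real (card L) \<le> N"
       "real (card P) \<le> N" "N powr (4/3 - K * e) / C \<le> real (card (incidences L P))"
      using ext unfolding extremal_def configuration_def by blast+
    have pw: "N powr a \<le> N powr b" if "a \<le> b" for a b using that N2 by (intro powr_mono) auto
    have Npos: "N > 0" using N2 by simp
    have mu: "\<mu> = N powr d" unfolding \<mu>_def \<nu>_def d_def using Npos by (simp add: powr_power)
    have sa: "s ^ n = N powr (real n / 3)" for n unfolding s_def using Npos by (simp add: powr_power)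
    have ma: "\<mu> ^ n = N powr (real n * d)" for n unfolding mu using Npos by (simp add: powr_power mult.commute)
    have s3: "s ^ 3 = N" unfolding sa using Npos by simp
    have d0: "0 < d" using e D by (simp add: d_def)
    have De: "D * e \<le> 1 / 24000"
    proof -
      have "D * e \<le> D * e1" using e D by (intro mult_left_mono) auto
      then show ?thesis using D by (simp add: e1_def)
    qed
    have dK: "K' * e = 600 * d" "K * e = D * e - e" unfolding K'_def d_def D_def by (simp_all add: algebra_simps)
    have K'1: "N powr (a - K' * e) / (C + 3) \<le> N powr b" if "a - 600 * d \<le> b" for a b
    proof -
      have "N powr (a - K' * e) / (C + 3) \<le> N powr (a - K' * e) / 1" using C by (intro divide_left_mono) auto
      also have "\<dots> \<le> N powr b" using pw[of "a - K' * e" b] that unfolding dK by simp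
      finally show ?thesis .
    qed
    have "s ^ 4 / \<nu> = N powr (4/3 - D * e)" unfolding sa \<nu>_def by (simp add: powr_diff)
    moreover have "N powr (4/3 - D * e) * 2 \<le> N powr (4/3 - K * e) / C"
    proof -
      have "4/3 - K * e = (4/3 - D * e) + e" unfolding dK by simp
      then have "N powr (4/3 - K * e) = N powr (4/3 - D * e) * N powr e" by (simp only: powr_add)
      moreover have "N powr (4/3 - D * e) * (2 * C) \<le> N powr (4/3 - D * e) * N powr e" using big(2) by (intro mult_left_mono) auto
      ultimately show ?thesis using C by (simp add: pos_le_divide_eq mult.assoc)
    qed
    moreover have "N \<le> N powr (4/3 - D * e)" using pw[of 1 "4/3 - D * e"] De Npos by simp
    ultimately have inc: "s ^ 4 / \<nu> + s ^ 3 \<le> real (card (incidences L P))" using conf(7) unfolding s3 by linarith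
    have ss: "s \<ge> (\<nu> ^ 40) ^ 200" unfolding \<mu>_def[symmetric] ma s_def using De by (intro pw) (simp add: d_def)
    have cL: "real (card L) \<le> s ^ 3" and cP: "real (card P) \<le> s ^ 3" unfolding s3 by fact+
    have confl: "\<forall>l\<in>L. is_line l" using conf(3) by (rule ballI)
    have st': "st_const (s ^ 3) \<nu>" unfolding s3 \<nu>_def by (rule st)
    obtain p1 p2 M \<theta>1 \<theta>2 P' where p: "p1 \<in> P" "p2 \<in> P" "p1 \<noteq> p2" and M: "2 \<le> M" "s / \<mu> ^ 44 \<le> real M" "real M \<le> s * \<mu>"
      and o: "ordered_angles M \<theta>1" "ordered_angles M \<theta>2" and la: "\<forall>j<M. line_at p1 (\<theta>1 j) \<in> L \<and> line_at p2 (\<theta>2 j) \<in> L"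
      and str: "\<forall>j<M. structured_sector s \<mu> L P p1 M \<theta>1 j \<and> structured_sector s \<mu> L P p2 M \<theta>2 j"
      and P': "P' \<subseteq> P" "s ^ 3 / \<mu> ^ 42 \<le> real (card P')" and dg: "\<forall>q\<in>P'. s / \<mu> \<le> real (card {l\<in>L. q \<in> l})"
      and off: "\<forall>q\<in>P'. \<forall>k<M. side (\<theta>1 k) p1 q \<noteq> 0 \<and> side (\<theta>2 k) p2 q \<noteq> 0"
      and cov: "\<forall>q\<in>P'. (\<exists>i<M. q \<in> sector p1 M \<theta>1 i) \<and> (\<exists>j<M. q \<in> sector p2 M \<theta>2 j)"
      and cel: "\<forall>i<M. \<forall>j<M. real (card (P' \<inter> sector p1 M \<theta>1 i \<inter> sector p2 M \<theta>2 j)) \<le> s * \<mu> ^ 519"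
      and lm: "\<forall>j<M. real (card (P' \<inter> sector p1 M \<theta>1 j)) * s \<le> \<mu> ^ 474 * real (card (lines_meeting L (P' \<inter> sector p1 M \<theta>1 j)))"
      using extremal_bushes[OF conf(1) confl cL conf(2) cP inc st' big(1)[folded \<nu>_def] ss \<mu>_def]
      by (elim exE conjE) (rule that)
    have fP': "finite P'" by (rule finite_subset[OF P'(1) conf(2)])
    have Mlow: "N powr (1/3 - K' * e) / (C + 3) \<le> real M"
    proof -
      have "N powr (1/3 - K' * e) / (C + 3) \<le> N powr (1/3 - 44 * d)" using d0 by (intro K'1) simp
      also have "\<dots> = s / \<mu> ^ 44" unfolding ma s_def by (simp add: powr_diff)
      finally show ?thesis using M(2) by linarith
    qed
    have sec: "\<exists>Q. Q \<subseteq> P \<inter> sector p M \<theta> j \<and> structured K' e N Q \<and> N powr (2/3 - K' * e) / (C + 3) \<le> real (card Q)"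
      if S: "structured_sector s \<mu> L P p M \<theta> j" for p \<theta> j
    proof -
      obtain Q0 A where Q0: "Q0 \<subseteq> P \<inter> sector p M \<theta> j" "s\<^sup>2 / (2 * \<mu> ^ 21) \<le> real (card Q0)"
        and A: "A \<subseteq> L" "finite A" "real (card A) \<le> s * \<mu>" "\<forall>q\<in>Q0. \<exists>l\<in>A. \<exists>l'\<in>A. l \<noteq> l' \<and> q \<in> l \<and> q \<in> l'"
        using S unfolding structured_sector_def by (elim exE conjE) (rule that)
      have "finite Q0" by (rule finite_subset[OF Q0(1)]) (simp add: conf(2))
      have "2 \<le> \<mu>"
      proof -
        have "N powr (D * e) \<le> N powr d" using e D by (intro pw) (simp add: d_def)
        then show ?thesis using big(1) unfolding mu by linarith
      qed
      then have "2 * \<mu> ^ 21 \<le> \<mu> * \<mu> ^ 21" by (intro mult_right_mono) auto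
      also have "\<dots> = \<mu> ^ 22" by (simp flip: power_Suc)
      finally have m22: "2 * \<mu> ^ 21 \<le> \<mu> ^ 22" .
      have "N powr (2/3 - 22 * d) = s\<^sup>2 / \<mu> ^ 22" unfolding ma sa by (simp add: powr_diff)
      also have "\<dots> \<le> s\<^sup>2 / (2 * \<mu> ^ 21)" using m22 \<open>2 \<le> \<mu>\<close> by (intro divide_left_mono) auto
      finally have c: "N powr (2/3 - 22 * d) \<le> real (card Q0)" using Q0(2) by linarith
      have c1: "N powr (2/3 - K' * e) \<le> real (card Q0)"
        using pw[of "2/3 - K' * e" "2/3 - 22 * d"] d0 c unfolding dK by linarith
      have c2: "N powr (2/3 - K' * e) / (C + 3) \<le> real (card Q0)"
        using K'1[of "2/3" "2/3 - 22 * d"] d0 c by linarith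
      have "s * \<mu> = N powr (1/3 + d)" unfolding mu s_def by (simp add: powr_add)
      also have "\<dots> \<le> N powr (1/3 + K' * e)" unfolding dK using d0 by (intro pw) simp
      finally have "real (card A) \<le> N powr (1/3 + K' * e)" using A(3) by linarith
      then have "structured K' e N Q0" unfolding structured_def using \<open>finite Q0\<close> c1 A conf(3) by blast
      then show ?thesis using Q0(1) c2 by blast
    qed
    have bush: "bush K' (C + 3) e N L P p1 M \<theta>1" "bush K' (C + 3) e N L P p2 M \<theta>2"
    proof -
      have la': "\<forall>j<M. line_at p1 (\<theta>1 j) \<in> L" "\<forall>j<M. line_at p2 (\<theta>2 j) \<in> L" using la by simp_all
      have sec': "\<forall>j<M. \<exists>Q. Q \<subseteq> P \<inter> sector p1 M \<theta>1 j \<and> structured K' e N Q \<and> N powr (2/3 - K' * e) / (C + 3) \<le> real (card Q)"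
          "\<forall>j<M. \<exists>Q. Q \<subseteq> P \<inter> sector p2 M \<theta>2 j \<and> structured K' e N Q \<and> N powr (2/3 - K' * e) / (C + 3) \<le> real (card Q)"
        using str by (intro allI impI sec; simp)+
      show "bush K' (C + 3) e N L P p1 M \<theta>1"
        unfolding bush_def by (intro conjI o(1) la'(1) Mlow sec'(1))
      show "bush K' (C + 3) e N L P p2 M \<theta>2"
        unfolding bush_def by (intro conjI o(2) la'(2) Mlow sec'(2))
    qed
    have organ: "organizing K' (C + 3) e N L P p1" "organizing K' (C + 3) e N L P p2"
      unfolding organizing_def using p(1,2) bush by (iprover intro: conjI exI)+
    have cP': "N powr (1 - 42 * d) \<le> real (card P')"
      using P'(2) unfolding ma sa by (simp add: powr_diff)
    have ref: "refinement K' (C + 3) e N L P P'"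
      unfolding refinement_def extremal_def configuration_def
    proof (intro conjI ballI)
      show "P' \<subseteq> P" "finite L" "finite P'" "real (card L) \<le> N" by fact+
      show "is_line l" if "l \<in> L" for l by (rule conf(3)[OF that])
      show "real (card P') \<le> N" using card_mono[OF conf(2) P'(1)] conf(6) by linarith
      show "N powr (1 - K' * e) / (C + 3) \<le> real (card P')" using K'1[of 1 "1 - 42 * d"] d0 cP' by linarith
      have "N powr (1 - K' * e) / (C + 3) \<le> N powr (1 - K * e) / C"
        using C KK e pw[of "1 - K' * e" "1 - K * e"] by (intro frac_le) (auto intro!: mult_right_mono)
      then show "N powr (1 - K' * e) / (C + 3) \<le> real (card L)" using conf(4) by linarith
      have "N powr (4/3 - K' * e) / (C + 3) \<le> N powr (4/3 - 43 * d)" using d0 by (intro K'1) simp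
      also have "\<dots> = N powr (1 - 42 * d) * (s / \<mu>)" unfolding mu s_def by (simp flip: powr_diff powr_add)
      also have "\<dots> \<le> real (card P') * (s / \<mu>)" using cP' by (intro mult_right_mono) (auto simp: s_def mu)
      also have "\<dots> = (\<Sum>q\<in>P'. s / \<mu>)" by simp
      also have "\<dots> \<le> (\<Sum>q\<in>P'. real (card {l\<in>L. q \<in> l}))" using dg by (intro sum_mono) blast
      also have "\<dots> = real (card (incidences L P'))" unfolding card_incidences[OF conf(1) fP'] by simp
      finally show "N powr (4/3 - K' * e) / (C + 3) \<le> real (card (incidences L P'))" .
    qed
    have r: "sqrt (real (M * M)) = real M" by simp
    let ?cell = "\<lambda>(i, j). P' \<inter> sector p1 M \<theta>1 i \<inter> sector p2 M \<theta>2 j"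
    have cells: "point_weighted_cell_decomposition K' (C + 3) e N L P' (real M) ({..<M} \<times> {..<M}) ?cell"
      unfolding point_weighted_cell_decomposition_def
    proof (intro conjI ballI)
      show "finite ({..<M} \<times> {..<M})" by simp
      show "real (card ({..<M} \<times> {..<M})) = (real M)\<^sup>2" by (simp add: power2_eq_square)
      show "disjoint_family_on ?cell ({..<M} \<times> {..<M})"
        unfolding disjoint_family_on_def
      proof (intro ballI impI)
        fix x y assume xy: "x \<in> {..<M} \<times> {..<M}" "y \<in> {..<M} \<times> {..<M}" "x \<noteq> y"
        show "?cell x \<inter> ?cell y = {}"
        proof (rule ccontr)
          assume "?cell x \<inter> ?cell y \<noteq> {}"
          then obtain q where "q \<in> sector p1 M \<theta>1 (fst x)" "q \<in> sector p1 M \<theta>1 (fst y)"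
             "q \<in> sector p2 M \<theta>2 (snd x)" "q \<in> sector p2 M \<theta>2 (snd y)" by (auto simp: case_prod_beta)
          then have "fst x = fst y" "snd x = snd y"
            using sector_unique[OF o(1) M(1), of "fst x" "fst y"] sector_unique[OF o(2) M(1), of "snd x" "snd y"] xy by auto
          then show False using xy(3) by (simp add: prod_eq_iff)
        qed
      qed
      show "(\<Union>i\<in>{..<M} \<times> {..<M}. ?cell i) = P'"
      proof
        show "P' \<subseteq> (\<Union>i\<in>{..<M} \<times> {..<M}. ?cell i)"
        proof
          fix q assume q: "q \<in> P'"
          then obtain i j where "i < M" "j < M" "q \<in> sector p1 M \<theta>1 i" "q \<in> sector p2 M \<theta>2 j" using cov by blast
          then show "q \<in> (\<Union>i\<in>{..<M} \<times> {..<M}. ?cell i)" using q by (intro UN_I[of "(i, j)"]) auto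
        qed
      qed auto
      show "real (card {i\<in>{..<M} \<times> {..<M}. ?cell i \<inter> l \<noteq> {}}) \<le> (C + 3) * real M" if "l \<in> L" for l
      proof -
        have "card {i\<in>{..<M} \<times> {..<M}. ?cell i \<inter> l \<noteq> {}} \<le> 2 * M + 1"
          unfolding case_prod_beta by (rule card_cells_on_line[OF o M(1) conf(3)[OF that]]) (use off in blast)
        \<comment> \<open>This 3 is the reason for the constant C + 3.\<close>
        also have "\<dots> \<le> 3 * M" using M(1) by simp
        finally have "real (card {i\<in>{..<M} \<times> {..<M}. ?cell i \<inter> l \<noteq> {}}) \<le> 3 * real M" by linarith
        also have "\<dots> \<le> (C + 3) * real M" using C by (intro mult_right_mono) auto
        finally show ?thesis .
      qed
      show "real (card (?cell i)) \<le> (C + 3) * (N powr (1 + K' * e) / (real M)\<^sup>2)" if i: "i \<in> {..<M} \<times> {..<M}" for i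
      proof -
        have Mp: "0 < (real M)\<^sup>2" using M(1) by simp
        have "(real M)\<^sup>2 \<le> (s * \<mu>)\<^sup>2" using M(3) by (intro power_mono) auto
        then have "s * \<mu> ^ 519 * (real M)\<^sup>2 \<le> s * \<mu> ^ 519 * (s * \<mu>)\<^sup>2" by (intro mult_left_mono) (auto simp: s_def mu)
        also have "\<dots> = (s * s\<^sup>2) * (\<mu> ^ 519 * \<mu>\<^sup>2)" by (simp only: power_mult_distrib mult_ac)
        also have "\<dots> = s ^ 3 * \<mu> ^ 521" by (simp flip: power_Suc power_add)
        also have "\<dots> = N powr (1 + 521 * d)" unfolding sa ma by (simp add: powr_add)
        also have "\<dots> \<le> N powr (1 + K' * e)" unfolding dK using d0 by (intro pw) simp
        also have "\<dots> \<le> (C + 3) * N powr (1 + K' * e)" using C by (simp add: mult_le_cancel_right1)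
        finally have "s * \<mu> ^ 519 \<le> (C + 3) * N powr (1 + K' * e) / (real M)\<^sup>2" using Mp by (simp only: pos_le_divide_eq)
        moreover have "real (card (?cell i)) \<le> s * \<mu> ^ 519" using cel i by (simp add: case_prod_beta mem_Times_iff)
        ultimately show ?thesis by simp
      qed
    qed
    have lines: "N powr (1 - g k * e) \<le> real (card (lines_meeting L (P' \<inter> sector p1 M \<theta>1 j)))"
      if j: "j < M" "N powr (2/3 - k * e) \<le> real (card (P' \<inter> sector p1 M \<theta>1 j))" for k j
    proof -
      have "N powr (1 - g k * e) * \<mu> ^ 474 = N powr (2/3 - k * e) * s"
        unfolding ma s_def g_def d_def powr_add[symmetric] by (simp add: algebra_simps)
      also have "\<dots> \<le> real (card (P' \<inter> sector p1 M \<theta>1 j)) * s" using j(2) by (intro mult_right_mono) (auto simp: s_def)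
      also have "\<dots> \<le> real (card (lines_meeting L (P' \<inter> sector p1 M \<theta>1 j))) * \<mu> ^ 474" using lm j(1) by (simp add: mult.commute)
      finally show ?thesis using Npos by (simp add: mu)
    qed
    show ?thesis
      by (rule exI[of _ p1], rule exI[of _ p2], rule exI[of _ M], rule exI[of _ M], rule exI[of _ \<theta>1], rule exI[of _ \<theta>2], rule exI[of _ P'])
        (unfold r, intro conjI allI impI p(3) organ bush ref cells lines; assumption)
  qed
  show ?thesis
  proof (rule exI[of _ K'], rule conjI[OF KK(2)], rule exI[of _ g], rule exI[of _ e1], rule conjI[OF e1], intro allI impI)
    fix e C :: real assume e: "0 < e \<and> e \<le> e1" and C: "1 \<le> C"
    obtain N0 where N0: "N0 \<ge> 2" "\<And>N. N \<ge> N0 \<Longrightarrow> 1000 \<le> N powr (D * e) \<and> 2 * C \<le> N powr e \<and> st_const N (N powr (D * e))"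
      using large_scale[OF conjunct1[OF e] D C] by blast
    show "\<exists>C'\<ge>1. \<exists>N0\<ge>1. \<forall>N\<ge>N0. \<forall>L P.
      extremal K C e N L P \<longrightarrow>
      (\<exists>p1 p2 M1 M2 \<theta>1 \<theta>2 P'.
         p1 \<noteq> p2 \<and>
         organizing K' C' e N L P p1 \<and> organizing K' C' e N L P p2 \<and>
         bush K' C' e N L P p1 M1 \<theta>1 \<and> bush K' C' e N L P p2 M2 \<theta>2 \<and>
         refinement K' C' e N L P P' \<and>
         point_weighted_cell_decomposition K' C' e N L P' (sqrt (real (M1 * M2)))
           ({..<M1} \<times> {..<M2})
           (\<lambda>(i, j). P' \<inter> sector p1 M1 \<theta>1 i \<inter> sector p2 M2 \<theta>2 j) \<and>
         (\<forall>k\<ge>0. \<forall>j<M1.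
            real (card (P' \<inter> sector p1 M1 \<theta>1 j)) \<ge> N powr (2/3 - k * e) \<longrightarrow>
            real (card (lines_meeting L (P' \<inter> sector p1 M1 \<theta>1 j))) \<ge> N powr (1 - g k * e)))"
    proof (rule exI[of _ "C + 3"], rule conjI, goal_cases)
      case 1 then show ?case using C by simp
    next
      case 2 show ?case
      proof (rule exI[of _ N0], rule conjI, goal_cases)
        case 1 then show ?case using N0(1) by simp
      next
        case 2 show ?case
        proof (intro allI impI)
          fix N L P assume N: "N0 \<le> N" and ext: "extremal K C e N L P"
          note b = N0(2)[OF N]
          show "\<exists>p1 p2 M1 M2 \<theta>1 \<theta>2 P'.
         p1 \<noteq> p2 \<and>
         organizing K' (C + 3) e N L P p1 \<and> organizing K' (C + 3) e N L P p2 \<and>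
         bush K' (C + 3) e N L P p1 M1 \<theta>1 \<and> bush K' (C + 3) e N L P p2 M2 \<theta>2 \<and>
         refinement K' (C + 3) e N L P P' \<and>
         point_weighted_cell_decomposition K' (C + 3) e N L P' (sqrt (real (M1 * M2)))
           ({..<M1} \<times> {..<M2})
           (\<lambda>(i, j). P' \<inter> sector p1 M1 \<theta>1 i \<inter> sector p2 M2 \<theta>2 j) \<and>
         (\<forall>k\<ge>0. \<forall>j<M1.
            real (card (P' \<inter> sector p1 M1 \<theta>1 j)) \<ge> N powr (2/3 - k * e) \<longrightarrow>
            real (card (lines_meeting L (P' \<inter> sector p1 M1 \<theta>1 j))) \<ge> N powr (1 - g k * e))"
            by (rule main[OF conjunct1[OF e] conjunct2[OF e] C order_trans[OF N0(1) N]
                 conjunct1[OF b] conjunct1[OF conjunct2[OF b]] conjunct2[OF conjunct2[OF b]] ext])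
        qed
      qed
    qed
  qed
qed

end
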